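(* Let $F(z,u)=G(uH(z))\,M(z)$ be a pure critical extended composition scheme, with $0<\lambda_H<1$ (all terms and standing assumptions as in the context), and let $X_n$ be the associated core size, $\mathbb P\{X_n=k\}=\frac{[z^nu^k]F(z,u)}{[z^n]F(z,1)}$. Put $$\alpha=\lambda_H,\qquad \beta=-\lambda_G\lambda_H,\qquad \gamma=-\min(0,\lambda_M),\qquad \kappa=\frac{\tau_H}{-c_H}.$$ Then, as $n\to\infty$, $$\frac{X_n}{\kappa\, n^{\lambda_H}}\longrightarrow X$$ in distribution and with convergence of all moments, where $X$ has the three-parameter Mittag-Leffler distribution $\mathrm{ML}(\alpha,\beta,\gamma)$. What is more, one has the local limit theorem $$\mathbb P\{X_n=x\cdot\kappa n^{\lambda_H}\}\sim\frac{1}{\kappa n^{\lambda_H}}\cdot f_X(x),$$ with uniform convergence over any interval in $(0,+\infty)$, where $f_X$ is the density of $X$: $$f_X(x)=\frac{\Gamma(\beta+\gamma)}{\Gamma(\beta/\alpha)}\sum_{j\ge0}\frac{(-1)^j}{j!\,\Gamma(\gamma-j\alpha)}\,x^{\beta/\alpha+j-1},$$ with the convention $1/\Gamma(m)=0$ for integers $m\le 0$.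
   Context: Standing assumptions. $G(z)=\sum_n g_nz^n$, $H(z)=\sum_n h_nz^n$, $M(z)$ are power series with nonnegative coefficients, analytic at $0$, with $H(0)=0$ and $M\not\equiv0$; $\rho_G,\rho_H$ (finite) and $\rho_M\in(0,\infty]$ are their radii of convergence. For $f\in\{G,H\}$: $z=\rho_f$ is the only singularity of $f$ on $|z|\le\rho_f$, $f$ is analytic in a domain $\{|z|<\rho_f+\varepsilon,\ |\arg(z-\rho_f)|>\theta\}$ for some $\varepsilon>0$, $0<\theta<\pi/2$, and there, as $z\to\rho_f$, $$f(z)=P_f(1-z/\rho_f)+c_f(1-z/\rho_f)^{\lambda_f}(1+o(1)),$$ with $c_f\ne0$, singular exponent $\lambda_f\in\mathbb R\setminus\{0,1,2,\dots\}$ and $P_f$ a polynomial ($P_f=0$ if $\lambda_f<0$, $P_f$ constant if $0<\lambda_f<1$, $1\le\deg P_f\le\lfloor\lambda_f\rfloor$ if $\lambda_f>1$). For $\lambda_f>0$, $\tau_f:=f(\rho_f)$. If $\rho_M=\rho_H$, the same is assumed for $M$; if $\rho_M>\rho_H$ (e.g. $M=1$) one sets $\lambda_M=+\infty$. Critical: $H(\rho_H)=\rho_G$ and $\rho_M\ge\rho_H$. Pure (for $0<\lambda_H<1$): either $\lambda_G<0$, or $0<\lambda_G<1$ and $\lambda_M>\min(\lambda_G\lambda_H,\lambda_H)$. Distributions. For $\alpha\in(0,1)$, $\beta>-\alpha$, the two-parameter Mittag-Leffler distribution $\mathrm{ML}(\alpha,\beta)$ is the law on $(0,\infty)$ uniquely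 determined by the moments $\mathbb E(Y^s)=\frac{\Gamma(s+\beta/\alpha+1)\Gamma(\beta+1)}{\Gamma(\alpha s+\beta+1)\Gamma(\beta/\alpha+1)}$. The three-parameter Mittag-Leffler distribution $\mathrm{ML}(\alpha,\beta,\gamma)$ ($0<\alpha<1$, $\beta>0$, $\gamma\ge0$) is the law of $Y\cdot B^{\alpha}$ with $Y\sim\mathrm{ML}(\alpha,\beta)$ and $B\sim\mathrm{Beta}(\beta,\gamma)$ independent, where $\mathrm{Beta}(\beta,0)$ is the constant $1$. When $\gamma=0$, $\mathrm{ML}(\alpha,\beta,0)=\mathrm{ML}(\alpha,\beta)$, a convention also used for $-\alpha<\beta<0$. Convergence of all moments: the $s$-th moments converge to $\mathbb E(X^s)$ for every $s$.
   Formalization: Uniformity in the local limit theorem is stated over compact intervals [a,b] with 0<a≤b; over an arbitrary interval in (0,+∞) it fails, e.g. on (1,+∞), since X_n ≤ n forces probability 0 for large x while f_X(x)>0. *)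

theory Defs
  imports
    "HOL-Complex_Analysis.Complex_Analysis"
    "HOL-Probability.Probability"
begin

section \<open>Singular expansions\<close>

text \<open>
  Since \<^term>\<open>Arg 0 = 0\<close> and \<open>\<theta> > 0\<close>, the point \<open>\<rho>\<close> itself is not in the domain.
\<close>

definition delta_domain :: "real \<Rightarrow> real \<Rightarrow> real \<Rightarrow> complex set" where
  "delta_domain \<rho> \<epsilon> \<theta> = {z. norm z < \<rho> + \<epsilon> \<and> \<bar>Arg (z - of_real \<rho>)\<bar> > \<theta>}"

text \<open>
  The series \<open>A\<close> has radius of convergence \<open>\<rho>\<close>, continues analytically to a delta domain, and
  there \<open>f(z) = P(1 - z/\<rho>) + c (1 - z/\<rho>)\<^sup>r (1 + o(1))\<close> as \<open>z \<rightarrow> \<rho>\<close>.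
  That \<open>\<rho>\<close> is the only singularity on the closed disc needs no separate clause: the
  delta domain contains the rest of the closed disc (next lemma), and a series has a
  singularity on its circle of convergence.
  \<open>c\<close> is real because the series considered have real coefficients.
\<close>

definition singular_expansion :: "real fps \<Rightarrow> real \<Rightarrow> real \<Rightarrow> real \<Rightarrow> bool" where
  "singular_expansion A \<rho> c r \<longleftrightarrow>
     0 < \<rho> \<and> fps_conv_radius A = ereal \<rho> \<and> c \<noteq> 0 \<and> r \<notin> \<nat> \<and>
     (\<exists>f \<epsilon> \<theta> P.
        0 < \<epsilon> \<and> 0 < \<theta> \<and> \<theta> < pi / 2 \<and>
        f analytic_on delta_domain \<rho> \<epsilon> \<theta> \<and>
        (\<forall>z. norm z < \<rho> \<longrightarrow> (\<lambda>n. of_real (fps_nth A n) * z ^ n) sums f z) \<and>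
        (\<lambda>z. f z - poly P (1 - z / of_real \<rho>))
          \<sim>[at (of_real \<rho>) within delta_domain \<rho> \<epsilon> \<theta>]
          (\<lambda>z. of_real c * (1 - z / of_real \<rho>) powr of_real r) \<and>
        (r < 0 \<longrightarrow> P = 0) \<and>
        (0 < r \<and> r < 1 \<longrightarrow> degree P = 0) \<and>
        (1 < r \<longrightarrow> 1 \<le> degree P \<and> degree P \<le> nat \<lfloor>r\<rfloor>))"

lemma cball_minus_point_subset_delta_domain:
  assumes "0 < \<rho>" "0 < \<epsilon>" "\<theta> < pi / 2"
  shows "cball 0 \<rho> - {of_real \<rho>} \<subseteq> delta_domain \<rho> \<epsilon> \<theta>"
proof
  fix z :: complex assume z: "z \<in> cball 0 \<rho> - {of_real \<rho>}"
  then have n: "norm z \<le> \<rho>" and ne: "z \<noteq> of_real \<rho>" by auto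
  have "Re z \<noteq> \<rho>"
  proof
    assume r: "Re z = \<rho>"
    have "(Re z)\<^sup>2 + (Im z)\<^sup>2 \<le> \<rho>\<^sup>2"
      using n by (metis cmod_power2 norm_ge_zero power_mono)
    with r have "Im z = 0" by simp
    with r ne show False by (simp add: complex_eq_iff)
  qed
  moreover have "Re z \<le> \<rho>" using n complex_Re_le_cmod[of z] by linarith
  ultimately have "\<not> 0 \<le> Re (z - of_real \<rho>)" by simp
  moreover have "z - of_real \<rho> \<noteq> 0" using ne by simp
  ultimately have "\<bar>Arg (z - of_real \<rho>)\<bar> > pi / 2"
    using Re_Ln_pos_le[of "z - of_real \<rho>"] by (simp add: Arg_eq_Im_Ln)
  with assms n show "z \<in> delta_domain \<rho> \<epsilon> \<theta>" by (simp add: delta_domain_def)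
qed

section \<open>Extended composition schemes\<close>

text \<open>
  \<open>G(u H(z)) M(z)\<close> as a power series in \<open>z\<close>, for \<open>u\<close> in the coefficient ring (\<open>H(0) = 0\<close>).
\<close>

definition ext_scheme :: "'a :: comm_ring_1 \<Rightarrow> 'a fps \<Rightarrow> 'a fps \<Rightarrow> 'a fps \<Rightarrow> 'a fps" where
  "ext_scheme u G H M = (G oo (fps_const u * H)) * M"

text \<open>
  The bivariate series \<open>F(z,u)\<close> is a power series in \<open>z\<close> whose coefficients are power
  series in \<open>u\<close>: the coefficient of \<open>z\<^sup>n u\<^sup>k\<close> is \<open>fps_nth (fps_nth (bivariate_scheme G H M) n) k\<close>.
\<close>

definition lift_fps :: "real fps \<Rightarrow> real fps fps" where
  "lift_fps A = Abs_fps (\<lambda>n. fps_const (fps_nth A n))"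

definition bivariate_scheme :: "real fps \<Rightarrow> real fps \<Rightarrow> real fps \<Rightarrow> real fps fps" where
  "bivariate_scheme G H M = ext_scheme fps_X (lift_fps G) (lift_fps H) (lift_fps M)"

text \<open>
  The law of \<open>X\<^sub>n\<close>. It is meaningful only if the denominator is nonzero;
  see \<open>pmf_core_size\<close> below.
\<close>

definition core_size :: "real fps \<Rightarrow> real fps \<Rightarrow> real fps \<Rightarrow> nat \<Rightarrow> nat pmf" where
  "core_size G H M n = embed_pmf (\<lambda>k.
     fps_nth (fps_nth (bivariate_scheme G H M) n) k / fps_nth (ext_scheme 1 G H M) n)"

lemma lift_fps_nth [simp]: "fps_nth (lift_fps A) n = fps_const (fps_nth A n)"
  by (simp add: lift_fps_def)

lemma fps_const_sum: "fps_const (sum f A) = (\<Sum>x\<in>A. fps_const (f x :: real))"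
  by (induction A rule: infinite_finite_induct) (auto simp flip: fps_const_add)

lemma lift_fps_mult: "lift_fps (A * B) = lift_fps A * lift_fps B"
  by (rule fps_ext) (simp add: fps_mult_nth fps_const_sum)

lemma lift_fps_power: "lift_fps (A ^ k) = lift_fps A ^ k"
proof (induction k)
  case 0
  show ?case by (rule fps_ext) simp
qed (simp add: lift_fps_mult)

lemma bivariate_scheme_nth:
  assumes "fps_nth H 0 = 0"
  shows "fps_nth (fps_nth (bivariate_scheme G H M) n) k = fps_nth G k * fps_nth (H ^ k * M) n"
proof -
  have z: "fps_nth (H ^ k) i = 0" if "i < k" for i
    using assms that startsby_zero_power_prefix by blast
  have *: "fps_nth (fps_nth (lift_fps G oo (fps_const fps_X * lift_fps H)) i) k
        = fps_nth G k * fps_nth (H ^ k) i" for i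
  proof -
    have "fps_nth (fps_nth (lift_fps G oo (fps_const fps_X * lift_fps H)) i) k
        = (\<Sum>j = 0..i. if j = k then fps_nth G k * fps_nth (H ^ k) i else 0)"
      unfolding fps_compose_nth fps_sum_nth
      by (rule sum.cong)
        (auto simp: power_mult_distrib fps_const_power fps_X_power_nth
              mult.assoc simp flip: lift_fps_power)
    also have "\<dots> = fps_nth G k * fps_nth (H ^ k) i"
      using z[of i] by (cases "k \<le> i") auto
    finally show ?thesis .
  qed
  have "fps_nth (fps_nth (bivariate_scheme G H M) n) k
      = (\<Sum>i = 0..n. (fps_nth G k * fps_nth (H ^ k) i) * fps_nth M (n - i))"
    by (simp add: bivariate_scheme_def ext_scheme_def fps_mult_nth[of _ "lift_fps M"] fps_sum_nth *)
  then show ?thesis by (simp add: fps_mult_nth sum_distrib_left mult.assoc)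
qed

lemma ext_scheme_one_nth:
  assumes "fps_nth H 0 = (0 :: real)"
  shows "fps_nth (ext_scheme 1 G H M) n = (\<Sum>k\<le>n. fps_nth G k * fps_nth (H ^ k * M) n)"
proof -
  have z: "fps_nth (H ^ k) i = 0" if "i < k" for i k
    using assms that startsby_zero_power_prefix by blast
  have "fps_nth (G oo H) i = (\<Sum>k\<le>n. fps_nth G k * fps_nth (H ^ k) i)" if "i \<le> n" for i
    unfolding fps_compose_nth using that z by (intro sum.mono_neutral_left) auto
  then have "fps_nth (ext_scheme 1 G H M) n
      = (\<Sum>i = 0..n. \<Sum>k\<le>n. fps_nth G k * fps_nth (H ^ k) i * fps_nth M (n - i))"
    by (simp add: ext_scheme_def fps_mult_nth sum_distrib_right)
  also have "\<dots> = (\<Sum>k\<le>n. \<Sum>i = 0..n. fps_nth G k * fps_nth (H ^ k) i * fps_nth M (n - i))"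
    by (rule sum.swap)
  finally show ?thesis by (simp add: fps_mult_nth sum_distrib_left mult.assoc)
qed

lemma fps_mult_nonneg:
  assumes "\<And>n. 0 \<le> fps_nth A n" "\<And>n. 0 \<le> fps_nth B n"
  shows "0 \<le> fps_nth (A * B :: real fps) n"
  using assms by (auto simp: fps_mult_nth intro!: sum_nonneg)

lemma fps_power_nonneg:
  assumes "\<And>n. 0 \<le> fps_nth A n"
  shows "0 \<le> fps_nth (A ^ k :: real fps) n"
proof (induction k arbitrary: n)
  case (Suc k)
  then show ?case using assms by (auto intro: fps_mult_nonneg)
qed simp

lemma pmf_core_size:
  assumes "\<And>n. 0 \<le> fps_nth G n" "\<And>n. 0 \<le> fps_nth H n" "\<And>n. 0 \<le> fps_nth M n"
    and H0: "fps_nth H 0 = 0" and nz: "fps_nth (ext_scheme 1 G H M) n \<noteq> 0"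
  shows "pmf (core_size G H M n) k =
     fps_nth (fps_nth (bivariate_scheme G H M) n) k / fps_nth (ext_scheme 1 G H M) n"
proof -
  define N D where "N = (\<lambda>k. fps_nth (fps_nth (bivariate_scheme G H M) n) k)"
    and "D = fps_nth (ext_scheme 1 G H M) n"
  have N_nonneg: "0 \<le> N k" for k
    unfolding N_def bivariate_scheme_nth[OF H0]
    by (intro mult_nonneg_nonneg fps_mult_nonneg fps_power_nonneg assms)
  have D_eq: "D = (\<Sum>k\<le>n. N k)"
    unfolding N_def D_def by (simp add: bivariate_scheme_nth[OF H0] ext_scheme_one_nth[OF H0])
  with N_nonneg have "0 \<le> D" by (simp add: sum_nonneg)
  with nz have D: "0 < D" by (simp add: D_def)
  have N0: "N k = 0" if "k > n" for k
  proof -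
    have "fps_nth (H ^ k) i = 0" if "i \<le> n" for i
      using startsby_zero_power_prefix[OF H0] that \<open>k > n\<close> by auto
    then show ?thesis by (simp add: N_def bivariate_scheme_nth[OF H0] fps_mult_nth)
  qed
  have "(\<integral>\<^sup>+x. ennreal (N x / D) \<partial>count_space UNIV) = (\<Sum>x\<le>n. ennreal (N x / D))"
    using N0 by (intro nn_integral_count_space'[OF finite_atMost]) (auto simp: not_le)
  also have "\<dots> = ennreal (\<Sum>x\<le>n. N x / D)"
    using N_nonneg D by (intro sum_ennreal) simp
  also have "\<dots> = 1" using D D_eq by (simp flip: sum_divide_distrib)
  finally have "(\<integral>\<^sup>+x. ennreal (N x / D) \<partial>count_space UNIV) = 1" .
  then have "pmf (embed_pmf (\<lambda>k. N k / D)) k = N k / D"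
    using N_nonneg D by (intro pmf_embed_pmf) auto
  then show ?thesis by (simp add: core_size_def N_def D_def)
qed

section \<open>Mittag-Leffler distributions\<close>

text \<open>
  The law is given by its defining property rather than as a constant: these moments
  determine it uniquely.
\<close>

definition mittag_leffler2 :: "real \<Rightarrow> real \<Rightarrow> real measure \<Rightarrow> bool" where
  "mittag_leffler2 \<alpha> \<beta> Y \<longleftrightarrow>
     prob_space Y \<and> sets Y = sets borel \<and> (AE y in Y. 0 < y) \<and>
     (\<forall>s :: nat. integrable Y (\<lambda>y. y ^ s) \<and>
        (\<integral>y. y ^ s \<partial>Y) =
          Gamma (real s + \<beta> / \<alpha> + 1) * Gamma (\<beta> + 1)
            / (Gamma (\<alpha> * real s + \<beta> + 1) * Gamma (\<beta> / \<alpha> + 1)))"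

definition beta_law :: "real \<Rightarrow> real \<Rightarrow> real measure" where
  "beta_law a b =
     (if b = 0 then return borel 1
      else density lborel (\<lambda>x. ennreal
        (if 0 < x \<and> x < 1 then x powr (a - 1) * (1 - x) powr (b - 1) / Beta a b else 0)))"

text \<open>
  The product measure makes \<open>Y\<close> and \<open>B\<close> independent. For \<open>\<gamma> = 0\<close> the factor \<open>B\<close> is the
  constant 1, so this is \<^const>\<open>mittag_leffler2\<close>, also for \<open>-\<alpha> < \<beta> < 0\<close>.
\<close>

definition mittag_leffler3 :: "real \<Rightarrow> real \<Rightarrow> real \<Rightarrow> real measure \<Rightarrow> bool" where
  "mittag_leffler3 \<alpha> \<beta> \<gamma> X \<longleftrightarrow>
     (\<exists>Y. mittag_leffler2 \<alpha> \<beta> Y \<and>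
        X = distr (Y \<Otimes>\<^sub>M beta_law \<beta> \<gamma>) borel (\<lambda>(y, b). y * b powr \<alpha>))"

text \<open>\<^const>\<open>rGamma\<close> is the entire function \<open>1/\<Gamma>\<close>, zero at the integers \<open>\<le> 0\<close>.\<close>

definition ml3_density_term :: "real \<Rightarrow> real \<Rightarrow> real \<Rightarrow> real \<Rightarrow> nat \<Rightarrow> real" where
  "ml3_density_term \<alpha> \<beta> \<gamma> x j =
     (-1) ^ j / fact j * rGamma (\<gamma> - real j * \<alpha>) * x powr (\<beta> / \<alpha> + real j - 1)"

definition ml3_density :: "real \<Rightarrow> real \<Rightarrow> real \<Rightarrow> real \<Rightarrow> real" where
  "ml3_density \<alpha> \<beta> \<gamma> x =
     Gamma (\<beta> + \<gamma>) / Gamma (\<beta> / \<alpha>) * (\<Sum>j. ml3_density_term \<alpha> \<beta> \<gamma> x j)"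

end

theory Submission
  imports Defs "HOL-Real_Asymp.Real_Asymp"
begin

text \<open>
  After rescaling to \<open>\<rho>\<^sub>H = 1\<close> and \<open>H(1) = 1\<close>, singularity analysis on a contour shrinking to 1
  gives \<open>[z\<^sup>n] H(z)\<^sup>k M(z) \<sim> C n\<^bsup>\<gamma>-1\<^esup> \<phi>(x)\<close> for \<open>k = x \<kappa> n\<^bsup>\<alpha>\<^esup>\<close>, where the Wright function
  \<open>\<phi>(x) = \<Sum>j. (-x)\<^sup>j / (j! \<Gamma>(\<gamma> - j\<alpha>))\<close> is the Hankel integral of \<open>exp (t - x t\<^bsup>\<alpha>\<^esup>) t\<^bsup>-\<gamma>\<^esup>\<close>. The
  coefficients of \<open>G\<close> contribute a factor \<open>k\<^bsup>p-1\<^esup>\<close> with \<open>p = -\<lambda>\<^sub>G\<close>, so sums over \<open>k\<close> become Riemann sums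
  for \<open>x\<^bsup>p-1\<^esup> \<phi>(x)\<close>, which up to normalisation is the limit density. Its moments
  \<open>\<Gamma>(p + s) / \<Gamma>(\<gamma> + \<alpha>(p + s))\<close> grow slowly enough to determine the law, which identifies it as
  Mittag-Leffler. For \<open>p < 0\<close> the integral at 0 converges only because \<open>\<phi>(0) = 1/\<Gamma>(0) = 0\<close>.
\<close>

section \<open>The Hankel contour\<close>

text \<open>The contour consists of two straight legs of slopes \<open>S\<close> and
  \<open>- S\<close> that start at 1 - 1/n, closed by an arc about 0. Under w = 1 - t/n the legs
  become fixed rays in t, so one integrable majorant on a half-line serves all n. The main obstacle
  is uniformity in the power k: a limit at fixed x does not control sums over all k. It is met by
  making \<open>S\<close> so steep that Re ((1 - w)^\<alpha>) dominates a fixed multiple of |1 -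
  w|^\<alpha> on the whole sector; the k-th power of the normalised H then decays like exp (- c k |1
  - w|^\<alpha>) on the legs and geometrically in k on the arc. The latter rests on |H| < 1 away
  from 1, an aperiodicity that the singular expansion itself enforces. The second obstacle is that
  the local limit is a statement about ratios: it needs a strictly positive density, while
  nonnegative coefficients only give a nonnegative one. The domain is cut by |Im w| <= T (Re w - 1)
  rather than by a condition on the argument, so that the cut is described by real and imaginary
  parts alone.\<close>

definition slit_disc :: "real \<Rightarrow> real \<Rightarrow> complex set" where
  "slit_disc \<epsilon> T = {w. norm w < 1 + \<epsilon> \<and> T * (Re w - 1) < \<bar>Im w\<bar>}"

lemma open_slit_disc: "open (slit_disc \<epsilon> T)"
  unfolding slit_disc_def by (intro open_Collect_conj open_Collect_less continuous_intros)

text \<open>Contracting towards 0 moves a point away from the slit, whose vertex is 1. Starlikeness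
  supplies what the residue theorem asks of the domain in \<open>coeff_contour\<close>:
  connectedness, and winding number 0 about every outside point.\<close>

lemma starlike_slit_disc:
  assumes "0 < \<epsilon>" "0 < T"
  shows "starlike (slit_disc \<epsilon> T)"
  unfolding starlike_def
proof (intro bexI ballI subsetI)
  show "0 \<in> slit_disc \<epsilon> T" using assms by (auto simp: slit_disc_def)
  fix w z assume w: "w \<in> slit_disc \<epsilon> T" and "z \<in> closed_segment 0 w"
  then obtain u where u: "0 \<le> u" "u \<le> 1" "z = of_real u * w"
    by (auto simp: closed_segment_def scaleR_conv_of_real)
  have "norm z \<le> norm w" using u by (simp add: norm_mult mult_left_le_one_le)
  moreover have "T * (u * Re w - 1) < u * \<bar>Im w\<bar>"
  proof (cases "u = 0")
    case False
    have "T * (u * Re w - 1) \<le> u * (T * (Re w - 1))"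
      using assms u by (simp add: algebra_simps mult_left_le)
    also have "\<dots> < u * \<bar>Im w\<bar>" using w u False by (simp add: slit_disc_def)
    finally show ?thesis .
  qed (use assms in simp)
  ultimately show "z \<in> slit_disc \<epsilon> T"
    using w u by (auto simp: slit_disc_def abs_mult)
qed

text \<open>\<open>\<epsilon>\<close> and \<open>T\<close> describe the domain, \<open>S\<close> the
  slope of the legs and \<open>r\<close> their horizontal extent. As \<open>T < S\<close>, the
  closed sector outside the legs meets the slit only at 1. The quantity \<open>r * (2 + S)\<close>
  bounds the distance of a leg from 1: at most \<open>r / 2\<close> for the vertex plus
  \<open>r * (1 + S)\<close> for the leg.\<close>

locale hankel_contour =
  fixes \<epsilon> T S r :: real
  assumes T: "0 < T" "T < S" and S: "1 \<le> S"
    and r: "0 < r" "r \<le> 1" "r * (2 + S) < \<epsilon>"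
begin

text \<open>The contour moves with n. Hypotheses on functions are therefore stated on two fixed sets
  that contain all its positions: this one for the legs, and the compact \<open>far_set\<close> for
  the arc.\<close>

definition "near_set = {w. S * (Re w - 1) \<le> \<bar>Im w\<bar> \<and> w \<noteq> 1 \<and> norm (1 - w) \<le> r * (2 + S)}"

definition "far_set = {w. S * (Re w - 1) \<le> \<bar>Im w\<bar> \<and> 1 + r / 2 \<le> norm w \<and> norm w \<le> 1 + r * (2 + S)}"

definition "dirs = {Complex 1 S, Complex 1 (- S)}"

lemma rS_pos: "0 < r * (2 + S)" using r S by simp

lemma \<epsilon>_pos: "0 < \<epsilon>" using r(3) rS_pos by linarith

lemma sector_strict:
  assumes "S * (Re w - 1) \<le> \<bar>Im w\<bar>" "w \<noteq> 1"
  shows "T * (Re w - 1) < \<bar>Im w\<bar>"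
proof -
  consider "Re w > 1" | "Re w = 1" | "Re w < 1" by linarith
  then show ?thesis
  proof cases
    case 1
    then have "T * (Re w - 1) < S * (Re w - 1)" using T by simp
    with assms show ?thesis by linarith
  next
    case 2
    with assms have "Im w \<noteq> 0" by (auto simp: complex_eq_iff)
    with 2 show ?thesis by simp
  next
    case 3
    then have "T * (Re w - 1) < 0" using T by (simp add: mult_pos_neg)
    then show ?thesis by linarith
  qed
qed

lemma near_subset: "near_set \<subseteq> slit_disc \<epsilon> T"
proof
  fix w assume w: "w \<in> near_set"
  have "norm w \<le> 1 + norm (1 - w)" using norm_triangle_ineq4[of 1 "1 - w"] by simp
  with w r show "w \<in> slit_disc \<epsilon> T"
    using sector_strict[of w] by (auto simp: near_set_def slit_disc_def)
qed

lemma far_subset: "far_set \<subseteq> slit_disc \<epsilon> T"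
proof
  fix w assume w: "w \<in> far_set"
  then have "w \<noteq> 1" using r by (auto simp: far_set_def)
  with w r show "w \<in> slit_disc \<epsilon> T"
    using sector_strict[of w] by (auto simp: far_set_def slit_disc_def)
qed

lemma compact_far: "compact far_set"
proof -
  have "closed far_set" unfolding far_set_def
    by (intro closed_Collect_conj closed_Collect_le continuous_intros)
  moreover have "bounded far_set"
    by (rule bounded_subset[of "cball 0 (1 + r * (2 + S))"]) (auto simp: far_set_def)
  ultimately show ?thesis by (simp add: compact_eq_bounded_closed)
qed

lemma far_nonempty: "far_set \<noteq> {}"
proof -
  have "r * 1 \<le> r * (2 + S)" using r S by (intro mult_left_mono) auto
  moreover have "S * (- 1 - r - 1) \<le> 0" using S r by (intro mult_nonneg_nonpos) auto
  moreover have "norm (of_real (- 1 - r) :: complex) = 1 + r" using r by (simp only: norm_of_real)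
  ultimately have "of_real (- 1 - r) \<in> far_set"
    using r unfolding far_set_def by (simp del: of_real_diff of_real_minus)
  then show ?thesis by blast
qed

lemma dirs_simps: "d \<in> dirs \<Longrightarrow> Re d = 1" "d \<in> dirs \<Longrightarrow> \<bar>Im d\<bar> = S"
  "d \<in> dirs \<Longrightarrow> norm d \<le> 1 + S" "d \<in> dirs \<Longrightarrow> d \<noteq> 0"
  using S by (auto simp: dirs_def complex_eq_iff intro: order.trans[OF cmod_le])

lemma ray_near:
  assumes d: "d \<in> dirs" and s: "0 < s" "s \<le> r / 2" and u: "0 \<le> u" "u \<le> r"
  shows "of_real (1 - s) + of_real u * d \<in> near_set"
proof -
  let ?w = "of_real (1 - s) + of_real u * d :: complex"
  have re: "Re ?w = 1 - s + u" and im: "\<bar>Im ?w\<bar> = u * S"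
    using d u by (auto simp: dirs_simps abs_mult)
  have "norm (1 - ?w) = norm (of_real s - of_real u * d)" by simp
  also have "\<dots> \<le> s + u * norm d"
    using norm_triangle_ineq4[of "of_real s :: complex" "of_real u * d"] s u by (simp add: norm_mult)
  also have "\<dots> \<le> r / 2 + r * (1 + S)"
    using s u d S by (intro add_mono mult_mono dirs_simps) auto
  also have "\<dots> \<le> r * (2 + S)" using r by (simp add: algebra_simps)
  finally have "norm (1 - ?w) \<le> r * (2 + S)" .
  moreover have "?w \<noteq> 1"
  proof
    assume "?w = 1"
    then have "Im ?w = 0" "Re ?w = 1" by (simp_all only: one_complex.sel)
    with re im s S show False by auto
  qed
  moreover have "S * (Re ?w - 1) \<le> \<bar>Im ?w\<bar>"
    unfolding re im using s S by (simp add: algebra_simps)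
  ultimately show ?thesis by (auto simp: near_set_def)
qed

definition "corner s = of_real (1 - s) + of_real r * Complex 1 S"

definition "big_arc s = part_circlepath 0 (norm (corner s)) (Arg (corner s)) (2 * pi - Arg (corner s))"

text \<open>The vertex \<open>1 - s\<close> lies to the left of the singularity. In the coefficient
  estimates \<open>s\<close> is 1/n, so that the vertex corresponds to t = 1 after scaling.\<close>

definition "contour s =
  linepath (of_real (1 - s)) (corner s) +++ (big_arc s +++ linepath (cnj (corner s)) (of_real (1 - s)))"

context
  fixes s :: real
  assumes s: "0 < s" "s \<le> r / 2"
begin

lemma corner_simps: "Re (corner s) = 1 - s + r" "Im (corner s) = r * S" "corner s \<noteq> 0"
  using s r S by (auto simp: corner_def complex_eq_iff)

lemma Arg_corner: "0 < Arg (corner s)" "Arg (corner s) < pi / 2"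
proof -
  have "0 < Re (corner s)" "0 < Im (corner s)" using corner_simps s r S by auto
  then show "0 < Arg (corner s)" "Arg (corner s) < pi / 2"
    using Arg_Re_pos[of "corner s"] Arg_lt_pi[of "corner s"]
    by (auto simp: Arg_Re_pos abs_less_iff)
qed

lemma big_arc_ends: "pathstart (big_arc s) = corner s" "pathfinish (big_arc s) = cnj (corner s)"
proof -
  have c: "corner s = of_real (norm (corner s)) * exp (\<i> * Arg (corner s))"
    using Arg_eq[of "corner s"] corner_simps by auto
  then show "pathstart (big_arc s) = corner s" by (simp add: big_arc_def)
  have "exp (\<i> * complex_of_real (2 * pi - Arg (corner s))) = exp (2 * of_real pi * \<i> - \<i> * Arg (corner s))"
    by (simp add: algebra_simps)
  also have "\<dots> = exp (- (\<i> * Arg (corner s)))"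
    by (simp add: exp_diff exp_minus field_simps)
  also have "\<dots> = cnj (exp (\<i> * Arg (corner s)))" by (simp add: exp_cnj)
  finally show "pathfinish (big_arc s) = cnj (corner s)"
    unfolding big_arc_def pathfinish_part_circlepath
    by (subst (3) c) simp
qed

lemma norm_corner: "1 + r / 2 \<le> norm (corner s)" "norm (corner s) \<le> 1 + r * (2 + S)"
proof -
  show "1 + r / 2 \<le> norm (corner s)"
    using complex_Re_le_cmod[of "corner s"] s by (simp add: corner_simps)
  have "norm (corner s) \<le> \<bar>Re (corner s)\<bar> + \<bar>Im (corner s)\<bar>" by (rule cmod_le)
  also have "\<dots> \<le> 1 + r * (2 + S)" using s r S by (simp add: corner_simps algebra_simps)
  finally show "norm (corner s) \<le> 1 + r * (2 + S)" .
qed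

text \<open>A point of the arc has the modulus of the corner and a real part no larger. If it
  violated the sector inequality, its imaginary part would be smaller than that of the corner as
  well, while its real part is positive; so its modulus would be too small.\<close>

lemma big_arc_far: "path_image (big_arc s) \<subseteq> far_set"
proof
  fix w assume "w \<in> path_image (big_arc s)"
  then obtain x where x: "Arg (corner s) \<le> x" "x \<le> 2 * pi - Arg (corner s)"
      and w: "w = norm (corner s) * exp (\<i> * of_real x)"
    using Arg_corner by (auto simp: big_arc_def path_image_part_circlepath)
  have nw: "norm w = norm (corner s)" by (simp add: w norm_mult)
  have "cos x \<le> cos (Arg (corner s))"
  proof (cases "x \<le> pi")
    case True
    then show ?thesis using x Arg_corner by (intro cos_monotone_0_pi_le) auto
  next
    case False
    have "cos x = cos (2 * pi - x)" by (simp add: cos_diff)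
    also have "\<dots> \<le> cos (Arg (corner s))" using False x Arg_corner by (intro cos_monotone_0_pi_le) auto
    finally show ?thesis .
  qed
  moreover have "norm (corner s) * cos (Arg (corner s)) = Re (corner s)"
    using corner_simps by (simp add: cos_Arg)
  moreover have "Re w = norm (corner s) * cos x" by (simp add: w Re_exp)
  ultimately have "Re w \<le> 1 - s + r"
    using mult_left_mono[of "cos x" "cos (Arg (corner s))" "norm (corner s)"] corner_simps(1) by simp
  moreover have False if "S * (Re w - 1) > \<bar>Im w\<bar>"
  proof -
    have "0 < S * (Re w - 1)" using that by linarith
    then have p: "0 < Re w - 1" using S by (simp add: zero_less_mult_iff)
    have "\<bar>Im w\<bar> < S * r"
    proof -
      have "S * (Re w - 1) \<le> S * r" using \<open>Re w \<le> 1 - s + r\<close> s S by (intro mult_left_mono) auto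
      with that show ?thesis by linarith
    qed
    then have "(Im w)\<^sup>2 < (r * S)\<^sup>2"
      using abs_square_less_1 power2_strict_mono[of "Im w" "S * r"] S r by (simp add: mult.commute)
    moreover have "(Re w)\<^sup>2 \<le> (1 - s + r)\<^sup>2" using p \<open>Re w \<le> 1 - s + r\<close> by (intro power_mono) auto
    ultimately have "(norm w)\<^sup>2 < (norm (corner s))\<^sup>2"
      by (simp add: cmod_power2 corner_simps)
    with nw show False by simp
  qed
  ultimately show "w \<in> far_set"
    unfolding far_set_def using nw norm_corner by (simp add: not_less) (meson not_less)
qed

lemma line_near:
  assumes "d \<in> dirs"
  shows "path_image (linepath (of_real (1 - s)) (of_real (1 - s) + of_real r * d)) \<subseteq> near_set"
proof
  fix w assume "w \<in> path_image (linepath (of_real (1 - s)) (of_real (1 - s) + of_real r * d))"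
  then obtain u where u: "0 \<le> u" "u \<le> 1"
      "w = (1 - u) *\<^sub>R of_real (1 - s) + u *\<^sub>R (of_real (1 - s) + of_real r * d)"
    by (auto simp: closed_segment_def)
  have "w = of_real (1 - s) + of_real (u * r) * d"
    by (simp add: u(3) scaleR_conv_of_real algebra_simps)
  moreover have "0 \<le> u * r" "u * r \<le> r" using u r by (auto intro: mult_left_le_one_le)
  ultimately show "w \<in> near_set" using ray_near[OF assms s, of "u * r"] by metis
qed

lemma corner_cnj: "cnj (corner s) = of_real (1 - s) + of_real r * Complex 1 (- S)"
  by (simp add: corner_def complex_eq_iff)

lemma contour_props:
  "valid_path (contour s)" "pathfinish (contour s) = pathstart (contour s)"
  "path_image (contour s) \<subseteq> slit_disc \<epsilon> T - {0}"
proof -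
  show "valid_path (contour s)" unfolding contour_def
    by (intro valid_path_join) (auto simp: big_arc_ends, simp add: big_arc_def)
  show "pathfinish (contour s) = pathstart (contour s)" by (simp add: contour_def)
  have 1: "path_image (linepath (of_real (1 - s)) (corner s)) \<subseteq> near_set"
    using line_near[of "Complex 1 S"] by (simp add: dirs_def corner_def)
  have 2: "path_image (linepath (cnj (corner s)) (of_real (1 - s))) \<subseteq> near_set"
    using line_near[of "Complex 1 (- S)"]
    by (simp add: dirs_def corner_cnj closed_segment_commute)
  have re: "0 < Re w" if "w \<in> path_image (linepath (of_real (1 - s)) (corner s)) \<or>
     w \<in> path_image (linepath (cnj (corner s)) (of_real (1 - s)))" for w
  proof -
    have "convex {w. 0 < Re w}" by (rule convex_halfspace_Re_gt)
    then have "closed_segment a b \<subseteq> {w. 0 < Re w}" if "0 < Re a" "0 < Re b" for a b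
      using that closed_segment_subset[of a "{w. 0 < Re w}" b] by auto
    from this[of "of_real (1 - s)" "corner s"] this[of "cnj (corner s)" "of_real (1 - s)"] that
    show ?thesis using s r by (auto simp: corner_simps)
  qed
  have 3: "0 \<notin> far_set" using r by (auto simp: far_set_def)
  have "path_image (contour s) \<subseteq> path_image (linepath (of_real (1 - s)) (corner s)) \<union>
     (path_image (big_arc s) \<union> path_image (linepath (cnj (corner s)) (of_real (1 - s))))"
    unfolding contour_def by (simp add: path_image_join_subset path_image_join big_arc_ends)
  moreover have "w \<in> slit_disc \<epsilon> T - {0}" if "w \<in> path_image (big_arc s)" for w
    using big_arc_far far_subset 3 that by blast
  moreover have "w \<in> slit_disc \<epsilon> T - {0}"
    if "w \<in> path_image (linepath (of_real (1 - s)) (corner s)) \<or>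
     w \<in> path_image (linepath (cnj (corner s)) (of_real (1 - s)))" for w
    using 1 2 near_subset that re[OF that] by (auto simp del: path_image_linepath)
  ultimately show "path_image (contour s) \<subseteq> slit_disc \<epsilon> T - {0}" by blast
qed

lemma contour_integral_contour:
  assumes "continuous_on (slit_disc \<epsilon> T - {0}) f"
  shows "contour_integral (contour s) f = contour_integral (linepath (of_real (1 - s)) (corner s)) f
    + contour_integral (big_arc s) f - contour_integral (linepath (of_real (1 - s)) (cnj (corner s))) f"
proof -
  have sub: "path_image (linepath (of_real (1 - s)) (corner s)) \<subseteq> slit_disc \<epsilon> T - {0}"
    "path_image (big_arc s) \<subseteq> slit_disc \<epsilon> T - {0}"
    "path_image (linepath (cnj (corner s)) (of_real (1 - s))) \<subseteq> slit_disc \<epsilon> T - {0}"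
    using contour_props(3) unfolding contour_def by (simp_all add: path_image_join big_arc_ends)
  have 1: "f contour_integrable_on linepath (of_real (1 - s)) (corner s)"
    "f contour_integrable_on linepath (cnj (corner s)) (of_real (1 - s))"
    using sub by (auto intro!: contour_integrable_continuous_linepath continuous_on_subset[OF assms])
  have 2: "f contour_integrable_on big_arc s"
    using sub(2) unfolding big_arc_def
    by (intro contour_integrable_continuous_part_circlepath continuous_on_subset[OF assms])
  have "contour_integral (linepath (cnj (corner s)) (of_real (1 - s))) f =
    - contour_integral (linepath (of_real (1 - s)) (cnj (corner s))) f"
    using contour_integral_reversepath[of "linepath (of_real (1 - s)) (cnj (corner s))" f] by simp
  moreover have "valid_path (big_arc s)" by (simp add: big_arc_def)
  ultimately show ?thesis unfolding contour_def using 1 2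
    by (simp add: big_arc_ends contour_integrable_join)
qed

text \<open>The integral of 1/w is computed piecewise: the legs lie in the right half-plane, where
  \<open>Ln\<close> is a primitive, and together contribute 2 i Arg of the corner; the arc
  contributes the missing part of 2 pi i.\<close>

lemma winding_contour: "winding_number (contour s) 0 = 1"
proof -
  let ?a = "of_real (1 - s) :: complex" and ?c = "corner s"
  have a: "0 < 1 - s" using s r by linarith
  have "\<And>z. z \<in> {w. 0 < Re w} \<Longrightarrow> (Ln has_field_derivative inverse z) (at z within {w. 0 < Re w})"
    by (intro has_field_derivative_at_within[OF has_field_derivative_Ln])
      (auto simp: complex_nonpos_Reals_iff)
  from contour_integral_primitive[OF this]
  have L: "(inverse has_contour_integral (Ln b - Ln a)) (linepath a b)" if "0 < Re a" "0 < Re b" for a b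
  proof -
    have "closed_segment a b \<subseteq> {w. 0 < Re w}"
      using that by (intro closed_segment_subset convex_halfspace_Re_gt) auto
    then show ?thesis
      using contour_integral_primitive[of "{w. 0 < Re w}" Ln inverse "linepath a b"]
        \<open>\<And>z. z \<in> {w. 0 < Re w} \<Longrightarrow> _ z\<close> by auto
  qed
  have L1: "contour_integral (linepath ?a ?c) inverse = Ln ?c - Ln ?a"
    using a r by (intro contour_integral_unique L) (auto simp: corner_simps)
  have L2: "contour_integral (linepath ?a (cnj ?c)) inverse = Ln (cnj ?c) - Ln ?a"
    using a r by (intro contour_integral_unique L) (auto simp: corner_simps)
  have lt: "Arg ?c < 2 * pi - Arg ?c" using Arg_corner by linarith
  have L3: "contour_integral (big_arc s) inverse = \<i> * of_real (2 * pi - 2 * Arg ?c)"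
  proof -
    have "contour_integral (big_arc s) inverse =
      integral {Arg ?c..2 * pi - Arg ?c} (\<lambda>t. inverse (0 + norm ?c * cis t) * norm ?c * \<i> * cis t)"
      unfolding big_arc_def by (rule contour_integral_part_circlepath_eq[OF lt])
    also have "(\<lambda>t. inverse (0 + norm ?c * cis t) * norm ?c * \<i> * cis t) = (\<lambda>t. \<i>)"
      using corner_simps(3) by (auto simp: fun_eq_iff field_simps)
    finally show ?thesis using lt by (simp add: scaleR_conv_of_real mult.commute)
  qed
  have "Ln ?c = of_real (ln (norm ?c)) + \<i> * Arg ?c" by (rule Ln_Arg[OF corner_simps(3)])
  moreover have "Ln (cnj ?c) = of_real (ln (norm ?c)) - \<i> * Arg ?c"
  proof -
    have "?c \<notin> \<real>" using corner_simps r S by (auto simp: complex_is_Real_iff)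
    then show ?thesis using Ln_Arg[of "cnj ?c"] corner_simps(3) by (simp add: Arg_cnj)
  qed
  ultimately have "(Ln ?c - Ln ?a) + \<i> * of_real (2 * pi - 2 * Arg ?c) - (Ln (cnj ?c) - Ln ?a) = 2 * of_real pi * \<i>"
    by (simp only:) (simp add: algebra_simps)
  moreover have "continuous_on (slit_disc \<epsilon> T - {0}) inverse"
    by (intro continuous_intros) auto
  ultimately have "contour_integral (contour s) inverse = 2 * of_real pi * \<i>"
    by (simp only: contour_integral_contour L1 L2 L3)
  then have *: "contour_integral (contour s) (\<lambda>w. 1 / (w - 0)) = 2 * of_real pi * \<i>"
    by (simp add: divide_inverse)
  have nz: "0 \<notin> path_image (contour s)" using contour_props(3) by blast
  have "winding_number (contour s) 0 = 1 / (2 * of_real pi * \<i>) * contour_integral (contour s) (\<lambda>w. 1 / (w - 0))"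
    by (rule winding_number_valid_path[OF contour_props(1) nz, unfolded of_real_mult of_real_numeral])
  then show ?thesis unfolding * by (rule trans) simp
qed

end

lemma coeff_contour:
  assumes "f holomorphic_on slit_disc \<epsilon> T" "f has_fps_expansion F" "0 < s" "s \<le> r / 2"
  shows "2 * of_real pi * \<i> * fps_nth F n = contour_integral (contour s) (\<lambda>w. f w / w ^ Suc n)"
proof -
  note s = assms(3,4)
  have sl: "starlike (slit_disc \<epsilon> T)" using starlike_slit_disc \<epsilon>_pos T by blast
  have "contour_integral (contour s) (\<lambda>w. f w / w ^ Suc n) = 2 * pi * \<i> *
     (\<Sum>p\<in>{0}. winding_number (contour s) p * residue (\<lambda>w. f w / w ^ Suc n) p)"
  proof (rule Residue_theorem)
    show "connected (slit_disc \<epsilon> T)" using sl by (rule starlike_imp_connected)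
    show "(\<lambda>w. f w / w ^ Suc n) holomorphic_on slit_disc \<epsilon> T - {0}"
      by (intro holomorphic_intros holomorphic_on_subset[OF assms(1)]) auto
    show "\<forall>z. z \<notin> slit_disc \<epsilon> T \<longrightarrow> winding_number (contour s) z = 0"
      using contour_props[OF s] sl
      by (intro allI impI simply_connected_imp_winding_number_zero[of "slit_disc \<epsilon> T"]
        starlike_imp_simply_connected) (auto intro: valid_path_imp_path)
  qed (use contour_props[OF s] open_slit_disc in auto)
  then show ?thesis
    using winding_contour[OF s] residue_fps_expansion_over_power_at_0[OF assms(2)] by simp
qed

end

section \<open>Elementary estimates for powers and exponentials\<close>

lemma powr_le_exp:
  fixes c e :: real
  assumes "0 \<le> c" "0 < e"
  obtains C where "0 < C" "\<And>y. 0 \<le> y \<Longrightarrow> (1 + y) powr c \<le> C * exp (e * y)"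
proof -
  \<comment> \<open>The logarithm is bounded by its tangent at \<open>b\<close>. The slope
    \<open>c / b\<close> is at most \<open>e\<close>, and the summand 1 keeps \<open>b\<close>
    positive when \<open>c = 0\<close>.\<close>
  define b where "b = (c + 1) / e"
  have b: "0 < b" using assms by (simp add: b_def)
  show ?thesis
  proof (rule that[of "exp (c * ln b + c / b)"])
    fix y :: real assume y: "0 \<le> y"
    have "ln ((1 + y) / b) \<le> (1 + y) / b - 1" using b y by (intro ln_le_minus_one) auto
    then have "ln (1 + y) \<le> (1 + y) / b + ln b" using b y by (simp add: ln_div)
    then have "c * ln (1 + y) \<le> c * ((1 + y) / b + ln b)" using assms by (intro mult_left_mono) auto
    also have "\<dots> = c * ln b + c / b + c / b * y" by (simp add: algebra_simps add_divide_distrib)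
    also have "c / b * y \<le> e * y"
      using assms y by (intro mult_right_mono) (auto simp: b_def field_simps)
    finally show "(1 + y) powr c \<le> exp (c * ln b + c / b) * exp (e * y)"
      using y by (simp add: powr_def exp_add [symmetric])
  qed simp
qed

lemma integrable_powr_exp:
  fixes c e :: real
  assumes "0 \<le> c" "0 < e"
  shows "set_integrable lborel {0..} (\<lambda>y. (1 + y) powr c * exp (- (e * y)))"
proof -
  obtain C where C: "0 < C" "\<And>y. 0 \<le> y \<Longrightarrow> (1 + y) powr c \<le> C * exp (e / 2 * y)"
    using powr_le_exp[of c "e / 2"] assms by auto
  show ?thesis
  proof (rule set_integrable_bound)
    show "set_integrable lborel {0..} (\<lambda>y. C * exp (- (y * (e / 2))))"
    proof -
      have "set_integrable lborel {0..} (\<lambda>y. exp (- (y * (e / 2))))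
         \<longleftrightarrow> set_integrable lborel {0<..} (\<lambda>y. exp (- (y * (e / 2))))"
        unfolding set_integrable_def
        by (rule integrable_cong_AE) (auto intro!: AE_I'[of "{0}"] simp: indicator_def)
      then show ?thesis using integrable_I0i_exp_mscale[of "e / 2"] assms by simp
    qed
    show "set_borel_measurable lborel {0..} (\<lambda>y. (1 + y) powr c * exp (- (e * y)))"
      unfolding set_borel_measurable_def by measurable
    have "(1 + y) powr c * exp (- (e * y)) \<le> C * exp (- (y * (e / 2)))" if "0 \<le> y" for y
    proof -
      have "(1 + y) powr c * exp (- (e * y)) \<le> C * exp (e / 2 * y) * exp (- (e * y))"
        using C(2)[of y] that by (intro mult_right_mono) auto
      also have "\<dots> = C * exp (e / 2 * y - e * y)" by (simp only: exp_diff exp_minus divide_inverse mult.assoc)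
      also have "e / 2 * y - e * y = - (y * (e / 2))" by (simp add: field_simps)
      finally show ?thesis .
    qed
    then show "AE y in lborel. y \<in> {0..} \<longrightarrow>
        norm ((1 + y) powr c * exp (- (e * y))) \<le> norm (C * exp (- (y * (e / 2))))"
      using C by (intro AE_I2) (auto simp: abs_mult)
  qed
qed

text \<open>The exponents are an arbitrary sequence because the lemma serves twice: for w^(n+1) on a
  scaled ray, and for powers of h whose exponent is of order n^\<alpha>. The extension
  \<open>g\<close> of Ln (1 + w) / w by 1 at 0 spares a distinction of the indices with
  \<open>z j = 0\<close>.\<close>

lemma tendsto_one_plus_power_exp:
  fixes z :: "nat \<Rightarrow> complex" and k :: "nat \<Rightarrow> nat"
  assumes kz: "(\<lambda>j. of_nat (k j) * z j) \<longlonglongrightarrow> l" and z: "z \<longlonglongrightarrow> 0"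
  shows "(\<lambda>j. (1 + z j) ^ k j) \<longlonglongrightarrow> exp l"
proof -
  define g where "g = (\<lambda>w::complex. if w = 0 then 1 else Ln (1 + w) / w)"
  have "((\<lambda>w. Ln (1 + w)) has_field_derivative 1) (at 0)"
    by (auto intro!: derivative_eq_intros)
  then have "((\<lambda>w::complex. Ln (1 + w) / w) \<longlongrightarrow> 1) (at 0)"
    by (simp add: DERIV_def)
  then have "(g \<longlongrightarrow> 1) (at 0)"
    by (rule Lim_transform_eventually) (auto simp: eventually_at_filter g_def)
  then have "isCont g 0" by (simp add: isCont_def g_def)
  then have "(\<lambda>j. g (z j)) \<longlonglongrightarrow> g 0"
    using z by (rule isCont_tendsto_compose)
  then have "(\<lambda>j. exp (of_nat (k j) * z j * g (z j))) \<longlonglongrightarrow> exp (l * 1)"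
    by (intro tendsto_intros kz) (simp add: g_def)
  moreover have "\<forall>\<^sub>F j in sequentially. exp (of_nat (k j) * z j * g (z j)) = (1 + z j) ^ k j"
  proof -
    have "\<forall>\<^sub>F j in sequentially. norm (z j) < 1"
      using z by (auto simp: tendsto_iff)
    then show ?thesis
    proof eventually_elim
      case (elim j)
      then have "1 + z j \<noteq> 0" by (metis add_eq_0_iff less_irrefl norm_minus_cancel norm_one)
      moreover have "z j * g (z j) = Ln (1 + z j)" by (simp add: g_def)
      ultimately show ?case by (simp add: mult.assoc exp_of_nat_mult)
    qed
  qed
  ultimately show ?thesis by (simp add: Lim_transform_eventually)
qed

text \<open>On a leg Re w = 1 + (y - 1)/n, so this bounds |w|^(n+1) from below uniformly in n. The
  two cases use exp (v/2) <= 1 + v on [0, 1] and exp (2 v) <= 1 + v on [-1/2, 0]; the factor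
  \<open>exp (-4)\<close> covers the loss in both.\<close>

lemma one_plus_power_ge:
  fixes y :: real and n :: nat
  assumes n: "2 \<le> n" and y: "0 \<le> y" "y \<le> n"
  shows "exp (-4) * exp (y / 2) \<le> (1 + (y - 1) / n) ^ Suc n"
proof (cases "1 \<le> y")
  case True
  define v where "v = (y - 1) / n"
  have v: "0 \<le> v" "v \<le> 1" using True y n by (auto simp: v_def field_simps)
  have "exp (v / 2) \<le> 1 + v / 2 + (v / 2)\<^sup>2" using v by (intro exp_bound) auto
  also have "\<dots> \<le> 1 + v" using v by (simp add: power2_eq_square field_simps)
      (smt (verit) mult_left_le)
  finally have "exp (v / 2) ^ Suc n \<le> (1 + v) ^ Suc n" by (intro power_mono) auto
  moreover have "exp (v / 2) ^ Suc n = exp (real (Suc n) * (v / 2))" by (rule exp_of_nat_mult[symmetric])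
  moreover have "- 4 + y / 2 \<le> real (Suc n) * (v / 2)"
  proof -
    have "real (Suc n) * (v / 2) = real n * v / 2 + v / 2" by (simp add: algebra_simps)
    moreover have "real n * v = y - 1" using n by (simp add: v_def)
    ultimately have "real (Suc n) * (v / 2) = (y - 1) / 2 + v / 2" by simp
    moreover have "- 4 + y / 2 \<le> (y - 1) / 2 + v / 2" using v by (simp add: field_simps)
    ultimately show ?thesis by (simp only:)
  qed
  ultimately show ?thesis unfolding v_def exp_add[symmetric]
    by (metis exp_le_cancel_iff order.trans)
next
  case False
  define v where "v = (y - 1) / n"
  have v: "- 1 / 2 \<le> v" "v \<le> 0" using False y n by (auto simp: v_def field_simps)
  have "1 - 2 * v \<le> exp (- (2 * v))" using exp_ge_add_one_self[of "- (2 * v)"] by simp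
  then have "exp (2 * v) \<le> 1 / (1 - 2 * v)" using v by (simp add: exp_minus field_simps)
  also have "\<dots> \<le> 1 + v"
  proof -
    have "1 \<le> (1 + v) * (1 - 2 * v)"
      using mult_nonneg_nonneg[of "- v" "1 + 2 * v"] v by (simp add: algebra_simps)
    then show ?thesis using v by (simp add: field_simps)
  qed
  finally have "exp (2 * v) ^ Suc n \<le> (1 + v) ^ Suc n" by (intro power_mono) auto
  moreover have "exp (2 * v) ^ Suc n = exp (real (Suc n) * (2 * v))" by (rule exp_of_nat_mult[symmetric])
  moreover have "- 4 + y / 2 \<le> real (Suc n) * (2 * v)"
  proof -
    have "real (Suc n) * (2 * v) = 2 * (real n * v) + 2 * v" by (simp add: algebra_simps)
    moreover have "real n * v = y - 1" using n by (simp add: v_def)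
    ultimately have "real (Suc n) * (2 * v) = 2 * (y - 1) + 2 * v" by simp
    then show ?thesis using v y by simp
  qed
  ultimately show ?thesis unfolding v_def exp_add[symmetric]
    by (metis exp_le_cancel_iff order.trans)
qed

section \<open>Coefficients as truncated Hankel integrals\<close>

context hankel_contour
begin

definition ray :: "(complex \<Rightarrow> complex) \<Rightarrow> complex \<Rightarrow> complex" where
  "ray \<Psi> d = (LINT y:{0..}|lborel. \<Psi> (1 - of_real y * d) * d)"

text \<open>For d = 1 + i S the points 1 - y d run into the lower half-plane, because t = n (1 - w)
  reverses orientation. With dt = - d dy the difference is the integral over the path that arrives
  from infinity below the negative axis, passes through 1 and leaves above the axis.\<close>

definition hankel :: "(complex \<Rightarrow> complex) \<Rightarrow> complex" where
  "hankel \<Psi> = (ray \<Psi> (Complex 1 S) - ray \<Psi> (Complex 1 (- S))) / (2 * of_real pi * \<i>)"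

text \<open>For y up to 1/2 the real part is at least 1/2, beyond that the imaginary part is, thanks
  to 1 <= \<open>S\<close>. The lower bound keeps negative powers of t under control and is the
  source of the distance 1/(2n) in \<open>coeff_bound\<close>.\<close>

lemma norm_ray_point:
  assumes "d \<in> dirs" "0 \<le> y"
  shows "1 / 2 \<le> norm (1 - of_real y * d)" "norm (1 - of_real y * d) \<le> (1 + S) * (1 + y)"
proof -
  show "1 / 2 \<le> norm (1 - of_real y * d)"
  proof (cases "y \<le> 1 / 2")
    case True
    then show ?thesis
      using complex_Re_le_cmod[of "1 - of_real y * d"] assms by (simp add: dirs_simps)
  next
    case False
    have "1 / 2 * 1 \<le> y * S" using False S by (intro mult_mono) auto
    also have "\<dots> = \<bar>Im (1 - of_real y * d)\<bar>"
      using assms by (simp add: dirs_simps abs_mult)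
    also have "\<dots> \<le> norm (1 - of_real y * d)" by (rule abs_Im_le_cmod)
    finally show ?thesis by simp
  qed
  have "norm (1 - of_real y * d) \<le> 1 + y * norm d"
    using norm_triangle_ineq4[of 1 "of_real y * d"] assms by (simp add: norm_mult)
  also have "\<dots> \<le> 1 + y * (1 + S)" using assms dirs_simps(3) by (simp add: mult_left_mono)
  also have "\<dots> \<le> (1 + S) * (1 + y)" using S by (simp add: algebra_simps)
  finally show "norm (1 - of_real y * d) \<le> (1 + S) * (1 + y)" .
qed

text \<open>Both |t| and 1/|t| are at most 2 (1 + S) (1 + y), so a single bound covers exponents of
  either sign.\<close>

lemma norm_ray_point_powr:
  assumes "d \<in> dirs" "0 \<le> y"
  shows "norm (1 - of_real y * d) powr c \<le> (2 * (1 + S)) powr \<bar>c\<bar> * (1 + y) powr \<bar>c\<bar>"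
proof -
  let ?t = "norm (1 - of_real y * d)" and ?b = "2 * (1 + S) * (1 + y)"
  note t = norm_ray_point[OF assms]
  have b: "1 \<le> ?b" using S assms by (simp add: algebra_simps)
  have "(1 + S) * (1 + y) \<le> ?b" using S assms by (intro mult_right_mono) auto
  with t have le: "?t \<le> ?b" by linarith
  have "2 * 1 * 1 \<le> ?b" using S assms by (intro mult_mono) auto
  then have "1 / ?b \<le> 1 / 2" by (intro divide_left_mono) auto
  with t have ge: "1 / ?b \<le> ?t" by linarith
  have "?t powr c \<le> ?b powr \<bar>c\<bar>"
  proof (cases "0 \<le> c")
    case True
    then show ?thesis using le powr_mono2[of c ?t ?b] by simp
  next
    case False
    have "?t powr c \<le> (1 / ?b) powr c" using ge b False by (intro powr_mono2') auto
    also have "\<dots> = ?b powr \<bar>c\<bar>" using b False by (simp add: powr_divide powr_minus_divide[symmetric])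
    finally show ?thesis .
  qed
  then show ?thesis using S assms by (simp add: powr_mult)
qed

lemma ray_point_near:
  assumes "d \<in> dirs" "2 / r \<le> real n" "0 \<le> y" "y \<le> n * r"
  shows "1 - (1 - of_real y * d) / of_nat n \<in> near_set"
proof -
  have n: "0 < real n" using assms r by (smt (verit) divide_pos_pos)
  have "of_real (1 - 1 / real n) + of_real (y / n) * d \<in> near_set"
    using assms n r by (intro ray_near) (auto simp: field_simps)
  moreover have "of_real (1 - 1 / real n) + of_real (y / n) * d = 1 - (1 - of_real y * d) / of_nat n"
    by (simp add: diff_divide_distrib)
  ultimately show ?thesis by metis
qed

lemma ray_point_power:
  assumes d: "d \<in> dirs" and n: "2 / r \<le> real n" "0 \<le> y" "y \<le> n * r"
  shows "norm (1 / (1 - (1 - of_real y * d) / of_nat n) ^ Suc n) \<le> exp 4 * exp (- (1 / 2 * y))"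
proof -
  have r2: "2 \<le> 2 / r" using r by (simp add: field_simps)
  then have n2: "2 \<le> n" using n by linarith
  have "y \<le> n" using n r mult_left_le[of r "real n"] by linarith
  then have "exp (-4) * exp (y / 2) \<le> (1 + (y - 1) / n) ^ Suc n"
    using one_plus_power_ge n2 n by blast
  also have "\<dots> \<le> norm (1 - (1 - of_real y * d) / of_nat n) ^ Suc n"
  proof (rule power_mono)
    have "1 + (y - 1) / n = Re (1 - (1 - of_real y * d) / of_nat n)"
      using d n2 by (simp add: dirs_simps field_simps)
    then show "1 + (y - 1) / n \<le> norm (1 - (1 - of_real y * d) / of_nat n)"
      using complex_Re_le_cmod by metis
    show "0 \<le> 1 + (y - 1) / n" using n2 n by (simp add: field_simps)
  qed
  finally have ge: "exp (-4) * exp (y / 2) \<le> norm (1 - (1 - of_real y * d) / of_nat n) ^ Suc n" .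
  then have "1 / norm (1 - (1 - of_real y * d) / of_nat n) ^ Suc n \<le> 1 / (exp (-4) * exp (y / 2))"
    by (rule divide_left_mono) (use order.strict_trans2[OF _ ge] in \<open>auto intro!: mult_pos_pos\<close>)
  also have "\<dots> = exp 4 * exp (- (1 / 2 * y))" by (simp add: exp_minus field_simps)
  finally show ?thesis by (simp only: norm_divide norm_power norm_one)
qed

text \<open>This is n times the integral over a leg after the substitution w = 1 - (1 - y d)/n; the
  leg ends at y = n r. Truncation by an indicator puts all n on one measure space, ready for
  dominated convergence.\<close>

definition "segm f n d = (\<integral>y. indicator {0..real n * r} y *\<^sub>R
   (f (1 - (1 - of_real y * d) / of_nat n) / (1 - (1 - of_real y * d) / of_nat n) ^ Suc n * d) \<partial>lborel)"

lemma segm_continuous: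
  assumes f: "f holomorphic_on slit_disc \<epsilon> T" and d: "d \<in> dirs" and n: "2 / r \<le> real n"
  shows "continuous_on {0..real n * r} (\<lambda>y.
     f (1 - (1 - of_real y * d) / of_nat n) / (1 - (1 - of_real y * d) / of_nat n) ^ Suc n * d)"
proof -
  have n0: "0 < real n" using n r by (smt (verit) divide_pos_pos)
  have nz: "1 - (1 - of_real y * d) / of_nat n \<noteq> 0" if "y \<in> {0..real n * r}" for y
  proof -
    have "2 / r \<ge> 2" using r by (simp add: field_simps)
    then have "0 < 1 + (y - 1) / n" using n that n0 by (simp add: field_simps)
    also have "1 + (y - 1) / n = Re (1 - (1 - of_real y * d) / of_nat n)"
      using d n0 by (simp add: dirs_simps field_simps)
    finally show ?thesis by (metis less_irrefl zero_complex.sel(1))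
  qed
  have "continuous_on {0..real n * r} (\<lambda>y. f (1 - (1 - of_real y * d) / of_nat n))"
  proof (rule continuous_on_compose2[OF holomorphic_on_imp_continuous_on[OF f]])
    show "(\<lambda>y. 1 - (1 - of_real y * d) / of_nat n) ` {0..real n * r} \<subseteq> slit_disc \<epsilon> T"
      using ray_point_near[OF d n] near_subset by auto
  qed (use n0 in \<open>auto intro!: continuous_intros\<close>)
  then show ?thesis using nz n0 by (intro continuous_intros) auto
qed

lemma line_segm:
  assumes f: "f holomorphic_on slit_disc \<epsilon> T" and d: "d \<in> dirs" and n: "2 / r \<le> real n"
  shows "contour_integral (linepath (of_real (1 - 1 / n)) (of_real (1 - 1 / n) + of_real r * d))
     (\<lambda>w. f w / w ^ Suc n) = segm f n d / of_nat n"
proof -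
  have n0: "0 < real n" using n r by (smt (verit) divide_pos_pos)
  let ?h = "\<lambda>y. f (1 - (1 - of_real y * d) / of_nat n) / (1 - (1 - of_real y * d) / of_nat n) ^ Suc n * d"
  let ?a = "of_real (1 - 1 / n) :: complex"
  have "set_integrable lborel {0..real n * r} ?h"
    using segm_continuous[OF f d n] by (intro borel_integrable_atLeastAtMost')
  then have 1: "(?h has_integral (LINT y:{0..real n * r}|lborel. ?h y)) {0..real n * r}"
    by (subst set_borel_integral_eq_integral(2)) (auto intro!: integrable_integral set_borel_integral_eq_integral(1))
  have 2: "(LINT y:{0..real n * r}|lborel. ?h y) = segm f n d"
    unfolding segm_def set_lebesgue_integral_def ..
  have "((\<lambda>x. ?h ((n * r) * x)) has_integral (1 / \<bar>n * r\<bar>) *\<^sub>R segm f n d) ((\<lambda>x. x / (n * r)) ` {0..n * r})"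
    using has_integral_stretch_real[OF 1[unfolded 2], of "n * r"] n0 r by simp
  moreover have "(\<lambda>x. x / (n * r)) ` {0..n * r} = {0..1}"
  proof (intro equalityI subsetI)
    fix x :: real assume "x \<in> {0..1}"
    then show "x \<in> (\<lambda>x. x / (n * r)) ` {0..n * r}"
      using n0 r by (intro image_eqI[of _ _ "x * (n * r)"]) (auto simp: mult_left_le_one_le)
  qed (use n0 r in \<open>auto simp: field_simps\<close>)
  ultimately have "((\<lambda>x. ?h ((n * r) * x)) has_integral (1 / (n * r)) *\<^sub>R segm f n d) {0..1}"
    using n0 r by simp
  then have "((\<lambda>x. r *\<^sub>R ?h ((n * r) * x)) has_integral r *\<^sub>R (1 / (n * r)) *\<^sub>R segm f n d) {0..1}"
    by (rule has_integral_cmul)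
  moreover have "r *\<^sub>R (1 / (n * r)) *\<^sub>R segm f n d = segm f n d / of_nat n"
    using r n0 by (simp add: scaleR_conv_of_real)
  moreover have "r *\<^sub>R ?h ((n * r) * x) = f (linepath ?a (?a + of_real r * d) x) /
      linepath ?a (?a + of_real r * d) x ^ Suc n * ((?a + of_real r * d) - ?a)" for x
  proof -
    have "linepath ?a (?a + of_real r * d) x = 1 - (1 - of_real ((n * r) * x) * d) / of_nat n"
      using n0 by (simp add: linepath_def scaleR_conv_of_real field_simps)
    then show ?thesis by (simp add: scaleR_conv_of_real)
  qed
  ultimately show ?thesis
    by (intro contour_integral_unique) (simp add: has_contour_integral_linepath)
qed

lemma coeff_segm:
  assumes f: "f holomorphic_on slit_disc \<epsilon> T" and F: "f has_fps_expansion F"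
    and n: "2 / r \<le> real n" and B: "\<And>w. w \<in> far_set \<Longrightarrow> norm (f w) \<le> B"
  shows "norm (2 * of_real pi * \<i> * of_nat n * fps_nth F n -
    (segm f n (Complex 1 S) - segm f n (Complex 1 (- S)))) \<le>
    n * (B / (1 + r / 2) ^ Suc n * (1 + r * (2 + S)) * (2 * pi))"
proof -
  have n0: "0 < real n" using n r by (smt (verit) divide_pos_pos)
  \<comment> \<open>With this vertex the scaled legs start at t = 1 for every n; the hypothesis 2/r
    <= n says exactly that \<open>s\<close> is at most \<open>r / 2\<close>.\<close>
  define s where "s = 1 / real n"
  have s: "0 < s" "s \<le> r / 2" using n n0 r by (auto simp: s_def field_simps)
  let ?g = "\<lambda>w. f w / w ^ Suc n"
  have cont: "continuous_on (slit_disc \<epsilon> T - {0}) ?g"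
    by (intro continuous_intros holomorphic_on_imp_continuous_on[OF holomorphic_on_subset[OF f]]) auto
  have B0: "0 \<le> B" using far_nonempty B norm_ge_zero order_trans by blast
  have "2 * of_real pi * \<i> * fps_nth F n = segm f n (Complex 1 S) / of_nat n
     + contour_integral (big_arc s) ?g - segm f n (Complex 1 (- S)) / of_nat n"
    unfolding coeff_contour[OF f F s] contour_integral_contour[OF s cont]
    using line_segm[OF f _ n, of "Complex 1 S"] line_segm[OF f _ n, of "Complex 1 (- S)"]
    unfolding corner_cnj[OF s] by (simp add: dirs_def corner_def s_def)
  then have "of_nat n * (2 * of_real pi * \<i> * fps_nth F n) = of_nat n * (segm f n (Complex 1 S) / of_nat n
     + contour_integral (big_arc s) ?g - segm f n (Complex 1 (- S)) / of_nat n)" by simp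
  also have "\<dots> = segm f n (Complex 1 S) + of_nat n * contour_integral (big_arc s) ?g - segm f n (Complex 1 (- S))"
    using n0 by (simp only: ring_distribs) simp
  finally have "2 * of_real pi * \<i> * of_nat n * fps_nth F n -
    (segm f n (Complex 1 S) - segm f n (Complex 1 (- S))) = of_nat n * contour_integral (big_arc s) ?g"
    by (simp add: mult_ac)
  moreover have "norm (contour_integral (big_arc s) ?g) \<le>
     B / (1 + r / 2) ^ Suc n * norm (corner s) * \<bar>2 * pi - Arg (corner s) - Arg (corner s)\<bar>"
    unfolding big_arc_def
  proof (rule contour_integral_bound_part_circlepath)
    show "?g contour_integrable_on part_circlepath 0 (norm (corner s)) (Arg (corner s)) (2 * pi - Arg (corner s))"
      using big_arc_far[OF s] far_subset r unfolding big_arc_def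
      by (intro contour_integrable_continuous_part_circlepath continuous_on_subset[OF cont])
        (auto simp: far_set_def)
    fix w assume "w \<in> path_image (part_circlepath 0 (norm (corner s)) (Arg (corner s)) (2 * pi - Arg (corner s)))"
    then have w: "w \<in> far_set" using big_arc_far[OF s] unfolding big_arc_def by blast
    then have "1 + r / 2 \<le> norm w" by (simp add: far_set_def)
    then have "(1 + r / 2) ^ Suc n \<le> norm w ^ Suc n" using r by (intro power_mono) auto
    then show "norm (?g w) \<le> B / (1 + r / 2) ^ Suc n"
      using B[OF w] B0 r unfolding norm_divide norm_power by (intro frac_le) auto
  qed (use B0 r in auto)
  moreover have "B / (1 + r / 2) ^ Suc n * norm (corner s) * \<bar>2 * pi - Arg (corner s) - Arg (corner s)\<bar>
     \<le> B / (1 + r / 2) ^ Suc n * (1 + r * (2 + S)) * (2 * pi)"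
    using B0 r norm_corner[OF s] Arg_corner[OF s] by (intro mult_mono) auto
  ultimately show ?thesis using n0
    by (simp only: norm_mult norm_of_nat) (intro mult_left_mono, auto)
qed

text \<open>An n-free majorant of the scaled integrand: the power of 1 + y bounds |t|^(- \<gamma>),
  the factor exp (4 - y/2) bounds |w|^(- n - 1), and 1 + S bounds |d|.\<close>

definition "maj \<gamma> y = (2 * (1 + S)) powr \<bar>\<gamma>\<bar> * exp 4 * (1 + S) * ((1 + y) powr \<bar>\<gamma>\<bar> * exp (- (1 / 2 * y)))"

lemma maj_integrable: "set_integrable lborel {0..} (maj \<gamma>)"
  unfolding maj_def using integrable_powr_exp[of "\<bar>\<gamma>\<bar>" "1 / 2"] by simp

lemma maj_nonneg: "0 \<le> maj \<gamma> y" using S by (simp add: maj_def)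

lemma segm_integrand_bound:
  assumes d: "d \<in> dirs" and n: "2 / r \<le> real n" "0 \<le> y" "y \<le> n * r" and K: "0 \<le> K"
    and f: "norm (f (1 - (1 - of_real y * d) / of_nat n))
      \<le> K * norm ((1 - of_real y * d) / of_nat n) powr (- \<gamma>)"
  shows "norm (f (1 - (1 - of_real y * d) / of_nat n) / (1 - (1 - of_real y * d) / of_nat n) ^ Suc n * d)
    \<le> K * n powr \<gamma> * maj \<gamma> y"
proof -
  have n0: "0 < real n" using n r by (smt (verit) divide_pos_pos)
  let ?w = "1 - (1 - of_real y * d) / of_nat n"
  have "norm (f ?w) \<le> K * (norm (1 - of_real y * d) / n) powr (- \<gamma>)"
    using f by (simp add: norm_divide)
  also have "\<dots> = K * n powr \<gamma> * norm (1 - of_real y * d) powr (- \<gamma>)"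
    using n0 by (simp add: powr_divide powr_minus_divide)
  also have "\<dots> \<le> K * n powr \<gamma> * ((2 * (1 + S)) powr \<bar>- \<gamma>\<bar> * (1 + y) powr \<bar>- \<gamma>\<bar>)"
    using K norm_ray_point_powr[OF d n(2), of "- \<gamma>"] by (intro mult_left_mono) auto
  finally have 1: "norm (f ?w) \<le> K * n powr \<gamma> * ((2 * (1 + S)) powr \<bar>\<gamma>\<bar> * (1 + y) powr \<bar>\<gamma>\<bar>)"
    by simp
  have "f ?w / ?w ^ Suc n * d = f ?w * (1 / ?w ^ Suc n) * d" by simp
  then have "norm (f ?w / ?w ^ Suc n * d) = norm (f ?w) * norm (1 / ?w ^ Suc n) * norm d"
    by (simp only: norm_mult)
  also have "\<dots> \<le> K * n powr \<gamma> * ((2 * (1 + S)) powr \<bar>\<gamma>\<bar> * (1 + y) powr \<bar>\<gamma>\<bar>) *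
      (exp 4 * exp (- (1 / 2 * y))) * (1 + S)"
    using ray_point_power[OF d n] dirs_simps(3)[OF d] 1 K S by (intro mult_mono) auto
  also have "\<dots> = K * n powr \<gamma> * maj \<gamma> y" by (simp add: maj_def mult_ac)
  finally show ?thesis .
qed

lemma segm_measurable:
  assumes "f holomorphic_on slit_disc \<epsilon> T" "d \<in> dirs" "2 / r \<le> real n"
  shows "(\<lambda>y. indicator {0..real n * r} y *\<^sub>R
   (f (1 - (1 - of_real y * d) / of_nat n) / (1 - (1 - of_real y * d) / of_nat n) ^ Suc n * d)) \<in> borel_measurable lborel"
  using borel_measurable_continuous_on_indicator[OF _ segm_continuous[OF assms]] by simp

lemma segm_bound:
  assumes f: "f holomorphic_on slit_disc \<epsilon> T" and d: "d \<in> dirs" and n: "2 / r \<le> real n" and K: "0 \<le> K"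
    and near: "\<And>w. w \<in> near_set \<Longrightarrow> 1 / (2 * n) \<le> norm (1 - w) \<Longrightarrow> norm (f w) \<le> K * norm (1 - w) powr (- \<gamma>)"
  shows "norm (segm f n d) \<le> K * n powr \<gamma> * (LINT y:{0..}|lborel. maj \<gamma> y)"
proof -
  have n0: "0 < real n" using n r by (smt (verit) divide_pos_pos)
  have b: "norm (indicator {0..real n * r} y *\<^sub>R
   (f (1 - (1 - of_real y * d) / of_nat n) / (1 - (1 - of_real y * d) / of_nat n) ^ Suc n * d))
     \<le> indicator {0..} y *\<^sub>R (K * n powr \<gamma> * maj \<gamma> y)" for y
  proof (cases "y \<in> {0..real n * r}")
    case True
    have "1 / (2 * n) \<le> norm ((1 - of_real y * d) / of_nat n)"
      using norm_ray_point(1)[OF d, of y] True n0 by (simp add: norm_divide field_simps)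
    then show ?thesis
      using segm_integrand_bound[OF d n _ _ K, of y f \<gamma>] True near[OF ray_point_near[OF d n]] by simp
  next
    case False
    then show ?thesis using K maj_nonneg by (auto simp: indicator_def)
  qed
  have i: "integrable lborel (\<lambda>y. indicator {0..} y *\<^sub>R (K * n powr \<gamma> * maj \<gamma> y))"
    using maj_integrable[of \<gamma>] unfolding set_integrable_def[symmetric] by simp
  have "norm (segm f n d) \<le> (\<integral>y. indicator {0..} y *\<^sub>R (K * n powr \<gamma> * maj \<gamma> y) \<partial>lborel)"
    unfolding segm_def
    by (rule Bochner_Integration.integral_norm_bound_integral
      [OF Bochner_Integration.integrable_bound[OF i segm_measurable[OF f d n]] i])
      (use b order.trans[OF b abs_ge_self] in auto)
  also have "\<dots> = K * n powr \<gamma> * (LINT y:{0..}|lborel. maj \<gamma> y)"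
    unfolding set_lebesgue_integral_def[symmetric] by simp
  finally show ?thesis .
qed

text \<open>The constant depends on \<gamma> and the contour only, not on the function, so
  \<open>K\<close> and \<open>B\<close> may carry decay in the power k when f contains h^k. That the
  near bound is asked only at distance 1/(2n) or more from 1 is what lets \<open>K\<close> absorb
  exp (- c k |1 - w|^\<alpha>).\<close>

proposition coeff_bound:
  obtains C where "0 \<le> C"
    "\<And>n f F K B. \<lbrakk>2 / r \<le> real n; f holomorphic_on slit_disc \<epsilon> T; f has_fps_expansion F; 0 \<le> K;
      \<And>w. w \<in> near_set \<Longrightarrow> 1 / (2 * n) \<le> norm (1 - w) \<Longrightarrow> norm (f w) \<le> K * norm (1 - w) powr (- \<gamma>);
      \<And>w. w \<in> far_set \<Longrightarrow> norm (f w) \<le> B\<rbrakk>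
     \<Longrightarrow> norm (fps_nth F n) \<le> C * (K * n powr (\<gamma> - 1) + B / (1 + r / 2) ^ n)"
proof -
  define I where "I = (LINT y:{0..}|lborel. maj \<gamma> y)"
  have I: "0 \<le> I" unfolding I_def set_lebesgue_integral_def
    using maj_nonneg by (intro integral_nonneg_AE) auto
  define C where "C = max I ((1 + r * (2 + S)) * (2 * pi))"
  show ?thesis
  proof (rule that)
    show "0 \<le> C" using I by (simp add: C_def)
    fix n f F K B
    assume n: "2 / r \<le> real n" and f: "f holomorphic_on slit_disc \<epsilon> T" and F: "f has_fps_expansion F"
      and K: "0 \<le> K"
      and near: "\<And>w. w \<in> near_set \<Longrightarrow> 1 / (2 * n) \<le> norm (1 - w) \<Longrightarrow> norm (f w) \<le> K * norm (1 - w) powr (- \<gamma>)"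
      and far: "\<And>w. w \<in> far_set \<Longrightarrow> norm (f w) \<le> B"
    have n0: "0 < real n" using n r by (smt (verit) divide_pos_pos)
    have B0: "0 \<le> B" using far_nonempty far norm_ge_zero order_trans by blast
    let ?A = "segm f n (Complex 1 S)" and ?A' = "segm f n (Complex 1 (- S))"
    have s: "norm ?A \<le> K * n powr \<gamma> * I" "norm ?A' \<le> K * n powr \<gamma> * I"
      unfolding I_def by (intro segm_bound f n K near; simp add: dirs_def)+
    let ?X = "2 * of_real pi * \<i> * of_nat n * fps_nth F n"
    have "norm ?X \<le> norm (?X - (?A - ?A')) + (norm ?A + norm ?A')"
      using norm_triangle_ineq[of "?X - (?A - ?A')" "?A - ?A'"] norm_triangle_ineq4[of ?A ?A'] by simp
    also have "\<dots> \<le> n * (B / (1 + r / 2) ^ Suc n * (1 + r * (2 + S)) * (2 * pi)) + (K * n powr \<gamma> * I + K * n powr \<gamma> * I)"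
      using coeff_segm[OF f F n far] s by (intro add_mono) auto
    also have "\<dots> \<le> n * (B / (1 + r / 2) ^ n * C) + 2 * (K * n powr \<gamma> * C)"
    proof -
      have "B / (1 + r / 2) ^ Suc n \<le> B / (1 + r / 2) ^ n"
        using B0 r by (intro divide_left_mono power_increasing mult_pos_pos zero_less_power) auto
      then have "B / (1 + r / 2) ^ Suc n * ((1 + r * (2 + S)) * (2 * pi)) \<le> B / (1 + r / 2) ^ n * C"
        using B0 r S by (intro mult_mono) (auto simp: C_def)
      moreover have "K * n powr \<gamma> * I \<le> K * n powr \<gamma> * C" using K by (intro mult_left_mono) (auto simp: C_def)
      ultimately show ?thesis
        using mult_left_mono[of "B / (1 + r / 2) ^ Suc n * ((1 + r * (2 + S)) * (2 * pi))" "B / (1 + r / 2) ^ n * C" "real n"]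
        using n0 unfolding mult.assoc by linarith
    qed
    finally have "2 * pi * n * norm (fps_nth F n) \<le> n * (B / (1 + r / 2) ^ n * C) + 2 * (K * n powr \<gamma> * C)"
      by (simp add: norm_mult)
    also have "\<dots> = n * (C * (2 * K * n powr (\<gamma> - 1) + B / (1 + r / 2) ^ n))"
      using n0 by (simp add: powr_diff field_simps)
    also have "\<dots> \<le> n * (C * (2 * K * n powr (\<gamma> - 1) + 2 * (B / (1 + r / 2) ^ n)))"
    proof -
      have "0 \<le> B / (1 + r / 2) ^ n" "0 \<le> C" using B0 r I by (auto simp: C_def)
      then show ?thesis by (intro mult_left_mono add_left_mono) auto
    qed
    finally have "2 * pi * n * norm (fps_nth F n) \<le> 2 * n * (C * (K * n powr (\<gamma> - 1) + B / (1 + r / 2) ^ n))"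
      by (simp add: algebra_simps)
    then have "pi * norm (fps_nth F n) \<le> C * (K * n powr (\<gamma> - 1) + B / (1 + r / 2) ^ n)"
      using n0 by (simp add: mult.assoc mult.left_commute[of _ "real n"])
    moreover have "1 * norm (fps_nth F n) \<le> pi * norm (fps_nth F n)"
      using pi_gt3 by (intro mult_right_mono) auto
    ultimately show "norm (fps_nth F n) \<le> C * (K * n powr (\<gamma> - 1) + B / (1 + r / 2) ^ n)" by simp
  qed
qed

lemma powr_over_power_tendsto_0:
  fixes N :: "nat \<Rightarrow> nat"
  assumes "filterlim N at_top sequentially"
  shows "(\<lambda>j. N j powr c / (1 + r / 2) ^ N j) \<longlonglongrightarrow> 0"
proof -
  have "(\<lambda>n. real n powr c / exp (ln (1 + r / 2) * real n)) \<longlonglongrightarrow> 0"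
    using r by real_asymp
  moreover have "exp (ln (1 + r / 2) * real n) = (1 + r / 2) ^ n" for n
    using r by (simp add: exp_of_nat2_mult)
  ultimately have "(\<lambda>n. real n powr c / (1 + r / 2) ^ n) \<longlonglongrightarrow> 0" by simp
  from filterlim_compose[OF this assms] show ?thesis .
qed

text \<open>Dominated convergence: w^(- N - 1) tends to exp t on the ray, and after division by
  N^\<gamma> the integrands are bounded by \<open>K * maj \<gamma>\<close>. The function may change
  with j, since it will be a product of m with a growing power of h.\<close>

lemma segm_limit:
  fixes N :: "nat \<Rightarrow> nat" and f :: "nat \<Rightarrow> complex \<Rightarrow> complex"
  assumes N: "filterlim N at_top sequentially" "\<And>j. 2 / r \<le> real (N j)" and d: "d \<in> dirs" and K: "0 \<le> K"
    and f: "\<And>j. f j holomorphic_on slit_disc \<epsilon> T"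
    and near: "\<And>j w. w \<in> near_set \<Longrightarrow> norm (f j w) \<le> K * norm (1 - w) powr (- \<gamma>)"
    and lim: "\<And>y. 0 \<le> y \<Longrightarrow> (\<lambda>j. of_real (N j powr (- \<gamma>)) * f j (1 - (1 - of_real y * d) / of_nat (N j)))
       \<longlonglongrightarrow> \<Phi> (1 - of_real y * d)"
  shows "(\<lambda>j. of_real (N j powr (- \<gamma>)) * segm (f j) (N j) d) \<longlonglongrightarrow> ray (\<lambda>t. exp t * \<Phi> t) d"
proof -
  have n0: "0 < real (N j)" for j using N(2)[of j] r by (smt (verit) divide_pos_pos)
  define s where "s = (\<lambda>j y. of_real (N j powr (- \<gamma>)) * (indicator {0..real (N j) * r} y *\<^sub>R
     (f j (1 - (1 - of_real y * d) / of_nat (N j)) / (1 - (1 - of_real y * d) / of_nat (N j)) ^ Suc (N j) * d)))"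
  have meas: "s j \<in> borel_measurable lborel" for j
    unfolding s_def using segm_measurable[OF f d N(2)] by measurable
  have rN: "filterlim (\<lambda>j. real (N j)) at_top sequentially"
    using filterlim_compose[OF filterlim_real_sequentially N(1)] .
  have ptw: "(\<lambda>j. s j y) \<longlonglongrightarrow> indicator {0..} y *\<^sub>R (exp (1 - of_real y * d) * \<Phi> (1 - of_real y * d) * d)" for y
  proof (cases "0 \<le> y")
    case True
    let ?t = "1 - of_real y * d"
    have "(\<lambda>j. (1 + - ?t / of_nat (N j)) ^ Suc (N j)) \<longlonglongrightarrow> exp (- ?t)"
    proof (rule tendsto_one_plus_power_exp)
      have inv: "(\<lambda>j. 1 / of_nat (N j) :: complex) \<longlonglongrightarrow> 0"
        using filterlim_compose[OF lim_1_over_n N(1)] by simp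
      from tendsto_mult[OF this tendsto_const[of "- ?t"]]
      show "(\<lambda>j. - ?t / of_nat (N j)) \<longlonglongrightarrow> 0" by simp
      from tendsto_add[OF this tendsto_const[of "- ?t"]]
      have "(\<lambda>j. - ?t / of_nat (N j) + - ?t) \<longlonglongrightarrow> - ?t" by simp
      moreover have "- ?t / of_nat (N j) + - ?t = of_nat (Suc (N j)) * (- ?t / of_nat (N j))" for j
        using n0[of j] by (simp add: field_simps)
      ultimately show "(\<lambda>j. of_nat (Suc (N j)) * (- ?t / of_nat (N j))) \<longlonglongrightarrow> - ?t" by simp
    qed
    then have "(\<lambda>j. of_real (N j powr (- \<gamma>)) * f j (1 - ?t / of_nat (N j)) / (1 + - ?t / of_nat (N j)) ^ Suc (N j) * d)
       \<longlonglongrightarrow> \<Phi> ?t / exp (- ?t) * d"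
      by (intro tendsto_intros lim True) auto
    moreover have "\<forall>\<^sub>F j in sequentially. y / r \<le> real (N j)"
      using rN by (simp add: filterlim_at_top)
    then have "\<forall>\<^sub>F j in sequentially. of_real (N j powr (- \<gamma>)) * f j (1 - ?t / of_nat (N j)) / (1 + - ?t / of_nat (N j)) ^ Suc (N j) * d
        = s j y"
    proof eventually_elim
      case (elim j)
      then have "y \<in> {0..real (N j) * r}" using True r by (simp add: field_simps)
      moreover have "1 + - ?t / of_nat (N j) = 1 - ?t / of_nat (N j)" by (simp add: diff_divide_distrib)
      ultimately show ?case by (simp only: s_def indicator_simps scaleR_one times_divide_eq_right mult.assoc times_divide_eq_left)
    qed
    ultimately have "(\<lambda>j. s j y) \<longlonglongrightarrow> \<Phi> ?t / exp (- ?t) * d" by (rule Lim_transform_eventually)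
    moreover have "\<Phi> ?t / exp (- ?t) * d = exp ?t * \<Phi> ?t * d"
      unfolding exp_minus divide_inverse inverse_inverse_eq by (simp only: mult_ac)
    ultimately show ?thesis using True by simp
  qed (simp add: s_def)
  have bnd: "norm (s j y) \<le> indicator {0..} y *\<^sub>R (K * maj \<gamma> y)" for j y
  proof (cases "y \<in> {0..real (N j) * r}")
    case True
    have "norm (f j (1 - (1 - of_real y * d) / of_nat (N j)))
        \<le> K * norm ((1 - of_real y * d) / of_nat (N j)) powr (- \<gamma>)"
      using near[OF ray_point_near[OF d N(2)], of y j j] True by simp
    then have *: "norm (f j (1 - (1 - of_real y * d) / of_nat (N j)) / (1 - (1 - of_real y * d) / of_nat (N j)) ^ Suc (N j) * d)
        \<le> K * N j powr \<gamma> * maj \<gamma> y" (is "norm ?x \<le> _")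
      using True by (intro segm_integrand_bound[OF d N(2) _ _ K]) auto
    have "s j y = of_real (N j powr (- \<gamma>)) * ?x"
      using True by (simp only: s_def indicator_simps scaleR_one)
    then have "norm (s j y) = N j powr (- \<gamma>) * norm ?x"
      by (simp only: norm_mult[of "of_real _"] norm_of_real abs_of_nonneg[OF powr_ge_zero])
    also have "\<dots> \<le> N j powr (- \<gamma>) * (K * N j powr \<gamma> * maj \<gamma> y)"
      using * by (rule mult_left_mono) simp
    also have "\<dots> = K * maj \<gamma> y" using n0[of j] by (simp add: powr_minus field_simps)
    finally show ?thesis using True by simp
  next
    case False
    then show ?thesis using K maj_nonneg by (auto simp: s_def indicator_def)
  qed
  have "(\<lambda>j. \<integral>y. s j y \<partial>lborel) \<longlonglongrightarrow>
      (\<integral>y. indicator {0..} y *\<^sub>R (exp (1 - of_real y * d) * \<Phi> (1 - of_real y * d) * d) \<partial>lborel)"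
  proof (rule integral_dominated_convergence)
    show "integrable lborel (\<lambda>y. indicator {0..} y *\<^sub>R (K * maj \<gamma> y))"
      using maj_integrable[of \<gamma>] unfolding set_integrable_def[symmetric] by simp
    show "(\<lambda>y. indicator {0..} y *\<^sub>R (exp (1 - of_real y * d) * \<Phi> (1 - of_real y * d) * d)) \<in> borel_measurable lborel"
      by (rule borel_measurable_LIMSEQ_metric[OF meas ptw])
  qed (use meas ptw bnd in auto)
  then show ?thesis
    unfolding s_def segm_def ray_def set_lebesgue_integral_def integral_mult_right_zero .
qed

proposition coeff_limit:
  fixes N :: "nat \<Rightarrow> nat" and f :: "nat \<Rightarrow> complex \<Rightarrow> complex"
  assumes N: "filterlim N at_top sequentially" and K: "0 \<le> K"
    and f: "\<And>j. f j holomorphic_on slit_disc \<epsilon> T" and F: "\<And>j. f j has_fps_expansion F j"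
    and near: "\<And>j w. w \<in> near_set \<Longrightarrow> norm (f j w) \<le> K * norm (1 - w) powr (- \<gamma>)"
    and far: "\<And>j w. w \<in> far_set \<Longrightarrow> norm (f j w) \<le> B"
    and lim: "\<And>d y. d \<in> dirs \<Longrightarrow> 0 \<le> y \<Longrightarrow>
       (\<lambda>j. of_real (N j powr (- \<gamma>)) * f j (1 - (1 - of_real y * d) / of_nat (N j)))
       \<longlonglongrightarrow> \<Phi> (1 - of_real y * d)"
  shows "(\<lambda>j. of_real (N j powr (1 - \<gamma>)) * fps_nth (F j) (N j)) \<longlonglongrightarrow> hankel (\<lambda>t. exp t * \<Phi> t)"
proof -
  have rN: "filterlim (\<lambda>j. real (N j)) at_top sequentially"
    using filterlim_compose[OF filterlim_real_sequentially N(1)] .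
  then have "\<forall>\<^sub>F j in sequentially. 2 / r \<le> real (N j)" by (simp add: filterlim_at_top)
  \<comment> \<open>The estimates on the legs need 2/r <= N j for every index, so an initial segment
    is dropped.\<close>
  then obtain j0 where j0: "\<And>j. 2 / r \<le> real (N (j + j0))" unfolding eventually_sequentially by (metis le_add2)
  define N' where "N' = (\<lambda>j. N (j + j0))"
  have N': "filterlim N' at_top sequentially" "\<And>j. 2 / r \<le> real (N' j)"
    using filterlim_compose[OF N filterlim_add_const_nat_at_top[of j0]] j0 by (auto simp: N'_def)
  have n0: "0 < real (N' j)" for j using N'(2)[of j] r by (smt (verit) divide_pos_pos)
  have seg: "(\<lambda>j. of_real (N' j powr (- \<gamma>)) * segm (f (j + j0)) (N' j) d) \<longlonglongrightarrow> ray (\<lambda>t. exp t * \<Phi> t) d"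
    if "d \<in> dirs" for d
    using LIMSEQ_ignore_initial_segment[OF lim[OF that], of _ j0]
    by (intro segm_limit[where K = K] N' that K f near) (simp_all add: N'_def)
  have main: "(\<lambda>j. of_real (N' j powr (- \<gamma>)) * (segm (f (j + j0)) (N' j) (Complex 1 S) - segm (f (j + j0)) (N' j) (Complex 1 (- S))) / (2 * of_real pi * \<i>))
     \<longlonglongrightarrow> hankel (\<lambda>t. exp t * \<Phi> t)"
    unfolding hankel_def right_diff_distrib
    by (intro tendsto_intros seg) (auto simp: dirs_def)
  define E where "E = B * (1 + r * (2 + S))"
  have B0: "0 \<le> B" using far_nonempty far norm_ge_zero order_trans by blast
  have err: "norm (of_real (N' j powr (- \<gamma>)) * (segm (f (j + j0)) (N' j) (Complex 1 S) - segm (f (j + j0)) (N' j) (Complex 1 (- S))) / (2 * of_real pi * \<i>)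
     - of_real (N' j powr (1 - \<gamma>)) * fps_nth (F (j + j0)) (N' j)) \<le> N' j powr (1 - \<gamma>) / (1 + r / 2) ^ N' j * E" for j
  proof -
    let ?A = "segm (f (j + j0)) (N' j) (Complex 1 S) - segm (f (j + j0)) (N' j) (Complex 1 (- S))"
      and ?X = "2 * of_real pi * \<i> * of_nat (N' j) * fps_nth (F (j + j0)) (N' j)"
    have "N' j powr (1 - \<gamma>) = N' j powr (- \<gamma>) * N' j" using n0[of j] by (simp add: powr_diff powr_minus field_simps)
    then have "of_real (N' j powr (- \<gamma>)) * ?A / (2 * of_real pi * \<i>)
     - of_real (N' j powr (1 - \<gamma>)) * fps_nth (F (j + j0)) (N' j) = - (of_real (N' j powr (- \<gamma>)) * (?X - ?A) / (2 * of_real pi * \<i>))"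
      by (simp add: field_simps)
    then have "norm (of_real (N' j powr (- \<gamma>)) * ?A / (2 * of_real pi * \<i>)
     - of_real (N' j powr (1 - \<gamma>)) * fps_nth (F (j + j0)) (N' j)) = N' j powr (- \<gamma>) * norm (?X - ?A) / (2 * pi)"
      by (simp add: norm_mult norm_divide)
    also have "\<dots> \<le> N' j powr (- \<gamma>) * (N' j * (B / (1 + r / 2) ^ Suc (N' j) * (1 + r * (2 + S)) * (2 * pi))) / (2 * pi)"
      using coeff_segm[OF f F N'(2) far] by (intro divide_right_mono mult_left_mono) auto
    also have "\<dots> = N' j powr (1 - \<gamma>) * (1 / (1 + r / 2) ^ Suc (N' j)) * E"
    proof -
      have "N' j powr (1 - \<gamma>) = N' j powr (- \<gamma>) * N' j" using n0[of j] by (simp add: powr_diff powr_minus field_simps)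
      then show ?thesis by (simp add: E_def)
    qed
    also have "\<dots> \<le> N' j powr (1 - \<gamma>) * (1 / (1 + r / 2) ^ N' j) * E"
      using r B0 S by (intro mult_right_mono mult_left_mono divide_left_mono power_increasing mult_pos_pos zero_less_power)
        (auto simp: E_def)
    finally show ?thesis by simp
  qed
  have "(\<lambda>j. N' j powr (1 - \<gamma>) / (1 + r / 2) ^ N' j * E) \<longlonglongrightarrow> 0 * E"
    by (intro tendsto_intros powr_over_power_tendsto_0 N')
  then have "(\<lambda>j. of_real (N' j powr (- \<gamma>)) * (segm (f (j + j0)) (N' j) (Complex 1 S) - segm (f (j + j0)) (N' j) (Complex 1 (- S))) / (2 * of_real pi * \<i>)
     - of_real (N' j powr (1 - \<gamma>)) * fps_nth (F (j + j0)) (N' j)) \<longlonglongrightarrow> 0"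
    by (intro Lim_null_comparison[OF always_eventually[OF allI[OF err]]]) simp
  from tendsto_diff[OF main this]
  have "(\<lambda>j. of_real (N' j powr (1 - \<gamma>)) * fps_nth (F (j + j0)) (N' j)) \<longlonglongrightarrow> hankel (\<lambda>t. exp t * \<Phi> t)" by simp
  then show ?thesis unfolding N'_def by (rule LIMSEQ_offset)
qed

text \<open>Hankel's formula is read off the coefficients of \<open>(1 - w)\<^bsup>-s\<^esup>\<close>.\<close>

proposition hankel_rGamma:
  fixes s :: real
  shows "hankel (\<lambda>t. exp t * t powr (- of_real s)) = of_real (rGamma s)"
proof -
  define f where "f = (\<lambda>w::complex. (1 + - w) powr (- of_real s))"
  define F where "F = fps_compose (fps_binomial (- of_real s :: complex)) (- fps_X)"
  have dom: "1 - w \<notin> \<real>\<^sub>\<le>\<^sub>0" if "w \<in> slit_disc \<epsilon> T" for w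
  proof
    assume "1 - w \<in> \<real>\<^sub>\<le>\<^sub>0"
    then have "1 \<le> Re w" "Im w = 0" by (auto simp: complex_nonpos_Reals_iff)
    moreover from this have "0 \<le> T * (Re w - 1)" using T by simp
    ultimately show False using that by (simp add: slit_disc_def)
  qed
  have holo: "f holomorphic_on slit_disc \<epsilon> T"
    unfolding f_def using dom by (intro holomorphic_intros) auto
  have exp: "f has_fps_expansion F"
  proof -
    have "((\<lambda>x. (1 + x) powr (- of_real s)) \<circ> uminus) has_fps_expansion F"
      unfolding F_def
      by (intro has_fps_expansion_compose has_fps_expansion_binomial_complex fps_expansion_intros) auto
    then show ?thesis by (simp add: f_def o_def)
  qed
  have nrm: "norm (f w) = norm (1 - w) powr (- s)" for w
    unfolding f_def using norm_powr_real_powr'[of "- of_real s" "1 - w"] by simp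
  have "bounded (f ` far_set)"
    by (intro compact_imp_bounded compact_continuous_image compact_far
      continuous_on_subset[OF holomorphic_on_imp_continuous_on[OF holo] far_subset])
  then obtain B where B: "\<And>w. w \<in> far_set \<Longrightarrow> norm (f w) \<le> B" by (auto simp: bounded_iff)
  have "(\<lambda>j. of_real (real j powr (1 - s)) * fps_nth F j) \<longlonglongrightarrow> hankel (\<lambda>t. exp t * t powr (- of_real s))"
  proof (rule coeff_limit[where N = "\<lambda>j. j" and f = "\<lambda>_. f" and F = "\<lambda>_. F" and K = 1 and B = B])
    fix d :: complex and y :: real assume d: "d \<in> dirs" and y: "0 \<le> y"
    let ?t = "1 - of_real y * d"
    have "\<forall>\<^sub>F j in sequentially. ?t powr (- of_real s) = of_real (real j powr (- s)) * f (1 - ?t / of_nat j)"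
      using eventually_gt_at_top[of 0]
    proof eventually_elim
      case (elim j)
      have "f (1 - ?t / of_nat j) = (of_real (1 / real j) * ?t) powr (- of_real s)" by (simp add: f_def)
      also have "\<dots> = of_real (1 / real j) powr (- of_real s) * ?t powr (- of_real s)"
        by (rule powr_times_real_left) auto
      also have "complex_of_real (1 / real j) powr (- of_real s) = of_real ((1 / real j) powr (- s))"
        using powr_of_real[of "1 / real j" "- s"] by simp
      finally show ?case using elim by (simp add: powr_divide powr_minus field_simps flip: of_real_mult)
    qed
    then show "(\<lambda>j. of_real (real j powr (- s)) * f (1 - ?t / of_nat j)) \<longlonglongrightarrow> ?t powr (- of_real s)"
      by (rule Lim_transform_eventually[OF tendsto_const])
  qed (use holo exp B in \<open>auto simp: nrm filterlim_ident\<close>)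
  moreover have "(\<lambda>j. of_real (real j powr (1 - s)) * fps_nth F j) \<longlonglongrightarrow> complex_of_real (rGamma s)"
  proof -
    have coeff: "fps_nth F j = of_real (pochhammer s j / fact j)" for j
    proof -
      have "- fps_X = fps_const (- 1 :: complex) * fps_X" by (simp add: fps_eq_iff)
      then have "fps_nth F j = (- 1) ^ j * ((- of_real s) gchoose j)"
        unfolding F_def by (simp only: fps_compose_linear) (simp add: fps_binomial_def)
      then show ?thesis
        by (simp add: gbinomial_pochhammer pochhammer_of_real flip: power_mult_distrib)
    qed
    \<comment> \<open>\<open>rGamma_series s j\<close> contains the rising factorial of length j +
      1; this factor cancels its last entry s + j and tends to 1.\<close>
    have "(\<lambda>j. real j / (s + real j) * rGamma_series s j) \<longlonglongrightarrow> 1 * rGamma s"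
    proof (intro tendsto_mult rGamma_series_LIMSEQ)
      show "(\<lambda>j. real j / (s + real j)) \<longlonglongrightarrow> 1" by real_asymp
    qed
    moreover have "\<forall>\<^sub>F j in sequentially. real j / (s + real j) * rGamma_series s j =
        real j powr (1 - s) * (pochhammer s j / fact j)"
      using eventually_gt_at_top[of "nat \<lceil>\<bar>s\<bar>\<rceil>"]
    proof eventually_elim
      case (elim j)
      then have "0 < s + real j" "0 < real j" by linarith+
      then show ?case
        by (simp add: rGamma_series_def pochhammer_Suc powr_diff powr_def[of _ s] divide_simps)
    qed
    ultimately have "(\<lambda>j. real j powr (1 - s) * (pochhammer s j / fact j)) \<longlonglongrightarrow> rGamma s"
      by (simp add: Lim_transform_eventually)
    from tendsto_of_real[OF this] show ?thesis by (simp only: coeff of_real_mult)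
  qed
  ultimately show ?thesis by (rule LIMSEQ_unique)
qed

end

section \<open>The Wright function\<close>

lemma has_bochner_integral_Gamma:
  fixes p A :: real
  assumes p: "0 < p" and A: "0 < A"
  shows "has_bochner_integral lborel (\<lambda>x. indicator {0<..} x *\<^sub>R (x powr (p - 1) * exp (- (A * x)))) (Gamma p * A powr (- p))"
proof -
  let ?f = "\<lambda>x::real. indicator {0<..} x *\<^sub>R (x powr (p - 1) * exp (- x))"
  have "has_bochner_integral lborel ?f (Gamma p)"
  proof (rule has_bochner_integral_nn_integral)
    show "(\<integral>\<^sup>+ x. ennreal (?f x) \<partial>lborel) = ennreal (Gamma p)"
      unfolding Gamma_conv_nn_integral_real[OF p]
      by (intro nn_integral_cong) (auto simp: indicator_def exp_minus divide_inverse)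
  qed (use p Gamma_real_pos[of p] in \<open>auto simp: less_imp_le\<close>)
  then have i: "integrable lborel ?f" and v: "(\<integral>x. ?f x \<partial>lborel) = Gamma p"
    by (auto simp: has_bochner_integral_iff)
  have eq: "?f (A * x) = A powr (p - 1) * (indicator {0<..} x *\<^sub>R (x powr (p - 1) * exp (- (A * x))))" for x
    using A by (auto simp: indicator_def zero_less_mult_iff powr_mult)
  have "integrable lborel (\<lambda>x. ?f (0 + A * x))"
    using i A by (subst lborel_integrable_real_affine_iff) auto
  then have I: "integrable lborel (\<lambda>x. indicator {0<..} x *\<^sub>R (x powr (p - 1) * exp (- (A * x))))"
    using A by (simp only: add_0 eq) simp
  have "Gamma p = \<bar>A\<bar> *\<^sub>R (\<integral>x. ?f (0 + A * x) \<partial>lborel)"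
    using lborel_integral_real_affine[of A ?f 0] A v by simp
  also have "\<dots> = A * A powr (p - 1) * (\<integral>x. indicator {0<..} x *\<^sub>R (x powr (p - 1) * exp (- (A * x))) \<partial>lborel)"
    using A by (simp only: add_0 eq integral_mult_right_zero) simp
  also have "A * A powr (p - 1) = A powr p" using A by (simp add: powr_diff)
  finally have "(\<integral>x. indicator {0<..} x *\<^sub>R (x powr (p - 1) * exp (- (A * x))) \<partial>lborel) = Gamma p * A powr (- p)"
    using A by (simp add: powr_minus field_simps)
  with I show ?thesis by (simp add: has_bochner_integral_iff)
qed

text \<open>Expand \<open>exp (- a x)\<close> about a large real point and sum the binomial series.\<close>

lemma Laplace_powr_complex:
  fixes a :: complex and p :: real
  assumes p: "0 < p" and a: "0 < Re a"
  shows "(\<integral>x. indicator {0<..} x *\<^sub>R (of_real (x powr (p - 1)) * exp (- (of_real x * a))) \<partial>lborel)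
    = of_real (Gamma p) * a powr (- of_real p)"
proof -
  \<comment> \<open>For real A the condition |A - a| < A means |a|^2 < 2 A Re a. This choice gives
    |A - a|^2 = A^2 - A Re a, so the binomial series converges and exp (- (A - |b|) x) dominates all
    partial sums.\<close>
  define A where "A = (norm a)\<^sup>2 / Re a"
  define b where "b = of_real A - a"
  have an: "0 < norm a" using a by auto
  have A: "0 < A" using a an by (simp add: A_def)
  have bA: "norm b < A"
  proof -
    have "A * Re a = (Re a)\<^sup>2 + (Im a)\<^sup>2" using a by (simp add: A_def cmod_power2)
    then have "(norm b)\<^sup>2 = A\<^sup>2 - A * Re a"
      unfolding b_def cmod_power2 by (simp add: power2_eq_square algebra_simps)
    also have "\<dots> < A\<^sup>2" using A a by simp
    finally show ?thesis using A by (simp add: power_less_imp_less_base)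
  qed
  define f where "f = (\<lambda>k x. indicator {0<..} x *\<^sub>R (of_real (x powr (p - 1) * exp (- (A * x))) * (\<Sum>j<k. (of_real x * b) ^ j / fact j)))"
  define g where "g = (\<lambda>x. indicator {0<..} x *\<^sub>R (of_real (x powr (p - 1)) * exp (- (of_real x * a))))"
  have fm: "f k \<in> borel_measurable lborel" for k unfolding f_def by measurable
  have gm: "g \<in> borel_measurable lborel" unfolding g_def by measurable
  have "(\<lambda>k. \<integral>x. f k x \<partial>lborel) \<longlonglongrightarrow> (\<integral>x. g x \<partial>lborel)"
  proof (rule integral_dominated_convergence[OF gm fm])
    show "integrable lborel (\<lambda>x. indicator {0<..} x *\<^sub>R (x powr (p - 1) * exp (- ((A - norm b) * x))))"
      using has_bochner_integral_Gamma[OF p, of "A - norm b"] bA by (simp add: has_bochner_integral_iff)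
    show "AE x in lborel. (\<lambda>k. f k x) \<longlonglongrightarrow> g x"
    proof (rule AE_I2)
      fix x :: real
      have "(\<lambda>k. \<Sum>j<k. (of_real x * b) ^ j / fact j) \<longlonglongrightarrow> exp (of_real x * b)"
        using exp_converges[of "of_real x * b"] by (simp add: sums_def scaleR_conv_of_real field_simps)
      then have "(\<lambda>k. f k x) \<longlonglongrightarrow> indicator {0<..} x *\<^sub>R (of_real (x powr (p - 1) * exp (- (A * x))) * exp (of_real x * b))"
        unfolding f_def by (intro tendsto_intros)
      also have "of_real (x powr (p - 1) * exp (- (A * x))) * exp (of_real x * b) =
          of_real (x powr (p - 1)) * exp (- (of_real x * a))"
      proof -
        have "complex_of_real (exp (- (A * x))) = exp (- (of_real A * of_real x))"
          by (simp flip: exp_of_real)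
        moreover have "- (of_real x * a) = - (of_real A * of_real x) + of_real x * b"
          by (simp add: b_def algebra_simps)
        ultimately show ?thesis by (simp only: of_real_mult exp_add mult.assoc)
      qed
      finally show "(\<lambda>k. f k x) \<longlonglongrightarrow> g x" by (simp add: g_def)
    qed
    show "AE x in lborel. norm (f k x) \<le> indicator {0<..} x *\<^sub>R (x powr (p - 1) * exp (- ((A - norm b) * x)))" for k
    proof (rule AE_I2)
      fix x :: real
      show "norm (f k x) \<le> indicator {0<..} x *\<^sub>R (x powr (p - 1) * exp (- ((A - norm b) * x)))"
      proof (cases "0 < x")
        case True
        have "norm (\<Sum>j<k. (of_real x * b) ^ j / fact j) \<le> (\<Sum>j<k. (x * norm b) ^ j / fact j)"
          using True by (intro order.trans[OF norm_sum] sum_mono) (simp add: norm_divide norm_power norm_mult)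
        also have "\<dots> \<le> exp (x * norm b)"
          using sum_le_suminf[of "\<lambda>j. (x * norm b) ^ j / fact j" "{..<k}"] True summable_exp[of "x * norm b"]
          by (simp add: exp_def scaleR_conv_of_real field_simps)
        finally have "norm (f k x) \<le> x powr (p - 1) * exp (- (A * x)) * exp (x * norm b)"
          using True by (simp add: f_def norm_mult mult_left_mono)
        also have "\<dots> = x powr (p - 1) * exp (- (A * x) + x * norm b)"
          by (simp only: exp_add mult.assoc)
        also have "- (A * x) + x * norm b = - ((A - norm b) * x)" by (simp add: algebra_simps)
        finally show ?thesis using True by simp
      qed (simp add: f_def)
    qed
  qed
  moreover have "(\<integral>x. f k x \<partial>lborel) = (\<Sum>j<k. of_real (Gamma p * A powr (- p)) * (((- of_real p) gchoose j) * (- b / of_real A) ^ j))" for k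
  proof -
    define h where "h = (\<lambda>j x. indicator {0<..} x *\<^sub>R (x powr (p + real j - 1) * exp (- (A * x))))"
    have h: "has_bochner_integral lborel (h j) (Gamma (p + real j) * A powr (- (p + real j)))" for j
      unfolding h_def using has_bochner_integral_Gamma[of "p + real j" A] p A by simp
    have "f k x = (\<Sum>j<k. b ^ j / fact j * of_real (h j x))" for x
    proof (cases "0 < x")
      case True
      then have "x powr (p + real j - 1) = x powr (p - 1) * x ^ j" for j
        by (simp add: powr_add[symmetric] powr_realpow[symmetric] add.commute add_diff_eq)
      with True show ?thesis
        by (simp add: f_def h_def sum_distrib_left power_mult_distrib mult_ac)
    qed (simp add: f_def h_def)
    then have "f k = (\<lambda>x. \<Sum>j<k. b ^ j / fact j * of_real (h j x))" by blast
    moreover have "has_bochner_integral lborel (\<lambda>x. b ^ j / fact j * of_real (h j x))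
       (b ^ j / fact j * of_real (Gamma (p + real j) * A powr (- (p + real j))))" for j
      by (intro has_bochner_integral_mult_right has_bochner_integral_of_real h)
    ultimately have "has_bochner_integral lborel (f k)
       (\<Sum>j<k. b ^ j / fact j * of_real (Gamma (p + real j) * A powr (- (p + real j))))"
      by (simp only:) (intro has_bochner_integral_sum)
    moreover have "b ^ j / fact j * of_real (Gamma (p + real j) * A powr (- (p + real j)))
       = of_real (Gamma p * A powr (- p)) * (((- of_real p) gchoose j) * (- b / of_real A) ^ j)" for j
    proof -
      have "Gamma (p + real j) = Gamma p * pochhammer p j"
      proof -
        have "p \<notin> \<int>\<^sub>\<le>\<^sub>0" using p by (auto elim!: nonpos_Ints_cases)
        moreover have "Gamma p \<noteq> 0" using Gamma_real_pos[OF p] by linarith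
        ultimately show ?thesis by (simp add: pochhammer_Gamma)
      qed
      moreover have "A powr (- (p + real j)) = A powr (- p) / A ^ j"
        using A by (simp add: powr_diff powr_realpow[symmetric] powr_minus_divide powr_add)
      moreover have "((- complex_of_real p) gchoose j) * (- b / of_real A) ^ j
          = of_real (pochhammer p j) / fact j * (b ^ j / of_real A ^ j)"
      proof -
        have "(- complex_of_real p) gchoose j = (- 1) ^ j * (of_real (pochhammer p j) / fact j)"
          by (simp add: gbinomial_pochhammer pochhammer_of_real)
        moreover have "(- b / of_real A) ^ j = (- 1) ^ j * (b ^ j / of_real A ^ j)"
          unfolding power_divide power_minus[of b] by simp
        moreover have "((- 1) ^ j * u) * ((- 1) ^ j * v) = u * v" for u v :: complex
          by (cases "even j") auto
        ultimately show ?thesis by (simp only:)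
      qed
      ultimately show ?thesis
        by (simp only: of_real_mult of_real_divide of_real_power times_divide_eq_left times_divide_eq_right divide_divide_eq_left)
          (simp add: mult_ac)
    qed
    ultimately show ?thesis by (simp add: has_bochner_integral_iff)
  qed
  ultimately have "(\<lambda>j. of_real (Gamma p * A powr (- p)) * (((- of_real p) gchoose j) * (- b / of_real A) ^ j))
      sums (\<integral>x. g x \<partial>lborel)"
    by (simp add: sums_def)
  moreover have "(\<lambda>j. of_real (Gamma p * A powr (- p)) * (((- of_real p) gchoose j) * (- b / of_real A) ^ j))
      sums (of_real (Gamma p * A powr (- p)) * (1 + - b / of_real A) powr (- of_real p))"
    using bA A by (intro sums_mult gen_binomial_complex) (simp add: norm_divide)
  ultimately have "(\<integral>x. g x \<partial>lborel) = of_real (Gamma p * A powr (- p)) * (1 + - b / of_real A) powr (- of_real p)"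
    by (rule sums_unique2)
  also have "1 + - b / of_real A = of_real (1 / A) * a" using A by (simp add: b_def field_simps)
  also have "(of_real (1 / A) * a) powr (- of_real p) = of_real ((1 / A) powr (- p)) * a powr (- of_real p)"
    using A powr_of_real[of "1 / A" "- p"] by (subst powr_times_real_left) auto
  also have "(1 / A) powr (- p) = 1 / A powr (- p)" using A by (simp add: powr_divide)
  finally show ?thesis using A by (simp add: g_def)
qed

definition wright :: "real \<Rightarrow> real \<Rightarrow> real \<Rightarrow> real" where
  "wright \<alpha> \<gamma> x = (\<Sum>j. (- 1) ^ j / fact j * rGamma (\<gamma> - real j * \<alpha>) * x ^ j)"

text \<open>The curves u^\<alpha> and e u cross at u = e^(- 1/(1 - \<alpha>)): up to there
  monotonicity gives the constant, beyond it the linear term suffices. The slope is free, so exp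
  (|x| |t|^\<alpha>) can be charged to any exponential rate.\<close>

lemma powr_le_linear:
  fixes \<alpha> e u :: real
  assumes "0 < \<alpha>" "\<alpha> < 1" "0 < e" "0 < u"
  shows "u powr \<alpha> \<le> e * u + e powr (- \<alpha> / (1 - \<alpha>))"
proof (cases "u \<le> e powr (- 1 / (1 - \<alpha>))")
  case True
  then have "u powr \<alpha> \<le> (e powr (- 1 / (1 - \<alpha>))) powr \<alpha>" using assms by (intro powr_mono2) auto
  also have "\<dots> = e powr (- \<alpha> / (1 - \<alpha>))" by (simp add: powr_powr)
  finally show ?thesis using assms by (smt (verit) mult_pos_pos)
next
  case False
  have "u powr \<alpha> = u powr (- (1 - \<alpha>)) * u" using assms by (simp add: powr_diff powr_minus field_simps)
  also have "\<dots> \<le> (e powr (- 1 / (1 - \<alpha>))) powr (- (1 - \<alpha>)) * u"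
    using False assms by (intro mult_right_mono powr_mono2') auto
  also have "\<dots> = e * u"
  proof -
    have "- 1 / (1 - \<alpha>) * - (1 - \<alpha>) = 1" using assms by (simp add: field_simps)
    then show ?thesis using assms by (simp only: powr_powr) simp
  qed
  finally show ?thesis using powr_ge_zero[of e "- \<alpha> / (1 - \<alpha>)"] by linarith
qed

text \<open>The inequality is required at t = 1 - w for w in the sector of the contour, and hence on
  the rays. It makes exp (- x t^\<alpha>) decay in x for all such t, and it forces |h| < 1 near 1.
  Slopes with this property are supplied by \<open>sector_exists\<close>.\<close>

locale hankel_alpha = hankel_contour +
  fixes \<alpha> \<delta> :: real
  assumes \<alpha>: "0 < \<alpha>" "\<alpha> < 1" and \<delta>: "0 < \<delta>"
    and sector: "\<And>t. - (S * Re t) \<le> \<bar>Im t\<bar> \<Longrightarrow> \<delta> * norm t powr \<alpha> \<le> Re (t powr of_real \<alpha>)"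
begin

lemma ray_point_sector:
  assumes "d \<in> dirs" "0 \<le> y"
  shows "\<delta> * norm (1 - of_real y * d) powr \<alpha> \<le> Re ((1 - of_real y * d) powr of_real \<alpha>)"
    "\<delta> / 2 \<le> Re ((1 - of_real y * d) powr of_real \<alpha>)"
proof -
  have "- (S * Re (1 - of_real y * d)) \<le> \<bar>Im (1 - of_real y * d)\<bar>"
    using assms S by (simp add: dirs_simps abs_mult algebra_simps)
  then show 1: "\<delta> * norm (1 - of_real y * d) powr \<alpha> \<le> Re ((1 - of_real y * d) powr of_real \<alpha>)"
    by (rule sector)
  have "(1 / 2) powr 1 \<le> (1 / 2 :: real) powr \<alpha>" using \<alpha> by (intro powr_mono') auto
  also have "\<dots> \<le> norm (1 - of_real y * d) powr \<alpha>"
    using \<alpha> norm_ray_point[OF assms] by (intro powr_mono2) auto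
  finally have "\<delta> * (1 / 2) \<le> \<delta> * norm (1 - of_real y * d) powr \<alpha>" using \<delta> by (intro mult_left_mono) auto
  with 1 show "\<delta> / 2 \<le> Re ((1 - of_real y * d) powr of_real \<alpha>)" by linarith
qed

lemma ray_powr_continuous:
  assumes "d \<in> dirs"
  shows "continuous_on {0..} (\<lambda>y. (1 - of_real y * d) powr c)"
proof (rule continuous_on_compose2[of "- \<real>\<^sub>\<le>\<^sub>0" "\<lambda>t. t powr c"])
  show "(\<lambda>y. 1 - of_real y * d) ` {0..} \<subseteq> - \<real>\<^sub>\<le>\<^sub>0"
  proof
    fix t assume "t \<in> (\<lambda>y. 1 - of_real y * d) ` {0..}"
    then obtain y where y: "0 \<le> y" "t = 1 - of_real y * d" by auto
    have "Im t = 0 \<longrightarrow> Re t = 1"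
      using dirs_simps[OF assms] S by (auto simp: y(2))
    then show "t \<in> - \<real>\<^sub>\<le>\<^sub>0" by (auto simp: complex_nonpos_Reals_iff)
  qed
  show "continuous_on (- \<real>\<^sub>\<le>\<^sub>0) (\<lambda>t::complex. t powr c)"
    by (intro continuous_intros) (auto simp: complex_nonpos_Reals_iff)
  show "continuous_on {0..} (\<lambda>y. 1 - of_real y * d)" by (intro continuous_intros)
qed

lemma ray_measurable:
  assumes "d \<in> dirs"
  shows "(\<lambda>y. indicator {0..} y *\<^sub>R (1 - of_real y * d) powr c) \<in> borel_measurable lborel"
  using borel_measurable_continuous_on_indicator[OF _ ray_powr_continuous[OF assms]] by simp

lemma ray_powr_bound:
  assumes d: "d \<in> dirs" and y: "0 \<le> y"
  shows "norm (exp (1 - of_real y * d) * (1 - of_real y * d) powr (- of_real s) * d) \<le>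
     exp 1 * (2 * (1 + S)) powr \<bar>s\<bar> * (1 + S) * ((1 + y) powr \<bar>s\<bar> * exp (- (1 * y)))"
proof -
  have "norm (exp (1 - of_real y * d) * (1 - of_real y * d) powr (- of_real s) * d)
     = exp (1 - y) * norm (1 - of_real y * d) powr (- s) * norm d"
    using d norm_powr_real_powr'[of "- of_real s" "1 - of_real y * d"]
    by (simp add: norm_mult dirs_simps)
  also have "\<dots> \<le> exp (1 - y) * ((2 * (1 + S)) powr \<bar>- s\<bar> * (1 + y) powr \<bar>- s\<bar>) * (1 + S)"
    using norm_ray_point_powr[OF d y, of "- s"] dirs_simps(3)[OF d] by (intro mult_mono) auto
  also have "\<dots> = exp 1 * (2 * (1 + S)) powr \<bar>s\<bar> * (1 + S) * ((1 + y) powr \<bar>s\<bar> * exp (- (1 * y)))"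
    by (simp add: exp_diff exp_minus field_simps)
  finally show ?thesis .
qed

lemma ray_powr_integrable:
  assumes d: "d \<in> dirs"
  shows "integrable lborel (\<lambda>y. indicator {0..} y *\<^sub>R (exp (1 - of_real y * d) * (1 - of_real y * d) powr (- of_real s) * d))"
proof (rule Bochner_Integration.integrable_bound)
  show "integrable lborel (\<lambda>y. indicator {0..} y *\<^sub>R
     (exp 1 * (2 * (1 + S)) powr \<bar>s\<bar> * (1 + S) * ((1 + y) powr \<bar>s\<bar> * exp (- (1 * y)))))"
    using integrable_powr_exp[of "\<bar>s\<bar>" 1] unfolding set_integrable_def[symmetric] by (intro set_integrable_mult_right) auto
  have "(\<lambda>y. exp (1 - of_real y * d) * (indicator {0..} y *\<^sub>R (1 - of_real y * d) powr (- of_real s)) * d) \<in> borel_measurable lborel"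
    using ray_measurable[OF d] by measurable
  then show "(\<lambda>y. indicator {0..} y *\<^sub>R (exp (1 - of_real y * d) * (1 - of_real y * d) powr (- of_real s) * d)) \<in> borel_measurable lborel"
    by simp
  show "AE y in lborel. norm (indicator {0..} y *\<^sub>R (exp (1 - of_real y * d) * (1 - of_real y * d) powr (- of_real s) * d))
     \<le> norm (indicator {0..} y *\<^sub>R
     (exp 1 * (2 * (1 + S)) powr \<bar>s\<bar> * (1 + S) * ((1 + y) powr \<bar>s\<bar> * exp (- (1 * y)))))"
  proof (rule AE_I2)
    fix y :: real
    show "norm (indicator {0..} y *\<^sub>R (exp (1 - of_real y * d) * (1 - of_real y * d) powr (- of_real s) * d))
     \<le> norm (indicator {0..} y *\<^sub>R
     (exp 1 * (2 * (1 + S)) powr \<bar>s\<bar> * (1 + S) * ((1 + y) powr \<bar>s\<bar> * exp (- (1 * y)))))"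
      using ray_powr_bound[OF d, of y s] by (cases "0 \<le> y") (auto intro: order.trans[OF _ abs_ge_self])
  qed
qed

text \<open>The exponential of - x t^\<alpha> is expanded and integrated term by term. All partial
  sums are bounded by exp (|x| |t|^\<alpha>), and since \<alpha> < 1 this growth consumes only half
  of the decay exp (- y) of exp t.\<close>

lemma ray_wright_sums:
  assumes d: "d \<in> dirs"
  shows "(\<lambda>j. of_real ((- 1) ^ j / fact j * x ^ j) * ray (\<lambda>t. exp t * t powr (- of_real (\<gamma> - real j * \<alpha>))) d)
    sums ray (\<lambda>t. exp t * (exp (- of_real x * t powr of_real \<alpha>) * t powr (- of_real \<gamma>))) d"
proof -
  define h where "h = (\<lambda>j y. indicator {0..} y *\<^sub>R (exp (1 - of_real y * d) * (1 - of_real y * d) powr (- of_real (\<gamma> - real j * \<alpha>)) * d))"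
  define f where "f = (\<lambda>k y. \<Sum>j<k. of_real ((- 1) ^ j / fact j * x ^ j) * h j y)"
  define g where "g = (\<lambda>y. indicator {0..} y *\<^sub>R (exp (1 - of_real y * d) *
     (exp (- of_real x * (1 - of_real y * d) powr of_real \<alpha>) * (1 - of_real y * d) powr (- of_real \<gamma>)) * d))"
  have hi: "integrable lborel (h j)" for j
    unfolding h_def using ray_powr_integrable[OF d, of "\<gamma> - real j * \<alpha>"] by simp
  have fm: "f k \<in> borel_measurable lborel" for k unfolding f_def
    by (intro borel_measurable_sum borel_measurable_times borel_measurable_const borel_measurable_integrable hi)
  have h_eq: "h j y = (((1 - of_real y * d) powr of_real \<alpha>) ^ j) * h 0 y" if "0 \<le> y" for j y
  proof -
    have nz: "1 - of_real y * d \<noteq> 0" using norm_ray_point[OF d that] by auto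
    have "- complex_of_real (\<gamma> - real j * \<alpha>) = of_nat j * of_real \<alpha> + - of_real \<gamma>" by simp
    then have "(1 - of_real y * d) powr (- of_real (\<gamma> - real j * \<alpha>)) =
        ((1 - of_real y * d) powr of_real \<alpha>) ^ j * (1 - of_real y * d) powr (- of_real \<gamma>)"
      by (simp only: powr_add powr_power[OF nz])
    then show ?thesis using that by (simp add: h_def)
  qed
  define X where "X = \<bar>x\<bar> * (1 + S) powr \<alpha>"
  have X: "0 \<le> X" by (simp add: X_def)
  \<comment> \<open>The slope 1/(2 (X + 1)) is used in \<open>powr_le_linear\<close>: multiplied by
    X it is at most 1/2. The summand 1/2 comes from the 1 in 1 + y.\<close>
  define E where "E = X * (1 / (2 * (X + 1))) powr (- \<alpha> / (1 - \<alpha>)) + 1 / 2"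
  have ex: "exp (\<bar>x\<bar> * norm (1 - of_real y * d) powr \<alpha>) \<le> exp E * exp (1 / 2 * y)" if y: "0 \<le> y" for y
  proof -
    have "\<bar>x\<bar> * norm (1 - of_real y * d) powr \<alpha> \<le> \<bar>x\<bar> * ((1 + S) * (1 + y)) powr \<alpha>"
      using norm_ray_point[OF d y] \<alpha> by (intro mult_left_mono powr_mono2) auto
    also have "\<dots> = X * (1 + y) powr \<alpha>" using S y by (simp add: X_def powr_mult)
    also have "\<dots> \<le> X * (1 / (2 * (X + 1)) * (1 + y) + (1 / (2 * (X + 1))) powr (- \<alpha> / (1 - \<alpha>)))"
      using X y \<alpha> by (intro mult_left_mono powr_le_linear) auto
    also have "\<dots> \<le> E + 1 / 2 * y"
    proof -
      have "X * (1 / (2 * (X + 1)) * (1 + y)) \<le> 1 / 2 * (1 + y)"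
      proof -
        have "X * (1 / (2 * (X + 1))) \<le> 1 / 2" using X by (simp add: divide_simps)
        then have "X * (1 / (2 * (X + 1))) * (1 + y) \<le> 1 / 2 * (1 + y)"
          using y by (intro mult_right_mono) auto
        then show ?thesis by (simp only: mult.assoc)
      qed
      then show ?thesis by (simp add: E_def distrib_left)
    qed
    finally show ?thesis by (simp add: exp_add[symmetric])
  qed
  define D where "D = exp E * (exp 1 * (2 * (1 + S)) powr \<bar>\<gamma>\<bar> * (1 + S))"
  have D: "0 \<le> D" using S by (simp add: D_def)
  have bound: "norm (f k y) \<le> indicator {0..} y *\<^sub>R (D * ((1 + y) powr \<bar>\<gamma>\<bar> * exp (- (1 / 2 * y))))" for k y
  proof (cases "0 \<le> y")
    case True
    let ?t = "1 - of_real y * d"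
    have "f k y = (\<Sum>j<k. of_real ((- 1) ^ j / fact j * x ^ j) * (?t powr of_real \<alpha>) ^ j) * h 0 y"
      unfolding f_def sum_distrib_right
    proof (intro sum.cong refl)
      fix j
      show "of_real ((- 1) ^ j / fact j * x ^ j) * h j y = of_real ((- 1) ^ j / fact j * x ^ j) * (?t powr of_real \<alpha>) ^ j * h 0 y"
        unfolding h_eq[OF True, of j] mult.assoc ..
    qed
    also have "norm \<dots> \<le> (\<Sum>j<k. (\<bar>x\<bar> * norm ?t powr \<alpha>) ^ j / fact j) * norm (h 0 y)"
      unfolding norm_mult using norm_powr_real_powr'[of "of_real \<alpha>" ?t]
      by (intro mult_right_mono order.trans[OF norm_sum] sum_mono)
        (auto simp: norm_mult norm_divide norm_power power_abs power_mult_distrib)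
    also have "\<dots> \<le> exp (\<bar>x\<bar> * norm ?t powr \<alpha>) * norm (h 0 y)"
      using sum_le_suminf[of "\<lambda>j. (\<bar>x\<bar> * norm ?t powr \<alpha>) ^ j / fact j" "{..<k}"] summable_exp[of "\<bar>x\<bar> * norm ?t powr \<alpha>"]
      by (intro mult_right_mono) (simp_all add: exp_def scaleR_conv_of_real field_simps)
    also have "\<dots> \<le> (exp E * exp (1 / 2 * y)) * (exp 1 * (2 * (1 + S)) powr \<bar>\<gamma>\<bar> * (1 + S) * ((1 + y) powr \<bar>\<gamma>\<bar> * exp (- (1 * y))))"
      using ex[OF True] ray_powr_bound[OF d True, of \<gamma>] True by (intro mult_mono) (auto simp: h_def)
    also have "\<dots> = D * ((1 + y) powr \<bar>\<gamma>\<bar> * (exp (1 / 2 * y) * exp (- (1 * y))))" by (simp add: D_def)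
    also have "exp (1 / 2 * y) * exp (- (1 * y)) = exp (- (1 / 2 * y))" by (simp add: exp_add[symmetric])
    finally show ?thesis using True by simp
  qed (simp add: f_def h_def)
  have ptw: "(\<lambda>k. f k y) \<longlonglongrightarrow> g y" for y
  proof (cases "0 \<le> y")
    case True
    let ?t = "1 - of_real y * d"
    have "(\<lambda>j. (- of_real x * ?t powr of_real \<alpha>) ^ j /\<^sub>R fact j * h 0 y) sums (exp (- of_real x * ?t powr of_real \<alpha>) * h 0 y)"
      by (intro sums_mult2 exp_converges)
    moreover have "(- of_real x * ?t powr of_real \<alpha>) ^ j /\<^sub>R fact j * h 0 y = of_real ((- 1) ^ j / fact j * x ^ j) * h j y" for j
    proof -
      have "(- of_real x * ?t powr of_real \<alpha>) ^ j = (- 1) ^ j * (of_real x ^ j * (?t powr of_real \<alpha>) ^ j)"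
        using power_minus[of "of_real x * ?t powr of_real \<alpha>" j] by (simp add: power_mult_distrib)
      then show ?thesis
        unfolding h_eq[OF True, of j] by (simp add: scaleR_conv_of_real divide_inverse)
    qed
    ultimately have "(\<lambda>k. f k y) \<longlonglongrightarrow> exp (- of_real x * ?t powr of_real \<alpha>) * h 0 y"
      by (simp add: sums_def f_def)
    also have "exp (- of_real x * ?t powr of_real \<alpha>) * h 0 y = g y" using True by (simp add: g_def h_def)
    finally show ?thesis .
  qed (simp add: f_def h_def g_def)
  have "(\<lambda>k. \<integral>y. f k y \<partial>lborel) \<longlonglongrightarrow> (\<integral>y. g y \<partial>lborel)"
  proof (rule integral_dominated_convergence)
    show "integrable lborel (\<lambda>y. indicator {0..} y *\<^sub>R (D * ((1 + y) powr \<bar>\<gamma>\<bar> * exp (- (1 / 2 * y)))))"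
      using integrable_powr_exp[of "\<bar>\<gamma>\<bar>" "1 / 2"] unfolding set_integrable_def[symmetric] by (intro set_integrable_mult_right) auto
    show "g \<in> borel_measurable lborel" by (rule borel_measurable_LIMSEQ_metric[OF fm ptw])
  qed (use fm ptw bound in auto)
  moreover have "(\<integral>y. f k y \<partial>lborel) = (\<Sum>j<k. of_real ((- 1) ^ j / fact j * x ^ j) * (\<integral>y. h j y \<partial>lborel))" for k
  proof -
    have "(\<integral>y. f k y \<partial>lborel) = (\<Sum>j<k. \<integral>y. of_real ((- 1) ^ j / fact j * x ^ j) * h j y \<partial>lborel)"
      unfolding f_def by (intro Bochner_Integration.integral_sum integrable_mult_right hi)
    then show ?thesis by (simp only: integral_mult_right_zero)
  qed
  ultimately show ?thesis
    unfolding sums_def ray_def set_lebesgue_integral_def h_def g_def by simp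
qed

lemma wright_sums_hankel:
  "(\<lambda>j. of_real ((- 1) ^ j / fact j * rGamma (\<gamma> - real j * \<alpha>) * x ^ j)) sums
     hankel (\<lambda>t. exp t * (exp (- of_real x * t powr of_real \<alpha>) * t powr (- of_real \<gamma>)))"
proof -
  have "(\<lambda>j. of_real ((- 1) ^ j / fact j * x ^ j) * hankel (\<lambda>t. exp t * t powr (- of_real (\<gamma> - real j * \<alpha>)))) sums
     hankel (\<lambda>t. exp t * (exp (- of_real x * t powr of_real \<alpha>) * t powr (- of_real \<gamma>)))"
    unfolding hankel_def times_divide_eq_right right_diff_distrib
    by (intro sums_divide sums_diff ray_wright_sums) (auto simp: dirs_def)
  then show ?thesis unfolding hankel_rGamma by (simp add: mult_ac)
qed

text \<open>Convergence of the real series is inherited from the term-by-term integration, so no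
  estimate of 1/Gamma at large negative arguments is needed.\<close>

lemma wright_sums: "(\<lambda>j. (- 1) ^ j / fact j * rGamma (\<gamma> - real j * \<alpha>) * x ^ j) sums wright \<alpha> \<gamma> x"
  and wright_hankel: "hankel (\<lambda>t. exp t * (exp (- of_real x * t powr of_real \<alpha>) * t powr (- of_real \<gamma>))) = of_real (wright \<alpha> \<gamma> x)"
proof -
  have "summable (\<lambda>j. complex_of_real ((- 1) ^ j / fact j * rGamma (\<gamma> - real j * \<alpha>) * x ^ j))"
    using wright_sums_hankel sums_summable by blast
  then have "summable (\<lambda>j. (- 1) ^ j / fact j * rGamma (\<gamma> - real j * \<alpha>) * x ^ j)"
    by (simp only: summable_of_real_iff)
  then show 1: "(\<lambda>j. (- 1) ^ j / fact j * rGamma (\<gamma> - real j * \<alpha>) * x ^ j) sums wright \<alpha> \<gamma> x"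
    unfolding wright_def by (rule summable_sums)
  show "hankel (\<lambda>t. exp t * (exp (- of_real x * t powr of_real \<alpha>) * t powr (- of_real \<gamma>))) = of_real (wright \<alpha> \<gamma> x)"
    using sums_unique2[OF wright_sums_hankel sums_of_real[OF 1]] .
qed

lemma isCont_wright: "isCont (wright \<alpha> \<gamma>) x"
  unfolding wright_def[abs_def]
  using isCont_powser_converges_everywhere[of "\<lambda>j. (- 1) ^ j / fact j * rGamma (\<gamma> - real j * \<alpha>)" x]
    wright_sums sums_summable by blast

lemma exp_ray_point_bound:
  assumes "d \<in> dirs" "0 \<le> y" "0 \<le> x"
  shows "norm (exp (- of_real x * (1 - of_real y * d) powr of_real \<alpha>)) \<le> exp (- (\<delta> / 2 * x))"
proof -
  have "x * (\<delta> / 2) \<le> x * Re ((1 - of_real y * d) powr of_real \<alpha>)"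
    using ray_point_sector(2)[OF assms(1,2)] assms(3) by (rule mult_left_mono)
  then show ?thesis by (simp add: mult.commute)
qed

lemma ray_wright_measurable:
  assumes "d \<in> dirs"
  shows "(\<lambda>(x, y). indicator {0..} y *\<^sub>R (exp (1 - of_real y * d) *
     (exp (- of_real x * (1 - of_real y * d) powr of_real \<alpha>) * (1 - of_real y * d) powr (- of_real \<gamma>)) * d))
      \<in> borel_measurable (lborel \<Otimes>\<^sub>M lborel)"
proof -
  define P where "P = (\<lambda>c y. indicator {0..} y *\<^sub>R (1 - of_real y * d) powr c)"
  have P[measurable]: "P c \<in> borel_measurable lborel" for c
    unfolding P_def by (rule ray_measurable[OF assms])
  have "(\<lambda>(x, y). exp (1 - of_real y * d) * (exp (- of_real x * P (of_real \<alpha>) y) * P (- of_real \<gamma>) y) * d)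
      \<in> borel_measurable (lborel \<Otimes>\<^sub>M lborel)"
    by measurable
  also have "(\<lambda>(x, y). exp (1 - of_real y * d) * (exp (- of_real x * P (of_real \<alpha>) y) * P (- of_real \<gamma>) y) * d) =
    (\<lambda>(x, y). indicator {0..} y *\<^sub>R (exp (1 - of_real y * d) *
     (exp (- of_real x * (1 - of_real y * d) powr of_real \<alpha>) * (1 - of_real y * d) powr (- of_real \<gamma>)) * d))"
    by (auto simp: fun_eq_iff P_def indicator_def)
  finally show ?thesis .
qed

definition "ray_mass \<gamma> d = (\<integral>y. norm (indicator {0..} y *\<^sub>R (exp (1 - of_real y * d) * (1 - of_real y * d) powr (- of_real \<gamma>) * d)) \<partial>lborel)"

lemma ray_mass_nonneg: "0 \<le> ray_mass \<gamma> d"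
  unfolding ray_mass_def by (intro integral_nonneg_AE) auto

lemma ray_wright_integrable:
  assumes d: "d \<in> dirs" and x: "0 \<le> x"
  shows "integrable lborel (\<lambda>y. indicator {0..} y *\<^sub>R (exp (1 - of_real y * d) *
     (exp (- of_real x * (1 - of_real y * d) powr of_real \<alpha>) * (1 - of_real y * d) powr (- of_real \<gamma>)) * d))" (is "integrable _ ?f")
    and "(\<integral>y. norm (indicator {0..} y *\<^sub>R (exp (1 - of_real y * d) *
     (exp (- of_real x * (1 - of_real y * d) powr of_real \<alpha>) * (1 - of_real y * d) powr (- of_real \<gamma>)) * d)) \<partial>lborel)
       \<le> exp (- (\<delta> / 2 * x)) * ray_mass \<gamma> d"
proof -
  let ?g = "\<lambda>y. indicator {0..} y *\<^sub>R (exp (1 - of_real y * d) * (1 - of_real y * d) powr (- of_real \<gamma>) * d)"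
  have g: "integrable lborel ?g" by (rule ray_powr_integrable[OF d])
  have b: "norm (?f y) \<le> exp (- (\<delta> / 2 * x)) * norm (?g y)" for y
  proof (cases "0 \<le> y")
    case True
    have "norm (?f y) = norm (exp (- of_real x * (1 - of_real y * d) powr of_real \<alpha>)) * norm (?g y)"
      by (simp add: norm_mult)
    also have "\<dots> \<le> exp (- (\<delta> / 2 * x)) * norm (?g y)"
      by (intro mult_right_mono exp_ray_point_bound d True x) simp
    finally show ?thesis .
  qed simp
  have m: "?f \<in> borel_measurable lborel"
    using measurable_compose[OF measurable_Pair1'[of x lborel lborel] ray_wright_measurable[OF d, of \<gamma>]] by simp
  have i: "integrable lborel (\<lambda>y. exp (- (\<delta> / 2 * x)) * norm (?g y))"
    by (rule integrable_mult_right[OF integrable_norm[OF g]])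
  show f: "integrable lborel ?f"
    by (rule Bochner_Integration.integrable_bound[OF i m]) (use b in \<open>auto intro!: AE_I2 simp del: norm_scaleR\<close>)
  have "(\<integral>y. norm (?f y) \<partial>lborel) \<le> (\<integral>y. exp (- (\<delta> / 2 * x)) * norm (?g y) \<partial>lborel)"
    by (intro integral_mono integrable_norm f i b)
  then show "(\<integral>y. norm (?f y) \<partial>lborel) \<le> exp (- (\<delta> / 2 * x)) * ray_mass \<gamma> d"
    by (simp only: ray_mass_def integral_mult_right_zero)
qed

lemma wright_measurable [measurable]: "wright \<alpha> \<gamma> \<in> borel_measurable borel"
  by (intro borel_measurable_continuous_onI continuous_at_imp_continuous_on ballI isCont_wright)

text \<open>Fubini: for fixed t the integral over x is the Laplace transform of x^(p-1) at
  t^\<alpha>, which contributes Gamma p and t^(- \<alpha> p). Absolute integrability comes from the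
  decay exp (- \<delta> x / 2) along the whole ray.\<close>

lemma ray_power_moment:
  assumes d: "d \<in> dirs" and p: "0 < p"
  shows "has_bochner_integral lborel (\<lambda>x. indicator {0<..} x *\<^sub>R (of_real (x powr (p - 1)) *
      ray (\<lambda>t. exp t * (exp (- of_real x * t powr of_real \<alpha>) * t powr (- of_real \<gamma>))) d))
    (of_real (Gamma p) * ray (\<lambda>t. exp t * t powr (- of_real (\<gamma> + \<alpha> * p))) d)"
proof -
  define k where "k = (\<lambda>x y. indicator {0..} y *\<^sub>R (exp (1 - of_real y * d) *
     (exp (- of_real x * (1 - of_real y * d) powr of_real \<alpha>) * (1 - of_real y * d) powr (- of_real \<gamma>)) * d))"
  define f where "f = (\<lambda>(x, y). indicator {0<..} x *\<^sub>R (of_real (x powr (p - 1)) * k x y))"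
  have km[measurable]: "(\<lambda>(x, y). k x y) \<in> borel_measurable (lborel \<Otimes>\<^sub>M lborel)"
    unfolding k_def by (rule ray_wright_measurable[OF d])
  have fm[measurable]: "f \<in> borel_measurable (lborel \<Otimes>\<^sub>M lborel)"
    unfolding f_def by measurable
  have ki: "integrable lborel (k x)" "(\<integral>y. norm (k x y) \<partial>lborel) \<le> exp (- (\<delta> / 2 * x)) * ray_mass \<gamma> d" if "0 \<le> x" for x
    unfolding k_def using ray_wright_integrable[OF d that, of \<gamma>] by auto
  have "integrable (lborel \<Otimes>\<^sub>M lborel) f"
  proof (rule lborel_pair.Fubini_integrable)
    show "AE x in lborel. integrable lborel (\<lambda>y. f (x, y))"
    proof (rule AE_I2)
      fix x :: real
      show "integrable lborel (\<lambda>y. f (x, y))" using ki(1)[of x] by (cases "0 < x") (simp_all add: f_def)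
    qed
    have dom: "integrable lborel (\<lambda>x. (indicator {0<..} x *\<^sub>R (x powr (p - 1) * exp (- (\<delta> / 2 * x)))) * ray_mass \<gamma> d)"
      using has_bochner_integral_Gamma[OF p, of "\<delta> / 2"] \<delta>
      by (intro integrable_mult_left) (simp add: has_bochner_integral_iff)
    show "integrable lborel (\<lambda>x. \<integral>y. norm (f (x, y)) \<partial>lborel)"
    proof (rule Bochner_Integration.integrable_bound[OF dom])
      show "(\<lambda>x. \<integral>y. norm (f (x, y)) \<partial>lborel) \<in> borel_measurable lborel" by measurable
      show "AE x in lborel. norm (\<integral>y. norm (f (x, y)) \<partial>lborel)
         \<le> norm ((indicator {0<..} x *\<^sub>R (x powr (p - 1) * exp (- (\<delta> / 2 * x)))) * ray_mass \<gamma> d)"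
      proof (rule AE_I2)
        fix x :: real
        show "norm (\<integral>y. norm (f (x, y)) \<partial>lborel)
         \<le> norm ((indicator {0<..} x *\<^sub>R (x powr (p - 1) * exp (- (\<delta> / 2 * x)))) * ray_mass \<gamma> d)"
        proof (cases "0 < x")
          case True
          have "(\<integral>y. norm (f (x, y)) \<partial>lborel) = x powr (p - 1) * (\<integral>y. norm (k x y) \<partial>lborel)"
            using True by (simp add: f_def norm_mult)
          also have "\<dots> \<le> x powr (p - 1) * (exp (- (\<delta> / 2 * x)) * ray_mass \<gamma> d)"
            using ki(2)[of x] True by (intro mult_left_mono) auto
          finally show ?thesis using True ray_mass_nonneg[of \<gamma> d]
            by (simp add: abs_mult)
        qed (simp add: f_def)
      qed
    qed
  qed measurable
  then have I: "integrable (lborel \<Otimes>\<^sub>M lborel) (\<lambda>(x, y). f (x, y))" by simp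
  have inner_y: "(\<integral>y. f (x, y) \<partial>lborel) = indicator {0<..} x *\<^sub>R (of_real (x powr (p - 1)) *
      ray (\<lambda>t. exp t * (exp (- of_real x * t powr of_real \<alpha>) * t powr (- of_real \<gamma>))) d)" for x
  proof (cases "0 < x")
    case True
    have "f (x, y) = of_real (x powr (p - 1)) * k x y" for y using True by (simp add: f_def)
    then have "(\<integral>y. f (x, y) \<partial>lborel) = of_real (x powr (p - 1)) * (\<integral>y. k x y \<partial>lborel)"
      by (simp only: integral_mult_right_zero)
    then show ?thesis using True unfolding ray_def set_lebesgue_integral_def k_def by simp
  qed (simp add: f_def)
  have inner_x: "(\<integral>x. f (x, y) \<partial>lborel) = of_real (Gamma p) * (indicator {0..} y *\<^sub>R
      (exp (1 - of_real y * d) * (1 - of_real y * d) powr (- of_real (\<gamma> + \<alpha> * p)) * d))" for y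
  proof (cases "0 \<le> y")
    case True
    let ?t = "1 - of_real y * d"
    have t0: "?t \<noteq> 0" using norm_ray_point[OF d True] by auto
    have a: "0 < Re (?t powr of_real \<alpha>)" using ray_point_sector(2)[OF d True] \<delta> by linarith
    have "f (x, y) = (indicator {0<..} x *\<^sub>R (of_real (x powr (p - 1)) * exp (- (of_real x * ?t powr of_real \<alpha>)))) *
        (exp ?t * ?t powr (- of_real \<gamma>) * d)" for x
      using True by (simp add: f_def k_def indicator_def)
    then have "(\<integral>x. f (x, y) \<partial>lborel) =
        (\<integral>x. indicator {0<..} x *\<^sub>R (of_real (x powr (p - 1)) * exp (- (of_real x * ?t powr of_real \<alpha>))) \<partial>lborel) *
        (exp ?t * ?t powr (- of_real \<gamma>) * d)"
      by (simp only: integral_mult_left_zero)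
    also have "\<dots> = of_real (Gamma p) * (?t powr of_real \<alpha>) powr (- of_real p) * (exp ?t * ?t powr (- of_real \<gamma>) * d)"
      by (simp only: Laplace_powr_complex[OF p a])
    \<comment> \<open>Iterated principal powers multiply here because \<alpha> < 1 keeps the
      argument of t^\<alpha> inside (- pi, pi).\<close>
    also have "(?t powr of_real \<alpha>) powr (- of_real p) = ?t powr (- of_real (\<alpha> * p))"
    proof -
      have im: "\<bar>\<alpha> * Im (Ln ?t)\<bar> < pi"
      proof -
        have "\<bar>\<alpha> * Im (Ln ?t)\<bar> \<le> \<alpha> * pi"
          using mpi_less_Im_Ln[OF t0] Im_Ln_le_pi[OF t0] \<alpha> by (simp add: abs_mult)
        also have "\<dots> < pi" using \<alpha> by simp
        finally show ?thesis .
      qed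
      have "Ln (exp (of_real \<alpha> * Ln ?t)) = of_real \<alpha> * Ln ?t"
        using im by (intro Ln_exp) (auto simp: abs_less_iff)
      then show ?thesis using t0 by (simp add: powr_def mult_ac)
    qed
    finally show ?thesis using True t0 by (simp add: powr_add minus_add_distrib powr_diff powr_minus field_simps)
  qed (simp add: f_def k_def)
  have "integrable lborel (\<lambda>x. \<integral>y. f (x, y) \<partial>lborel)"
    using lborel_pair.integrable_fst'[OF \<open>integrable _ f\<close>] by simp
  moreover have "(\<integral>x. (\<integral>y. f (x, y) \<partial>lborel) \<partial>lborel) = (\<integral>y. (\<integral>x. f (x, y) \<partial>lborel) \<partial>lborel)"
    using lborel_pair.Fubini_integral[OF I] by simp
  moreover have "(\<integral>y. (\<integral>x. f (x, y) \<partial>lborel) \<partial>lborel) = of_real (Gamma p) * ray (\<lambda>t. exp t * t powr (- of_real (\<gamma> + \<alpha> * p))) d"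
    unfolding inner_x ray_def set_lebesgue_integral_def by (rule integral_mult_right_zero)
  ultimately show ?thesis unfolding has_bochner_integral_iff inner_y by simp
qed

lemma wright_moment_pos:
  assumes p: "0 < p"
  shows "has_bochner_integral lborel (\<lambda>x. indicator {0<..} x *\<^sub>R (x powr (p - 1) * wright \<alpha> \<gamma> x))
    (Gamma p * rGamma (\<gamma> + \<alpha> * p))"
proof -
  let ?R = "\<lambda>x. ray (\<lambda>t. exp t * (exp (- of_real x * t powr of_real \<alpha>) * t powr (- of_real \<gamma>)))"
  let ?Q = "ray (\<lambda>t. exp t * t powr (- of_real (\<gamma> + \<alpha> * p)))"
  have "has_bochner_integral lborel (\<lambda>x.
     (indicator {0<..} x *\<^sub>R (of_real (x powr (p - 1)) * ?R x (Complex 1 S)) -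
      indicator {0<..} x *\<^sub>R (of_real (x powr (p - 1)) * ?R x (Complex 1 (- S)))) / (2 * of_real pi * \<i>))
     ((of_real (Gamma p) * ?Q (Complex 1 S) - of_real (Gamma p) * ?Q (Complex 1 (- S))) / (2 * of_real pi * \<i>))"
    by (intro has_bochner_integral_divide has_bochner_integral_diff ray_power_moment p) (auto simp: dirs_def)
  moreover have "(indicator {0<..} x *\<^sub>R (of_real (x powr (p - 1)) * ?R x (Complex 1 S)) -
      indicator {0<..} x *\<^sub>R (of_real (x powr (p - 1)) * ?R x (Complex 1 (- S)))) / (2 * of_real pi * \<i>)
      = of_real (indicator {0<..} x *\<^sub>R (x powr (p - 1) * wright \<alpha> \<gamma> x))" for x
  proof -
    have "(of_real (x powr (p - 1)) * ?R x (Complex 1 S) - of_real (x powr (p - 1)) * ?R x (Complex 1 (- S))) / (2 * of_real pi * \<i>)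
      = of_real (x powr (p - 1)) * ((?R x (Complex 1 S) - ?R x (Complex 1 (- S))) / (2 * of_real pi * \<i>))"
      by (simp only: right_diff_distrib[symmetric] times_divide_eq_right)
    also have "\<dots> = of_real (x powr (p - 1) * wright \<alpha> \<gamma> x)"
      unfolding hankel_def[symmetric] wright_hankel by simp
    finally show ?thesis by (cases "0 < x") simp_all
  qed
  moreover have "(of_real (Gamma p) * ?Q (Complex 1 S) - of_real (Gamma p) * ?Q (Complex 1 (- S))) / (2 * of_real pi * \<i>)
      = of_real (Gamma p * rGamma (\<gamma> + \<alpha> * p))"
    using hankel_rGamma[of "\<gamma> + \<alpha> * p"] unfolding hankel_def right_diff_distrib[symmetric] times_divide_eq_right[symmetric]
    by (simp only: of_real_mult)
  ultimately have c: "has_bochner_integral lborel (\<lambda>x. complex_of_real (indicator {0<..} x *\<^sub>R (x powr (p - 1) * wright \<alpha> \<gamma> x)))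
     (of_real (Gamma p * rGamma (\<gamma> + \<alpha> * p)))" by simp
  from has_bochner_integral_Re[OF this] show ?thesis by simp
qed

text \<open>The term j = 0 vanishes because 1/Gamma(0) = 0, and the functional equation of Gamma
  identifies the shifted series. The explicit factor x is what makes x^(p-1) integrable against the
  function at 0 when -1 < p < 0.\<close>

lemma wright_zero: "wright \<alpha> 0 x = \<alpha> * x * wright \<alpha> (1 - \<alpha>) x"
proof -
  let ?a = "\<lambda>j. (- 1) ^ j / fact j * rGamma (0 - real j * \<alpha>) * x ^ j"
  have "(\<lambda>j. ?a (Suc j)) sums (wright \<alpha> 0 x - ?a 0)"
    using wright_sums[of 0 x] by (subst sums_Suc_iff) simp
  moreover have "?a (Suc j) = \<alpha> * x * ((- 1) ^ j / fact j * rGamma ((1 - \<alpha>) - real j * \<alpha>) * x ^ j)" for j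
  proof -
    have "rGamma (0 - real (Suc j) * \<alpha>) = - real (Suc j) * \<alpha> * rGamma ((1 - \<alpha>) - real j * \<alpha>)"
      using rGamma_plus1[of "- real (Suc j) * \<alpha>"] by (simp add: algebra_simps)
    then show ?thesis by (simp add: field_simps del: of_nat_Suc)
  qed
  ultimately have "(\<lambda>j. \<alpha> * x * ((- 1) ^ j / fact j * rGamma ((1 - \<alpha>) - real j * \<alpha>) * x ^ j)) sums wright \<alpha> 0 x"
    by simp
  moreover have "(\<lambda>j. \<alpha> * x * ((- 1) ^ j / fact j * rGamma ((1 - \<alpha>) - real j * \<alpha>) * x ^ j)) sums
      (\<alpha> * x * wright \<alpha> (1 - \<alpha>) x)"
    by (intro sums_mult wright_sums)
  ultimately show ?thesis by (rule sums_unique2)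
qed

text \<open>For negative p the factor x in \<open>wright_zero\<close> raises the exponent to p + 1 >
  0 at parameter 1 - \<alpha>; the functional equations of Gamma and 1/Gamma restore the same closed
  form.\<close>

lemma wright_moment:
  assumes p: "0 < p \<or> (\<gamma> = 0 \<and> - 1 < p \<and> p < 0)"
  shows "has_bochner_integral lborel (\<lambda>x. indicator {0<..} x *\<^sub>R (x powr (p - 1) * wright \<alpha> \<gamma> x))
    (Gamma p * rGamma (\<gamma> + \<alpha> * p))"
proof (cases "0 < p")
  case False
  with p have p: "\<gamma> = 0" "- 1 < p" "p < 0" by auto
  have "has_bochner_integral lborel (\<lambda>x. \<alpha> * (indicator {0<..} x *\<^sub>R (x powr (p + 1 - 1) * wright \<alpha> (1 - \<alpha>) x)))
    (\<alpha> * (Gamma (p + 1) * rGamma ((1 - \<alpha>) + \<alpha> * (p + 1))))"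
    using p by (intro has_bochner_integral_mult_right wright_moment_pos) auto
  moreover have "\<alpha> * (indicator {0<..} x *\<^sub>R (x powr (p + 1 - 1) * wright \<alpha> (1 - \<alpha>) x)) =
     indicator {0<..} x *\<^sub>R (x powr (p - 1) * wright \<alpha> \<gamma> x)" for x
    by (auto simp: p wright_zero indicator_def powr_diff)
  moreover have "\<alpha> * (Gamma (p + 1) * rGamma ((1 - \<alpha>) + \<alpha> * (p + 1))) = Gamma p * rGamma (\<gamma> + \<alpha> * p)"
  proof -
    have "p \<notin> \<int>\<^sub>\<le>\<^sub>0" using p by (auto simp: nonpos_Ints_def)
    then have "Gamma (p + 1) = p * Gamma p" by (rule Gamma_plus1)
    moreover have "(1 - \<alpha>) + \<alpha> * (p + 1) = \<alpha> * p + 1" by (simp add: algebra_simps)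
    ultimately have "\<alpha> * (Gamma (p + 1) * rGamma ((1 - \<alpha>) + \<alpha> * (p + 1))) = \<alpha> * ((p * Gamma p) * rGamma (\<alpha> * p + 1))"
      by (simp only:)
    also have "\<dots> = Gamma p * ((\<alpha> * p) * rGamma (\<alpha> * p + 1))" by (simp only: mult_ac)
    also have "\<dots> = Gamma p * rGamma (\<gamma> + \<alpha> * p)" by (simp only: rGamma_plus1 p(1) add_0_left)
    finally show ?thesis .
  qed
  ultimately show ?thesis by (simp only:)
qed (rule wright_moment_pos)

text \<open>The function extends to an entire one. It is not identically 0: if its first two
  coefficients vanished, \<gamma> and \<gamma> - \<alpha> would both be integers, against 0 <
  \<alpha> < 1.\<close>

lemma wright_zeros_countable: "countable {x. wright \<alpha> \<gamma> x = 0}"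
proof -
  define a where "a = (\<lambda>j. (- 1) ^ j / fact j * rGamma (\<gamma> - real j * \<alpha>))"
  define F where "F = Abs_fps (\<lambda>j. complex_of_real (a j))"
  have sm: "summable (\<lambda>n. complex_of_real (a n * x ^ n))" for x
    unfolding a_def by (intro summable_of_real sums_summable[OF wright_sums])
  have "conv_radius (fps_nth F) = \<infinity>"
  proof (intro conv_radius_inftyI'[of 0])
    fix r :: real assume "0 < r"
    with sm[of r]
    show "\<exists>z. norm z = r \<and> summable (\<lambda>n. fps_nth F n * z ^ n)"
      by (intro exI[of _ "complex_of_real r"]) (simp add: F_def)
  qed
  then have R: "fps_conv_radius F = \<infinity>" by (simp add: fps_conv_radius_def)
  have ev: "eval_fps F (of_real x) = of_real (wright \<alpha> \<gamma> x)" for x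
  proof -
    have "(\<lambda>n. fps_nth F n * of_real x ^ n) sums of_real (wright \<alpha> \<gamma> x)"
      using sums_of_real[OF wright_sums, of \<gamma> x, where 'a = complex] by (simp add: F_def a_def)
    then show ?thesis by (simp add: eval_fps_def sums_iff)
  qed
  have "eval_fps F \<noteq> (\<lambda>_. 0)"
  proof
    assume "eval_fps F = (\<lambda>_. 0)"
    moreover have "eval_fps F has_fps_expansion F" by (rule eval_fps_has_fps_expansion) (simp add: R)
    ultimately have "(\<lambda>_. 0) has_fps_expansion F" by simp
    then have "F = 0" using fps_expansion_unique_complex has_fps_expansion_0 by blast
    then have "a 0 = 0" "a 1 = 0" by (auto simp: F_def fps_eq_iff)
    then have "\<gamma> \<in> \<int>\<^sub>\<le>\<^sub>0" "\<gamma> - \<alpha> \<in> \<int>\<^sub>\<le>\<^sub>0" by (auto simp: a_def rGamma_eq_zero_iff)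
    then obtain m n where "\<gamma> = of_int m" "\<gamma> - \<alpha> = of_int n" by (metis nonpos_Ints_cases)
    then have "\<alpha> = of_int (m - n)" by simp
    with \<alpha> show False by simp
  qed
  moreover have "eval_fps F holomorphic_on UNIV" by (intro holomorphic_on_eval_fps) (simp add: R)
  ultimately have "countable {z. eval_fps F z = 0}"
    using holomorphic_countable_equal_UNIV[of "eval_fps F" "\<lambda>_. 0"] by auto
  moreover have "of_real ` {x. wright \<alpha> \<gamma> x = 0} \<subseteq> {z. eval_fps F z = 0}" by (auto simp: ev)
  ultimately have "countable (complex_of_real ` {x. wright \<alpha> \<gamma> x = 0})" by (rule countable_subset[rotated])
  then show ?thesis by (rule countable_image_inj_on) (auto simp: inj_on_def)
qed

end

text \<open>Since \<alpha> < 1 there is an angle \<omega> beyond pi/2, below pi, with \<alpha>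
  \<omega> < pi/2. On the cone |arg t| <= \<omega> the constant
  \<open>cos (\<alpha> * \<omega>)\<close> works, and a large slope confines the region to that
  cone.\<close>

lemma sector_exists:
  fixes \<alpha> T :: real
  assumes \<alpha>: "0 < \<alpha>" "\<alpha> < 1"
  obtains S \<delta> where "T < S" "1 \<le> S" "0 < \<delta>"
    "\<And>t. - (S * Re t) \<le> \<bar>Im t\<bar> \<Longrightarrow> \<delta> * norm t powr \<alpha> \<le> Re (t powr of_real \<alpha>)"
proof -
  define M where "M = min pi (pi / (2 * \<alpha>))"
  define \<omega> where "\<omega> = (pi / 2 + M) / 2"
  have "pi / 2 < M" using \<alpha> by (simp add: M_def field_simps)
  then have "pi / 2 < \<omega>" "\<omega> < M" by (auto simp: \<omega>_def)
  then have \<omega>: "pi / 2 < \<omega>" "\<omega> < min pi (pi / (2 * \<alpha>))" by (simp_all add: M_def)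
  have \<omega>\<alpha>: "\<alpha> * \<omega> < pi / 2" using \<omega>(2) \<alpha> by (simp add: field_simps)
  \<comment> \<open>The tangent controls points outside the cone: there B = pi - |arg t| satisfies
    tan B < tan (pi - \<omega>) <= \<open>S\<close>, which says |Im t| < - S Re t.\<close>
  define S where "S = max (max 1 (T + 1)) (tan (pi - \<omega>))"
  show ?thesis
  proof (rule that)
    show "T < S" "1 \<le> S" by (auto simp: S_def)
    show "0 < cos (\<alpha> * \<omega>)" using \<omega>\<alpha> \<omega> \<alpha> pi_gt_zero
      by (intro cos_gt_zero_pi) (auto intro: order.strict_trans[of _ 0] mult_pos_pos)
    fix t :: complex assume t: "- (S * Re t) \<le> \<bar>Im t\<bar>"
    show "cos (\<alpha> * \<omega>) * norm t powr \<alpha> \<le> Re (t powr of_real \<alpha>)"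
    proof (cases "t = 0")
      case False
      have arg: "\<bar>Arg t\<bar> \<le> \<omega>"
      proof (rule ccontr)
        assume "\<not> \<bar>Arg t\<bar> \<le> \<omega>"
        define B where "B = pi - \<bar>Arg t\<bar>"
        have B: "0 \<le> B" "B < pi - \<omega>"
          using \<open>\<not> \<bar>Arg t\<bar> \<le> \<omega>\<close> Arg_bounded[of t] by (auto simp: B_def)
        have "cos \<bar>Arg t\<bar> = Re t / norm t" using cos_Arg[OF False] by (simp add: abs_if)
        then have re: "cos B = - (Re t / norm t)" by (simp add: B_def)
        have "\<bar>sin (Arg t)\<bar> = \<bar>Im t\<bar> / norm t" using sin_Arg[OF False] by (simp add: abs_divide)
        moreover have "sin B = sin \<bar>Arg t\<bar>" by (simp add: B_def)
        moreover have "0 \<le> sin B" using B \<omega> pi_gt_zero by (intro sin_ge_zero) auto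
        ultimately have im: "sin B = \<bar>Im t\<bar> / norm t" by (simp add: abs_if split: if_splits)
        have c: "0 < cos B" using B \<omega> pi_gt_zero by (intro cos_gt_zero_pi) auto
        have "tan B < tan (pi - \<omega>)" using B \<omega> pi_gt_zero by (intro tan_monotone) auto
        also have "\<dots> \<le> S" by (simp add: S_def)
        finally have "sin B < S * cos B" using c by (simp add: tan_def field_simps)
        then have "\<bar>Im t\<bar> / norm t < - (S * Re t) / norm t" unfolding re im by simp
        then have "\<bar>Im t\<bar> < - (S * Re t)" using False divide_less_cancel[of "\<bar>Im t\<bar>" "norm t" "- (S * Re t)"] by simp
        with t show False by simp
      qed
      have "Re (t powr of_real \<alpha>) = norm t powr \<alpha> * cos (\<alpha> * Arg t)"
        using False by (simp add: powr_def Ln_Arg Re_exp algebra_simps)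
      moreover have "cos (\<alpha> * \<omega>) \<le> cos \<bar>\<alpha> * Arg t\<bar>"
        using arg \<alpha> \<omega>\<alpha> \<omega> pi_gt_zero by (intro cos_monotone_0_pi_le) (auto simp: abs_mult)
      ultimately show ?thesis by (simp add: mult.commute[of "cos (\<alpha> * \<omega>)"] mult_left_mono)
    qed simp
  qed
qed

section \<open>Large powers\<close>

definition cfps :: "real fps \<Rightarrow> complex fps" where
  "cfps A = Abs_fps (\<lambda>n. of_real (fps_nth A n))"

lemma cfps_nth [simp]: "fps_nth (cfps A) n = of_real (fps_nth A n)"
  by (simp add: cfps_def)

lemma cfps_mult: "cfps (A * B) = cfps A * cfps B"
  by (rule fps_ext) (simp add: fps_mult_nth)

lemma cfps_one: "cfps 1 = 1"
  by (rule fps_ext) simp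

lemma cfps_power: "cfps (A ^ k) = cfps A ^ k"
  by (induction k) (simp_all add: cfps_mult cfps_one)

lemma nat_floor_ratio:
  fixes s :: "nat \<Rightarrow> real"
  assumes "0 \<le> y" and s: "filterlim s at_top sequentially"
  shows "(\<lambda>n. real (nat \<lfloor>y * s n\<rfloor>) / s n) \<longlonglongrightarrow> y"
proof (rule tendsto_sandwich)
  have pos: "\<forall>\<^sub>F n in sequentially. 0 < s n"
    using s by (simp add: filterlim_at_top_dense)
  then show "\<forall>\<^sub>F n in sequentially. real (nat \<lfloor>y * s n\<rfloor>) / s n \<le> y"
    by eventually_elim (use assms in \<open>simp add: divide_le_eq\<close>)
  from pos show "\<forall>\<^sub>F n in sequentially. y - 1 / s n \<le> real (nat \<lfloor>y * s n\<rfloor>) / s n"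
  proof eventually_elim
    case (elim n)
    have "y * s n - 1 \<le> real (nat \<lfloor>y * s n\<rfloor>)" using assms elim by (simp add: le_nat_floor)
    then have "(y * s n - 1) / s n \<le> real (nat \<lfloor>y * s n\<rfloor>) / s n" using elim by (intro divide_right_mono) auto
    then show ?case using elim by (simp add: diff_divide_distrib)
  qed
  have "(\<lambda>n. 1 / s n) \<longlonglongrightarrow> 0"
    using tendsto_divide_0[OF tendsto_const filterlim_at_top_imp_at_infinity[OF s]] .
  from tendsto_diff[OF tendsto_const[of y] this]
  show "(\<lambda>n. y - 1 / s n) \<longlonglongrightarrow> y" by simp
qed simp

lemma filterlim_real_powr:
  fixes N :: "nat \<Rightarrow> nat"
  assumes "filterlim N at_top sequentially" "0 < c" "0 < \<alpha>"
  shows "filterlim (\<lambda>j. c * real (N j) powr \<alpha>) at_top sequentially"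
proof -
  have "filterlim (\<lambda>n::nat. c * real n powr \<alpha>) at_top sequentially"
    using assms(2,3) by real_asymp
  from filterlim_compose[OF this assms(1)] show ?thesis .
qed

section \<open>Coefficients of h^k m on the scaled contour\<close>

context hankel_contour
begin

lemma ray_point_filterlim:
  assumes N: "filterlim N at_top sequentially" and d: "d \<in> dirs" and y: "0 \<le> y"
  shows "filterlim (\<lambda>j. 1 - (1 - of_real y * d) / of_nat (N j)) (at 1 within slit_disc \<epsilon> T) sequentially"
proof -
  have "(\<lambda>j. 1 / of_nat (N j) :: complex) \<longlonglongrightarrow> 0"
    using filterlim_compose[OF lim_1_over_n N(1)] by simp
  from tendsto_diff[OF tendsto_const[of 1] tendsto_mult[OF this tendsto_const[of "1 - of_real y * d"]]]
  have 1: "(\<lambda>j. 1 - (1 - of_real y * d) / of_nat (N j)) \<longlonglongrightarrow> 1" by simp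
  have "filterlim (\<lambda>j. real (N j)) at_top sequentially"
    using filterlim_compose[OF filterlim_real_sequentially N(1)] .
  then have "\<forall>\<^sub>F j in sequentially. max (2 / r) (y / r) \<le> real (N j)" unfolding filterlim_at_top by blast
  then have "\<forall>\<^sub>F j in sequentially. 1 - (1 - of_real y * d) / of_nat (N j) \<in> slit_disc \<epsilon> T - {1}"
  proof eventually_elim
    case (elim j)
    then have "2 / r \<le> real (N j)" "y \<le> real (N j) * r" using r by (auto simp: field_simps)
    from ray_point_near[OF d this(1) y this(2)] show ?case using near_subset by (auto simp: near_set_def)
  qed
  with 1 show ?thesis by (auto simp: filterlim_at elim: eventually_mono)
qed

lemma ray_point_powr:
  fixes t :: complex
  assumes "0 < n"
  shows "(t / of_nat n) powr of_real s = of_real (real n powr (- s)) * t powr of_real s"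
proof -
  have "t / of_nat n = of_real (1 / real n) * t" by simp
  then have "(t / of_nat n) powr of_real s = of_real (1 / real n) powr of_real s * t powr of_real s"
    by (simp only:) (rule powr_times_real_left, auto)
  also have "complex_of_real (1 / real n) powr of_real s = of_real ((1 / real n) powr s)"
    by (rule powr_of_real) simp
  finally show ?thesis using assms by (simp add: powr_divide powr_minus_divide)
qed

lemma ray_point_limit:
  assumes lim: "((\<lambda>w. f w * (1 - w) powr of_real \<gamma>) \<longlongrightarrow> b) (at 1 within slit_disc \<epsilon> T)"
    and N: "filterlim N at_top sequentially" and d: "d \<in> dirs" and y: "0 \<le> y"
  shows "(\<lambda>j. of_real (real (N j) powr (- \<gamma>)) * f (1 - (1 - of_real y * d) / of_nat (N j)))
    \<longlonglongrightarrow> b * (1 - of_real y * d) powr (- of_real \<gamma>)"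
proof (rule Lim_transform_eventually)
  let ?t = "1 - of_real y * d" and ?w = "\<lambda>j. 1 - (1 - of_real y * d) / of_nat (N j)"
  show "(\<lambda>j. f (?w j) * (1 - ?w j) powr of_real \<gamma> * ?t powr (- of_real \<gamma>)) \<longlonglongrightarrow> b * ?t powr (- of_real \<gamma>)"
    by (intro tendsto_intros filterlim_compose[OF lim ray_point_filterlim[OF N d y]])
  have "\<forall>\<^sub>F j in sequentially. 0 < N j"
    by (rule eventually_compose_filterlim[OF eventually_gt_at_top N])
  then show "\<forall>\<^sub>F j in sequentially. f (?w j) * (1 - ?w j) powr of_real \<gamma> * ?t powr (- of_real \<gamma>) =
      of_real (real (N j) powr (- \<gamma>)) * f (?w j)"
  proof eventually_elim
    case (elim j)
    have "?t \<noteq> 0" using norm_ray_point[OF d y] by auto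
    then have "?t powr of_real \<gamma> * ?t powr (- of_real \<gamma>) = 1" by (simp add: powr_minus)
    moreover have "1 - ?w j = ?t / of_nat (N j)" by simp
    ultimately show ?case using ray_point_powr[OF elim, of ?t \<gamma>] by (simp only:) (simp add: mult_ac)
  qed
qed

end

text \<open>Here h is H rescaled so that h(1) = 1, with h(w) = 1 - (1 - w)^\<alpha> / \<kappa> + ...
  at 1. The exponential bound \<open>h_near\<close> and the bound \<open>q\<close> on the arc give
  decay in k; \<open>h_near_one\<close> controls h^k - 1 for small k.\<close>

locale large_powers = hankel_alpha +
  fixes h :: "real fps" and fh :: "complex \<Rightarrow> complex" and \<kappa> c q Kh :: real
  assumes h_nonneg: "0 \<le> fps_nth h n" and h_zero: "fps_nth h 0 = 0"
    and h_holo: "fh holomorphic_on slit_disc \<epsilon> T"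
    and h_exp: "fh has_fps_expansion cfps h"
    and pars: "0 < \<kappa>" "0 < c" "0 < q" "q < 1" "0 \<le> Kh"
    and h_near: "w \<in> near_set \<Longrightarrow> norm (fh w) \<le> exp (- (c * norm (1 - w) powr \<alpha>))"
    and h_near_one: "w \<in> near_set \<Longrightarrow> norm (fh w - 1) \<le> Kh * norm (1 - w) powr \<alpha>"
    and h_far: "w \<in> far_set \<Longrightarrow> norm (fh w) \<le> q"
    and h_lim: "((\<lambda>w. (fh w - 1) / (1 - w) powr of_real \<alpha>) \<longlongrightarrow> - of_real (1 / \<kappa>)) (at 1 within slit_disc \<epsilon> T)"
begin

text \<open>A factor behaves like C (1 - w)^(- \<gamma>) at 1. With \<gamma> = 0 this covers any
  function with limit C there, whether regular at 1 or singular with positive exponent.\<close>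

definition factor :: "real fps \<Rightarrow> real \<Rightarrow> real \<Rightarrow> bool" where
  "factor m \<gamma> C \<longleftrightarrow> (\<forall>n. 0 \<le> fps_nth m n) \<and>
     (\<exists>f K B. f holomorphic_on slit_disc \<epsilon> T \<and> f has_fps_expansion cfps m \<and> 0 \<le> K \<and>
        (\<forall>w\<in>near_set. norm (f w) \<le> K * norm (1 - w) powr (- \<gamma>)) \<and> (\<forall>w\<in>far_set. norm (f w) \<le> B) \<and>
        ((\<lambda>w. f w * (1 - w) powr of_real \<gamma>) \<longlongrightarrow> of_real C) (at 1 within slit_disc \<epsilon> T))"

lemma factor_one: "factor 1 0 1"
proof -
  have "((\<lambda>w. 1 * (1 - w) powr of_real 0) \<longlongrightarrow> complex_of_real 1) (at 1 within slit_disc \<epsilon> T)"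
    by (rule Lim_transform_eventually[of "\<lambda>_. 1"]) (auto simp: eventually_at_filter)
  then show ?thesis unfolding factor_def
    by (intro conjI exI[of _ "\<lambda>_. 1"] exI[of _ "1::real"]) (auto simp: cfps_one near_set_def fps_one_nth)
qed

lemma h_near_le_1: "w \<in> near_set \<Longrightarrow> norm (fh w) \<le> 1"
  using h_near[of w] pars(2) by (smt (verit) exp_le_one_iff mult_nonneg_nonneg powr_ge_zero)

text \<open>At w = 1 - t/N one has k (h(w) - 1) -> - x t^\<alpha>, hence h^k -> exp (- x
  t^\<alpha>), while m contributes C N^\<gamma> t^(- \<gamma>). Domination needs only |h| <= 1.
  \<open>N\<close> and \<open>k\<close> are arbitrary sequences because the positivity proof and the
  local limit argue along subsequences.\<close>

proposition kernel_limit: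
  fixes N k :: "nat \<Rightarrow> nat"
  assumes m: "factor m \<gamma> C" and N: "filterlim N at_top sequentially"
    and k: "(\<lambda>j. real (k j) / (\<kappa> * real (N j) powr \<alpha>)) \<longlonglongrightarrow> x"
  shows "(\<lambda>j. real (N j) powr (1 - \<gamma>) * fps_nth (h ^ k j * m) (N j)) \<longlonglongrightarrow> C * wright \<alpha> \<gamma> x"
proof -
  obtain f K B where f: "f holomorphic_on slit_disc \<epsilon> T" "f has_fps_expansion cfps m" and K: "0 \<le> K"
    and near: "\<And>w. w \<in> near_set \<Longrightarrow> norm (f w) \<le> K * norm (1 - w) powr (- \<gamma>)"
    and far: "\<And>w. w \<in> far_set \<Longrightarrow> norm (f w) \<le> B"
    and lim: "((\<lambda>w. f w * (1 - w) powr of_real \<gamma>) \<longlongrightarrow> of_real C) (at 1 within slit_disc \<epsilon> T)"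
    using m unfolding factor_def by blast
  let ?F = "\<lambda>j w. fh w ^ k j * f w"
  have Npos: "\<forall>\<^sub>F j in sequentially. 0 < N j"
    by (rule eventually_compose_filterlim[OF eventually_gt_at_top N])
  have "(\<lambda>j. of_real (real (N j) powr (1 - \<gamma>)) * fps_nth (cfps (h ^ k j * m)) (N j)) \<longlonglongrightarrow>
     hankel (\<lambda>t. exp t * (of_real C * (exp (- of_real x * t powr of_real \<alpha>) * t powr (- of_real \<gamma>))))"
  proof (rule coeff_limit[where f = ?F and K = K and B = B])
    show "?F j holomorphic_on slit_disc \<epsilon> T" for j by (intro holomorphic_intros f h_holo)
    show "?F j has_fps_expansion cfps (h ^ k j * m)" for j
      unfolding cfps_mult cfps_power by (intro fps_expansion_intros f h_exp)
    show "norm (?F j w) \<le> K * norm (1 - w) powr (- \<gamma>)" if w: "w \<in> near_set" for j w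
    proof -
      have "norm (?F j w) \<le> 1 * (K * norm (1 - w) powr (- \<gamma>))"
        unfolding norm_mult norm_power
        using h_near_le_1[OF w] near[OF w] by (intro mult_mono power_le_one) auto
      then show ?thesis by simp
    qed
    show "norm (?F j w) \<le> B" if w: "w \<in> far_set" for j w
    proof -
      have "norm (?F j w) \<le> 1 * B"
        unfolding norm_mult norm_power
        using h_far[OF w] pars far[OF w] by (intro mult_mono power_le_one) auto
      then show ?thesis by simp
    qed
    fix d y assume d: "d \<in> dirs" and y: "0 \<le> (y :: real)"
    let ?t = "1 - of_real y * d" and ?w = "\<lambda>j. 1 - (1 - of_real y * d) / of_nat (N j)"
    have t0: "?t \<noteq> 0" using norm_ray_point[OF d y] by auto
    note w = ray_point_filterlim[OF N d y]
    have scale: "(1 - ?w j) powr of_real s = of_real (real (N j) powr (- s)) * ?t powr of_real s" if "0 < N j" for s j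
      using ray_point_powr[OF that, of ?t s] by simp
    have L1: "(\<lambda>j. of_real (real (N j) powr (- \<gamma>)) * f (?w j)) \<longlonglongrightarrow> of_real C * ?t powr (- of_real \<gamma>)"
      by (rule ray_point_limit[OF lim N d y])
    have L2: "(\<lambda>j. (1 + (fh (?w j) - 1)) ^ k j) \<longlonglongrightarrow> exp (- of_real x * ?t powr of_real \<alpha>)"
    proof (rule tendsto_one_plus_power_exp)
      have hl: "(\<lambda>j. (fh (?w j) - 1) / (1 - ?w j) powr of_real \<alpha>) \<longlonglongrightarrow> - of_real (1 / \<kappa>)"
        by (rule filterlim_compose[OF h_lim w])
      have "(\<lambda>j. of_real (real (k j) / (\<kappa> * real (N j) powr \<alpha>) * \<kappa>) * ?t powr of_real \<alpha> * ((fh (?w j) - 1) / (1 - ?w j) powr of_real \<alpha>))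
         \<longlonglongrightarrow> of_real (x * \<kappa>) * ?t powr of_real \<alpha> * (- of_real (1 / \<kappa>))"
        by (intro tendsto_intros k hl)
      moreover have "\<forall>\<^sub>F j in sequentially. of_real (real (k j) / (\<kappa> * real (N j) powr \<alpha>) * \<kappa>) * ?t powr of_real \<alpha> * ((fh (?w j) - 1) / (1 - ?w j) powr of_real \<alpha>)
          = of_nat (k j) * (fh (?w j) - 1)"
        using Npos
      proof eventually_elim
        case (elim j)
        have "?t powr of_real \<alpha> \<noteq> 0" using t0 by simp
        then show ?case unfolding scale[OF elim] using pars elim
          by (simp add: powr_minus field_simps)
      qed
      ultimately have "(\<lambda>j. of_nat (k j) * (fh (?w j) - 1)) \<longlonglongrightarrow> of_real (x * \<kappa>) * ?t powr of_real \<alpha> * (- of_real (1 / \<kappa>))"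
        by (rule Lim_transform_eventually)
      then show "(\<lambda>j. of_nat (k j) * (fh (?w j) - 1)) \<longlonglongrightarrow> - of_real x * ?t powr of_real \<alpha>"
        using pars by simp
      have "(\<lambda>j. real (N j) powr (- \<alpha>)) \<longlonglongrightarrow> 0"
      proof -
        have "(\<lambda>n. real n powr (- \<alpha>)) \<longlonglongrightarrow> 0" using \<alpha> by real_asymp
        from filterlim_compose[OF this N] show ?thesis .
      qed
      then have "(\<lambda>j. of_real (real (N j) powr (- \<alpha>)) * ?t powr of_real \<alpha> * ((fh (?w j) - 1) / (1 - ?w j) powr of_real \<alpha>))
         \<longlonglongrightarrow> of_real 0 * ?t powr of_real \<alpha> * (- of_real (1 / \<kappa>))"
        by (intro tendsto_intros hl)
      moreover have "\<forall>\<^sub>F j in sequentially. of_real (real (N j) powr (- \<alpha>)) * ?t powr of_real \<alpha> * ((fh (?w j) - 1) / (1 - ?w j) powr of_real \<alpha>)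
          = fh (?w j) - 1"
        using Npos
      proof eventually_elim
        case (elim j)
        have "of_real (real (N j) powr (- \<alpha>)) * ?t powr of_real \<alpha> \<noteq> 0" using t0 elim by simp
        then show ?case unfolding scale[OF elim] by (simp only: times_divide_eq_right) (rule nonzero_mult_div_cancel_left)
      qed
      ultimately show "(\<lambda>j. fh (?w j) - 1) \<longlonglongrightarrow> 0"
        by (simp add: Lim_transform_eventually)
    qed
    from tendsto_mult[OF L2 L1]
    show "(\<lambda>j. of_real (real (N j) powr (- \<gamma>)) * ?F j (?w j)) \<longlonglongrightarrow>
        of_real C * (exp (- of_real x * ?t powr of_real \<alpha>) * ?t powr (- of_real \<gamma>))"
      by (simp add: mult_ac)
  qed (use N K in auto)
  moreover have "hankel (\<lambda>t. exp t * (of_real C * (exp (- of_real x * t powr of_real \<alpha>) * t powr (- of_real \<gamma>)))) =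
      of_real C * hankel (\<lambda>t. exp t * (exp (- of_real x * t powr of_real \<alpha>) * t powr (- of_real \<gamma>)))"
  proof -
    have "ray (\<lambda>t. exp t * (of_real C * g t)) d = of_real C * ray (\<lambda>t. exp t * g t) d" for g d
    proof -
      have "indicator {0..} y *\<^sub>R (exp (1 - of_real y * d) * (of_real C * g (1 - of_real y * d)) * d) =
         of_real C * (indicator {0..} y *\<^sub>R (exp (1 - of_real y * d) * g (1 - of_real y * d) * d))" for y :: real
        by (simp add: mult_ac)
      then show ?thesis unfolding ray_def set_lebesgue_integral_def by (simp only: integral_mult_right_zero)
    qed
    then show ?thesis unfolding hankel_def by (simp only: right_diff_distrib[symmetric] times_divide_eq_right)
  qed
  ultimately have "(\<lambda>j. complex_of_real (real (N j) powr (1 - \<gamma>) * fps_nth (h ^ k j * m) (N j))) \<longlonglongrightarrow> of_real (C * wright \<alpha> \<gamma> x)"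
    by (simp only: wright_hankel cfps_nth of_real_mult)
  then show ?thesis by (simp only: tendsto_of_real_iff)
qed

lemma power_decay_bound:
  obtains E where "0 \<le> E" "\<And>n::nat. 1 \<le> n \<Longrightarrow> real n powr s / (1 + r / 2) ^ n \<le> E"
proof -
  have "(\<lambda>n. real n powr s / (1 + r / 2) ^ n) \<longlonglongrightarrow> 0"
    using powr_over_power_tendsto_0[of "\<lambda>n. n"] by (simp add: filterlim_ident)
  then have "Bseq (\<lambda>n. real n powr s / (1 + r / 2) ^ n)" by (meson Bseq_conv_Bfun convergent_imp_Bseq convergentI)
  then obtain E where "0 < E" "\<And>n. norm (real n powr s / (1 + r / 2) ^ n) \<le> E" by (auto elim!: BseqE)
  then show ?thesis using r by (intro that[of E]) auto
qed

text \<open>Valid for all k at once, also for k far beyond n^\<alpha>; this decay is what makes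
  tails of sums over k negligible and moments converge.\<close>

proposition kernel_bound:
  assumes m: "factor m \<gamma> C"
  obtains K e n0 where "0 \<le> K" "0 < e"
    "\<And>n k. n0 \<le> n \<Longrightarrow> real n powr (1 - \<gamma>) * fps_nth (h ^ k * m) n \<le> K * exp (- (e * (k / n powr \<alpha>)))"
proof -
  obtain f Km B where f: "f holomorphic_on slit_disc \<epsilon> T" "f has_fps_expansion cfps m" and Km: "0 \<le> Km"
    and near: "\<And>w. w \<in> near_set \<Longrightarrow> norm (f w) \<le> Km * norm (1 - w) powr (- \<gamma>)"
    and far: "\<And>w. w \<in> far_set \<Longrightarrow> norm (f w) \<le> B"
    using m unfolding factor_def by blast
  have B0: "0 \<le> B" using far_nonempty far norm_ge_zero order_trans by blast
  obtain D where D: "0 \<le> D"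
    "\<And>n g G L A. \<lbrakk>2 / r \<le> real n; g holomorphic_on slit_disc \<epsilon> T; g has_fps_expansion G; 0 \<le> L;
      \<And>w. w \<in> near_set \<Longrightarrow> 1 / (2 * n) \<le> norm (1 - w) \<Longrightarrow> norm (g w) \<le> L * norm (1 - w) powr (- \<gamma>);
      \<And>w. w \<in> far_set \<Longrightarrow> norm (g w) \<le> A\<rbrakk>
     \<Longrightarrow> norm (fps_nth G n) \<le> D * (L * n powr (\<gamma> - 1) + A / (1 + r / 2) ^ n)"
    using coeff_bound[of \<gamma>] by metis
  obtain E where E: "0 \<le> E" "\<And>n::nat. 1 \<le> n \<Longrightarrow> real n powr (1 - \<gamma>) / (1 + r / 2) ^ n \<le> E"
    using power_decay_bound[of "1 - \<gamma>"] by metis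
  \<comment> \<open>The first entry handles the legs, where |1 - w| is at least 1/(2n). The second
    handles the arc: q^k decays at a rate free of n, which is enough because n^\<alpha> >=
    1.\<close>
  define e where "e = min (c / 2 powr \<alpha>) (- ln q)"
  have e: "0 < e" using pars by (simp add: e_def ln_less_zero)
  show ?thesis
  proof (rule that)
    show "0 \<le> D * (Km + B * E)" "0 < e" using D Km B0 E e by auto
    fix n k :: nat assume "max 1 (nat \<lceil>2 / r\<rceil>) \<le> n"
    then have n: "1 \<le> n" "2 / r \<le> real n" by (auto simp: nat_le_iff ceiling_le_iff)
    define x where "x = exp (- (e * (k / n powr \<alpha>)))"
    have n\<alpha>: "1 \<le> real n powr \<alpha>" using n \<alpha> by (simp add: ge_one_powr_ge_zero)
    have "norm (fps_nth (cfps (h ^ k * m)) n) \<le> D * (Km * x * n powr (\<gamma> - 1) + B * x / (1 + r / 2) ^ n)"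
    proof (rule D(2)[of n "\<lambda>w. fh w ^ k * f w"])
      show "(\<lambda>w. fh w ^ k * f w) holomorphic_on slit_disc \<epsilon> T" by (intro holomorphic_intros f h_holo)
      show "(\<lambda>w. fh w ^ k * f w) has_fps_expansion cfps (h ^ k * m)"
        unfolding cfps_mult cfps_power by (intro fps_expansion_intros f h_exp)
      show "norm (fh w ^ k * f w) \<le> Km * x * norm (1 - w) powr (- \<gamma>)"
        if w: "w \<in> near_set" "1 / (2 * real n) \<le> norm (1 - w)" for w
      proof -
        have "norm (fh w) ^ k \<le> exp (- (c * norm (1 - w) powr \<alpha>)) ^ k"
          using h_near[OF w(1)] by (intro power_mono) auto
        also have "\<dots> = exp (real k * (- (c * norm (1 - w) powr \<alpha>)))" by (rule exp_of_nat_mult[symmetric])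
        also have "\<dots> \<le> x"
        proof -
          have "1 / (2 powr \<alpha> * n powr \<alpha>) = (1 / (2 * real n)) powr \<alpha>" using n by (simp add: powr_divide powr_mult)
          also have "\<dots> \<le> norm (1 - w) powr \<alpha>" using w \<alpha> by (intro powr_mono2) auto
          finally have "c * (1 / (2 powr \<alpha> * n powr \<alpha>)) \<le> c * norm (1 - w) powr \<alpha>"
            using pars by (intro mult_left_mono) auto
          moreover have "e / n powr \<alpha> \<le> c / 2 powr \<alpha> / n powr \<alpha>"
            using n\<alpha> by (intro divide_right_mono) (auto simp: e_def)
          ultimately have "e / n powr \<alpha> \<le> c * norm (1 - w) powr \<alpha>" by simp
          then have "real k * (e / n powr \<alpha>) \<le> real k * (c * norm (1 - w) powr \<alpha>)" by (intro mult_left_mono) auto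
          then show ?thesis by (simp add: x_def mult.commute)
        qed
        finally have "norm (fh w ^ k * f w) \<le> x * (Km * norm (1 - w) powr (- \<gamma>))"
          unfolding norm_mult norm_power using near[OF w(1)] by (intro mult_mono) (auto simp: x_def)
        then show ?thesis by (simp add: mult_ac)
      qed
      show "norm (fh w ^ k * f w) \<le> B * x" if w: "w \<in> far_set" for w
      proof -
        have "norm (fh w) ^ k \<le> q ^ k" using h_far[OF w] by (intro power_mono) auto
        also have "\<dots> = exp (real k * ln q)" using pars by (simp add: exp_of_nat_mult)
        also have "\<dots> \<le> x"
        proof -
          have "e / n powr \<alpha> \<le> e / 1" using n\<alpha> e n(1) by (intro divide_left_mono) auto
          also have "\<dots> \<le> - ln q" by (simp add: e_def)
          finally have "real k * (e / n powr \<alpha>) \<le> real k * (- ln q)" by (intro mult_left_mono) auto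
          then show ?thesis by (simp add: x_def mult.commute)
        qed
        finally have "norm (fh w ^ k * f w) \<le> x * B"
          unfolding norm_mult norm_power using far[OF w] by (intro mult_mono) (auto simp: x_def)
        then show ?thesis by (simp add: mult_ac)
      qed
    qed (use n Km in \<open>auto simp: x_def\<close>)
    then have "\<bar>fps_nth (h ^ k * m) n\<bar> \<le> D * (Km * x * n powr (\<gamma> - 1) + B * x / (1 + r / 2) ^ n)"
      by (simp only: cfps_nth norm_of_real)
    then have "fps_nth (h ^ k * m) n \<le> D * (Km * x * n powr (\<gamma> - 1) + B * x / (1 + r / 2) ^ n)" by simp
    then have "real n powr (1 - \<gamma>) * fps_nth (h ^ k * m) n \<le>
        real n powr (1 - \<gamma>) * (D * (Km * x * n powr (\<gamma> - 1) + B * x / (1 + r / 2) ^ n))"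
      by (intro mult_left_mono) auto
    also have "\<dots> = D * x * (Km * (n powr (1 - \<gamma>) * n powr (\<gamma> - 1)) + B * (n powr (1 - \<gamma>) / (1 + r / 2) ^ n))"
      by (simp add: algebra_simps)
    also have "n powr (1 - \<gamma>) * n powr (\<gamma> - 1) = 1" using n by (simp add: powr_add[symmetric])
    also have "D * x * (Km * 1 + B * (n powr (1 - \<gamma>) / (1 + r / 2) ^ n)) \<le> D * x * (Km + B * E)"
      using D E(2)[OF n(1)] B0 by (intro mult_left_mono add_mono) (auto simp: x_def)
    finally show "real n powr (1 - \<gamma>) * fps_nth (h ^ k * m) n \<le> D * (Km + B * E) * exp (- (e * (k / n powr \<alpha>)))"
      by (simp add: x_def mult_ac)
  qed
qed

text \<open>From |h^k - 1| <= k |h - 1| <= k Kh |1 - w|^\<alpha>, the difference h^k m - m gains a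
  factor |1 - w|^\<alpha> over m. Its coefficients are thus of order k n^(- \<alpha> - 1), a bound
  that vanishes linearly with k / n^\<alpha>.\<close>

proposition kernel_difference_bound:
  assumes m: "factor m 0 C"
  obtains K n0 where "0 \<le> K"
    "\<And>n k. n0 \<le> n \<Longrightarrow> real n * fps_nth (h ^ k * m) n \<le> K * (k / n powr \<alpha>) + real n * fps_nth m n"
proof -
  obtain f Km B where f: "f holomorphic_on slit_disc \<epsilon> T" "f has_fps_expansion cfps m" and Km: "0 \<le> Km"
    and near': "\<And>w. w \<in> near_set \<Longrightarrow> norm (f w) \<le> Km * norm (1 - w) powr (- 0)"
    and far: "\<And>w. w \<in> far_set \<Longrightarrow> norm (f w) \<le> B"
    using m unfolding factor_def by blast
  have near: "norm (f w) \<le> Km" if "w \<in> near_set" for w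
    using near'[OF that] that by (simp add: near_set_def)
  have B0: "0 \<le> B" using far_nonempty far norm_ge_zero order_trans by blast
  obtain D where D: "0 \<le> D"
    "\<And>n g G L A. \<lbrakk>2 / r \<le> real n; g holomorphic_on slit_disc \<epsilon> T; g has_fps_expansion G; 0 \<le> L;
      \<And>w. w \<in> near_set \<Longrightarrow> 1 / (2 * n) \<le> norm (1 - w) \<Longrightarrow> norm (g w) \<le> L * norm (1 - w) powr (- (- \<alpha>));
      \<And>w. w \<in> far_set \<Longrightarrow> norm (g w) \<le> A\<rbrakk>
     \<Longrightarrow> norm (fps_nth G n) \<le> D * (L * n powr (- \<alpha> - 1) + A / (1 + r / 2) ^ n)"
    using coeff_bound[of "- \<alpha>"] by metis
  obtain E where E: "0 \<le> E" "\<And>n::nat. 1 \<le> n \<Longrightarrow> real n powr (1 + \<alpha>) / (1 + r / 2) ^ n \<le> E"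
    using power_decay_bound[of "1 + \<alpha>"] by metis
  show ?thesis
  proof (rule that)
    show "0 \<le> D * (Kh * Km + 2 * B * E)" using D Km B0 E pars by auto
    fix n k :: nat assume "max 1 (nat \<lceil>2 / r\<rceil>) \<le> n"
    then have n: "1 \<le> n" "2 / r \<le> real n" by (auto simp: nat_le_iff ceiling_le_iff)
    show "real n * fps_nth (h ^ k * m) n \<le> D * (Kh * Km + 2 * B * E) * (k / n powr \<alpha>) + real n * fps_nth m n"
    proof (cases "k = 0")
      case False
      have "norm (fps_nth (cfps (h ^ k * m) - cfps m) n) \<le> D * (real k * Kh * Km * n powr (- \<alpha> - 1) + 2 * B / (1 + r / 2) ^ n)"
      proof (rule D(2)[of n "\<lambda>w. fh w ^ k * f w - f w"])
        show "(\<lambda>w. fh w ^ k * f w - f w) holomorphic_on slit_disc \<epsilon> T" by (intro holomorphic_intros f h_holo)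
        show "(\<lambda>w. fh w ^ k * f w - f w) has_fps_expansion cfps (h ^ k * m) - cfps m"
          unfolding cfps_mult cfps_power by (intro fps_expansion_intros f h_exp)
        show "norm (fh w ^ k * f w - f w) \<le> real k * Kh * Km * norm (1 - w) powr (- (- \<alpha>))"
          if w: "w \<in> near_set" for w
        proof -
          have "norm (fh w ^ k - 1 ^ k) \<le> real k * norm (fh w - 1)"
            using h_near_le_1[OF w] by (intro norm_power_diff) auto
          also have "\<dots> \<le> real k * (Kh * norm (1 - w) powr \<alpha>)"
            using h_near_one[OF w] by (intro mult_left_mono) auto
          finally have "norm ((fh w ^ k - 1) * f w) \<le> real k * (Kh * norm (1 - w) powr \<alpha>) * Km"
            unfolding norm_mult using near[OF w] pars by (intro mult_mono) auto
          moreover have "(fh w ^ k - 1) * f w = fh w ^ k * f w - f w" by (simp add: algebra_simps)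
          ultimately show ?thesis by (simp add: mult_ac)
        qed
        show "norm (fh w ^ k * f w - f w) \<le> 2 * B" if w: "w \<in> far_set" for w
        proof -
          have "norm (fh w ^ k * f w) \<le> 1 * B" unfolding norm_mult norm_power
            using h_far[OF w] pars far[OF w] by (intro mult_mono power_le_one) auto
          then show ?thesis using norm_triangle_ineq4[of "fh w ^ k * f w" "f w"] far[OF w] by simp
        qed
      qed (use n Km pars in auto)
      then have "\<bar>fps_nth (h ^ k * m) n - fps_nth m n\<bar> \<le> D * (real k * Kh * Km * n powr (- \<alpha> - 1) + 2 * B / (1 + r / 2) ^ n)"
        by (simp only: fps_sub_nth cfps_nth norm_of_real flip: of_real_diff)
      then have "fps_nth (h ^ k * m) n - fps_nth m n \<le> D * (real k * Kh * Km * n powr (- \<alpha> - 1) + 2 * B / (1 + r / 2) ^ n)"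
        by simp
      then have "real n * (fps_nth (h ^ k * m) n - fps_nth m n) \<le> real n * (D * (real k * Kh * Km * n powr (- \<alpha> - 1) + 2 * B / (1 + r / 2) ^ n))"
        by (intro mult_left_mono) auto
      also have "\<dots> = D * (k / n powr \<alpha> * (Kh * Km) + 2 * B * (n powr (1 + \<alpha>) / (1 + r / 2) ^ n) * (1 / n powr \<alpha>))"
        using n by (simp add: powr_diff powr_minus powr_add field_simps)
      also have "\<dots> \<le> D * (k / n powr \<alpha> * (Kh * Km) + 2 * B * E * (k / n powr \<alpha>))"
        using D B0 E False n by (intro mult_left_mono add_left_mono mult_mono divide_right_mono) auto
      finally show ?thesis by (simp add: algebra_simps)
    qed simp
  qed
qed

end

section \<open>Riemann sums by dominated convergence\<close>

lemma sum_indicator_steps: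
  fixes s x :: real and a :: "nat \<Rightarrow> real"
  assumes s: "0 < s"
  shows "(\<Sum>k\<in>{1..n}. a k * indicator {real (k - 1) / s<..real k / s} x) =
    (if 0 < x \<and> nat \<lceil>x * s\<rceil> \<le> n then a (nat \<lceil>x * s\<rceil>) else 0)"
proof -
  have iff: "x \<in> {real (k - 1) / s<..real k / s} \<longleftrightarrow> 0 < x \<and> k = nat \<lceil>x * s\<rceil>" if k: "1 \<le> k" for k
  proof -
    have "x \<in> {real (k - 1) / s<..real k / s} \<longleftrightarrow> real k - 1 < x * s \<and> x * s \<le> real k"
      using s k by (simp add: field_simps of_nat_diff)
    also have "\<dots> \<longleftrightarrow> \<lceil>x * s\<rceil> = int k" by (auto simp: ceiling_eq_iff)
    also have "\<dots> \<longleftrightarrow> 0 < x \<and> k = nat \<lceil>x * s\<rceil>"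
    proof
      assume c: "\<lceil>x * s\<rceil> = int k"
      then have "0 < \<lceil>x * s\<rceil>" using k by simp
      then have "0 < x * s" by simp
      then show "0 < x \<and> k = nat \<lceil>x * s\<rceil>" using c s by (simp add: zero_less_mult_iff)
    next
      assume "0 < x \<and> k = nat \<lceil>x * s\<rceil>"
      moreover from this have "0 < x * s" using s by simp
      then have "0 \<le> \<lceil>x * s\<rceil>" by linarith
      ultimately show "\<lceil>x * s\<rceil> = int k" by simp
    qed
    finally show ?thesis .
  qed
  have "(\<Sum>k\<in>{1..n}. a k * indicator {real (k - 1) / s<..real k / s} x) =
     (\<Sum>k\<in>{1..n}. if k = nat \<lceil>x * s\<rceil> then (if 0 < x then a k else 0) else 0)"
    using iff by (intro sum.cong refl) (auto simp: indicator_def)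
  also have "\<dots> = (if nat \<lceil>x * s\<rceil> \<in> {1..n} then (if 0 < x then a (nat \<lceil>x * s\<rceil>) else 0) else 0)"
    by (simp add: sum.delta)
  also have "\<dots> = (if 0 < x \<and> nat \<lceil>x * s\<rceil> \<le> n then a (nat \<lceil>x * s\<rceil>) else 0)"
  proof -
    have "1 \<le> nat \<lceil>x * s\<rceil>" if "0 < x" using that s by (simp add: nat_le_iff Suc_le_eq)
    then show ?thesis by auto
  qed
  finally show ?thesis .
qed

text \<open>
  A Riemann sum of mesh \<open>1 / s n\<close>, written as the integral of a step function so that dominated
  convergence applies.
\<close>

proposition riemann_sum_limit:
  fixes B :: "nat \<Rightarrow> nat \<Rightarrow> real" and s :: "nat \<Rightarrow> real" and g :: "nat \<Rightarrow> real" and \<phi> W :: "real \<Rightarrow> real"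
  assumes s: "filterlim s at_top sequentially"
    and g: "(\<lambda>k. real k powr (1 - p) * g k) \<longlonglongrightarrow> Cg"
    and lim: "\<And>x k. 0 < x \<Longrightarrow> (\<lambda>n. real (k n) / s n) \<longlonglongrightarrow> x \<Longrightarrow> (\<lambda>n. B n (k n)) \<longlonglongrightarrow> W x"
    and bound: "\<And>n k. n0 \<le> n \<Longrightarrow> 1 \<le> k \<Longrightarrow> \<bar>B n k\<bar> \<le> K * (real k / s n) powr v * exp (- (e * (real k / s n)))"
    and pars: "0 \<le> v" "0 < p + v" "0 < e"
    and B0: "\<And>n k. n < k \<Longrightarrow> B n k = 0"
    and \<phi>: "continuous_on {0..} \<phi>" "\<And>x. 0 \<le> x \<Longrightarrow> \<bar>\<phi> x\<bar> \<le> L * (1 + x) powr \<sigma>" "0 \<le> \<sigma>"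
  shows "(\<lambda>n. s n powr (- p) * (\<Sum>k\<in>{1..n}. g k * \<phi> (real k / s n) * B n k)) \<longlonglongrightarrow>
    Cg * (\<integral>x. indicator {0<..} x *\<^sub>R (\<phi> x * x powr (p - 1) * W x) \<partial>lborel)"
proof -
  have "\<forall>\<^sub>F n in sequentially. 1 \<le> s n" using s unfolding filterlim_at_top by blast
  then obtain n1 where n1: "\<And>n. n1 \<le> n \<Longrightarrow> 1 \<le> s n" by (auto simp: eventually_sequentially)
  define N where "N = max n0 n1"
  have sN: "1 \<le> s n" if "N \<le> n" for n using n1 that by (simp add: N_def)
  define f where "f = (\<lambda>n k. s n powr (1 - p) * (g k * \<phi> (real k / s n) * B n k))"
  define F where "F = (\<lambda>n x. \<Sum>k\<in>{1..n}. f n k * indicator {real (k - 1) / s n<..real k / s n} x)"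
  have F: "F n x = (if 0 < x then f n (nat \<lceil>x * s n\<rceil>) else 0)" if "N \<le> n" for n x
  proof -
    have "f n (nat \<lceil>x * s n\<rceil>) = 0" if "n < nat \<lceil>x * s n\<rceil>" using B0[OF that] by (simp only: f_def mult_zero_right)
    moreover have s0: "0 < s n" using sN[OF that] by linarith
    ultimately show ?thesis unfolding F_def sum_indicator_steps[OF s0] by (metis not_le)
  qed
  have intF: "(\<integral>x. F n x \<partial>lborel) = s n powr (- p) * (\<Sum>k\<in>{1..n}. g k * \<phi> (real k / s n) * B n k)" if n: "N \<le> n" for n
  proof -
    have s1: "0 < s n" using sN[OF n] by linarith
    have m: "measure lborel {real (k - 1) / s n<..real k / s n} = 1 / s n" if "k \<in> {1..n}" for k
    proof -
      have "real (k - 1) / s n \<le> real k / s n" using s1 by (intro divide_right_mono) auto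
      then show ?thesis using that s1 by (simp add: of_nat_diff diff_divide_distrib[symmetric])
    qed
    have "(\<integral>x. F n x \<partial>lborel) = (\<Sum>k\<in>{1..n}. f n k * measure lborel {real (k - 1) / s n<..real k / s n})"
    proof -
      have "emeasure lborel {a<..b} < \<infinity>" for a b :: real by (cases "a \<le> b") auto
      then show ?thesis unfolding F_def
        by (subst Bochner_Integration.integral_sum) (auto intro!: integrable_real_indicator)
    qed
    also have "\<dots> = (\<Sum>k\<in>{1..n}. f n k * (1 / s n))" using m by (intro sum.cong) auto
    also have "\<dots> = s n powr (- p) * (\<Sum>k\<in>{1..n}. g k * \<phi> (real k / s n) * B n k)"
      unfolding sum_distrib_left
    proof (intro sum.cong refl)
      fix k
      have "s n powr (1 - p) = s n powr (- p) * s n" using s1 by (simp add: powr_diff powr_minus field_simps)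
      then show "f n k * (1 / s n) = s n powr (- p) * (g k * \<phi> (real k / s n) * B n k)"
        using s1 by (simp add: f_def)
    qed
    finally show ?thesis .
  qed
  have "Bseq (\<lambda>k. real k powr (1 - p) * g k)" using g by (intro convergent_imp_Bseq convergentI)
  then obtain Gb where Gb: "0 < Gb" "\<And>k. \<bar>real k powr (1 - p) * g k\<bar> \<le> Gb" by (auto elim!: BseqE)
  \<comment> \<open>The exponent of x at 0 in the majorant: the weights contribute p - 1 and the
    bound on \<open>B\<close> contributes \<open>v\<close>. The hypothesis 0 < p + v makes it
    integrable.\<close>
  define u where "u = p + v - 1"
  obtain Q where Q: "0 < Q" "\<And>y. 0 \<le> y \<Longrightarrow> (1 + y) powr \<sigma> \<le> Q * exp (e / 2 * y)"
    using powr_le_exp[of \<sigma> "e / 2"] \<phi>(3) pars by auto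
  have L0: "0 \<le> L" using \<phi>(2)[of 0] by simp
  define Kp where "Kp = \<bar>K\<bar>"
  \<comment> \<open>The step function at x evaluates its data at a point z of [x, x + 1]. For
    negative u the power z^u is at most x^u, for nonnegative u at most (1 + x)^u; hence two terms.
    Half of the exponential rate pays for the growth of \<phi>.\<close>
  define D where "D = (\<lambda>x. Gb * L * Kp * 2 powr \<sigma> * Q * (indicator {0<..} x *\<^sub>R (x powr u * exp (- (e / 2 * x)))
     + indicator {0<..} x *\<^sub>R ((1 + x) powr \<bar>u\<bar> * exp (- (e / 2 * x)))))"
  have Kp: "0 \<le> Kp" by (simp add: Kp_def)
  have c0: "0 \<le> Gb * L * Kp * 2 powr \<sigma> * Q" using Gb L0 Kp Q by simp
  have "(\<lambda>n. \<integral>x. F (n + N) x \<partial>lborel) \<longlonglongrightarrow> (\<integral>x. Cg * (indicator {0<..} x *\<^sub>R (\<phi> x * x powr (p - 1) * W x)) \<partial>lborel)"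
  proof (rule integral_dominated_convergence)
    have "integrable lborel (\<lambda>x. indicator {0<..} x *\<^sub>R (x powr u * exp (- (e / 2 * x))))"
      using has_bochner_integral_Gamma[of "p + v" "e / 2"] pars by (simp add: has_bochner_integral_iff u_def)
    moreover have "integrable lborel (\<lambda>x. indicator {0<..} x *\<^sub>R ((1 + x) powr \<bar>u\<bar> * exp (- (e / 2 * x))))"
      unfolding set_integrable_def[symmetric]
      by (rule set_integrable_subset[OF integrable_powr_exp]) (use pars in auto)
    ultimately show "integrable lborel D" unfolding D_def by (intro integrable_mult_right Bochner_Integration.integrable_add)
    show Fm: "F (n + N) \<in> borel_measurable lborel" for n unfolding F_def by measurable
    have ptw: "(\<lambda>n. F (n + N) x) \<longlonglongrightarrow> Cg * (indicator {0<..} x *\<^sub>R (\<phi> x * x powr (p - 1) * W x))" for x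
    proof (cases "0 < x")
      case True
      define k where "k = (\<lambda>n. nat \<lceil>x * s n\<rceil>)"
      have kr: "(\<lambda>n. real (k n) / s n) \<longlonglongrightarrow> x"
      proof (rule tendsto_sandwich)
        have ev: "\<forall>\<^sub>F n in sequentially. 1 \<le> s n" using s unfolding filterlim_at_top by blast
        have c: "real (k n) = of_int \<lceil>x * s n\<rceil>" if "1 \<le> s n" for n
        proof -
          have "0 < x * s n" using True that by simp
          then have "0 \<le> \<lceil>x * s n\<rceil>" by linarith
          then show ?thesis by (simp add: k_def)
        qed
        from ev show "\<forall>\<^sub>F n in sequentially. x \<le> real (k n) / s n"
          by eventually_elim (use c in \<open>simp add: pos_le_divide_eq\<close>)
        from ev show "\<forall>\<^sub>F n in sequentially. real (k n) / s n \<le> x + 1 / s n"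
        proof eventually_elim
          case (elim n)
          have "real (k n) \<le> x * s n + 1" using c[OF elim] by linarith
          then have "real (k n) / s n \<le> (x * s n + 1) / s n" using elim by (intro divide_right_mono) auto
          then show ?case using elim by (simp add: add_divide_distrib)
        qed
        have "(\<lambda>n. 1 / s n) \<longlonglongrightarrow> 0"
          using tendsto_divide_0[OF tendsto_const filterlim_at_top_imp_at_infinity[OF s]] .
        from tendsto_add[OF tendsto_const[of x] this]
        show "(\<lambda>n. x + 1 / s n) \<longlonglongrightarrow> x" by simp
      qed simp
      have kinf: "filterlim k at_top sequentially"
      proof -
        have "filterlim (\<lambda>n. real (k n)) at_top sequentially"
        proof (rule filterlim_at_top_mono)
          show "filterlim (\<lambda>n. x * s n) at_top sequentially"
            by (rule filterlim_tendsto_pos_mult_at_top[OF tendsto_const True s])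
          show "\<forall>\<^sub>F n in sequentially. x * s n \<le> real (k n)"
            by (intro always_eventually allI) (simp add: k_def real_nat_ceiling_ge)
        qed
        then show ?thesis by (simp add: filterlim_sequentially_iff_filterlim_real)
      qed
      have "isCont \<phi> x" using continuous_on_interior[OF \<phi>(1), of x] True by simp
      then have "(\<lambda>n. \<phi> (real (k n) / s n)) \<longlonglongrightarrow> \<phi> x" using kr by (rule isCont_tendsto_compose)
      then have "(\<lambda>n. (real (k n) / s n) powr (p - 1) * (real (k n) powr (1 - p) * g (k n)) * \<phi> (real (k n) / s n) * B n (k n))
         \<longlonglongrightarrow> x powr (p - 1) * Cg * \<phi> x * W x"
        using True by (intro tendsto_mult tendsto_powr kr tendsto_const filterlim_compose[OF g kinf] lim) auto
      moreover have "\<forall>\<^sub>F n in sequentially. (real (k n) / s n) powr (p - 1) * (real (k n) powr (1 - p) * g (k n)) * \<phi> (real (k n) / s n) * B n (k n) = F n x"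
        using eventually_ge_at_top[of N] eventually_compose_filterlim[OF eventually_gt_at_top[of 0] kinf]
      proof eventually_elim
        case (elim n)
        have s1: "0 < s n" using sN[OF elim(1)] by linarith
        have "(real (k n) / s n) powr (p - 1) * real (k n) powr (1 - p) = s n powr (1 - p)"
          using elim s1 by (simp add: powr_divide powr_diff field_simps)
        moreover have "F n x = s n powr (1 - p) * (g (k n) * \<phi> (real (k n) / s n) * B n (k n))"
          using F[OF elim(1), of x] True by (simp add: f_def k_def)
        ultimately show ?case by (simp only: mult.assoc[symmetric])
      qed
      ultimately have "(\<lambda>n. F n x) \<longlonglongrightarrow> x powr (p - 1) * Cg * \<phi> x * W x" by (rule Lim_transform_eventually)
      from LIMSEQ_ignore_initial_segment[OF this, of N] show ?thesis using True by (simp add: mult_ac)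
    qed (use F in simp)
    show "AE x in lborel. (\<lambda>n. F (n + N) x) \<longlonglongrightarrow> Cg * (indicator {0<..} x *\<^sub>R (\<phi> x * x powr (p - 1) * W x))"
      using ptw by auto
    show "(\<lambda>x. Cg * (indicator {0<..} x *\<^sub>R (\<phi> x * x powr (p - 1) * W x))) \<in> borel_measurable lborel"
      by (rule borel_measurable_LIMSEQ_metric[OF Fm ptw])
    show "AE x in lborel. norm (F (n + N) x) \<le> D x" for n
    proof (rule AE_I2)
      fix x :: real
      show "norm (F (n + N) x) \<le> D x"
      proof (cases "0 < x")
        case True
        let ?s = "s (n + N)"
        define k where "k = nat \<lceil>x * ?s\<rceil>"
        define z where "z = real k / ?s"
        have s1: "1 \<le> ?s" by (rule sN) simp
        have "0 < x * ?s" using True s1 by simp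
        then have k1: "1 \<le> k" "x * ?s \<le> real k" "real k \<le> x * ?s + 1" unfolding k_def by linarith+
        have z: "x \<le> z" "z \<le> x + 1"
        proof -
          show "x \<le> z" using k1 s1 by (simp add: z_def pos_le_divide_eq)
          have "real k \<le> (x + 1) * ?s" using k1 s1 by (simp add: algebra_simps)
          then show "z \<le> x + 1" using s1 by (simp add: z_def pos_divide_le_eq)
        qed
        have zp: "0 < z" using z True by linarith
        have "\<bar>F (n + N) x\<bar> = \<bar>?s powr (1 - p) * g k\<bar> * \<bar>\<phi> z\<bar> * \<bar>B (n + N) k\<bar>"
          using F[of "n + N" x] True by (simp add: f_def k_def z_def abs_mult)
        also have "?s powr (1 - p) * g k = z powr (p - 1) * (real k powr (1 - p) * g k)"
          using k1 s1 by (simp add: z_def powr_divide powr_diff field_simps)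
        also have "\<bar>z powr (p - 1) * (real k powr (1 - p) * g k)\<bar> \<le> z powr (p - 1) * Gb"
          using Gb(2)[of k] by (simp add: abs_mult mult_left_mono)
        also have "\<bar>\<phi> z\<bar> \<le> L * (1 + z) powr \<sigma>" using \<phi>(2)[of z] zp by simp
        also have "\<bar>B (n + N) k\<bar> \<le> Kp * z powr v * exp (- (e * z))"
        proof -
          have "\<bar>B (n + N) k\<bar> \<le> K * z powr v * exp (- (e * z))"
            using bound[of "n + N" k] k1 by (simp add: N_def z_def)
          also have "\<dots> \<le> Kp * z powr v * exp (- (e * z))" by (intro mult_right_mono) (auto simp: Kp_def)
          finally show ?thesis .
        qed
        finally have "\<bar>F (n + N) x\<bar> \<le> z powr (p - 1) * Gb * (L * (1 + z) powr \<sigma>) * (Kp * z powr v * exp (- (e * z)))"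
          using L0 Gb Kp by (simp add: mult_right_mono mult_left_mono)
        also have "\<dots> = Gb * L * Kp * ((z powr (p - 1) * z powr v) * (1 + z) powr \<sigma> * exp (- (e * z)))" by (simp add: mult_ac)
        also have "z powr (p - 1) * z powr v = z powr u" by (simp add: u_def powr_add[symmetric] algebra_simps)
        also have "Gb * L * Kp * (z powr u * (1 + z) powr \<sigma> * exp (- (e * z)))
           \<le> Gb * L * Kp * ((x powr u + (1 + x) powr \<bar>u\<bar>) * (2 powr \<sigma> * (Q * exp (e / 2 * x))) * exp (- (e * x)))"
        proof (intro mult_left_mono mult_mono)
          show "z powr u \<le> x powr u + (1 + x) powr \<bar>u\<bar>"
          proof (cases "0 \<le> u")
            case True
            then have "z powr u \<le> (1 + x) powr \<bar>u\<bar>" using z zp by (auto intro!: powr_mono2)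
            then show ?thesis by (simp add: add_increasing)
          next
            case False
            then have "z powr u \<le> x powr u" using z \<open>0 < x\<close> by (intro powr_mono2') auto
            then show ?thesis by (simp add: add_increasing2)
          qed
          have "(1 + z) powr \<sigma> \<le> (2 * (1 + x)) powr \<sigma>" using z True \<phi>(3) by (intro powr_mono2) auto
          also have "\<dots> \<le> 2 powr \<sigma> * (Q * exp (e / 2 * x))"
            using True Q(2)[of x] by (subst powr_mult) (auto intro!: mult_left_mono)
          finally show "(1 + z) powr \<sigma> \<le> 2 powr \<sigma> * (Q * exp (e / 2 * x))" .
          show "exp (- (e * z)) \<le> exp (- (e * x))" using z pars by simp
        qed (use Gb L0 Kp Q in auto)
        also have "\<dots> = Gb * L * Kp * 2 powr \<sigma> * Q * ((x powr u + (1 + x) powr \<bar>u\<bar>) * (exp (e / 2 * x) * exp (- (e * x))))"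
          by (simp add: mult_ac)
        also have "exp (e / 2 * x) * exp (- (e * x)) = exp (- (e / 2 * x))" by (simp add: exp_add[symmetric])
        also have "Gb * L * Kp * 2 powr \<sigma> * Q * ((x powr u + (1 + x) powr \<bar>u\<bar>) * exp (- (e / 2 * x))) = D x"
          using True by (simp add: D_def distrib_right)
        finally show ?thesis by simp
      qed (use F in \<open>simp add: D_def\<close>)
    qed
  qed
  then have "(\<lambda>n. s (n + N) powr (- p) * (\<Sum>k\<in>{1..n + N}. g k * \<phi> (real k / s (n + N)) * B (n + N) k)) \<longlonglongrightarrow>
    Cg * (\<integral>x. indicator {0<..} x *\<^sub>R (\<phi> x * x powr (p - 1) * W x) \<partial>lborel)"
    by (simp only: intF[OF le_add2] integral_mult_right_zero)
  then show ?thesis by (rule LIMSEQ_offset)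
qed

lemma fps_mult_zero_power_nth:
  fixes h m :: "real fps"
  assumes "fps_nth h 0 = 0" "n < k"
  shows "fps_nth (h ^ k * m) n = 0"
proof -
  have "fps_nth (h ^ k) i = 0" if "i \<le> n" for i
    using startsby_zero_power_prefix[OF assms(1)] that assms(2) by auto
  then show ?thesis by (simp add: fps_mult_nth)
qed

section \<open>Positivity of the Wright function and weighted sums over k\<close>

context large_powers
begin

lemma factor_nonneg: "factor m \<gamma> C \<Longrightarrow> 0 \<le> fps_nth m n"
  by (auto simp: factor_def)

lemma kernel_nonneg: "factor m \<gamma> C \<Longrightarrow> 0 \<le> fps_nth (h ^ k * m) n"
  by (intro fps_mult_nonneg fps_power_nonneg h_nonneg factor_nonneg)

text \<open>A limit of nonnegative coefficients, reached along k = floor (x \<kappa> n^\<alpha>). No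
  analytic argument for the sign of the alternating series is needed.\<close>

lemma wright_nonneg:
  assumes m: "factor m \<gamma> C" and C: "0 < C" and x: "0 \<le> x"
  shows "0 \<le> wright \<alpha> \<gamma> x"
proof -
  have s: "filterlim (\<lambda>n. \<kappa> * real n powr \<alpha>) at_top sequentially"
    using filterlim_real_powr[OF filterlim_ident pars(1) \<alpha>(1)] by simp
  have "(\<lambda>n. real n powr (1 - \<gamma>) * fps_nth (h ^ nat \<lfloor>x * (\<kappa> * real n powr \<alpha>)\<rfloor> * m) n) \<longlonglongrightarrow> C * wright \<alpha> \<gamma> x"
    by (rule kernel_limit[OF m filterlim_ident nat_floor_ratio[OF x s]])
  then have "0 \<le> C * wright \<alpha> \<gamma> x"
    by (rule LIMSEQ_le_const) (auto intro!: mult_nonneg_nonneg kernel_nonneg[OF m])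
  then show ?thesis using C by (simp add: zero_le_mult_iff)
qed

text \<open>The map u -> y u^(- \<alpha>) is injective, so countability pulls back. In
  \<open>wright_pos\<close> the variable u is the fraction of the index n that falls to one factor
  of a convolution.\<close>

lemma wright_zeros_scaled:
  assumes y: "0 < y"
  shows "countable {u. 0 < u \<and> wright \<alpha> \<gamma> (y * u powr (- \<alpha>)) = 0}"
proof -
  have "inj_on (\<lambda>u. y * u powr (- \<alpha>)) {u. 0 < u \<and> wright \<alpha> \<gamma> (y * u powr (- \<alpha>)) = 0}"
  proof (rule inj_onI)
    fix u v assume u: "u \<in> {u. 0 < u \<and> wright \<alpha> \<gamma> (y * u powr (- \<alpha>)) = 0}"
      and v: "v \<in> {u. 0 < u \<and> wright \<alpha> \<gamma> (y * u powr (- \<alpha>)) = 0}"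
      and "y * u powr (- \<alpha>) = y * v powr (- \<alpha>)"
    then have "(u powr (- \<alpha>)) powr (- 1 / \<alpha>) = (v powr (- \<alpha>)) powr (- 1 / \<alpha>)" using y by simp
    then show "u = v" using u v \<alpha> by (simp add: powr_powr)
  qed
  moreover have "countable ((\<lambda>u. y * u powr (- \<alpha>)) ` {u. 0 < u \<and> wright \<alpha> \<gamma> (y * u powr (- \<alpha>)) = 0})"
    by (rule countable_subset[OF _ wright_zeros_countable[of \<gamma>]]) auto
  ultimately show ?thesis by (rule countable_image_inj_on[rotated])
qed

text \<open>
  Split the power in two halves: \<open>h\<^sup>2\<^sup>k m = h\<^sup>k (h\<^sup>k m)\<close>. The zeros of the limit functions are
  isolated, so both factors are of the expected order on a whole window of the convolution.
\<close>

proposition wright_pos: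
  assumes m: "factor m \<gamma> C" and C: "0 < C" and x: "0 < x"
  shows "0 < wright \<alpha> \<gamma> x"
proof -
  define y where "y = x / 2"
  have y: "0 < y" using x by (simp add: y_def)
  have "countable ({u. 0 < u \<and> wright \<alpha> 0 (y * u powr (- \<alpha>)) = 0} \<union>
      (\<lambda>u. 1 - u) ` {u. 0 < u \<and> wright \<alpha> \<gamma> (y * u powr (- \<alpha>)) = 0})" (is "countable ?Z")
    by (intro countable_Un countable_image wright_zeros_scaled y)
  moreover have "uncountable {0<..<1::real}" by (rule uncountable_open_interval[THEN iffD2]) simp
  ultimately have "\<not> {0<..<1} \<subseteq> ?Z" using countable_subset by blast
  then obtain u where "u \<in> {0<..<1}" and uZ: "u \<notin> ?Z" by blast
  then have u: "0 < u" "u < 1" "u \<notin> ?Z" by (simp_all only: greaterThanLessThan_iff uZ)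
  \<comment> \<open>A power k of order y \<kappa> n^\<alpha>, viewed at index l close to u n, has
    the parameter k / (\<kappa> l^\<alpha>), close to y u^(- \<alpha>); the complementary index n -
    l gives y (1 - u)^(- \<alpha>).\<close>
  define y1 y2 where "y1 = y * u powr (- \<alpha>)" and "y2 = y * (1 - u) powr (- \<alpha>)"
  have yp: "0 < y1" "0 < y2" using y u by (auto simp: y1_def y2_def)
  have "wright \<alpha> \<gamma> y2 \<noteq> 0"
  proof
    assume "wright \<alpha> \<gamma> y2 = 0"
    then have "1 - (1 - u) \<in> ?Z" using u by (intro UnI2 imageI) (auto simp: y2_def)
    with u show False by simp
  qed
  then have W2: "0 < wright \<alpha> \<gamma> y2" using wright_nonneg[OF m C, of y2] yp by simp
  have "wright \<alpha> 0 y1 \<noteq> 0" using u by (auto simp: y1_def)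
  then have W1: "0 < wright \<alpha> 0 y1" using wright_nonneg[OF factor_one, of y1] yp by simp
  define k where "k = (\<lambda>n::nat. nat \<lfloor>y * (\<kappa> * real n powr \<alpha>)\<rfloor>)"
  have s: "filterlim (\<lambda>n. \<kappa> * real n powr \<alpha>) at_top sequentially"
    using filterlim_real_powr[OF filterlim_ident pars(1) \<alpha>(1)] by simp
  have k: "(\<lambda>n. real (k n) / (\<kappa> * real n powr \<alpha>)) \<longlonglongrightarrow> y"
    unfolding k_def using y by (intro nat_floor_ratio s) auto
  define b1 b2 where "b1 = wright \<alpha> 0 y1 / 2" and "b2 = C * wright \<alpha> \<gamma> y2 / 2"
  have b: "0 < b1" "0 < b2" using W1 W2 C by (auto simp: b1_def b2_def)
  define good where "good = (\<lambda>n l. b1 \<le> real l powr (1 - 0) * fps_nth (h ^ k n * 1) l \<and>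
      b2 \<le> real (n - l) powr (1 - \<gamma>) * fps_nth (h ^ k n * m) (n - l))"
  \<comment> \<open>Both lower bounds must hold for all l of a window at once, while
    \<open>kernel_limit\<close> speaks of sequences. If every window failed, one could pick n and l
    with l/n -> u and contradict that limit. The same i fixes the threshold for n and the width of
    the window.\<close>
  have "\<exists>i::nat. \<forall>n\<ge>i. \<forall>l\<le>n. \<bar>real l / real n - u\<bar> < 1 / real (Suc i) \<longrightarrow> good n l"
  proof (rule ccontr)
    assume "\<not> ?thesis"
    then have "\<forall>i. \<exists>n l. i \<le> n \<and> l \<le> n \<and> \<bar>real l / real n - u\<bar> < 1 / real (Suc i) \<and> \<not> good n l" by blast
    then obtain n l where nl: "\<And>i. i \<le> n i" "\<And>i. l i \<le> n i"
        "\<And>i. \<bar>real (l i) / real (n i) - u\<bar> < 1 / real (Suc i)" "\<And>i. \<not> good (n i) (l i)" by metis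
    have n_inf: "filterlim n at_top sequentially"
      by (rule filterlim_at_top_mono[OF filterlim_ident]) (use nl in auto)
    have n_real: "filterlim (\<lambda>i. real (n i)) at_top sequentially"
      by (rule filterlim_compose[OF filterlim_real_sequentially n_inf])
    have n_pos: "\<forall>\<^sub>F i in sequentially. 0 < n i"
      by (rule eventually_compose_filterlim[OF eventually_gt_at_top n_inf])
    have "(\<lambda>i. real (l i) / real (n i) - u) \<longlonglongrightarrow> 0"
    proof (rule Lim_null_comparison)
      show "\<forall>\<^sub>F i in sequentially. norm (real (l i) / real (n i) - u) \<le> 1 / real (Suc i)"
        by (intro always_eventually allI) (simp only: real_norm_def less_imp_le[OF nl(3)])
      show "(\<lambda>i. 1 / real (Suc i)) \<longlonglongrightarrow> 0" by (rule LIMSEQ_Suc[OF lim_1_over_n[where 'a = real, simplified]])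
    qed
    then have lu: "(\<lambda>i. real (l i) / real (n i)) \<longlonglongrightarrow> u" by (simp add: LIM_zero_iff)
    have nlu: "(\<lambda>i. real (n i - l i) / real (n i)) \<longlonglongrightarrow> 1 - u"
    proof (rule Lim_transform_eventually[OF tendsto_diff[OF tendsto_const lu]])
      show "\<forall>\<^sub>F i in sequentially. 1 - real (l i) / real (n i) = real (n i - l i) / real (n i)"
        using n_pos by eventually_elim (use nl(2) in \<open>simp add: of_nat_diff field_simps\<close>)
    qed
    have aux: "filterlim L at_top sequentially \<and> (\<lambda>i. real (k (n i)) / (\<kappa> * real (L i) powr \<alpha>)) \<longlonglongrightarrow> y * v powr (- \<alpha>)"
      if L: "(\<lambda>i. real (L i) / real (n i)) \<longlonglongrightarrow> v" and v: "0 < v" for L v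
    proof
      have "filterlim (\<lambda>i. real (L i) / real (n i) * real (n i)) at_top sequentially"
        by (rule filterlim_tendsto_pos_mult_at_top[OF L v n_real])
      moreover have "\<forall>\<^sub>F i in sequentially. real (L i) / real (n i) * real (n i) = real (L i)"
        using n_pos by eventually_elim simp
      then have "filterlim (\<lambda>i. real (L i) / real (n i) * real (n i)) at_top sequentially
          \<longleftrightarrow> filterlim (\<lambda>i. real (L i)) at_top sequentially"
        by (intro filterlim_cong refl)
      ultimately have "filterlim (\<lambda>i. real (L i)) at_top sequentially" by blast
      then show L_inf: "filterlim L at_top sequentially" by (simp add: filterlim_sequentially_iff_filterlim_real)
      have "(\<lambda>i. real (k (n i)) / (\<kappa> * real (n i) powr \<alpha>) * (real (L i) / real (n i)) powr (- \<alpha>)) \<longlonglongrightarrow> y * v powr (- \<alpha>)"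
        using v by (intro tendsto_intros L filterlim_compose[OF k n_inf]) auto
      moreover have "\<forall>\<^sub>F i in sequentially. real (k (n i)) / (\<kappa> * real (n i) powr \<alpha>) * (real (L i) / real (n i)) powr (- \<alpha>) =
         real (k (n i)) / (\<kappa> * real (L i) powr \<alpha>)"
        using n_pos eventually_compose_filterlim[OF eventually_gt_at_top[of 0] L_inf]
      proof eventually_elim
        case (elim i)
        then have "(real (L i) / real (n i)) powr (- \<alpha>) = real (n i) powr \<alpha> / real (L i) powr \<alpha>"
          by (simp add: powr_minus powr_divide)
        then show ?case using elim by simp
      qed
      ultimately show "(\<lambda>i. real (k (n i)) / (\<kappa> * real (L i) powr \<alpha>)) \<longlonglongrightarrow> y * v powr (- \<alpha>)"
        by (rule Lim_transform_eventually)
    qed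
    have "(\<lambda>i. real (l i) powr (1 - 0) * fps_nth (h ^ k (n i) * 1) (l i)) \<longlonglongrightarrow> 1 * wright \<alpha> 0 y1"
      using aux[OF lu u(1)] unfolding y1_def by (intro kernel_limit[OF factor_one]) auto
    then have e1: "\<forall>\<^sub>F i in sequentially. b1 < real (l i) powr (1 - 0) * fps_nth (h ^ k (n i) * 1) (l i)"
      by (rule order_tendstoD) (use W1 in \<open>simp add: b1_def\<close>)
    have "(\<lambda>i. real (n i - l i) powr (1 - \<gamma>) * fps_nth (h ^ k (n i) * m) (n i - l i)) \<longlonglongrightarrow> C * wright \<alpha> \<gamma> y2"
      using aux[OF nlu] u unfolding y2_def by (intro kernel_limit[OF m]) auto
    then have e2: "\<forall>\<^sub>F i in sequentially. b2 < real (n i - l i) powr (1 - \<gamma>) * fps_nth (h ^ k (n i) * m) (n i - l i)"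
      by (rule order_tendstoD) (use W2 C in \<open>simp add: b2_def\<close>)
    from e1 e2 have "\<forall>\<^sub>F i in sequentially. good (n i) (l i)"
      by eventually_elim (simp add: good_def)
    with nl(4) show False by simp
  qed
  then obtain i where i: "\<And>n l. i \<le> n \<Longrightarrow> l \<le> n \<Longrightarrow> \<bar>real l / real n - u\<bar> < 1 / real (Suc i) \<Longrightarrow> good n l" by blast
  \<comment> \<open>Besides fitting into the window, this half-width keeps l above u n / 2 and n - l
    above (1 - u) n / 2.\<close>
  define z where "z = min (1 / real (Suc i)) (min (u / 2) ((1 - u) / 2))"
  have z: "0 < z" "z \<le> 1 / real (Suc i)" "z \<le> u / 2" "z \<le> (1 - u) / 2"
    unfolding z_def using u by (simp, intro min.cobounded1, intro min.coboundedI2 min.cobounded1, intro min.coboundedI2 min.cobounded2)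
  \<comment> \<open>A lower bound for ((n - l)/n)^(\<gamma> - 1), whose base ranges over
    [(1 - u)/2, 1]; the minimum covers both signs of \<gamma> - 1.\<close>
  define c0 where "c0 = min 1 (((1 - u) / 2) powr (\<gamma> - 1))"
  have c0: "0 < c0" using u by (simp add: c0_def)
  have low: "z * (b1 * b2 * c0) \<le> real n powr (1 - \<gamma>) * fps_nth (h ^ (2 * k n) * m) n"
    if n: "i \<le> n" "2 / z \<le> real n" for n
  proof -
    have n0: "0 < real n" using n z by (smt (verit) divide_pos_pos)
    define I where "I = {l. l \<le> n \<and> \<bar>real l / real n - u\<bar> < z}"
    have fin: "finite I" by (rule finite_subset[of _ "{..n}"]) (auto simp: I_def)
    have summand: "b1 * b2 * c0 * real n powr (\<gamma> - 1) / real n \<le> fps_nth (h ^ k n) l * fps_nth (h ^ k n * m) (n - l)"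
      if l: "l \<in> I" for l
    proof -
      have ln: "l \<le> n" and lu: "\<bar>real l / real n - u\<bar> < z" using l by (auto simp: I_def)
      have g: "good n l" using i[OF n(1) ln] lu z by simp
      have "u / 2 < real l / real n" using lu z by linarith
      then have "0 < real l / real n" using u by linarith
      then have l0: "0 < real l" by (auto simp: zero_less_divide_iff)
      have "real l / real n < u + (1 - u) / 2" using lu z by linarith
      then have nl: "(1 - u) / 2 \<le> real (n - l) / real n"
      proof -
        have "real (n - l) / real n = 1 - real l / real n" using ln n0 by (simp add: of_nat_diff diff_divide_distrib)
        moreover have "u + (1 - u) / 2 = 1 - (1 - u) / 2" by (simp add: field_simps)
        ultimately show ?thesis using \<open>real l / real n < u + (1 - u) / 2\<close> by linarith
      qed
      have "0 < (1 - u) / 2" using u by simp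
      with nl have "0 < real (n - l) / real n" by linarith
      then have d0: "0 < real (n - l)" by (auto simp: zero_less_divide_iff)
      have "b1 / real n \<le> b1 / real l" using b ln l0 by (intro divide_left_mono) auto
      also have "\<dots> \<le> fps_nth (h ^ k n) l" using g l0 by (simp add: good_def pos_divide_le_eq mult.commute)
      finally have 1: "b1 / real n \<le> fps_nth (h ^ k n) l" .
      have "c0 \<le> (real (n - l) / real n) powr (\<gamma> - 1)"
      proof (cases "1 \<le> \<gamma>")
        case True
        have "((1 - u) / 2) powr (\<gamma> - 1) \<le> (real (n - l) / real n) powr (\<gamma> - 1)"
          using True u(1,2) by (intro powr_mono2 nl) auto
        then show ?thesis by (simp add: c0_def)
      next
        case False
        have "(1::real) powr (\<gamma> - 1) \<le> (real (n - l) / real n) powr (\<gamma> - 1)"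
          using False d0 n0 by (intro powr_mono2') auto
        then show ?thesis by (simp add: c0_def)
      qed
      then have "b2 * (c0 * real n powr (\<gamma> - 1)) \<le> b2 * real (n - l) powr (\<gamma> - 1)"
        using b n0 by (intro mult_left_mono) (simp_all add: powr_divide pos_le_divide_eq)
      also have "\<dots> \<le> (real (n - l) powr (1 - \<gamma>) * fps_nth (h ^ k n * m) (n - l)) * real (n - l) powr (\<gamma> - 1)"
        using g by (intro mult_right_mono) (auto simp: good_def)
      also have "\<dots> = (real (n - l) powr (1 - \<gamma>) * real (n - l) powr (\<gamma> - 1)) * fps_nth (h ^ k n * m) (n - l)"
        by (simp only: mult_ac)
      also have "real (n - l) powr (1 - \<gamma>) * real (n - l) powr (\<gamma> - 1) = 1"
        using d0 by (simp add: powr_add[symmetric])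
      finally have 2: "b2 * (c0 * real n powr (\<gamma> - 1)) \<le> fps_nth (h ^ k n * m) (n - l)" by simp
      have "b1 / real n * (b2 * (c0 * real n powr (\<gamma> - 1))) \<le> fps_nth (h ^ k n) l * fps_nth (h ^ k n * m) (n - l)"
        using 1 2 b c0 by (intro mult_mono) (auto intro!: fps_power_nonneg h_nonneg)
      then show ?thesis by (simp add: mult_ac)
    qed
    have card: "z * real n \<le> real (card I)"
    proof -
      \<comment> \<open>The window has length 2 z n. A run of more than z n integers starting at
        \<open>a\<close> fits into it, as 2 <= z n absorbs the rounding. With z n terms of order
        n^(\<gamma> - 2) the convolution reaches order n^(\<gamma> - 1).\<close>
      define a where "a = nat \<lceil>(u - z) * real n\<rceil> + 1"
      define w where "w = nat \<lfloor>z * real n\<rfloor>"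
      have zn: "2 \<le> z * real n" using n(2) z by (simp add: pos_divide_le_eq mult.commute)
      have uz: "0 \<le> (u - z) * real n" using z u n0 by simp
      have a: "(u - z) * real n < real a" "real a < (u - z) * real n + 2"
        using uz unfolding a_def by linarith+
      have w: "real w \<le> z * real n" "z * real n - 1 < real w" using zn unfolding w_def by linarith+
      have sub: "{a..<a + w + 1} \<subseteq> I"
      proof
        fix l assume "l \<in> {a..<a + w + 1}"
        then have "real a \<le> real l" "real l \<le> real a + real w" by auto
        then have l: "(u - z) * real n < real l" "real l < (u - z) * real n + 2 + z * real n" using a w by linarith+
        then have "real l < (u + z) * real n" using zn by (simp add: algebra_simps)
        with l have "u - z < real l / real n" "real l / real n < u + z" using n0
          by (auto simp: pos_less_divide_eq pos_divide_less_eq)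
        moreover have "u + z \<le> 1" using z(4) u(2) by (simp add: field_simps)
        then have "(u + z) * real n \<le> 1 * real n" using n0 by (intro mult_right_mono) auto
        then have "l \<le> n" using \<open>real l < (u + z) * real n\<close> by simp
        ultimately show "l \<in> I" by (auto simp: I_def abs_less_iff)
      qed
      have "real (card {a..<a + w + 1}) \<le> real (card I)" using card_mono[OF fin sub] by simp
      then show ?thesis using w by simp
    qed
    have "z * (b1 * b2 * c0) * real n powr (\<gamma> - 1) = z * real n * (b1 * b2 * c0 * real n powr (\<gamma> - 1) / real n)"
      using n0 by simp
    also have "\<dots> \<le> real (card I) * (b1 * b2 * c0 * real n powr (\<gamma> - 1) / real n)"
      using card b c0 by (intro mult_right_mono) auto
    also have "\<dots> \<le> (\<Sum>l\<in>I. fps_nth (h ^ k n) l * fps_nth (h ^ k n * m) (n - l))"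
      using summand by (rule sum_bounded_below)
    also have "\<dots> \<le> (\<Sum>l=0..n. fps_nth (h ^ k n) l * fps_nth (h ^ k n * m) (n - l))"
      by (rule sum_mono2) (auto simp: I_def intro!: mult_nonneg_nonneg fps_power_nonneg h_nonneg kernel_nonneg[OF m])
    also have "\<dots> = fps_nth (h ^ (2 * k n) * m) n"
      by (simp add: fps_mult_nth[symmetric] mult_2 power_add mult.assoc)
    finally have "real n powr (1 - \<gamma>) * (z * (b1 * b2 * c0) * real n powr (\<gamma> - 1)) \<le> real n powr (1 - \<gamma>) * fps_nth (h ^ (2 * k n) * m) n"
      by (rule mult_left_mono) simp
    moreover have "real n powr (1 - \<gamma>) * (z * (b1 * b2 * c0) * real n powr (\<gamma> - 1)) =
        z * (b1 * b2 * c0) * (real n powr (1 - \<gamma>) * real n powr (\<gamma> - 1))" by (simp only: mult_ac)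
    moreover have "real n powr (1 - \<gamma>) * real n powr (\<gamma> - 1) = 1" using n0 by (simp add: powr_add[symmetric])
    ultimately show ?thesis by simp
  qed
  have "(\<lambda>n. 2 * (real (k n) / (\<kappa> * real n powr \<alpha>))) \<longlonglongrightarrow> 2 * y" by (intro tendsto_intros k)
  then have "(\<lambda>n. real (2 * k n) / (\<kappa> * real n powr \<alpha>)) \<longlonglongrightarrow> x" by (simp add: y_def)
  then have "(\<lambda>n. real n powr (1 - \<gamma>) * fps_nth (h ^ (2 * k n) * m) n) \<longlonglongrightarrow> C * wright \<alpha> \<gamma> x"
    by (rule kernel_limit[OF m filterlim_ident])
  moreover have "\<forall>\<^sub>F n in sequentially. 2 / z \<le> real n"
    using filterlim_real_sequentially unfolding filterlim_at_top by blast
  then have "\<forall>\<^sub>F n in sequentially. z * (b1 * b2 * c0) \<le> real n powr (1 - \<gamma>) * fps_nth (h ^ (2 * k n) * m) n"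
    using eventually_ge_at_top[of i] by eventually_elim (rule low)
  ultimately have "z * (b1 * b2 * c0) \<le> C * wright \<alpha> \<gamma> x"
    by (rule tendsto_lowerbound) simp
  moreover have "0 < z * (b1 * b2 * c0)" using z b c0 by simp
  ultimately have "0 < C * wright \<alpha> \<gamma> x" by linarith
  then show ?thesis using C by (simp add: zero_less_mult_iff)
qed

text \<open>
  For \<open>p < 0\<close> the kernel bound \<^term>\<open>exp (- (e * x))\<close> is not integrable against \<open>x\<^bsup>p-1\<^esup>\<close> at 0;
  then \<open>h\<^sup>k m - m\<close> supplies a factor \<open>x\<close>, at the price of the remainder \<open>R\<close> coming from \<open>m\<close> itself.
\<close>

proposition weighted_sum_limit:
  fixes g m :: "real fps" and \<phi> :: "real \<Rightarrow> real"
  assumes m: "factor m \<gamma> C" and C: "0 < C"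
    and g0: "\<And>k. 0 \<le> fps_nth g k"
    and g: "(\<lambda>k. real k powr (1 - p) * fps_nth g k) \<longlonglongrightarrow> Cg"
    and p: "0 < p \<or> \<gamma> = 0 \<and> - 1 < p \<and> p < 0 \<and> summable (fps_nth g) \<and>
      (\<exists>\<mu> Km nm. - (\<alpha> * p) < \<mu> \<and> (\<forall>n\<ge>nm. real n * fps_nth m n \<le> Km * real n powr (- \<mu>)))"
    and \<phi>: "continuous_on {0..} \<phi>" "\<And>x. 0 \<le> x \<Longrightarrow> \<bar>\<phi> x\<bar> \<le> L * (1 + x) powr \<sigma>" "0 \<le> \<sigma>"
  shows "(\<lambda>n. real n powr (1 - \<gamma> - \<alpha> * p) * (\<Sum>k\<le>n. fps_nth g k * \<phi> (real k / (\<kappa> * real n powr \<alpha>)) * fps_nth (h ^ k * m) n))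
    \<longlonglongrightarrow> Cg * C * \<kappa> powr p * (\<integral>x. indicator {0<..} x *\<^sub>R (\<phi> x * x powr (p - 1) * wright \<alpha> \<gamma> x) \<partial>lborel)"
proof -
  define s where "s = (\<lambda>n::nat. \<kappa> * real n powr \<alpha>)"
  have s: "filterlim s at_top sequentially"
    unfolding s_def using filterlim_real_powr[OF filterlim_ident pars(1) \<alpha>(1)] by simp
  define A where "A = (\<lambda>n k. real n powr (1 - \<gamma>) * fps_nth (h ^ k * m) n)"
  have A0: "0 \<le> A n k" for n k unfolding A_def by (intro mult_nonneg_nonneg kernel_nonneg[OF m]) simp
  have Az: "A n k = 0" if "n < k" for n k
    using fps_mult_zero_power_nth[OF h_zero that] by (simp add: A_def)
  have Alim: "(\<lambda>n. A n (k n)) \<longlonglongrightarrow> C * wright \<alpha> \<gamma> x" if "(\<lambda>n. real (k n) / s n) \<longlonglongrightarrow> x" for k x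
    unfolding A_def using that by (intro kernel_limit[OF m filterlim_ident]) (simp add: s_def)
  obtain K e n0 where K: "0 \<le> K" "0 < e"
    and Ab: "\<And>n k. n0 \<le> n \<Longrightarrow> A n k \<le> K * exp (- (e * (real k / real n powr \<alpha>)))"
    using kernel_bound[OF m] unfolding A_def by metis
  have L0: "0 \<le> L" using \<phi>(2)[of 0] by simp
  have sn: "real k / real n powr \<alpha> = \<kappa> * (real k / s n)" for k n using pars by (simp add: s_def)
  have s_powr: "real n powr (- (\<alpha> * p)) = \<kappa> powr p * s n powr (- p)" if "0 < n" for n
    using that pars by (simp add: s_def powr_mult powr_powr powr_minus field_simps)
  have split: "(\<Sum>k\<le>n. f k) = f 0 + (\<Sum>k\<in>{1..n}. f k)" for f :: "nat \<Rightarrow> real" and n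
    by (simp add: atMost_atLeast0 sum.atLeast_Suc_atMost)
  have tot: "real n powr (1 - \<gamma> - \<alpha> * p) * (\<Sum>k\<le>n. fps_nth g k * \<phi> (real k / (\<kappa> * real n powr \<alpha>)) * fps_nth (h ^ k * m) n)
     = real n powr (- (\<alpha> * p)) * (\<Sum>k\<le>n. fps_nth g k * \<phi> (real k / s n) * A n k)" if "0 < n" for n
  proof -
    have "1 - \<gamma> - \<alpha> * p = - (\<alpha> * p) + (1 - \<gamma>)" by simp
    then have "real n powr (1 - \<gamma> - \<alpha> * p) = real n powr (- (\<alpha> * p)) * real n powr (1 - \<gamma>)"
      using that by (simp only: powr_add)
    then show ?thesis by (simp add: A_def s_def sum_distrib_left mult_ac)
  qed
  let ?J = "\<integral>x. indicator {0<..} x *\<^sub>R (\<phi> x * x powr (p - 1) * (C * wright \<alpha> \<gamma> x)) \<partial>lborel"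
  have "(\<lambda>n. real n powr (- (\<alpha> * p)) * (\<Sum>k\<le>n. fps_nth g k * \<phi> (real k / s n) * A n k)) \<longlonglongrightarrow> \<kappa> powr p * (Cg * ?J)"
  proof (cases "0 < p")
    case True
    have main: "(\<lambda>n. s n powr (- p) * (\<Sum>k\<in>{1..n}. fps_nth g k * \<phi> (real k / s n) * A n k)) \<longlonglongrightarrow> Cg * ?J"
    proof (rule riemann_sum_limit[OF s g, where K = K and v = 0 and e = "e * \<kappa>"])
      show "\<bar>A n k\<bar> \<le> K * (real k / s n) powr 0 * exp (- (e * \<kappa> * (real k / s n)))" if "n0 \<le> n" "1 \<le> k" for n k
      proof (cases "real k / s n = 0")
        case True
        then have "s n = 0" using that by auto
        then have "n = 0" using pars by (simp add: s_def)
        then show ?thesis using Az[of n k] that K by simp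
      next
        case False
        then show ?thesis using Ab[OF that(1), of k] A0[of n k] by (simp add: sn mult.assoc)
      qed
    qed (use Alim Az \<phi> True K pars in auto)
    \<comment> \<open>The Riemann sum starts at k = 1. The term k = 0 is bounded, so the factor n^(-
      \<alpha> p) removes it when p > 0.\<close>
    have "(\<lambda>n. real n powr (- (\<alpha> * p)) * (fps_nth g 0 * \<phi> 0 * A n 0)) \<longlonglongrightarrow> 0"
    proof (rule Lim_null_comparison)
      show "\<forall>\<^sub>F n in sequentially. norm (real n powr (- (\<alpha> * p)) * (fps_nth g 0 * \<phi> 0 * A n 0)) \<le> real n powr (- (\<alpha> * p)) * (\<bar>fps_nth g 0 * \<phi> 0\<bar> * K)"
        using eventually_ge_at_top[of n0]
      proof eventually_elim
        case (elim n)
        then show ?case using Ab[OF elim, of 0] A0[of n 0] by (simp add: abs_mult mult_left_mono)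
      qed
      have "(\<lambda>n. real n powr (- (\<alpha> * p))) \<longlonglongrightarrow> 0"
        using True \<alpha> by (intro tendsto_neg_powr filterlim_real_sequentially) simp
      from tendsto_mult[OF this tendsto_const]
      show "(\<lambda>n. real n powr (- (\<alpha> * p)) * (\<bar>fps_nth g 0 * \<phi> 0\<bar> * K)) \<longlonglongrightarrow> 0" by simp
    qed
    from tendsto_add[OF this tendsto_mult[OF tendsto_const[of "\<kappa> powr p"] main]]
    have "(\<lambda>n. real n powr (- (\<alpha> * p)) * (fps_nth g 0 * \<phi> 0 * A n 0) +
       \<kappa> powr p * (s n powr (- p) * (\<Sum>k\<in>{1..n}. fps_nth g k * \<phi> (real k / s n) * A n k))) \<longlonglongrightarrow> \<kappa> powr p * (Cg * ?J)"
      by simp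
    moreover have "\<forall>\<^sub>F n in sequentially. real n powr (- (\<alpha> * p)) * (fps_nth g 0 * \<phi> 0 * A n 0) +
       \<kappa> powr p * (s n powr (- p) * (\<Sum>k\<in>{1..n}. fps_nth g k * \<phi> (real k / s n) * A n k)) =
       real n powr (- (\<alpha> * p)) * (\<Sum>k\<le>n. fps_nth g k * \<phi> (real k / s n) * A n k)"
      using eventually_gt_at_top[of 0]
      by eventually_elim (simp add: split s_powr distrib_left)
    ultimately show ?thesis by (rule Lim_transform_eventually)
  next
    case False
    with p obtain \<mu> Km nm where \<gamma>: "\<gamma> = 0" and p': "- 1 < p" "p < 0" and sg: "summable (fps_nth g)"
      and \<mu>: "- (\<alpha> * p) < \<mu>" and m': "\<And>n. nm \<le> n \<Longrightarrow> real n * fps_nth m n \<le> Km * real n powr (- \<mu>)" by blast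
    obtain K2 n2 where K2: "0 \<le> K2"
      "\<And>n k. n2 \<le> n \<Longrightarrow> real n * fps_nth (h ^ k * m) n \<le> K2 * (real k / real n powr \<alpha>) + real n * fps_nth m n"
      using kernel_difference_bound m unfolding \<gamma> by metis
    \<comment> \<open>One constant for two regimes of x = k / n^\<alpha>. For x >= 1 the kernel
      bound exp (- e x) may be multiplied by x; for x < 1 the difference bound may be multiplied by
      exp e exp (- e x), which is at least 1.\<close>
    define K3 where "K3 = max K (max K2 \<bar>Km\<bar> * exp e)"
    have K3: "0 \<le> K3" "K \<le> K3" "max K2 \<bar>Km\<bar> * exp e \<le> K3" using K by (auto simp: K3_def)
    define n3 where "n3 = max 1 (max n0 (max n2 nm))"
    define R where "R = (\<lambda>n k. K3 * exp (- (e * (real k / real n powr \<alpha>))) * real n powr (- \<mu>))"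
    have R0: "0 \<le> R n k" for n k using K3 by (simp add: R_def)
    have A2: "A n k \<le> K3 * exp (- (e * (real k / real n powr \<alpha>))) * (real k / real n powr \<alpha>) + R n k" if n: "n3 \<le> n" for n k
    proof -
      define x where "x = real k / real n powr \<alpha>"
      have x0: "0 \<le> x" by (simp add: x_def)
      have "A n k \<le> K3 * exp (- (e * x)) * (x + real n powr (- \<mu>))"
      proof (cases "1 \<le> x")
        case True
        have "A n k \<le> K * exp (- (e * x))" using Ab[of n k] n by (simp add: n3_def x_def)
        also have "\<dots> \<le> K3 * exp (- (e * x))" using K3 by (intro mult_right_mono) auto
        also have "\<dots> = K3 * exp (- (e * x)) * 1" by simp
        also have "\<dots> \<le> K3 * exp (- (e * x)) * (x + real n powr (- \<mu>))"
          by (intro mult_left_mono) (use True K3 in \<open>auto intro: add_increasing2\<close>)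
        finally show ?thesis .
      next
        case False
        have "A n k = real n * fps_nth (h ^ k * m) n" using n by (simp add: A_def \<gamma> n3_def)
        also have "\<dots> \<le> K2 * x + Km * real n powr (- \<mu>)"
          using K2(2)[of n k] m'[of n] n by (simp add: n3_def x_def)
        also have "\<dots> \<le> max K2 \<bar>Km\<bar> * x + max K2 \<bar>Km\<bar> * real n powr (- \<mu>)"
          using x0 by (intro add_mono mult_right_mono) auto
        also have "\<dots> = max K2 \<bar>Km\<bar> * (x + real n powr (- \<mu>))" by (simp add: distrib_left)
        also have "\<dots> \<le> K3 * exp (- (e * x)) * (x + real n powr (- \<mu>))"
        proof (rule mult_right_mono)
          have "max K2 \<bar>Km\<bar> * exp (e * x) \<le> max K2 \<bar>Km\<bar> * exp e"
            using False K by (intro mult_left_mono) auto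
          then have "max K2 \<bar>Km\<bar> * exp (e * x) \<le> K3" using K3 by linarith
          then have "max K2 \<bar>Km\<bar> * exp (e * x) * exp (- (e * x)) \<le> K3 * exp (- (e * x))"
            by (intro mult_right_mono) auto
          then show "max K2 \<bar>Km\<bar> \<le> K3 * exp (- (e * x))" by (simp only: mult.assoc exp_add[symmetric]) simp
        qed (use x0 in auto)
        finally show ?thesis .
      qed
      then show ?thesis by (simp add: R_def x_def distrib_left)
    qed
    \<comment> \<open>The part of the kernel that vanishes linearly at 0: it is bounded by a
      multiple of x exp (- e x), so the Riemann sum applies with v = 1, where p + 1 > 0. What is cut
      off lies between 0 and \<open>R\<close>.\<close>
    define B where "B = (\<lambda>n k. max 0 (A n k - R n k))"
    have AB: "0 \<le> A n k - B n k" "A n k - B n k \<le> R n k" for n k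
      using A0[of n k] R0[of n k] by (auto simp: B_def)
    have Rlim: "(\<lambda>n. R n (k n)) \<longlonglongrightarrow> 0" for k
    proof (rule Lim_null_comparison)
      show "\<forall>\<^sub>F n in sequentially. norm (R n (k n)) \<le> K3 * real n powr (- \<mu>)"
        using K3 K by (intro always_eventually allI) (auto simp: R_def abs_mult intro!: mult_mono mult_left_le)
      have "0 < \<mu>" using \<mu> mult_pos_neg[OF \<alpha>(1) p'(2)] by linarith
      then have "(\<lambda>n. real n powr (- \<mu>)) \<longlonglongrightarrow> 0" by (intro tendsto_neg_powr filterlim_real_sequentially) simp
      from tendsto_mult[OF tendsto_const this] show "(\<lambda>n. K3 * real n powr (- \<mu>)) \<longlonglongrightarrow> 0" by simp
    qed
    have main: "(\<lambda>n. s n powr (- p) * (\<Sum>k\<in>{1..n}. fps_nth g k * \<phi> (real k / s n) * B n k)) \<longlonglongrightarrow> Cg * ?J"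
    proof (rule riemann_sum_limit[OF s g, where K = "K3 * \<kappa>" and v = 1 and e = "e * \<kappa>"])
      show "(\<lambda>n. B n (k n)) \<longlonglongrightarrow> C * wright \<alpha> \<gamma> x" if "0 < x" "(\<lambda>n. real (k n) / s n) \<longlonglongrightarrow> x" for x k
      proof -
        have "(\<lambda>n. B n (k n)) \<longlonglongrightarrow> max 0 (C * wright \<alpha> \<gamma> x - 0)"
          unfolding B_def by (intro tendsto_intros Alim Rlim that)
        then show ?thesis using wright_nonneg[OF m C, of x] that C by simp
      qed
      show "\<bar>B n k\<bar> \<le> K3 * \<kappa> * (real k / s n) powr 1 * exp (- (e * \<kappa> * (real k / s n)))" if "n3 \<le> n" "1 \<le> k" for n k
      proof -
        define z where "z = real k / s n"
        have z: "0 \<le> z" using pars by (simp add: s_def z_def)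
        have "A n k - R n k \<le> K3 * exp (- (e * (\<kappa> * z))) * (\<kappa> * z)"
          using A2[OF that(1), of k] unfolding sn z_def[symmetric] by linarith
        moreover have "0 \<le> K3 * exp (- (e * (\<kappa> * z))) * (\<kappa> * z)" using K3 z pars by simp
        ultimately have "\<bar>B n k\<bar> \<le> K3 * exp (- (e * (\<kappa> * z))) * (\<kappa> * z)" by (simp add: B_def)
        then show ?thesis using z unfolding z_def[symmetric] by (simp add: mult_ac)
      qed
      show "B n k = 0" if "n < k" for n k using Az[OF that] R0[of n k] by (simp add: B_def)
    qed (use \<phi> p' K pars in auto)
    obtain Q where Q: "0 < Q" "\<And>y. 0 \<le> y \<Longrightarrow> (1 + y) powr \<sigma> \<le> Q * exp (e * \<kappa> * y)"
      using powr_le_exp[of \<sigma> "e * \<kappa>"] \<phi>(3) K pars by auto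
    have rem: "(\<lambda>n. real n powr (- (\<alpha> * p)) * (\<Sum>k\<le>n. fps_nth g k * \<phi> (real k / s n) * (A n k - B n k))) \<longlonglongrightarrow> 0"
    proof (rule Lim_null_comparison)
      \<comment> \<open>The exponential in \<open>R\<close> cancels the growth of \<phi>, and the
        weights are summable, so the cut-off part totals at most n^(- \<alpha> p - \<mu>) times this
        constant; it vanishes because \<mu> > - \<alpha> p.\<close>
      define Z where "Z = L * Q * K3 * suminf (fps_nth g)"
      show "\<forall>\<^sub>F n in sequentially. norm (real n powr (- (\<alpha> * p)) * (\<Sum>k\<le>n. fps_nth g k * \<phi> (real k / s n) * (A n k - B n k)))
          \<le> real n powr (- (\<alpha> * p) - \<mu>) * Z"
        using eventually_gt_at_top[of 0]
      proof eventually_elim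
        case (elim n)
        have "\<bar>\<Sum>k\<le>n. fps_nth g k * \<phi> (real k / s n) * (A n k - B n k)\<bar> \<le> (\<Sum>k\<le>n. fps_nth g k * (L * Q * K3 * real n powr (- \<mu>)))"
        proof (intro order.trans[OF sum_abs] sum_mono)
          fix k
          have y: "0 \<le> real k / s n" using pars by (simp add: s_def)
          have "\<bar>\<phi> (real k / s n)\<bar> * \<bar>A n k - B n k\<bar> \<le> (L * (Q * exp (e * \<kappa> * (real k / s n)))) * R n k"
            using Q(2)[OF y] AB[of n k] L0 Q(1)
            by (intro mult_mono order.trans[OF \<phi>(2)[OF y]] mult_left_mono mult_nonneg_nonneg) auto
          also have "\<dots> = L * Q * K3 * real n powr (- \<mu>) * (exp (e * \<kappa> * (real k / s n)) * exp (- (e * \<kappa> * (real k / s n))))"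
            by (simp only: R_def sn mult_ac)
          also have "exp (e * \<kappa> * (real k / s n)) * exp (- (e * \<kappa> * (real k / s n))) = 1"
            by (simp add: exp_add[symmetric])
          finally show "\<bar>fps_nth g k * \<phi> (real k / s n) * (A n k - B n k)\<bar> \<le> fps_nth g k * (L * Q * K3 * real n powr (- \<mu>))"
            using g0[of k] by (simp add: abs_mult mult.assoc mult_left_mono)
        qed
        also have "\<dots> = (\<Sum>k\<le>n. fps_nth g k) * (L * Q * K3 * real n powr (- \<mu>))" by (simp only: sum_distrib_right)
        also have "\<dots> \<le> suminf (fps_nth g) * (L * Q * K3 * real n powr (- \<mu>))"
          using L0 Q K3 g0 by (intro mult_right_mono sum_le_suminf sg) auto
        finally have "real n powr (- (\<alpha> * p)) * \<bar>\<Sum>k\<le>n. fps_nth g k * \<phi> (real k / s n) * (A n k - B n k)\<bar>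
            \<le> real n powr (- (\<alpha> * p)) * (suminf (fps_nth g) * (L * Q * K3 * real n powr (- \<mu>)))"
          by (rule mult_left_mono) simp
        also have "\<dots> = (real n powr (- (\<alpha> * p)) * real n powr (- \<mu>)) * Z" by (simp only: Z_def mult_ac)
        also have "real n powr (- (\<alpha> * p)) * real n powr (- \<mu>) = real n powr (- (\<alpha> * p) - \<mu>)"
          by (simp add: powr_add[symmetric])
        finally show ?case by (simp add: abs_mult)
      qed
      have "(\<lambda>n. real n powr (- (\<mu> + \<alpha> * p))) \<longlonglongrightarrow> 0"
        using \<mu> by (intro tendsto_neg_powr filterlim_real_sequentially) simp
      moreover have "- (\<mu> + \<alpha> * p) = - (\<alpha> * p) - \<mu>" by simp
      ultimately have "(\<lambda>n. real n powr (- (\<alpha> * p) - \<mu>)) \<longlonglongrightarrow> 0" by (simp only:)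
      from tendsto_mult[OF this tendsto_const[of Z]]
      show "(\<lambda>n. real n powr (- (\<alpha> * p) - \<mu>) * Z) \<longlonglongrightarrow> 0" by simp
    qed
    from tendsto_add[OF rem tendsto_mult[OF tendsto_const[of "\<kappa> powr p"] main]]
    have "(\<lambda>n. real n powr (- (\<alpha> * p)) * (\<Sum>k\<le>n. fps_nth g k * \<phi> (real k / s n) * (A n k - B n k)) +
       \<kappa> powr p * (s n powr (- p) * (\<Sum>k\<in>{1..n}. fps_nth g k * \<phi> (real k / s n) * B n k))) \<longlonglongrightarrow> \<kappa> powr p * (Cg * ?J)"
      by simp
    moreover have "\<forall>\<^sub>F n in sequentially. real n powr (- (\<alpha> * p)) * (\<Sum>k\<le>n. fps_nth g k * \<phi> (real k / s n) * (A n k - B n k)) +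
       \<kappa> powr p * (s n powr (- p) * (\<Sum>k\<in>{1..n}. fps_nth g k * \<phi> (real k / s n) * B n k)) =
       real n powr (- (\<alpha> * p)) * (\<Sum>k\<le>n. fps_nth g k * \<phi> (real k / s n) * A n k)"
      using eventually_ge_at_top[of n3]
    proof eventually_elim
      case (elim n)
      have n: "0 < n" using elim by (simp add: n3_def)
      have "B n 0 = 0" using A2[OF elim, of 0] by (simp add: B_def)
      then have "(\<Sum>k\<in>{1..n}. fps_nth g k * \<phi> (real k / s n) * B n k) = (\<Sum>k\<le>n. fps_nth g k * \<phi> (real k / s n) * B n k)"
        by (simp add: split)
      then show ?case
        by (simp only: s_powr[OF n] mult.assoc[symmetric] distrib_left[symmetric] sum.distrib[symmetric])
          (simp add: algebra_simps)
    qed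
    ultimately show ?thesis by (rule Lim_transform_eventually)
  qed
  moreover have "?J = C * (\<integral>x. indicator {0<..} x *\<^sub>R (\<phi> x * x powr (p - 1) * wright \<alpha> \<gamma> x) \<partial>lborel)"
  proof -
    have "indicator {0<..} x *\<^sub>R (\<phi> x * x powr (p - 1) * (C * wright \<alpha> \<gamma> x)) =
        C * (indicator {0<..} x *\<^sub>R (\<phi> x * x powr (p - 1) * wright \<alpha> \<gamma> x))" for x by (simp add: mult_ac)
    then show ?thesis by (simp only: integral_mult_right_zero)
  qed
  ultimately have "(\<lambda>n. real n powr (- (\<alpha> * p)) * (\<Sum>k\<le>n. fps_nth g k * \<phi> (real k / s n) * A n k)) \<longlonglongrightarrow>
     Cg * C * \<kappa> powr p * (\<integral>x. indicator {0<..} x *\<^sub>R (\<phi> x * x powr (p - 1) * wright \<alpha> \<gamma> x) \<partial>lborel)"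
    by (simp add: mult_ac)
  then show ?thesis
    by (rule Lim_transform_eventually, intro eventually_mono[OF eventually_gt_at_top[of 0]]) (simp only: tot)
qed

end

section \<open>Mittag-Leffler laws\<close>

lemma char_eq_moment_series:
  fixes M :: "real measure"
  assumes M: "prob_space M" "sets M = sets borel" "AE x in M. 0 \<le> x"
    and int: "\<And>s. integrable M (\<lambda>x. x ^ s)"
    and sum: "summable (\<lambda>s. \<bar>t\<bar> ^ s / fact s * (\<integral>x. x ^ s \<partial>M))"
  shows "char M t = (\<Sum>s. (\<i> * of_real t) ^ s / fact s * of_real (\<integral>x. x ^ s \<partial>M))"
proof -
  interpret prob_space M by (rule M(1))
  define f where "f = (\<lambda>s x. (\<i> * of_real t) ^ s / fact s * complex_of_real (x ^ s))"
  have fi: "integrable M (f s)" for s unfolding f_def by (intro integrable_mult_right integrable_of_real int)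
  have norm_f: "norm (f s x) = \<bar>t\<bar> ^ s / fact s * \<bar>x\<bar> ^ s" for s x
    by (simp add: f_def norm_mult norm_divide norm_power)
  have exp_f: "(\<lambda>s. f s x) sums exp (\<i> * of_real (t * x))" for x
    using exp_converges[of "\<i> * of_real (t * x)"]
    by (simp add: f_def scaleR_conv_of_real power_mult_distrib field_simps)
  have "(\<integral>x. norm (f s x) \<partial>M) = \<bar>t\<bar> ^ s / fact s * (\<integral>x. x ^ s \<partial>M)" for s
  proof -
    have "(\<integral>x. norm (f s x) \<partial>M) = (\<integral>x. \<bar>t\<bar> ^ s / fact s * x ^ s \<partial>M)"
    proof (rule integral_cong_AE)
      show "AE x in M. norm (f s x) = \<bar>t\<bar> ^ s / fact s * x ^ s"
        using M(3) by eventually_elim (simp add: norm_f)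
    qed (use fi int in auto)
    then show ?thesis by (simp only: integral_mult_right_zero)
  qed
  with sum have sn: "summable (\<lambda>s. \<integral>x. norm (f s x) \<partial>M)" by simp
  have "summable (\<lambda>s. norm (f s x))" for x
  proof -
    have "summable (\<lambda>s. (\<bar>t\<bar> * \<bar>x\<bar>) ^ s / fact s)"
      using summable_exp[of "\<bar>t\<bar> * \<bar>x\<bar>"] by (simp add: field_simps)
    then show ?thesis by (simp add: norm_f power_mult_distrib)
  qed
  then have "(\<integral>x. (\<Sum>s. f s x) \<partial>M) = (\<Sum>s. \<integral>x. f s x \<partial>M)"
    by (intro integral_suminf fi sn AE_I2)
  moreover have "(\<Sum>s. f s x) = iexp (t * x)" for x using exp_f[of x] by (simp add: sums_iff)
  moreover have "(\<integral>x. f s x \<partial>M) = (\<i> * of_real t) ^ s / fact s * of_real (\<integral>x. x ^ s \<partial>M)" for s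
    unfolding f_def by (simp only: integral_mult_right_zero integral_complex_of_real)
  ultimately show ?thesis by (simp add: char_def)
qed

text \<open>Summability for every t makes the characteristic function the sum of its moment series
  on the whole line, so equal moments give equal characteristic functions and Levy's uniqueness
  theorem applies.\<close>

lemma moments_determine:
  fixes M N :: "real measure"
  assumes M: "prob_space M" "sets M = sets borel" "AE x in M. 0 \<le> x" "\<And>s. integrable M (\<lambda>x. x ^ s)"
    and N: "prob_space N" "sets N = sets borel" "AE x in N. 0 \<le> x" "\<And>s. integrable N (\<lambda>x. x ^ s)"
    and eq: "\<And>s. (\<integral>x. x ^ s \<partial>M) = (\<integral>x. x ^ s \<partial>N)"
    and sum: "\<And>t. 0 \<le> t \<Longrightarrow> summable (\<lambda>s. t ^ s / fact s * (\<integral>x. x ^ s \<partial>N))"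
  shows "M = N"
proof (rule Levy_uniqueness)
  interpret M: prob_space M by (rule M(1))
  interpret N: prob_space N by (rule N(1))
  show "real_distribution M" using M(2) sets_eq_imp_space_eq[OF M(2)] by unfold_locales auto
  show "real_distribution N" using N(2) sets_eq_imp_space_eq[OF N(2)] by unfold_locales auto
  show "char M = char N"
  proof
    fix t
    show "char M t = char N t"
      using char_eq_moment_series[OF M, of t] char_eq_moment_series[OF N, of t] sum[of "\<bar>t\<bar>"] by (simp add: eq)
  qed
qed

text \<open>Only the part of Euler's integral over [A, A + 1] is kept. As A is free, Gamma outgrows
  every geometric sequence.\<close>

lemma Gamma_lower_bound:
  fixes A y :: real
  assumes A: "1 \<le> A" and y: "1 \<le> y"
  shows "A powr (y - 1) * exp (- (A + 1)) \<le> Gamma y"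
proof -
  have G: "has_bochner_integral lborel (\<lambda>x. indicator {0<..} x *\<^sub>R (x powr (y - 1) * exp (- (1 * x)))) (Gamma y * 1 powr (- y))"
    using y by (intro has_bochner_integral_Gamma) auto
  have I: "integrable lborel (\<lambda>x. (A powr (y - 1) * exp (- (A + 1))) * indicator {A..A + 1} x)"
    by (intro integrable_mult_right integrable_real_indicator) auto
  have "(\<integral>x. (A powr (y - 1) * exp (- (A + 1))) * indicator {A..A + 1} x \<partial>lborel)
      \<le> (\<integral>x. indicator {0<..} x *\<^sub>R (x powr (y - 1) * exp (- (1 * x))) \<partial>lborel)"
  proof (rule integral_mono[OF I])
    show "integrable lborel (\<lambda>x. indicator {0<..} x *\<^sub>R (x powr (y - 1) * exp (- (1 * x))))"
      using G by (simp add: has_bochner_integral_iff)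
    show "A powr (y - 1) * exp (- (A + 1)) * indicator {A..A + 1} x
        \<le> indicator {0<..} x *\<^sub>R (x powr (y - 1) * exp (- (1 * x)))" for x :: real
      using A y by (auto simp: indicator_def intro!: mult_mono powr_mono2)
  qed
  then show ?thesis using G A by (simp add: has_bochner_integral_iff)
qed

lemma Gamma_neg:
  fixes p :: real
  assumes "- 1 < p" "p < 0"
  shows "Gamma p < 0"
proof -
  have "p \<notin> \<int>\<^sub>\<le>\<^sub>0" using assms by (auto elim!: nonpos_Ints_cases)
  then have "Gamma (p + 1) = p * Gamma p" by (rule Gamma_plus1)
  moreover have "0 < Gamma (p + 1)" using assms by (intro Gamma_real_pos) auto
  ultimately show ?thesis using assms by (simp add: zero_less_mult_iff)
qed

text \<open>The quotient Gamma(p + s)/s! obeys a recurrence with bounded factors, while 1/Gamma(q +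
  \<alpha> s) decays faster than any prescribed geometric sequence by
  \<open>Gamma_lower_bound\<close>.\<close>

lemma summable_Gamma_quotient:
  fixes p \<alpha> q t :: real
  assumes \<alpha>: "0 < \<alpha>" and t: "0 \<le> t"
  shows "summable (\<lambda>s. t ^ s / fact s * (Gamma (p + real s) * rGamma (q + \<alpha> * real s)))"
proof -
  \<comment> \<open>Chosen so that t A^(- \<alpha>) <= 1/4. The recurrence factor (p + s)/(s + 1) is
    eventually at most 2, which leaves the ratio 1/2.\<close>
  define A where "A = max 1 ((4 * t) powr (1 / \<alpha>))"
  have A: "1 \<le> A" by (simp add: A_def)
  have "4 * t \<le> A powr \<alpha>"
  proof -
    have "4 * t = ((4 * t) powr (1 / \<alpha>)) powr \<alpha>" using \<alpha> t by (simp add: powr_powr)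
    also have "\<dots> \<le> A powr \<alpha>" using \<alpha> by (intro powr_mono2) (auto simp: A_def)
    finally show ?thesis .
  qed
  define b where "b = t * A powr (- \<alpha>)"
  have b: "0 \<le> b" "b \<le> 1 / 4" using t \<open>4 * t \<le> A powr \<alpha>\<close> A by (auto simp: b_def powr_minus field_simps)
  define a where "a = (\<lambda>s. \<bar>Gamma (p + real s)\<bar> / fact s * b ^ s)"
  have "summable a"
  proof (rule summable_ratio_test)
    show "(1 / 2 :: real) < 1" by simp
    fix s assume s: "nat \<lceil>\<bar>p\<bar> + 1\<rceil> \<le> s"
    have "\<bar>p\<bar> + 1 \<le> real (nat \<lceil>\<bar>p\<bar> + 1\<rceil>)" by (rule real_nat_ceiling_ge)
    also have "\<dots> \<le> real s" using s by (simp only: of_nat_le_iff)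
    finally have "\<bar>p\<bar> + 1 \<le> real s" .
    then have ps: "0 < p + real s" "p + real s \<le> 2 * real (Suc s)"
      using abs_ge_self[of p] abs_ge_minus_self[of p] by simp_all
    have "Gamma (p + real s + 1) = (p + real s) * Gamma (p + real s)"
      using ps by (intro Gamma_plus1) (auto elim!: nonpos_Ints_cases)
    then have "a (Suc s) = (p + real s) / real (Suc s) * b * a s"
      using ps by (simp add: a_def abs_mult add_ac)
    also have "\<dots> \<le> 2 * (1 / 4) * a s"
      using ps b by (intro mult_right_mono mult_mono) (auto simp: a_def pos_divide_le_eq)
    finally show "norm (a (Suc s)) \<le> 1 / 2 * norm (a s)" using b by (simp add: a_def)
  qed
  then have "summable (\<lambda>s. A powr (1 - q) * exp (A + 1) * a s)" by (rule summable_mult)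
  then show ?thesis
  proof (rule summable_comparison_test'[where N = "nat \<lceil>(1 + \<bar>q\<bar>) / \<alpha>\<rceil>"])
    fix s assume "nat \<lceil>(1 + \<bar>q\<bar>) / \<alpha>\<rceil> \<le> s"
    then have "(1 + \<bar>q\<bar>) / \<alpha> \<le> real s" by (simp add: nat_le_iff ceiling_le_iff)
    then have "1 + \<bar>q\<bar> \<le> real s * \<alpha>" using \<alpha> by (simp add: pos_divide_le_eq)
    then have y: "1 \<le> q + \<alpha> * real s" using abs_ge_minus_self[of q] by (simp add: mult.commute)
    have G: "0 < Gamma (q + \<alpha> * real s)" using y by (intro Gamma_real_pos) auto
    have "\<bar>rGamma (q + \<alpha> * real s)\<bar> = 1 / Gamma (q + \<alpha> * real s)"
      using G by (simp add: rGamma_inverse_Gamma inverse_eq_divide)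
    also have "\<dots> \<le> 1 / (A powr (q + \<alpha> * real s - 1) * exp (- (A + 1)))"
      by (rule divide_left_mono[OF Gamma_lower_bound[OF A y]]) (use A G in simp_all)
    also have "\<dots> = A powr (1 - q) * exp (A + 1) * (A powr (- \<alpha>)) ^ s"
    proof -
      have "(A powr (- \<alpha>)) ^ s = A powr (- (\<alpha> * real s))" using A by (simp add: powr_power mult.commute)
      moreover have "A powr (1 - q) * A powr (- (\<alpha> * real s)) = 1 / A powr (q + \<alpha> * real s - 1)"
        by (simp add: powr_add[symmetric] powr_minus_divide[symmetric] algebra_simps)
      moreover have "exp (A + 1) = 1 / exp (- (A + 1))" unfolding exp_minus inverse_eq_divide by simp
      ultimately show ?thesis by (simp add: mult_ac)
    qed
    finally have r: "\<bar>rGamma (q + \<alpha> * real s)\<bar> \<le> A powr (1 - q) * exp (A + 1) * (A powr (- \<alpha>)) ^ s" .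
    have "norm (t ^ s / fact s * (Gamma (p + real s) * rGamma (q + \<alpha> * real s)))
       = t ^ s / fact s * \<bar>Gamma (p + real s)\<bar> * \<bar>rGamma (q + \<alpha> * real s)\<bar>"
      using t by (simp add: abs_mult)
    also have "\<dots> \<le> t ^ s / fact s * \<bar>Gamma (p + real s)\<bar> * (A powr (1 - q) * exp (A + 1) * (A powr (- \<alpha>)) ^ s)"
      using r t by (intro mult_left_mono) auto
    also have "\<dots> = A powr (1 - q) * exp (A + 1) * a s"
      by (simp add: a_def b_def power_mult_distrib)
    finally show "norm (t ^ s / fact s * (Gamma (p + real s) * rGamma (q + \<alpha> * real s))) \<le> A powr (1 - q) * exp (A + 1) * a s" .
  qed
qed

text \<open>For b = 0 the law is a point mass and \<open>a\<close> is unrestricted, as required by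
  negative \<beta>. Moments are taken with real exponents because B enters the product as
  B^\<alpha>.\<close>

lemma beta_law_props:
  assumes b: "b = 0 \<or> (0 < a \<and> 0 < b)"
  shows "prob_space (beta_law a b)" "sets (beta_law a b) = sets borel"
    "AE x in beta_law a b. 0 < x \<and> x \<le> 1"
    "0 \<le> v \<Longrightarrow> integrable (beta_law a b) (\<lambda>x. x powr v)"
    "0 \<le> v \<Longrightarrow> (\<integral>x. x powr v \<partial>beta_law a b) = (if b = 0 then 1 else Beta (a + v) b / Beta a b)"
proof -
  show sets: "sets (beta_law a b) = sets borel" by (simp add: beta_law_def)
  have all: "prob_space (beta_law a b) \<and> (AE x in beta_law a b. 0 < x \<and> x \<le> 1) \<and>
     (0 \<le> v \<longrightarrow> integrable (beta_law a b) (\<lambda>x. x powr v) \<and>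
      (\<integral>x. x powr v \<partial>beta_law a b) = (if b = 0 then 1 else Beta (a + v) b / Beta a b))" for v
  proof (cases "b = 0")
    case True
    have law: "beta_law a b = return borel 1" unfolding beta_law_def using True by (rule if_P)
    have P: "prob_space (return borel (1::real))" by (rule prob_space_return) simp
    then interpret R: prob_space "return borel (1::real)" .
    have ae: "AE x in return borel (1::real). 0 < x \<and> x \<le> 1" by (subst AE_return) simp_all
    have int: "integrable (return borel 1) (\<lambda>x::real. x powr v)"
    proof (rule R.integrable_const_bound[where B = 1])
      show "AE x in return borel 1. norm (x powr v) \<le> (1::real)" by (subst AE_return) simp_all
      show "(\<lambda>x. x powr v) \<in> borel_measurable (return borel (1::real))"
        by (subst measurable_cong_sets[OF sets_return refl]) measurable
    qed
    have val: "(\<integral>x. x powr v \<partial>return borel 1) = (1::real)" by (subst integral_return) simp_all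
    show ?thesis unfolding law
    proof (intro conjI impI)
      show "(\<integral>x. x powr v \<partial>return borel 1) = (if b = 0 then 1 else Beta (a + v) b / Beta a b)"
        unfolding val using True by simp
    qed (rule P ae int)+
  next
    case False
    with b have ab: "0 < a" "0 < b" by auto
    have B: "0 < Beta a b" unfolding Beta_def using ab by (intro divide_pos_pos mult_pos_pos Gamma_real_pos) auto
    define f where "f = (\<lambda>x::real. if 0 < x \<and> x < 1 then x powr (a - 1) * (1 - x) powr (b - 1) / Beta a b else 0)"
    have fm[measurable]: "f \<in> borel_measurable borel" unfolding f_def by measurable
    have f0: "0 \<le> f x" for x using B by (simp add: f_def)
    have law: "beta_law a b = density lborel (\<lambda>x. ennreal (f x))" using False by (simp add: beta_law_def f_def)
    have mom: "has_bochner_integral lborel (\<lambda>x. f x * x powr v) (Beta (a + v) b / Beta a b)" if v: "0 \<le> v" for v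
    proof -
      let ?g = "\<lambda>x::real. x powr (a + v - 1) * (1 - x) powr (b - 1)"
      have i: "set_integrable lborel {0..1} ?g" using integrable_Beta[of "a + v" b] ab v by simp
      have "(?g has_integral Beta (a + v) b) {0..1}" using has_integral_Beta_real[of "a + v" b] ab v by simp
      then have "(LINT x:{0..1}|lborel. ?g x) = Beta (a + v) b"
        using set_borel_integral_eq_integral(2)[OF i] by (simp add: integral_unique)
      with i have h: "has_bochner_integral lborel (\<lambda>x. indicator {0..1} x *\<^sub>R ?g x / Beta a b) (Beta (a + v) b / Beta a b)"
        unfolding set_integrable_def set_lebesgue_integral_def
        by (intro has_bochner_integral_divide) (simp add: has_bochner_integral_iff)
      have "AE x in lborel. indicator {0..1} x *\<^sub>R ?g x / Beta a b = f x * x powr v"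
      proof (rule AE_I'[of "{0, 1}"])
        show "{0, 1} \<in> null_sets (lborel :: real measure)" by (intro finite_imp_null_set_lborel) auto
        show "{x \<in> space lborel. indicator {0..1} x *\<^sub>R ?g x / Beta a b \<noteq> f x * x powr v} \<subseteq> {0, 1}"
        proof
          fix x :: real assume "x \<in> {x \<in> space lborel. indicator {0..1} x *\<^sub>R ?g x / Beta a b \<noteq> f x * x powr v}"
          moreover have "x powr (a + v - 1) = x powr (a - 1) * x powr v" by (simp add: powr_add[symmetric] algebra_simps)
          ultimately show "x \<in> {0, 1}" by (auto simp: f_def indicator_def split: if_splits)
        qed
      qed
      then show ?thesis using h
        by (subst (asm) has_bochner_integral_cong_AE[where g = "\<lambda>x. f x * x powr v"]) auto
    qed
    have one: "has_bochner_integral lborel f 1"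
    proof -
      have "(\<lambda>x. f x * x powr 0) = f" by (rule ext) (simp add: f_def)
      then show ?thesis using mom[of 0] B by (simp only: add_0_right) simp
    qed
    have "prob_space (beta_law a b)"
    proof (rule prob_spaceI)
      have "emeasure (beta_law a b) (space (beta_law a b)) = (\<integral>\<^sup>+x. ennreal (f x) \<partial>lborel)"
        unfolding law by (subst emeasure_density) auto
      also have "\<dots> = ennreal (\<integral>x. f x \<partial>lborel)"
        using one f0 by (intro nn_integral_eq_integral) (auto simp: has_bochner_integral_iff)
      finally show "emeasure (beta_law a b) (space (beta_law a b)) = 1" using one by (simp add: has_bochner_integral_iff)
    qed
    moreover have "AE x in beta_law a b. 0 < x \<and> x \<le> 1"
      unfolding law by (subst AE_density) (auto simp: f_def)
    moreover have "integrable (beta_law a b) (\<lambda>x. x powr v)" if "0 \<le> v"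
      unfolding law using mom[OF that] f0 by (subst integrable_density) (auto simp: has_bochner_integral_iff)
    moreover have "(\<integral>x. x powr v \<partial>beta_law a b) = Beta (a + v) b / Beta a b" if "0 \<le> v"
      unfolding law using mom[OF that] f0 by (subst integral_density) (auto simp: has_bochner_integral_iff)
    ultimately show ?thesis using False by simp
  qed
  show "prob_space (beta_law a b)" "AE x in beta_law a b. 0 < x \<and> x \<le> 1" using all[of 0] by auto
  show "0 \<le> v \<Longrightarrow> integrable (beta_law a b) (\<lambda>x. x powr v)"
    "0 \<le> v \<Longrightarrow> (\<integral>x. x powr v \<partial>beta_law a b) = (if b = 0 then 1 else Beta (a + v) b / Beta a b)"
    using all[of v] by auto
qed

section \<open>The Wright density and its law\<close>

context hankel_alpha
begin

text \<open>The three-parameter Mittag-Leffler density with \<beta> = \<alpha> p, so that p stands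
  for \<beta>/\<alpha>; the constant normalises it through \<open>wright_moment\<close>.\<close>

definition wdens :: "real \<Rightarrow> real \<Rightarrow> real \<Rightarrow> real" where
  "wdens \<gamma> p x = (if 0 < x then Gamma (\<alpha> * p + \<gamma>) / Gamma p * (x powr (p - 1) * wright \<alpha> \<gamma> x) else 0)"

lemma ml3_density_sums:
  assumes "0 < x"
  shows "ml3_density_term \<alpha> (\<alpha> * p) \<gamma> x sums (x powr (p - 1) * wright \<alpha> \<gamma> x)"
proof -
  have "ml3_density_term \<alpha> (\<alpha> * p) \<gamma> x j = x powr (p - 1) * ((- 1) ^ j / fact j * rGamma (\<gamma> - real j * \<alpha>) * x ^ j)" for j
  proof -
    have "\<alpha> * p / \<alpha> + real j - 1 = (p - 1) + real j" using \<alpha> by simp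
    then have "x powr (\<alpha> * p / \<alpha> + real j - 1) = x powr (p - 1) * x ^ j"
      using assms by (simp only: powr_add powr_realpow)
    then show ?thesis by (simp add: ml3_density_term_def)
  qed
  then have "ml3_density_term \<alpha> (\<alpha> * p) \<gamma> x = (\<lambda>j. x powr (p - 1) * ((- 1) ^ j / fact j * rGamma (\<gamma> - real j * \<alpha>) * x ^ j))"
    by blast
  then show ?thesis by (simp only:) (intro sums_mult wright_sums)
qed

lemma ml3_density_wdens:
  assumes "0 < x"
  shows "ml3_density \<alpha> (\<alpha> * p) \<gamma> x = wdens \<gamma> p x"
  using ml3_density_sums[OF assms, of p \<gamma>] assms \<alpha> by (simp add: ml3_density_def wdens_def sums_iff)

end

text \<open>Nonnegativity is an assumption here because its proof comes from outside: it is
  inherited from coefficients through \<open>wright_nonneg\<close>. The alternatives for p are the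
  two pure cases, with p = - \<lambda>_G.\<close>

locale wright_law = hankel_alpha +
  fixes \<gamma> p :: real
  assumes p: "0 < p \<and> 0 \<le> \<gamma> \<or> \<gamma> = 0 \<and> - 1 < p \<and> p < 0"
    and nonneg: "\<And>x. 0 \<le> x \<Longrightarrow> 0 \<le> wright \<alpha> \<gamma> x"
begin

text \<open>For negative p both p and \<alpha> p lie in (-1, 0), where Gamma is negative, so the
  quotient is still positive.\<close>

lemma wdens_const_pos: "0 < Gamma (\<alpha> * p + \<gamma>) / Gamma p"
proof (cases "0 < p")
  case True
  then have "0 < \<alpha> * p + \<gamma>" using p \<alpha> by (intro add_pos_nonneg) auto
  then show ?thesis using True by (intro divide_pos_pos Gamma_real_pos)
next
  case False
  with p have "\<gamma> = 0" "- 1 < p" "p < 0" by auto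
  moreover from this have "\<alpha> * p < 0" "- 1 < \<alpha> * p" using \<alpha> mult_pos_neg[of \<alpha> p] mult_strict_mono[of \<alpha> 1 "- p" 1] by auto
  ultimately show ?thesis using Gamma_neg[of p] Gamma_neg[of "\<alpha> * p"] by (simp add: divide_neg_neg)
qed

lemma wdens_nonneg: "0 \<le> wdens \<gamma> p x"
proof (cases "0 < x")
  case True
  then have "0 \<le> wright \<alpha> \<gamma> x" by (intro nonneg) simp
  then show ?thesis using True unfolding wdens_def
    by (simp only: if_True) (intro mult_nonneg_nonneg less_imp_le[OF wdens_const_pos] powr_ge_zero)
qed (simp add: wdens_def)

lemma wdens_measurable [measurable]: "wdens \<gamma> p \<in> borel_measurable borel"
proof -
  have "integrable lborel (\<lambda>x. indicator {0<..} x *\<^sub>R (x powr (p - 1) * wright \<alpha> \<gamma> x))"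
    using wright_moment[of p \<gamma>] p by (auto simp: has_bochner_integral_iff)
  then have "(\<lambda>x. Gamma (\<alpha> * p + \<gamma>) / Gamma p * (indicator {0<..} x *\<^sub>R (x powr (p - 1) * wright \<alpha> \<gamma> x))) \<in> borel_measurable lborel"
    by (intro borel_measurable_times borel_measurable_const borel_measurable_integrable)
  moreover have "(\<lambda>x. Gamma (\<alpha> * p + \<gamma>) / Gamma p * (indicator {0<..} x *\<^sub>R (x powr (p - 1) * wright \<alpha> \<gamma> x))) = wdens \<gamma> p"
    by (rule ext) (simp add: wdens_def indicator_def)
  ultimately have "wdens \<gamma> p \<in> borel_measurable lborel" by (simp only:)
  then show ?thesis by simp
qed

lemma wdens_moment:
  "has_bochner_integral lborel (\<lambda>x. wdens \<gamma> p x * x ^ s)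
    (Gamma (\<alpha> * p + \<gamma>) / Gamma p * (Gamma (p + real s) * rGamma ((\<gamma> + \<alpha> * p) + \<alpha> * real s)))"
proof -
  have "has_bochner_integral lborel (\<lambda>x. Gamma (\<alpha> * p + \<gamma>) / Gamma p * (indicator {0<..} x *\<^sub>R (x powr (p + real s - 1) * wright \<alpha> \<gamma> x)))
    (Gamma (\<alpha> * p + \<gamma>) / Gamma p * (Gamma (p + real s) * rGamma (\<gamma> + \<alpha> * (p + real s))))"
  proof (intro has_bochner_integral_mult_right wright_moment)
    show "0 < p + real s \<or> \<gamma> = 0 \<and> - 1 < p + real s \<and> p + real s < 0"
      using p by (cases s) auto
  qed
  moreover have "Gamma (\<alpha> * p + \<gamma>) / Gamma p * (indicator {0<..} x *\<^sub>R (x powr (p + real s - 1) * wright \<alpha> \<gamma> x)) = wdens \<gamma> p x * x ^ s" for x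
  proof (cases "0 < x")
    case True
    have "p + real s - 1 = (p - 1) + real s" by simp
    then have "x powr (p + real s - 1) = x powr (p - 1) * x ^ s" using True by (simp only: powr_add powr_realpow)
    then show ?thesis using True by (simp add: wdens_def)
  qed (simp add: wdens_def)
  moreover have "\<gamma> + \<alpha> * (p + real s) = (\<gamma> + \<alpha> * p) + \<alpha> * real s" by (simp add: algebra_simps)
  ultimately show ?thesis by (simp only:)
qed

definition "wlaw = density lborel (\<lambda>x. ennreal (wdens \<gamma> p x))"

lemma wlaw_moment:
  "integrable wlaw (\<lambda>x. x ^ s)"
  "(\<integral>x. x ^ s \<partial>wlaw) = Gamma (\<alpha> * p + \<gamma>) / Gamma p * (Gamma (p + real s) * rGamma ((\<gamma> + \<alpha> * p) + \<alpha> * real s))"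
proof -
  show "integrable wlaw (\<lambda>x. x ^ s)" unfolding wlaw_def
    using wdens_moment[of s] wdens_nonneg by (subst integrable_density) (auto simp: has_bochner_integral_iff)
  show "(\<integral>x. x ^ s \<partial>wlaw) = Gamma (\<alpha> * p + \<gamma>) / Gamma p * (Gamma (p + real s) * rGamma ((\<gamma> + \<alpha> * p) + \<alpha> * real s))"
    unfolding wlaw_def
    using wdens_moment[of s] wdens_nonneg by (subst integral_density) (auto simp: has_bochner_integral_iff)
qed

lemma wlaw_props: "prob_space wlaw" "sets wlaw = sets borel" "AE x in wlaw. 0 < x"
proof -
  show "sets wlaw = sets borel" by (simp add: wlaw_def)
  have i: "integrable lborel (wdens \<gamma> p)" using wdens_moment[of 0] by (simp add: has_bochner_integral_iff)
  have "(\<integral>x. wdens \<gamma> p x \<partial>lborel) = Gamma (\<alpha> * p + \<gamma>) / Gamma p * (Gamma p * rGamma (\<alpha> * p + \<gamma>))"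
    using wdens_moment[of 0] by (simp add: has_bochner_integral_iff add.commute)
  also have "\<dots> = 1"
    using wdens_const_pos by (auto simp: rGamma_inverse_Gamma field_simps)
  finally have 1: "(\<integral>x. wdens \<gamma> p x \<partial>lborel) = 1" .
  show "prob_space wlaw"
  proof (rule prob_spaceI)
    have "emeasure wlaw (space wlaw) = (\<integral>\<^sup>+x. ennreal (wdens \<gamma> p x) \<partial>lborel)"
      unfolding wlaw_def by (subst emeasure_density) auto
    also have "\<dots> = ennreal (\<integral>x. wdens \<gamma> p x \<partial>lborel)"
      using i wdens_nonneg by (intro nn_integral_eq_integral) auto
    finally show "emeasure wlaw (space wlaw) = 1" using 1 by simp
  qed
  show "AE x in wlaw. 0 < x" unfolding wlaw_def by (subst AE_density) (auto simp: wdens_def)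
qed

text \<open>The computed moments are Gamma(\<alpha> p) Gamma(p + s) / (Gamma(p) Gamma(\<alpha> p +
  \<alpha> s)). The defining formula has every argument raised by 1; the factors p, p + s, \<alpha>
  p and \<alpha> (p + s) that this produces cancel.\<close>

lemma wlaw_mittag_leffler2:
  assumes "\<gamma> = 0"
  shows "mittag_leffler2 \<alpha> (\<alpha> * p) wlaw"
  unfolding mittag_leffler2_def
proof (intro conjI allI wlaw_props wlaw_moment(1))
  fix s :: nat
  have np: "p + real s \<notin> \<int>\<^sub>\<le>\<^sub>0" "\<alpha> * p \<notin> \<int>\<^sub>\<le>\<^sub>0" "p \<notin> \<int>\<^sub>\<le>\<^sub>0"
  proof -
    have x: "x \<notin> \<int>\<^sub>\<le>\<^sub>0" if "0 < x \<or> - 1 < x \<and> x < 0" for x :: real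
      using that by (auto elim!: nonpos_Ints_cases)
    show "p \<notin> \<int>\<^sub>\<le>\<^sub>0" using p by (intro x) auto
    show "p + real s \<notin> \<int>\<^sub>\<le>\<^sub>0" using p by (intro x) (cases s; auto)
    show "\<alpha> * p \<notin> \<int>\<^sub>\<le>\<^sub>0"
    proof (intro x, cases "0 < p")
      case False
      then have "p < 0" "- 1 < p" using p by auto
      then show "0 < \<alpha> * p \<or> - 1 < \<alpha> * p \<and> \<alpha> * p < 0"
        using \<alpha> mult_pos_neg[of \<alpha> p] mult_strict_mono[of \<alpha> 1 "- p" 1] by auto
    qed (use \<alpha> in auto)
  qed
  have G: "Gamma (p + real s + 1) = (p + real s) * Gamma (p + real s)"
    "Gamma (\<alpha> * p + 1) = \<alpha> * p * Gamma (\<alpha> * p)" "Gamma (p + 1) = p * Gamma p"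
    by (rule Gamma_plus1, rule np)+
  have R: "rGamma (\<alpha> * p + \<alpha> * real s) = \<alpha> * (p + real s) * inverse (Gamma (\<alpha> * p + \<alpha> * real s + 1))"
    using rGamma_plus1[of "\<alpha> * p + \<alpha> * real s"] by (simp add: distrib_left rGamma_inverse_Gamma)
  have e: "real s + \<alpha> * p / \<alpha> + 1 = p + real s + 1" "\<alpha> * p / \<alpha> + 1 = p + 1"
    "\<alpha> * real s + \<alpha> * p + 1 = \<alpha> * p + \<alpha> * real s + 1" using \<alpha> by simp_all
  have p0: "p \<noteq> 0" using p by auto
  have M: "(\<integral>y. y ^ s \<partial>wlaw) = Gamma (\<alpha> * p + \<gamma>) / Gamma p * (Gamma (p + real s) * rGamma (\<gamma> + \<alpha> * p + \<alpha> * real s))"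
    using wlaw_moment(2)[of s] by simp
  show "(\<integral>y. y ^ s \<partial>wlaw) = Gamma (real s + \<alpha> * p / \<alpha> + 1) * Gamma (\<alpha> * p + 1) /
      (Gamma (\<alpha> * real s + \<alpha> * p + 1) * Gamma (\<alpha> * p / \<alpha> + 1))"
    using p0 \<alpha> unfolding M unfolding e G assms add_0_left add_0_right R by (simp add: divide_inverse)
qed

text \<open>For Y the law with the same p and \<gamma> = 0 is taken. The Beta moments of B^\<alpha>
  cancel Gamma(\<alpha> p + \<alpha> s) and replace it by Gamma(\<alpha> p + \<alpha> s + \<gamma>),
  so Y B^\<alpha> has the moments of \<open>wlaw\<close>, which determine it.\<close>

lemma wlaw_mittag_leffler3:
  assumes nonneg0: "\<And>x. 0 \<le> x \<Longrightarrow> 0 \<le> wright \<alpha> 0 x"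
  shows "mittag_leffler3 \<alpha> (\<alpha> * p) \<gamma> (wlaw)"
proof -
  interpret WY: wright_law \<epsilon> T S r \<alpha> \<delta> 0 p using p nonneg0 by unfold_locales auto
  define Y where "Y = WY.wlaw"
  define Z where "Z = beta_law (\<alpha> * p) \<gamma>"
  have \<beta>: "\<gamma> = 0 \<or> 0 < \<alpha> * p \<and> 0 < \<gamma>" using p \<alpha> by (cases "\<gamma> = 0") auto
  note wY = WY.wlaw_props[folded Y_def] WY.wlaw_moment[folded Y_def]
  note wX = wlaw_props wlaw_moment
  note bZ = beta_law_props[OF \<beta>, folded Z_def]
  interpret Y: prob_space Y by (rule wY(1))
  interpret Z: prob_space Z by (rule bZ(1))
  interpret YZ: pair_prob_space Y Z ..
  have [measurable_cong]: "sets Y = sets borel" "sets Z = sets borel" by (simp_all only: wY(2) bZ(2))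
  define X where "X = distr (Y \<Otimes>\<^sub>M Z) borel (\<lambda>(y, b). y * b powr \<alpha>)"
  have meas[measurable]: "(\<lambda>(y, b). y * b powr \<alpha>) \<in> borel_measurable (Y \<Otimes>\<^sub>M Z)" by measurable
  have Zmom: "integrable Z (\<lambda>b. (b powr \<alpha>) ^ s)"
    "(\<integral>b. (b powr \<alpha>) ^ s \<partial>Z) = (if \<gamma> = 0 then 1 else Beta (\<alpha> * p + \<alpha> * real s) \<gamma> / Beta (\<alpha> * p) \<gamma>)" for s
  proof -
    have ae: "AE b in Z. b powr (\<alpha> * real s) = (b powr \<alpha>) ^ s"
      using bZ(3) by eventually_elim (simp add: powr_power mult.commute)
    have s: "0 \<le> \<alpha> * real s" using \<alpha> by simp
    show "integrable Z (\<lambda>b. (b powr \<alpha>) ^ s)"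
      by (rule integrable_cong_AE_imp[OF bZ(4)[OF s]]) (use ae in \<open>auto elim: AE_mp\<close>)
    have "(\<integral>b. (b powr \<alpha>) ^ s \<partial>Z) = (\<integral>b. b powr (\<alpha> * real s) \<partial>Z)"
      by (rule integral_cong_AE) (use ae in \<open>auto elim: AE_mp\<close>)
    then show "(\<integral>b. (b powr \<alpha>) ^ s \<partial>Z) = (if \<gamma> = 0 then 1 else Beta (\<alpha> * p + \<alpha> * real s) \<gamma> / Beta (\<alpha> * p) \<gamma>)"
      using bZ(5)[OF s] by simp
  qed
  have pair_int: "integrable (Y \<Otimes>\<^sub>M Z) (\<lambda>(y, b). (y * b powr \<alpha>) ^ s)"
    and pair_val: "(\<integral>z. (case z of (y, b) \<Rightarrow> (y * b powr \<alpha>) ^ s) \<partial>(Y \<Otimes>\<^sub>M Z)) = (\<integral>y. y ^ s \<partial>Y) * (\<integral>b. (b powr \<alpha>) ^ s \<partial>Z)" for s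
  proof -
    show i: "integrable (Y \<Otimes>\<^sub>M Z) (\<lambda>(y, b). (y * b powr \<alpha>) ^ s)"
    proof (rule YZ.Fubini_integrable)
      show "(\<lambda>(y, b). (y * b powr \<alpha>) ^ s) \<in> borel_measurable (Y \<Otimes>\<^sub>M Z)" by measurable
      have "(\<integral>b. norm ((y * b powr \<alpha>) ^ s) \<partial>Z) = \<bar>y ^ s\<bar> * (\<integral>b. (b powr \<alpha>) ^ s \<partial>Z)" for y
        by (simp add: power_mult_distrib abs_mult power_abs)
      then show "integrable Y (\<lambda>y. \<integral>b. norm (case (y, b) of (y, b) \<Rightarrow> (y * b powr \<alpha>) ^ s) \<partial>Z)"
        using wY(4)[of s] by simp
      show "AE y in Y. integrable Z (\<lambda>b. case (y, b) of (y, b) \<Rightarrow> (y * b powr \<alpha>) ^ s)"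
        using Zmom(1)[of s] by (auto simp: power_mult_distrib)
    qed
    have "(\<integral>z. (case z of (y, b) \<Rightarrow> (y * b powr \<alpha>) ^ s) \<partial>(Y \<Otimes>\<^sub>M Z)) = (\<integral>y. (\<integral>b. (y * b powr \<alpha>) ^ s \<partial>Z) \<partial>Y)"
      using YZ.integral_fst'[OF i] by simp
    then show "(\<integral>z. (case z of (y, b) \<Rightarrow> (y * b powr \<alpha>) ^ s) \<partial>(Y \<Otimes>\<^sub>M Z)) = (\<integral>y. y ^ s \<partial>Y) * (\<integral>b. (b powr \<alpha>) ^ s \<partial>Z)"
      by (simp add: power_mult_distrib)
  qed
  have case_pow: "(case z of (y, b) \<Rightarrow> y * b powr \<alpha>) ^ s = (case z of (y, b) \<Rightarrow> (y * b powr \<alpha>) ^ s)" for z :: "real \<times> real" and s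
    by (simp add: case_prod_beta)
  have "X = wlaw"
  proof (rule moments_determine)
    show "prob_space X" unfolding X_def by (rule YZ.prob_space_distr[OF meas])
    show "sets X = sets borel" by (simp add: X_def)
    show "prob_space wlaw" by (rule wX(1))
    show "sets wlaw = sets borel" by (rule wX(2))
    show "AE x in wlaw. 0 \<le> x" using wX(3) by eventually_elim simp
    have "AE y in Y. AE b in Z. 0 \<le> (case (y, b) of (y, b) \<Rightarrow> y * b powr \<alpha>)"
      using wY(3) by eventually_elim auto
    then have "AE z in Y \<Otimes>\<^sub>M Z. 0 \<le> (case z of (y, b) \<Rightarrow> y * b powr \<alpha>)"
    proof (intro YZ.AE_pair_measure)
      have "{z \<in> space (Y \<Otimes>\<^sub>M Z). 0 \<le> (case z of (y, b) \<Rightarrow> y * b powr \<alpha>)} =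
          (\<lambda>(y, b). y * b powr \<alpha>) -` {0..} \<inter> space (Y \<Otimes>\<^sub>M Z)"
        unfolding vimage_def atLeast_iff mem_Collect_eq by blast
      also have "\<dots> \<in> sets (Y \<Otimes>\<^sub>M Z)" by (rule measurable_sets[OF meas]) simp
      finally show "{z \<in> space (Y \<Otimes>\<^sub>M Z). 0 \<le> (case z of (y, b) \<Rightarrow> y * b powr \<alpha>)} \<in> sets (Y \<Otimes>\<^sub>M Z)" .
    qed
    then show "AE x in X. 0 \<le> x" unfolding X_def by (subst AE_distr_iff[OF meas]) auto
    fix s :: nat
    show "integrable X (\<lambda>x. x ^ s)" unfolding X_def
      using pair_int[of s] by (subst integrable_distr_eq[OF meas]) (auto simp: case_pow)
    show "integrable (wlaw) (\<lambda>x. x ^ s)" by (rule wX)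
    have "(\<integral>x. x ^ s \<partial>X) = (\<integral>y. y ^ s \<partial>Y) * (\<integral>b. (b powr \<alpha>) ^ s \<partial>Z)"
      unfolding X_def using pair_val[of s] by (subst integral_distr[OF meas]) (auto simp: case_pow)
    also have "\<dots> = (\<integral>x. x ^ s \<partial>wlaw)"
    proof (cases "\<gamma> = 0")
      case False
      with \<beta> have pos: "0 < \<alpha> * p" "0 < \<gamma>" by auto
      have s: "0 \<le> \<alpha> * real s" using \<alpha> by simp
      have G: "0 < Gamma (\<alpha> * p)" "0 < Gamma \<gamma>" "0 < Gamma (\<alpha> * p + \<alpha> * real s)"
        "0 < Gamma (\<alpha> * p + \<alpha> * real s + \<gamma>)" "0 < Gamma (\<alpha> * p + \<gamma>)"
        using pos s by (auto intro!: Gamma_real_pos add_pos_nonneg)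
      have "\<gamma> + \<alpha> * p + \<alpha> * real s = \<alpha> * p + \<alpha> * real s + \<gamma>" by simp
      then show ?thesis unfolding wY(5) wX(5) Zmom(2) using False G
        by (simp only: if_False Beta_def rGamma_inverse_Gamma inverse_eq_divide add_0_left add_0_right) simp
    next
      case True
      show ?thesis unfolding wY(5) wX(5) Zmom(2) unfolding True by simp
    qed
    finally show "(\<integral>x. x ^ s \<partial>X) = (\<integral>x. x ^ s \<partial>wlaw)" .
  next
    fix t :: real assume t: "0 \<le> t"
    have "summable (\<lambda>s. Gamma (\<alpha> * p + \<gamma>) / Gamma p * (t ^ s / fact s * (Gamma (p + real s) * rGamma ((\<gamma> + \<alpha> * p) + \<alpha> * real s))))"
      by (intro summable_mult summable_Gamma_quotient \<alpha> t)
    then show "summable (\<lambda>s. t ^ s / fact s * (\<integral>x. x ^ s \<partial>wlaw))"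
      unfolding wX(5) by (simp add: mult_ac)
  qed
  moreover have "mittag_leffler2 \<alpha> (\<alpha> * p) Y"
    unfolding Y_def by (rule WY.wlaw_mittag_leffler2) simp
  ultimately show ?thesis unfolding mittag_leffler3_def X_def Z_def by (intro exI[of _ Y]) simp
qed

lemma wlaw_distributed:
  shows "distributed wlaw lborel (\<lambda>x. x) (\<lambda>x. ennreal (if 0 < x then ml3_density \<alpha> (\<alpha> * p) \<gamma> x else 0))"
proof -
  have eq: "(if 0 < x then ml3_density \<alpha> (\<alpha> * p) \<gamma> x else 0) = wdens \<gamma> p x" for x
    using ml3_density_wdens[of x p \<gamma>] by (simp add: wdens_def)
  have m: "(\<lambda>x. ennreal (wdens \<gamma> p x)) \<in> borel_measurable lborel" using wdens_measurable by simp
  have "distr wlaw lborel (\<lambda>x. x) = wlaw"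
    by (rule distr_id2) (simp add: wlaw_props(2))
  then show ?thesis unfolding distributed_def eq using m wlaw_props(2)
    by (auto simp: measurable_def wlaw_def)
qed

end

section \<open>Limit theorems for a normalised scheme\<close>

locale composition_limit = large_powers +
  fixes g m :: "real fps" and \<gamma> p C Cg :: real and core :: "nat \<Rightarrow> nat pmf"
  assumes m: "factor m \<gamma> C" and C: "0 < C"
    and g_nonneg: "0 \<le> fps_nth g k"
    and g_lim: "(\<lambda>k. real k powr (1 - p) * fps_nth g k) \<longlonglongrightarrow> Cg" and Cg: "0 < Cg"
    and p: "0 < p \<and> 0 \<le> \<gamma> \<or> \<gamma> = 0 \<and> - 1 < p \<and> p < 0"
    and p_neg: "p < 0 \<Longrightarrow> summable (fps_nth g) \<and>
      (\<exists>\<mu> Km nm. - (\<alpha> * p) < \<mu> \<and> (\<forall>n\<ge>nm. real n * fps_nth m n \<le> Km * real n powr (- \<mu>)))"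
    and core: "\<And>n k. (\<Sum>k\<le>n. fps_nth g k * fps_nth (h ^ k * m) n) \<noteq> 0 \<Longrightarrow>
      pmf (core n) k = fps_nth g k * fps_nth (h ^ k * m) n / (\<Sum>k\<le>n. fps_nth g k * fps_nth (h ^ k * m) n)"
begin

sublocale wright_law \<epsilon> T S r \<alpha> \<delta> \<gamma> p
  using p wright_nonneg[OF m C] by unfold_locales auto

lemma wright_0_nonneg: "0 \<le> x \<Longrightarrow> 0 \<le> wright \<alpha> 0 x" by (rule wright_nonneg[OF factor_one]) auto

definition total :: "nat \<Rightarrow> real" where
  "total n = (\<Sum>k\<le>n. fps_nth g k * fps_nth (h ^ k * m) n)"

text \<open>The integral of x^(p-1) times the Wright function over (0, \<infinity>); for p < 0 it is
  a product of two negative numbers.\<close>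

definition mass :: real where
  "mass = Gamma p * rGamma (\<gamma> + \<alpha> * p)"

lemma mass: "0 < mass" "1 / mass = Gamma (\<alpha> * p + \<gamma>) / Gamma p"
proof -
  have c: "0 < Gamma (\<alpha> * p + \<gamma>) / Gamma p" by (rule wdens_const_pos)
  show eq: "1 / mass = Gamma (\<alpha> * p + \<gamma>) / Gamma p"
    by (simp add: mass_def rGamma_inverse_Gamma add.commute divide_inverse)
  show "0 < mass" using c unfolding eq[symmetric] by simp
qed

text \<open>The decay assumption \<open>p_neg\<close> enters here. For \<gamma> = 0 the weighted
  sums are of order n^(\<alpha> p - 1), and the coefficients of m alone must be of smaller order to
  be negligible.\<close>

lemma weighted_limit:
  assumes "continuous_on {0..} \<phi>" "\<And>x. 0 \<le> x \<Longrightarrow> \<bar>\<phi> x\<bar> \<le> L * (1 + x) powr \<sigma>" "0 \<le> \<sigma>"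
  shows "(\<lambda>n. real n powr (1 - \<gamma> - \<alpha> * p) * (\<Sum>k\<le>n. fps_nth g k * \<phi> (real k / (\<kappa> * real n powr \<alpha>)) * fps_nth (h ^ k * m) n))
    \<longlonglongrightarrow> Cg * C * \<kappa> powr p * (\<integral>x. indicator {0<..} x *\<^sub>R (\<phi> x * x powr (p - 1) * wright \<alpha> \<gamma> x) \<partial>lborel)"
proof (rule weighted_sum_limit[OF m C g_nonneg g_lim _ assms])
  show "0 < p \<or> \<gamma> = 0 \<and> - 1 < p \<and> p < 0 \<and> summable (fps_nth g) \<and>
      (\<exists>\<mu> Km nm. - (\<alpha> * p) < \<mu> \<and> (\<forall>n\<ge>nm. real n * fps_nth m n \<le> Km * real n powr (- \<mu>)))"
    using p p_neg by auto
qed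

lemma total_limit: "(\<lambda>n. real n powr (1 - \<gamma> - \<alpha> * p) * total n) \<longlonglongrightarrow> Cg * C * \<kappa> powr p * mass"
proof -
  have "(\<integral>x. indicator {0<..} x *\<^sub>R (1 * x powr (p - 1) * wright \<alpha> \<gamma> x) \<partial>lborel) = mass"
    using wright_moment[of p \<gamma>] p unfolding mass_def by (auto simp: has_bochner_integral_iff)
  then show ?thesis
    using weighted_limit[of "\<lambda>_. 1" 1 0] by (simp add: total_def)
qed

lemma const_pos: "0 < Cg * C * \<kappa> powr p * mass" using Cg C pars mass by simp

lemma total_nonzero: "\<forall>\<^sub>F n in sequentially. total n \<noteq> 0"
  using order_tendstoD(1)[OF total_limit const_pos] by eventually_elim auto

lemma pmf_core: "total n \<noteq> 0 \<Longrightarrow> pmf (core n) k = fps_nth g k * fps_nth (h ^ k * m) n / total n"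
  using core by (simp add: total_def)

text \<open>Numerator and denominator have the same order and the same constant Cg C \<kappa>^p, so
  only the normalised integral survives. Polynomial growth of the test function covers bounded
  continuous functions and powers alike, hence weak convergence and all moments.\<close>

lemma expectation_limit:
  assumes "continuous_on {0..} \<phi>" "\<And>x. 0 \<le> x \<Longrightarrow> \<bar>\<phi> x\<bar> \<le> L * (1 + x) powr \<sigma>" "0 \<le> \<sigma>"
  shows "(\<lambda>n. measure_pmf.expectation (core n) (\<lambda>k. \<phi> (real k / (\<kappa> * real n powr \<alpha>)))) \<longlonglongrightarrow> (\<integral>x. wdens \<gamma> p x * \<phi> x \<partial>lborel)"
proof -
  let ?I = "\<integral>x. indicator {0<..} x *\<^sub>R (\<phi> x * x powr (p - 1) * wright \<alpha> \<gamma> x) \<partial>lborel"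
  have "(\<lambda>n. (real n powr (1 - \<gamma> - \<alpha> * p) * (\<Sum>k\<le>n. fps_nth g k * \<phi> (real k / (\<kappa> * real n powr \<alpha>)) * fps_nth (h ^ k * m) n)) /
     (real n powr (1 - \<gamma> - \<alpha> * p) * total n)) \<longlonglongrightarrow> (Cg * C * \<kappa> powr p * ?I) / (Cg * C * \<kappa> powr p * mass)"
    by (intro tendsto_divide weighted_limit[OF assms] total_limit) (use const_pos in auto)
  moreover have "\<forall>\<^sub>F n in sequentially. (real n powr (1 - \<gamma> - \<alpha> * p) * (\<Sum>k\<le>n. fps_nth g k * \<phi> (real k / (\<kappa> * real n powr \<alpha>)) * fps_nth (h ^ k * m) n)) /
     (real n powr (1 - \<gamma> - \<alpha> * p) * total n) = measure_pmf.expectation (core n) (\<lambda>k. \<phi> (real k / (\<kappa> * real n powr \<alpha>)))"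
    using total_nonzero eventually_gt_at_top[of 0]
  proof eventually_elim
    case (elim n)
    have "set_pmf (core n) \<subseteq> {..n}"
    proof
      fix k assume "k \<in> set_pmf (core n)"
      then have "fps_nth (h ^ k * m) n \<noteq> 0" using pmf_core[OF elim(1), of k] by (auto simp: set_pmf_iff)
      then show "k \<in> {..n}" using fps_mult_zero_power_nth[OF h_zero, of n k m] by (auto simp: not_less[symmetric])
    qed
    then have "measure_pmf.expectation (core n) (\<lambda>k. \<phi> (real k / (\<kappa> * real n powr \<alpha>)))
      = (\<Sum>k\<le>n. \<phi> (real k / (\<kappa> * real n powr \<alpha>)) * pmf (core n) k)"
      by (intro integral_measure_pmf_real) auto
    also have "\<dots> = (\<Sum>k\<le>n. fps_nth g k * \<phi> (real k / (\<kappa> * real n powr \<alpha>)) * fps_nth (h ^ k * m) n) / total n"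
      unfolding pmf_core[OF elim(1)] sum_divide_distrib by (intro sum.cong) auto
    finally show ?case using elim by simp
  qed
  ultimately have "(\<lambda>n. measure_pmf.expectation (core n) (\<lambda>k. \<phi> (real k / (\<kappa> * real n powr \<alpha>)))) \<longlonglongrightarrow> (Cg * C * \<kappa> powr p * ?I) / (Cg * C * \<kappa> powr p * mass)"
    by (rule Lim_transform_eventually)
  also have "(Cg * C * \<kappa> powr p * ?I) / (Cg * C * \<kappa> powr p * mass) = 1 / mass * ?I"
    proof -
    have "a \<noteq> 0 \<Longrightarrow> mass \<noteq> 0 \<Longrightarrow> a * ?I / (a * mass) = 1 / mass * ?I" for a by simp
    then show ?thesis using const_pos by auto
  qed
  also have "\<dots> = (\<integral>x. wdens \<gamma> p x * \<phi> x \<partial>lborel)"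
  proof -
    have "1 / mass * (indicator {0<..} x *\<^sub>R (\<phi> x * x powr (p - 1) * wright \<alpha> \<gamma> x)) = wdens \<gamma> p x * \<phi> x" for x
      unfolding mass(2) wdens_def by (cases "0 < x") simp_all
    then show ?thesis by (simp only: integral_mult_right_zero[symmetric])
  qed
  finally show ?thesis .
qed

lemma wlaw_integral:
  assumes "f \<in> borel_measurable borel"
  shows "(\<integral>x. f x \<partial>wlaw) = (\<integral>x. wdens \<gamma> p x * f x \<partial>lborel)"
  unfolding wlaw_def
  using assms wdens_measurable wdens_nonneg by (subst integral_density) auto

lemma moment_limit:
  "(\<lambda>n. measure_pmf.expectation (core n) (\<lambda>k. (real k / (\<kappa> * real n powr \<alpha>)) ^ s)) \<longlonglongrightarrow> (\<integral>x. x ^ s \<partial>wlaw)"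
proof -
  have "\<bar>x ^ s\<bar> \<le> 1 * (1 + x) powr real s" if "0 \<le> x" for x :: real
  proof -
    have "x ^ s \<le> (1 + x) ^ s" using that by (intro power_mono) auto
    then show ?thesis using that by (simp add: powr_realpow)
  qed
  moreover have "continuous_on {0..} (\<lambda>x :: real. x ^ s)" by (intro continuous_intros)
  ultimately show ?thesis
    using expectation_limit[of "\<lambda>x. x ^ s" 1 "real s"] by (subst wlaw_integral) (auto intro!: continuous_intros simp: power_abs)
qed

lemma weak_limit:
  "weak_conv_m (\<lambda>n. distr (measure_pmf (core n)) borel (\<lambda>k. real k / (\<kappa> * real n powr \<alpha>))) wlaw"
proof (rule integral_bdd_continuous_conv_imp_weak_conv)
  show "real_distribution (distr (measure_pmf (core n)) borel (\<lambda>k. real k / (\<kappa> * real n powr \<alpha>)))" for n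
    by (intro prob_space.real_distribution_distr measure_pmf.prob_space_axioms) simp
next
  interpret W: prob_space wlaw by (rule wlaw_props(1))
  show "real_distribution wlaw"
    using wlaw_props(2) sets_eq_imp_space_eq[OF wlaw_props(2)] by unfold_locales auto
next
  fix f :: "real \<Rightarrow> real"
  assume f: "\<And>x. isCont f x" "\<And>x. \<bar>f x\<bar> \<le> 1"
  have fm[measurable]: "f \<in> borel_measurable borel"
    using f(1) by (intro borel_measurable_continuous_onI continuous_at_imp_continuous_on) auto
  have "(\<integral>x. f x \<partial>distr (measure_pmf (core n)) borel (\<lambda>k. real k / (\<kappa> * real n powr \<alpha>))) =
      measure_pmf.expectation (core n) (\<lambda>k. f (real k / (\<kappa> * real n powr \<alpha>)))" for n
    by (subst integral_distr) auto
  moreover have "(\<lambda>n. measure_pmf.expectation (core n) (\<lambda>k. f (real k / (\<kappa> * real n powr \<alpha>)))) \<longlonglongrightarrow> (\<integral>x. f x \<partial>wlaw)"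
    unfolding wlaw_integral[OF fm]
  proof (rule expectation_limit[where L = 1 and \<sigma> = 0])
    show "continuous_on {0..} f" using f(1) by (intro continuous_at_imp_continuous_on) auto
  qed (use f(2) in auto)
  ultimately show "(\<lambda>n. \<integral>x. f x \<partial>distr (measure_pmf (core n)) borel (\<lambda>k. real k / (\<kappa> * real n powr \<alpha>))) \<longlonglongrightarrow> (\<integral>x. f x \<partial>wlaw)"
    by simp
qed

lemma wdens_pos: "0 < x \<Longrightarrow> 0 < wdens \<gamma> p x"
  using wright_pos[OF m C, of x] wdens_const_pos unfolding wdens_def by (simp only: if_True) (intro mult_pos_pos; simp)

text \<open>A single probability is the quotient of g_k times the kernel by the total; all three
  have known asymptotics along the sequence, and the powers of n and \<kappa> recombine to the local
  scale.\<close>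

lemma local_sequence_limit:
  fixes N k :: "nat \<Rightarrow> nat"
  assumes N: "filterlim N at_top sequentially" and x: "0 < x"
    and k: "(\<lambda>j. real (k j) / (\<kappa> * real (N j) powr \<alpha>)) \<longlonglongrightarrow> x"
  shows "(\<lambda>j. pmf (core (N j)) (k j) * (\<kappa> * real (N j) powr \<alpha>)) \<longlonglongrightarrow> wdens \<gamma> p x"
proof -
  have N_pos: "\<forall>\<^sub>F j in sequentially. 0 < N j"
    by (rule eventually_compose_filterlim[OF eventually_gt_at_top N])
  have s: "filterlim (\<lambda>j. \<kappa> * real (N j) powr \<alpha>) at_top sequentially"
    by (rule filterlim_real_powr[OF N pars(1) \<alpha>(1)])
  have k_inf: "filterlim k at_top sequentially"
  proof -
    have "filterlim (\<lambda>j. real (k j) / (\<kappa> * real (N j) powr \<alpha>) * (\<kappa> * real (N j) powr \<alpha>)) at_top sequentially"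
      by (rule filterlim_tendsto_pos_mult_at_top[OF k x s])
    moreover have "\<forall>\<^sub>F j in sequentially. real (k j) / (\<kappa> * real (N j) powr \<alpha>) * (\<kappa> * real (N j) powr \<alpha>) = real (k j)"
      using N_pos by eventually_elim (use pars in simp)
    then have "filterlim (\<lambda>j. real (k j) / (\<kappa> * real (N j) powr \<alpha>) * (\<kappa> * real (N j) powr \<alpha>)) at_top sequentially
       \<longleftrightarrow> filterlim (\<lambda>j. real (k j)) at_top sequentially"
      by (intro filterlim_cong refl)
    ultimately show ?thesis by (simp add: filterlim_sequentially_iff_filterlim_real)
  qed
  have k_pos: "\<forall>\<^sub>F j in sequentially. 0 < k j"
    by (rule eventually_compose_filterlim[OF eventually_gt_at_top k_inf])
  have "(\<lambda>j. (real (k j) / (\<kappa> * real (N j) powr \<alpha>)) powr (p - 1) * (real (k j) powr (1 - p) * fps_nth g (k j)) *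
      (real (N j) powr (1 - \<gamma>) * fps_nth (h ^ k j * m) (N j)) / (real (N j) powr (1 - \<gamma> - \<alpha> * p) * total (N j)))
    \<longlonglongrightarrow> x powr (p - 1) * Cg * (C * wright \<alpha> \<gamma> x) / (Cg * C * \<kappa> powr p * mass)"
    by (intro tendsto_divide tendsto_mult tendsto_powr k tendsto_const filterlim_compose[OF g_lim k_inf]
      kernel_limit[OF m N k] filterlim_compose[OF total_limit N]) (use x const_pos in auto)
  from tendsto_mult[OF tendsto_const[of "\<kappa> powr p"] this]
  have T1: "(\<lambda>j. \<kappa> powr p * ((real (k j) / (\<kappa> * real (N j) powr \<alpha>)) powr (p - 1) * (real (k j) powr (1 - p) * fps_nth g (k j)) *
      (real (N j) powr (1 - \<gamma>) * fps_nth (h ^ k j * m) (N j)) / (real (N j) powr (1 - \<gamma> - \<alpha> * p) * total (N j))))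
    \<longlonglongrightarrow> \<kappa> powr p * (x powr (p - 1) * Cg * (C * wright \<alpha> \<gamma> x) / (Cg * C * \<kappa> powr p * mass))" .
  have E: "\<kappa> powr p * (x powr (p - 1) * Cg * (C * wright \<alpha> \<gamma> x) / (Cg * C * \<kappa> powr p * mass)) = wdens \<gamma> p x"
  proof -
    have "\<kappa> powr p * (x powr (p - 1) * Cg * (C * wright \<alpha> \<gamma> x) / (Cg * C * \<kappa> powr p * mass)) = 1 / mass * (x powr (p - 1) * wright \<alpha> \<gamma> x)"
      using Cg C pars by simp
    then show ?thesis unfolding mass(2) using x by (simp add: wdens_def)
  qed
  have "\<forall>\<^sub>F j in sequentially. total (N j) \<noteq> 0"
    by (rule eventually_compose_filterlim[OF total_nonzero N])
  then have V: "\<forall>\<^sub>F j in sequentially. \<kappa> powr p * ((real (k j) / (\<kappa> * real (N j) powr \<alpha>)) powr (p - 1) * (real (k j) powr (1 - p) * fps_nth g (k j)) *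
      (real (N j) powr (1 - \<gamma>) * fps_nth (h ^ k j * m) (N j)) / (real (N j) powr (1 - \<gamma> - \<alpha> * p) * total (N j)))
     = pmf (core (N j)) (k j) * (\<kappa> * real (N j) powr \<alpha>)"
    using N_pos k_pos
  proof eventually_elim
    case (elim j)
    let ?k = "real (k j)" and ?n = "real (N j)"
    have pos: "0 < ?k" "0 < ?n" using elim by auto
    have n1: "?n powr (1 - \<gamma>) = ?n powr (1 - \<gamma> - \<alpha> * p) * ?n powr (\<alpha> * p)"
      by (simp add: powr_add[symmetric])
    have k1: "(?k / (\<kappa> * ?n powr \<alpha>)) powr (p - 1) * ?k powr (1 - p) = \<kappa> powr (1 - p) * ?n powr (\<alpha> * (1 - p))"
    proof -
      have "(?k / (\<kappa> * ?n powr \<alpha>)) powr (p - 1) = ?k powr (p - 1) / (\<kappa> powr (p - 1) * ?n powr (\<alpha> * (p - 1)))"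
        using pos pars by (simp add: powr_divide powr_mult powr_powr)
      moreover have "?k powr (p - 1) * ?k powr (1 - p) = 1" "\<kappa> powr (1 - p) * \<kappa> powr (p - 1) = 1"
        "?n powr (\<alpha> * (1 - p)) * ?n powr (\<alpha> * (p - 1)) = 1"
        using pos pars by (simp_all add: powr_add[symmetric] algebra_simps)
      moreover have "A / (B * D) * A' = B' * D'" if "A * A' = 1" "B' * B = 1" "D' * D = 1" for A A' B B' D D' :: real
      proof -
        have "B \<noteq> 0" "D \<noteq> 0" using that by auto
        moreover have "B' * D' * (B * D) = 1" using that by (simp add: mult.commute mult.left_commute)
        ultimately show ?thesis using that by (simp add: field_simps)
      qed
      ultimately show ?thesis by simp
    qed
    have "\<kappa> powr p * ((?k / (\<kappa> * ?n powr \<alpha>)) powr (p - 1) * (?k powr (1 - p) * fps_nth g (k j)) *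
      (?n powr (1 - \<gamma>) * fps_nth (h ^ k j * m) (N j)) / (?n powr (1 - \<gamma> - \<alpha> * p) * total (N j)))
      = (\<kappa> powr p * \<kappa> powr (1 - p)) * (?n powr (\<alpha> * (1 - p)) * ?n powr (\<alpha> * p)) * (fps_nth g (k j) * fps_nth (h ^ k j * m) (N j) / total (N j))"
      unfolding n1 mult.assoc[symmetric] k1[unfolded mult.assoc[symmetric]] using pos k1 by (simp add: mult_ac)
    also have "\<kappa> powr p * \<kappa> powr (1 - p) = \<kappa>" using pars by (simp add: powr_add[symmetric])
    also have "?n powr (\<alpha> * (1 - p)) * ?n powr (\<alpha> * p) = ?n powr \<alpha>" by (simp add: powr_add[symmetric] algebra_simps)
    also have "fps_nth g (k j) * fps_nth (h ^ k j * m) (N j) / total (N j) = pmf (core (N j)) (k j)"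
      using pmf_core[OF elim(1)] by simp
    finally show ?case by (simp add: mult_ac)
  qed
  show ?thesis using Lim_transform_eventually[OF T1 V] by (simp only: E)
qed

text \<open>Uniformity follows from the limit along sequences by compactness of [a, b]: violating
  points would have a convergent subsequence. The limit density must not vanish at the limit point,
  for there the ratio could not be controlled; this is where \<open>wright_pos\<close> is
  used.\<close>

proposition local_limit:
  assumes ab: "0 < a" "a \<le> b" and e: "0 < e"
  shows "\<forall>\<^sub>F n in sequentially. \<forall>x\<in>{a..b}. \<forall>k::nat. real k = x * (\<kappa> * real n powr \<alpha>) \<longrightarrow>
    \<bar>pmf (core n) k / (1 / (\<kappa> * real n powr \<alpha>) * wdens \<gamma> p x) - 1\<bar> < e"
proof (rule ccontr)
  assume "\<not> ?thesis"
  then have "\<forall>i. \<exists>n. i \<le> n \<and> \<not> (\<forall>x\<in>{a..b}. \<forall>k::nat. real k = x * (\<kappa> * real n powr \<alpha>) \<longrightarrow>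
    \<bar>pmf (core n) k / (1 / (\<kappa> * real n powr \<alpha>) * wdens \<gamma> p x) - 1\<bar> < e)"
    unfolding eventually_sequentially by blast
  then have "\<forall>i. \<exists>n x k. i \<le> n \<and> x \<in> {a..b} \<and> real k = x * (\<kappa> * real n powr \<alpha>) \<and>
    \<not> \<bar>pmf (core n) k / (1 / (\<kappa> * real n powr \<alpha>) * wdens \<gamma> p x) - 1\<bar> < e" by blast
  then obtain n x k where bad: "\<And>i. i \<le> n i" "\<And>i. x i \<in> {a..b}" "\<And>i. real (k i) = x i * (\<kappa> * real (n i) powr \<alpha>)"
    "\<And>i. \<not> \<bar>pmf (core (n i)) (k i) / (1 / (\<kappa> * real (n i) powr \<alpha>) * wdens \<gamma> p (x i)) - 1\<bar> < e" by metis
  obtain y r where y: "y \<in> {a..b}" "strict_mono r" "(x \<circ> r) \<longlonglongrightarrow> y"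
    using compact_Icc[of a b] bad(2) unfolding compact_def by blast
  have y0: "0 < y" using y ab by auto
  have N: "filterlim (\<lambda>j. n (r j)) at_top sequentially"
  proof (rule filterlim_at_top_mono[OF filterlim_ident])
    show "\<forall>\<^sub>F j in sequentially. j \<le> n (r j)"
      using order_trans[OF seq_suble[OF y(2)] bad(1)] by simp
  qed
  have N_pos: "\<forall>\<^sub>F j in sequentially. 0 < n (r j)"
    by (rule eventually_compose_filterlim[OF eventually_gt_at_top N])
  have "(\<lambda>j. real (k (r j)) / (\<kappa> * real (n (r j)) powr \<alpha>)) \<longlonglongrightarrow> y"
  proof (rule Lim_transform_eventually[OF y(3)])
    show "\<forall>\<^sub>F j in sequentially. (x \<circ> r) j = real (k (r j)) / (\<kappa> * real (n (r j)) powr \<alpha>)"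
      using N_pos by eventually_elim (use bad(3) pars in simp)
  qed
  from local_sequence_limit[OF N y0 this]
  have L: "(\<lambda>j. pmf (core (n (r j))) (k (r j)) * (\<kappa> * real (n (r j)) powr \<alpha>)) \<longlonglongrightarrow> wdens \<gamma> p y" .
  have xr: "(\<lambda>j. x (r j)) \<longlonglongrightarrow> y" using y(3) by (simp add: o_def)
  have "(\<lambda>j. Gamma (\<alpha> * p + \<gamma>) / Gamma p * (x (r j) powr (p - 1) * wright \<alpha> \<gamma> (x (r j)))) \<longlonglongrightarrow> Gamma (\<alpha> * p + \<gamma>) / Gamma p * (y powr (p - 1) * wright \<alpha> \<gamma> y)"
    using y0 by (intro tendsto_mult tendsto_powr tendsto_const xr isCont_tendsto_compose[OF isCont_wright]) auto
  moreover have "0 < x i" for i using bad(2)[of i] ab by auto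
  ultimately have "(\<lambda>j. wdens \<gamma> p (x (r j))) \<longlonglongrightarrow> wdens \<gamma> p y" using y0 by (simp add: wdens_def)
  from tendsto_divide[OF L this] wdens_pos[OF y0]
  have "(\<lambda>j. pmf (core (n (r j))) (k (r j)) * (\<kappa> * real (n (r j)) powr \<alpha>) / wdens \<gamma> p (x (r j))) \<longlonglongrightarrow> 1" by simp
  then have "\<forall>\<^sub>F j in sequentially. \<bar>pmf (core (n (r j))) (k (r j)) * (\<kappa> * real (n (r j)) powr \<alpha>) / wdens \<gamma> p (x (r j)) - 1\<bar> < e"
    using e unfolding tendsto_iff dist_real_def by blast
  moreover have "pmf (core (n i)) (k i) / (1 / (\<kappa> * real (n i) powr \<alpha>) * wdens \<gamma> p (x i)) =
      pmf (core (n i)) (k i) * (\<kappa> * real (n i) powr \<alpha>) / wdens \<gamma> p (x i)" for i by simp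
  ultimately have "\<forall>\<^sub>F j in sequentially. False" using bad(4) by simp
  then show False by simp
qed

end

section \<open>Normalising singular expansions\<close>

definition scale :: "real \<Rightarrow> real fps \<Rightarrow> real fps" where
  "scale \<rho> A = Abs_fps (\<lambda>n. fps_nth A n * \<rho> ^ n)"

lemma scale_nth [simp]: "fps_nth (scale \<rho> A) n = fps_nth A n * \<rho> ^ n"
  by (simp add: scale_def)

lemma scale_mult: "scale \<rho> (A * B) = scale \<rho> A * scale \<rho> B"
proof (rule fps_ext)
  fix n
  have "fps_nth A i * fps_nth B (n - i) * \<rho> ^ n = fps_nth A i * \<rho> ^ i * (fps_nth B (n - i) * \<rho> ^ (n - i))"
    if "i \<le> n" for i
    using power_add[of \<rho> i "n - i"] that by (simp add: mult_ac)
  then show "fps_nth (scale \<rho> (A * B)) n = fps_nth (scale \<rho> A * scale \<rho> B) n"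
    unfolding scale_nth fps_mult_nth sum_distrib_right by (intro sum.cong) auto
qed

lemma scale_one: "scale \<rho> 1 = 1"
  by (rule fps_ext) (simp add: fps_one_nth)

lemma scale_power: "scale \<rho> (A ^ k) = scale \<rho> A ^ k"
  by (induction k) (simp_all add: scale_mult scale_one)

lemma slit_disc_subset:
  assumes "\<epsilon> \<le> \<epsilon>'" "0 < T'" "T' \<le> T"
  shows "slit_disc \<epsilon> T \<subseteq> slit_disc \<epsilon>' T'"
proof
  fix w assume w: "w \<in> slit_disc \<epsilon> T"
  have "T' * (Re w - 1) < \<bar>Im w\<bar>"
  proof (cases "1 \<le> Re w")
    case True
    then have "T' * (Re w - 1) \<le> T * (Re w - 1)" using assms by (intro mult_right_mono) auto
    then show ?thesis using w by (simp add: slit_disc_def)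
  next
    case False
    then have "T' * (Re w - 1) < 0" using assms by (intro mult_pos_neg) auto
    then show ?thesis by linarith
  qed
  then show "w \<in> slit_disc \<epsilon>' T'" using w assms by (auto simp: slit_disc_def)
qed

lemma cball_slit_disc:
  assumes "norm w \<le> 1" "w \<noteq> 1" "0 < \<epsilon>" "0 < T"
  shows "w \<in> slit_disc \<epsilon> T"
proof -
  have "Re w \<le> 1" using complex_Re_le_cmod[of w] assms by linarith
  moreover have "Re w \<noteq> 1"
  proof
    assume r: "Re w = 1"
    have "(Re w)\<^sup>2 + (Im w)\<^sup>2 \<le> 1" using assms(1) by (metis cmod_power2 norm_ge_zero power_le_one)
    with r have "Im w = 0" by simp
    with r assms show False by (simp add: complex_eq_iff)
  qed
  ultimately have "T * (Re w - 1) < 0" using assms by (intro mult_pos_neg) auto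
  then show ?thesis using assms by (auto simp: slit_disc_def)
qed

text \<open>As \<theta> < pi/2, |arg z| <= \<theta> implies |Im z| <= tan \<theta> Re z for z = w -
  1, which the slit disc excludes; multiplication by \<rho> > 0 leaves the argument
  unchanged.\<close>

lemma slit_disc_scaled:
  assumes \<rho>: "0 < \<rho>" and \<theta>: "0 < \<theta>" "\<theta> < pi / 2" and w: "w \<in> slit_disc (\<epsilon> / \<rho>) (tan \<theta>)"
  shows "of_real \<rho> * w \<in> delta_domain \<rho> \<epsilon> \<theta>"
proof -
  have "norm (of_real \<rho> * w) < \<rho> * (1 + \<epsilon> / \<rho>)"
    using w \<rho> by (simp add: norm_mult slit_disc_def)
  also have "\<dots> = \<rho> + \<epsilon>" using \<rho> by (simp add: field_simps)
  finally have n: "norm (of_real \<rho> * w) < \<rho> + \<epsilon>" .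
  define z where "z = w - 1"
  have z: "tan \<theta> * Re z < \<bar>Im z\<bar>" using w by (simp add: slit_disc_def z_def)
  then have z0: "z \<noteq> 0" by auto
  have "\<theta> < \<bar>Arg z\<bar>"
  proof (rule ccontr)
    assume "\<not> \<theta> < \<bar>Arg z\<bar>"
    then have a: "\<bar>Arg z\<bar> \<le> \<theta>" by simp
    have re: "Re z = norm z * cos \<bar>Arg z\<bar>" using cos_Arg[OF z0] z0 by (simp add: abs_if)
    have "\<bar>sin (Arg z)\<bar> = sin \<bar>Arg z\<bar>"
      using a \<theta> sin_ge_zero[of "\<bar>Arg z\<bar>"] by (auto simp: abs_if split: if_splits)
    moreover have "\<bar>Im z\<bar> = norm z * \<bar>sin (Arg z)\<bar>" using sin_Arg[OF z0] z0 by (simp add: abs_mult abs_divide)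
    ultimately have im: "\<bar>Im z\<bar> = norm z * sin \<bar>Arg z\<bar>" by simp
    have c: "0 < cos \<bar>Arg z\<bar>" using a \<theta> by (intro cos_gt_zero_pi) auto
    have "tan \<bar>Arg z\<bar> \<le> tan \<theta>"
      using a \<theta> by (cases "\<bar>Arg z\<bar> = \<theta>") (auto intro!: less_imp_le[OF tan_monotone])
    then have "sin \<bar>Arg z\<bar> \<le> tan \<theta> * cos \<bar>Arg z\<bar>" using c by (simp add: tan_def pos_divide_le_eq)
    then have "norm z * sin \<bar>Arg z\<bar> \<le> norm z * (tan \<theta> * cos \<bar>Arg z\<bar>)" by (intro mult_left_mono) auto
    also have "\<dots> = tan \<theta> * Re z" unfolding re by (simp only: mult_ac)
    finally show False using z im by simp
  qed
  moreover have "of_real \<rho> * w - of_real \<rho> = of_real \<rho> * z" by (simp add: z_def algebra_simps)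
  ultimately show ?thesis using n \<rho> by (simp add: delta_domain_def)
qed

lemma singular_expansion_normalise:
  assumes A: "singular_expansion A \<rho> c l"
  obtains f \<epsilon> T P where "0 < \<epsilon>" "0 < T" "f holomorphic_on slit_disc \<epsilon> T"
    "\<And>w. norm w < 1 \<Longrightarrow> (\<lambda>n. of_real (fps_nth (scale \<rho> A) n) * w ^ n) sums f w"
    "((\<lambda>w. (f w - poly P (1 - w)) / (1 - w) powr of_real l) \<longlongrightarrow> of_real c) (at 1 within slit_disc \<epsilon> T)"
    "l < 0 \<Longrightarrow> P = 0" "0 < l \<Longrightarrow> l < 1 \<Longrightarrow> degree P = 0"
proof -
  from A obtain F \<epsilon> \<theta> P where \<rho>: "0 < \<rho>" and c: "c \<noteq> 0" and \<epsilon>: "0 < \<epsilon>" and \<theta>: "0 < \<theta>" "\<theta> < pi / 2"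
    and F: "F analytic_on delta_domain \<rho> \<epsilon> \<theta>"
    and sums: "\<And>z. norm z < \<rho> \<Longrightarrow> (\<lambda>n. of_real (fps_nth A n) * z ^ n) sums F z"
    and asym: "(\<lambda>z. F z - poly P (1 - z / of_real \<rho>))
          \<sim>[at (of_real \<rho>) within delta_domain \<rho> \<epsilon> \<theta>] (\<lambda>z. of_real c * (1 - z / of_real \<rho>) powr of_real l)"
    and P: "l < 0 \<Longrightarrow> P = 0" "0 < l \<Longrightarrow> l < 1 \<Longrightarrow> degree P = 0"
    unfolding singular_expansion_def by blast
  define f where "f = (\<lambda>w. F (of_real \<rho> * w))"
  let ?D = "slit_disc (\<epsilon> / \<rho>) (tan \<theta>)"
  have T: "0 < tan \<theta>" using \<theta> by (intro tan_gt_zero) auto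
  have maps: "of_real \<rho> * w \<in> delta_domain \<rho> \<epsilon> \<theta>" if "w \<in> ?D" for w
    using slit_disc_scaled[OF \<rho> \<theta> that] .
  show ?thesis
  proof (rule that)
    show "0 < \<epsilon> / \<rho>" "0 < tan \<theta>" using \<epsilon> \<rho> T by auto
    show "f holomorphic_on ?D" unfolding f_def
      using holomorphic_on_compose_gen[of "\<lambda>w. of_real \<rho> * w" ?D F "delta_domain \<rho> \<epsilon> \<theta>"]
        analytic_imp_holomorphic[OF F] maps by (auto simp: o_def intro!: holomorphic_intros)
    show "(\<lambda>n. of_real (fps_nth (scale \<rho> A) n) * w ^ n) sums f w" if "norm w < 1" for w
    proof -
      have "norm (of_real \<rho> * w) < \<rho>" using that \<rho> by (simp add: norm_mult)
      from sums[OF this] show ?thesis by (simp add: f_def power_mult_distrib mult.assoc)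
    qed
    have flt: "filterlim (\<lambda>w. of_real \<rho> * w) (at (of_real \<rho>) within delta_domain \<rho> \<epsilon> \<theta>) (at 1 within ?D)"
      unfolding filterlim_at
    proof (intro conjI)
      show "((\<lambda>w. complex_of_real \<rho> * w) \<longlongrightarrow> of_real \<rho>) (at 1 within ?D)"
        by (rule tendsto_eq_intros refl | simp)+
      show "\<forall>\<^sub>F w in at 1 within ?D. of_real \<rho> * w \<in> delta_domain \<rho> \<epsilon> \<theta> \<and> of_real \<rho> * w \<noteq> complex_of_real \<rho>"
        using maps \<rho> by (auto simp: eventually_at_filter)
    qed
    let ?r = "\<lambda>z. F z - poly P (1 - z / of_real \<rho>)" and ?s = "\<lambda>z. of_real c * (1 - z / of_real \<rho>) powr of_real l"
    \<comment> \<open>Asymptotic equivalence reads 0/0 as 1. Away from w = 1 the comparison function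
      is nonzero because c is, so the exceptional branch never occurs and the ordinary quotient has
      limit c.\<close>
    have "((\<lambda>w. of_real c * (if ?r (of_real \<rho> * w) = 0 \<and> ?s (of_real \<rho> * w) = 0 then 1 else ?r (of_real \<rho> * w) / ?s (of_real \<rho> * w)))
        \<longlongrightarrow> of_real c * 1) (at 1 within ?D)"
      by (intro tendsto_mult tendsto_const filterlim_compose[OF asymp_equivD[OF asym] flt])
    moreover have "\<forall>\<^sub>F w in at 1 within ?D. of_real c * (if ?r (of_real \<rho> * w) = 0 \<and> ?s (of_real \<rho> * w) = 0 then 1 else ?r (of_real \<rho> * w) / ?s (of_real \<rho> * w))
        = (f w - poly P (1 - w)) / (1 - w) powr of_real l"
    proof -
      have "of_real c * (if ?r (of_real \<rho> * w) = 0 \<and> ?s (of_real \<rho> * w) = 0 then 1 else ?r (of_real \<rho> * w) / ?s (of_real \<rho> * w))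
        = (f w - poly P (1 - w)) / (1 - w) powr of_real l" if "w \<noteq> 1" for w
        using that \<rho> c by (simp add: f_def)
      then show ?thesis by (auto simp: eventually_at_filter)
    qed
    ultimately show "((\<lambda>w. (f w - poly P (1 - w)) / (1 - w) powr of_real l) \<longlongrightarrow> of_real c) (at 1 within ?D)"
      by (simp add: Lim_transform_eventually)
  qed (use P in auto)
qed

section \<open>Boundary values at 1 and aperiodicity\<close>

lemma sums_has_fps_expansion:
  assumes "\<And>w. norm w < 1 \<Longrightarrow> (\<lambda>n. of_real (fps_nth A n) * w ^ n) sums f w"
  shows "f has_fps_expansion cfps A"
proof (rule has_fps_expansionI)
  have "\<forall>\<^sub>F u in nhds (0::complex). u \<in> ball 0 1" by (intro eventually_nhds_in_open) auto
  then show "\<forall>\<^sub>F u in nhds 0. (\<lambda>n. fps_nth (cfps A) n * u ^ n) sums f u"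
    by eventually_elim (use assms in auto)
qed

text \<open>The converse of Abel's theorem, available because the terms are nonnegative: each
  partial sum is a limit of partial sums below F x, hence at most l, and conversely F x never
  exceeds the full sum.\<close>

lemma nonneg_Abel:
  fixes a :: "nat \<Rightarrow> real"
  assumes a: "\<And>n. 0 \<le> a n" and sums: "\<And>x. 0 < x \<Longrightarrow> x < 1 \<Longrightarrow> (\<lambda>n. a n * x ^ n) sums F x"
    and lim: "(F \<longlongrightarrow> l) (at_left 1)"
  shows "a sums l"
proof -
  have ev: "\<forall>\<^sub>F x in at_left (1::real). 0 < x \<and> x < 1"
    using eventually_at_left_real[OF zero_less_one] by (auto elim: eventually_mono)
  have part: "sum a {..<N} \<le> l" for N
  proof (rule tendsto_le[OF _ lim])
    show "((\<lambda>x. \<Sum>n<N. a n * x ^ n) \<longlongrightarrow> sum a {..<N}) (at_left 1)"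
      by (rule tendsto_eq_intros refl | simp)+
    show "\<forall>\<^sub>F x in at_left 1. (\<Sum>n<N. a n * x ^ n) \<le> F x"
      using ev
    proof eventually_elim
      case (elim x)
      have "(\<Sum>n<N. a n * x ^ n) \<le> (\<Sum>n. a n * x ^ n)"
        using sums[of x] elim a by (intro sum_le_suminf) (auto simp: sums_iff)
      then show ?case using sums[of x] elim by (simp add: sums_iff)
    qed
  qed simp
  have s: "summable a"
    by (rule bounded_imp_summable[of _ l]) (use a part[of "Suc _"] in \<open>auto simp: lessThan_Suc_atMost\<close>)
  have "suminf a \<le> l" by (rule suminf_le_const[OF s part])
  moreover have "l \<le> suminf a"
  proof (rule tendsto_le[OF _ tendsto_const lim])
    show "\<forall>\<^sub>F x in at_left 1. F x \<le> suminf a"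
      using ev
    proof eventually_elim
      case (elim x)
      have "(\<Sum>n. a n * x ^ n) \<le> suminf a"
        using sums[of x] elim a s by (intro suminf_le) (auto simp: sums_iff intro!: mult_left_le power_le_one)
      then show ?case using sums[of x] elim by (simp add: sums_iff)
    qed
  qed simp
  ultimately show ?thesis using s by (simp add: sums_iff)
qed

lemma of_real_at_left_slit:
  assumes "0 < \<epsilon>" "0 < T"
  shows "filterlim (\<lambda>x. complex_of_real x) (at 1 within slit_disc \<epsilon> T) (at_left 1)"
  unfolding filterlim_at
proof (intro conjI)
  show "((\<lambda>x. complex_of_real x) \<longlongrightarrow> 1) (at_left 1)"
    by (rule tendsto_eq_intros refl | simp)+
  show "\<forall>\<^sub>F x in at_left 1. complex_of_real x \<in> slit_disc \<epsilon> T \<and> complex_of_real x \<noteq> 1"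
    using eventually_at_left_real[OF zero_less_one] by eventually_elim (use assms in \<open>auto intro!: cball_slit_disc\<close>)
qed

lemma real_sums_Re:
  assumes "\<And>w. norm w < 1 \<Longrightarrow> (\<lambda>n. of_real (fps_nth A n) * w ^ n) sums f w" "0 < x" "x < 1"
  shows "(\<lambda>n. fps_nth A n * x ^ n) sums Re (f (of_real x))" "f (of_real x) = of_real (Re (f (of_real x)))"
proof -
  have s: "(\<lambda>n. complex_of_real (fps_nth A n * x ^ n)) sums f (of_real x)"
    using assms(1)[of "of_real x"] assms(2,3) by simp
  from sums_Re[OF this] show r: "(\<lambda>n. fps_nth A n * x ^ n) sums Re (f (of_real x))" by simp
  show "f (of_real x) = of_real (Re (f (of_real x)))"
    using sums_unique2[OF s sums_of_real[OF r]] .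
qed

text \<open>Identifies the constant term of a singular expansion with the sum of the series on its
  circle of convergence; the limit is real because f is real on (0, 1).\<close>

lemma limit_sums:
  assumes sums: "\<And>w. norm w < 1 \<Longrightarrow> (\<lambda>n. of_real (fps_nth A n) * w ^ n) sums f w"
    and nonneg: "\<And>n. 0 \<le> fps_nth A n" and pos: "0 < \<epsilon>" "0 < T"
    and lim: "(f \<longlongrightarrow> L) (at 1 within slit_disc \<epsilon> T)"
  shows "fps_nth A sums Re L" "L = of_real (Re L)"
proof -
  have l: "((\<lambda>x. f (of_real x)) \<longlongrightarrow> L) (at_left 1)"
    by (rule filterlim_compose[OF lim of_real_at_left_slit[OF pos]])
  from nonneg_Abel[OF nonneg real_sums_Re(1)[OF sums] tendsto_Re[OF this]]
  show "fps_nth A sums Re L" by blast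
  have "((\<lambda>x. Im (f (of_real x))) \<longlongrightarrow> 0) (at_left 1)"
  proof (rule Lim_transform_eventually[OF tendsto_const])
    show "\<forall>\<^sub>F x in at_left 1. 0 = Im (f (of_real x))"
      using eventually_at_left_real[OF zero_less_one]
    proof (eventually_elim)
      case (elim x)
      have "f (of_real x) = of_real (Re (f (of_real x)))"
        by (rule real_sums_Re(2)[OF sums]) (use elim in auto)
      then show ?case by (metis Im_complex_of_real)
    qed
  qed
  with tendsto_Im[OF l] have "Im L = 0" by (rule tendsto_unique[OF trivial_limit_at_left_real])
  then show "L = of_real (Re L)" by (simp add: complex_eq_iff)
qed

lemma one_minus_powr_tendsto_0:
  assumes "0 < l"
  shows "((\<lambda>w. (1 - w) powr of_real l) \<longlongrightarrow> (0 :: complex)) (at 1 within A)"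
proof -
  have "((\<lambda>w. 1 - w) \<longlongrightarrow> (0::complex)) (at 1 within A)"
    by (rule tendsto_eq_intros refl | simp)+
  then have "((\<lambda>w. norm (1 - w) powr l) \<longlongrightarrow> 0) (at 1 within A)"
    using assms by (intro tendsto_zero_powrI[where b = l]) (auto intro: tendsto_norm_zero)
  then have "((\<lambda>w. norm ((1 - w) powr of_real l)) \<longlongrightarrow> 0) (at 1 within A)"
    using norm_powr_real_powr'[of "of_real l"] by simp
  then show ?thesis by (rule tendsto_norm_zero_cancel)
qed

lemma singular_part_limit:
  fixes f :: "complex \<Rightarrow> complex"
  assumes lim: "((\<lambda>w. (f w - poly P (1 - w)) / (1 - w) powr of_real l) \<longlongrightarrow> b) (at 1 within A)" and l: "0 < l"
  shows "(f \<longlongrightarrow> poly P 0) (at 1 within A)"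
proof -
  have "((\<lambda>w. (f w - poly P (1 - w)) / (1 - w) powr of_real l * (1 - w) powr of_real l + poly P (1 - w)) \<longlongrightarrow> b * 0 + poly P (1 - 1)) (at 1 within A)"
  proof (intro tendsto_add tendsto_mult lim one_minus_powr_tendsto_0[OF l])
    show "((\<lambda>w. poly P (1 - w)) \<longlongrightarrow> poly P (1 - 1)) (at 1 within A)"
    proof -
      have "((\<lambda>w. 1 - w) \<longlongrightarrow> (1 - 1 :: complex)) (at 1 within A)" by (intro tendsto_intros)
      then show ?thesis by (rule isCont_tendsto_compose[OF poly_isCont])
    qed
  qed
  moreover have "\<forall>\<^sub>F w in at 1 within A. (f w - poly P (1 - w)) / (1 - w) powr of_real l * (1 - w) powr of_real l + poly P (1 - w) = f w"
    by (auto simp: eventually_at_filter)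
  ultimately show ?thesis by (simp add: Lim_transform_eventually)
qed

text \<open>
  A point of modulus 1 other than 1 where \<open>\<bar>f\<bar> = 1\<close> would be a period of \<open>f\<close> up to a constant, so that
  the branch point at 1 would reappear there.
\<close>

lemma aperiodic_norm_less_1:
  fixes A :: "real fps"
  assumes nonneg: "\<And>n. 0 \<le> fps_nth A n" and A0: "fps_nth A 0 = 0" and A1: "fps_nth A sums 1"
    and pos: "0 < \<epsilon>" "0 < T" and f: "f holomorphic_on slit_disc \<epsilon> T"
    and sums: "\<And>w. norm w < 1 \<Longrightarrow> (\<lambda>n. of_real (fps_nth A n) * w ^ n) sums f w"
    and \<alpha>: "0 < \<alpha>" "\<alpha> < 1" and b: "b \<noteq> 0"
    and lim: "((\<lambda>w. (f w - 1) / (1 - w) powr of_real \<alpha>) \<longlongrightarrow> b) (at 1 within slit_disc \<epsilon> T)"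
    and w: "norm w \<le> 1" "w \<noteq> 1"
  shows "norm (f w) < 1"
proof -
  \<comment> \<open>The constant coefficient vanishes, so every term carries a factor |v| and the
    remaining coefficients sum to 1.\<close>
  have inside: "norm (f v) \<le> norm v" if v: "norm v < 1" for v
  proof -
    have t: "norm (complex_of_real (fps_nth A n) * v ^ n) \<le> norm v * fps_nth A n" for n
    proof (cases n)
      case (Suc k)
      have "norm v ^ Suc k \<le> norm v * 1" using v by (simp add: power_le_one mult_left_le)
      then have "fps_nth A n * norm v ^ n \<le> fps_nth A n * norm v" using nonneg Suc by (intro mult_left_mono) auto
      then show ?thesis using nonneg[of n] by (simp add: norm_mult norm_power mult.commute)
    qed (simp add: A0)
    have s: "summable (\<lambda>n. norm v * fps_nth A n)" using A1 by (intro summable_mult) (auto simp: sums_iff)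
    have "norm (\<Sum>n. complex_of_real (fps_nth A n) * v ^ n) \<le> (\<Sum>n. norm v * fps_nth A n)"
      by (rule norm_suminf_le[OF t s])
    also have "\<dots> = norm v" using A1 by (simp add: suminf_mult sums_iff)
    finally show ?thesis using sums[OF v] by (simp add: sums_iff)
  qed
  show ?thesis
  proof (cases "norm w < 1")
    case True
    then show ?thesis using inside[of w] by simp
  next
    case False
    with w have w1: "norm w = 1" by simp
    have wD: "w \<in> slit_disc \<epsilon> T" by (rule cball_slit_disc[OF w pos])
    have flt: "((\<lambda>x. of_real x * w) \<longlongrightarrow> w) (at_left (1::real))"
      by (rule tendsto_eq_intros refl | simp)+
    have "isCont f w"
      using holomorphic_on_imp_continuous_on[OF f] open_slit_disc wD by (simp add: continuous_on_eq_continuous_at)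
    then have fw: "((\<lambda>x. f (of_real x * w)) \<longlongrightarrow> f w) (at_left 1)"
      using flt by (rule isCont_tendsto_compose)
    have ev: "\<forall>\<^sub>F x in at_left (1::real). 0 < x \<and> x < 1"
      using eventually_at_left_real[OF zero_less_one] by (auto elim: eventually_mono)
    have "norm (f w) \<le> 1"
    proof (rule tendsto_le[OF _ tendsto_const tendsto_norm[OF fw]])
      show "\<forall>\<^sub>F x in at_left 1. norm (f (of_real x * w)) \<le> 1"
        using ev
      proof eventually_elim
        case (elim x)
        then have "norm (of_real x * w) = x" by (simp add: norm_mult w1)
        with inside[of "of_real x * w"] elim show ?case by simp
      qed
    qed simp
    moreover have False if eq: "norm (f w) = 1"
    proof -
      let ?\<zeta> = "f w"
      have \<zeta>: "cnj ?\<zeta> * ?\<zeta> = 1" using eq complex_norm_square[of ?\<zeta>] by (simp add: mult.commute)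
      \<comment> \<open>These terms are nonnegative since |w| = |f w| = 1, and by
        \<open>nonneg_Abel\<close> they sum to 1 - |f w|^2 = 0. Each of them is therefore 0, so w^n
        equals f w wherever the coefficient is nonzero.\<close>
      define a where "a = (\<lambda>n. fps_nth A n * (1 - Re (w ^ n * cnj ?\<zeta>)))"
      have le1: "Re (w ^ n * cnj ?\<zeta>) \<le> 1" for n
        using complex_Re_le_cmod[of "w ^ n * cnj ?\<zeta>"] w1 eq by (simp add: norm_mult norm_power)
      have f1: "((\<lambda>x. f (of_real x)) \<longlongrightarrow> 1) (at_left 1)"
      proof -
        have "(f \<longlongrightarrow> 1) (at 1 within slit_disc \<epsilon> T)"
          using singular_part_limit[of f "[:1:]" \<alpha> b] lim \<alpha> by simp
        then show ?thesis by (rule filterlim_compose[OF _ of_real_at_left_slit[OF pos]])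
      qed
      have ReR: "Re (of_real u * z) = u * Re z" for u z by simp
      have asums: "(\<lambda>n. a n * x ^ n) sums (Re (f (of_real x)) - Re (f (of_real x * w) * cnj ?\<zeta>))" if x: "0 < x" "x < 1" for x
      proof -
        have "(\<lambda>n. complex_of_real (fps_nth A n) * (of_real x * w) ^ n * cnj ?\<zeta>) sums (f (of_real x * w) * cnj ?\<zeta>)"
          using x by (intro sums_mult2 sums) (simp add: norm_mult w1)
        from sums_diff[OF real_sums_Re(1)[OF sums x] sums_Re[OF this]]
        have "(\<lambda>n. fps_nth A n * x ^ n - Re (complex_of_real (fps_nth A n) * (of_real x * w) ^ n * cnj ?\<zeta>)) sums
           (Re (f (of_real x)) - Re (f (of_real x * w) * cnj ?\<zeta>))" .
        moreover have "fps_nth A n * x ^ n - Re (complex_of_real (fps_nth A n) * (of_real x * w) ^ n * cnj ?\<zeta>) = a n * x ^ n" for n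
        proof -
          have "complex_of_real (fps_nth A n) * (of_real x * w) ^ n * cnj ?\<zeta> = of_real (fps_nth A n * x ^ n) * (w ^ n * cnj ?\<zeta>)"
            by (simp add: power_mult_distrib)
          then have "Re (complex_of_real (fps_nth A n) * (of_real x * w) ^ n * cnj ?\<zeta>) = fps_nth A n * x ^ n * Re (w ^ n * cnj ?\<zeta>)"
            by (simp only: ReR)
          then show ?thesis by (simp add: a_def algebra_simps)
        qed
        ultimately show ?thesis by simp
      qed
      have "((\<lambda>x. Re (f (of_real x)) - Re (f (of_real x * w) * cnj ?\<zeta>)) \<longlongrightarrow> Re 1 - Re (?\<zeta> * cnj ?\<zeta>)) (at_left 1)"
        by (intro tendsto_intros f1 fw)
      then have "((\<lambda>x. Re (f (of_real x)) - Re (f (of_real x * w) * cnj ?\<zeta>)) \<longlongrightarrow> 0) (at_left 1)"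
        by (simp only: mult.commute[of ?\<zeta> "cnj ?\<zeta>"] \<zeta> diff_self)
      from nonneg_Abel[OF _ asums this] have "a sums 0" using nonneg le1 by (simp add: a_def)
      moreover have "0 \<le> a n" for n using nonneg le1 by (simp add: a_def)
      ultimately have a0: "a n = 0" for n
        using suminf_eq_zero_iff[of a] by (auto simp: sums_iff)
      have wn: "of_real (fps_nth A n) * w ^ n = of_real (fps_nth A n) * ?\<zeta>" for n
      proof (cases "fps_nth A n = 0")
        case False
        define v where "v = w ^ n * cnj ?\<zeta>"
        have "Re v = 1" using a0[of n] False by (simp add: a_def v_def)
        moreover have "norm v = 1" using w1 eq by (simp add: v_def norm_mult norm_power)
        then have "(Re v)\<^sup>2 + (Im v)\<^sup>2 = 1" using cmod_power2[of v] by simp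
        ultimately have "v = 1" by (simp add: complex_eq_iff)
        then have "w ^ n * (cnj ?\<zeta> * ?\<zeta>) = ?\<zeta>" by (simp add: v_def mult.assoc[symmetric])
        then show ?thesis using \<zeta> by simp
      qed simp
      have rot: "f (of_real x * w) = ?\<zeta> * f (of_real x)" if x: "0 < x" "x < 1" for x
      proof -
        have "(\<lambda>n. complex_of_real (fps_nth A n) * (of_real x * w) ^ n) sums f (of_real x * w)"
          using x by (intro sums) (simp add: norm_mult w1)
        moreover have "complex_of_real (fps_nth A n) * (of_real x * w) ^ n = ?\<zeta> * (of_real (fps_nth A n) * of_real x ^ n)" for n
        proof -
          have "complex_of_real (fps_nth A n) * (of_real x * w) ^ n = of_real x ^ n * (of_real (fps_nth A n) * w ^ n)"
            by (simp add: power_mult_distrib)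
          also have "\<dots> = of_real x ^ n * (of_real (fps_nth A n) * ?\<zeta>)" by (simp only: wn)
          also have "\<dots> = ?\<zeta> * (of_real (fps_nth A n) * of_real x ^ n)" by (simp only: mult_ac)
          finally show ?thesis .
        qed
        ultimately have "(\<lambda>n. ?\<zeta> * (of_real (fps_nth A n) * of_real x ^ n)) sums f (of_real x * w)" by simp
        moreover have "(\<lambda>n. ?\<zeta> * (of_real (fps_nth A n) * of_real x ^ n)) sums (?\<zeta> * f (of_real x))"
          using x by (intro sums_mult sums) simp
        ultimately show ?thesis by (rule sums_unique2)
      qed
      have "(f has_field_derivative deriv f w) (at w)"
        by (rule holomorphic_derivI[OF f open_slit_disc wD])
      then have D: "((\<lambda>v. (f v - f w) / (v - w)) \<longlongrightarrow> deriv f w) (at w)" by (simp add: has_field_derivative_iff)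
      have "filterlim (\<lambda>x. of_real x * w) (at w) (at_left (1::real))"
      proof (rule filterlim_atI[OF flt])
        show "\<forall>\<^sub>F x in at_left 1. complex_of_real x * w \<noteq> w"
          using ev by eventually_elim (use w1 in auto)
      qed
      from filterlim_compose[OF D this]
      have D2: "((\<lambda>x. (f (of_real x * w) - f w) / (of_real x * w - w)) \<longlongrightarrow> deriv f w) (at_left 1)" .
      \<comment> \<open>Transported along the rotation, f(x) - 1 becomes a difference quotient at w,
        where f is differentiable. It is thus of order 1 - x, which divided by (1 - x)^\<alpha>
        tends to 0, while the expansion at 1 gives the limit b.\<close>
      have "((\<lambda>x::real. - (w * cnj ?\<zeta>) * ((f (of_real x * w) - f w) / (of_real x * w - w)) * of_real ((1 - x) powr (1 - \<alpha>)))
          \<longlongrightarrow> - (w * cnj ?\<zeta>) * deriv f w * of_real 0) (at_left 1)"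
      proof (intro tendsto_mult D2 tendsto_const tendsto_of_real)
        show "((\<lambda>x::real. (1 - x) powr (1 - \<alpha>)) \<longlongrightarrow> 0) (at_left 1)"
          using \<alpha> by real_asymp
      qed
      moreover have "\<forall>\<^sub>F x in at_left 1. - (w * cnj ?\<zeta>) * ((f (of_real x * w) - f w) / (of_real x * w - w)) * of_real ((1 - x) powr (1 - \<alpha>))
          = (f (of_real x) - 1) / (1 - of_real x) powr of_real \<alpha>"
        using ev
      proof eventually_elim
        case (elim x)
        have w0: "w \<noteq> 0" using w1 by auto
        have "f (of_real x * w) - f w = ?\<zeta> * (f (of_real x) - 1)" using rot[of x] elim by (simp add: algebra_simps)
        moreover have "of_real x * w - w = - (of_real (1 - x) * w)" by (simp add: algebra_simps)
        moreover have "(1 - x) powr (1 - \<alpha>) = (1 - x) / (1 - x) powr \<alpha>" using elim by (simp add: powr_diff)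
        moreover have "(1 - complex_of_real x) powr of_real \<alpha> = of_real ((1 - x) powr \<alpha>)"
          using powr_of_real[of "1 - x" \<alpha>] elim by simp
        moreover have "complex_of_real (1 - x) \<noteq> 0" using elim by (simp only: of_real_eq_0_iff) simp
        ultimately have "- (w * cnj ?\<zeta>) * ((f (of_real x * w) - f w) / (of_real x * w - w)) * of_real ((1 - x) powr (1 - \<alpha>))
           = (cnj ?\<zeta> * ?\<zeta>) * ((f (of_real x) - 1) / of_real ((1 - x) powr \<alpha>))"
          using w0 by (simp only: of_real_divide) (simp add: field_simps)
        then show ?case using \<zeta> powr_of_real[of "1 - x" \<alpha>] elim by simp
      qed
      ultimately have "((\<lambda>x. (f (of_real x) - 1) / (1 - of_real x) powr of_real \<alpha>) \<longlongrightarrow> 0) (at_left 1)"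
        by (simp add: Lim_transform_eventually)
      with filterlim_compose[OF lim of_real_at_left_slit[OF pos]]
      have "b = 0" by (rule tendsto_unique[OF trivial_limit_at_left_real])
      with b show False by simp
    qed
    ultimately show ?thesis by fastforce
  qed
qed

section \<open>Bounds near 1 and on the arc\<close>

lemma near_bound_of_limit:
  assumes lim: "((\<lambda>w. f w * (1 - w) powr of_real \<gamma>) \<longlongrightarrow> (b :: complex)) (at 1 within A)"
  obtains \<eta> K where "0 < \<eta>" "0 \<le> K"
    "\<And>w. w \<in> A \<Longrightarrow> w \<noteq> 1 \<Longrightarrow> norm (1 - w) < \<eta> \<Longrightarrow> norm (f w) \<le> K * norm (1 - w) powr (- \<gamma>)"
proof -
  have "\<forall>\<^sub>F w in at 1 within A. norm (f w * (1 - w) powr of_real \<gamma>) < norm b + 1"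
    using tendsto_norm[OF lim] by (rule order_tendstoD) simp
  then obtain \<eta> where \<eta>: "0 < \<eta>" "\<And>w. w \<in> A \<Longrightarrow> w \<noteq> 1 \<Longrightarrow> dist w 1 < \<eta> \<Longrightarrow> norm (f w * (1 - w) powr of_real \<gamma>) < norm b + 1"
    unfolding eventually_at by blast
  show ?thesis
  proof (rule that[OF \<eta>(1), of "norm b + 1"])
    fix w assume w: "w \<in> A" "w \<noteq> 1" "norm (1 - w) < \<eta>"
    then have "norm (f w * (1 - w) powr of_real \<gamma>) < norm b + 1"
      by (intro \<eta>(2)) (auto simp: dist_norm norm_minus_commute)
    then have "norm (f w) * norm (1 - w) powr \<gamma> \<le> norm b + 1"
      using norm_powr_real_powr'[of "of_real \<gamma>" "1 - w"] by (simp add: norm_mult)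
    moreover have "0 < norm (1 - w) powr \<gamma>" using w by simp
    ultimately show "norm (f w) \<le> (norm b + 1) * norm (1 - w) powr (- \<gamma>)"
      by (simp add: powr_minus_divide pos_le_divide_eq)
  qed simp
qed

text \<open>In |1 - v|^2 = 1 - 2 Re v + |v|^2 the linear term is at least 2 d |v| and the quadratic
  one at most d |v|, so one unit of d |v| remains; completing the square halves it.\<close>

lemma norm_one_minus_le:
  fixes v :: complex
  assumes d: "0 < d" "d * norm v \<le> Re v" "norm v \<le> d"
  shows "norm (1 - v) \<le> 1 - d * norm v / 2"
proof (cases "v = 0")
  case False
  then have nv: "0 < norm v" by simp
  have "d * norm v \<le> 1 * norm v" using d(2) complex_Re_le_cmod[of v] by simp
  then have d1: "d \<le> 1" using nv by (simp only: mult_le_cancel_right_pos)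
  have dv: "d * norm v \<le> 1" using mult_mono[of d 1 "norm v" 1] d d1 by simp
  have "(norm (1 - v))\<^sup>2 = 1 - 2 * Re v + (norm v)\<^sup>2"
    unfolding cmod_power2 by (simp add: power2_eq_square algebra_simps)
  also have "\<dots> \<le> 1 - 2 * (d * norm v) + d * norm v"
    using d(2) mult_right_mono[OF d(3) norm_ge_zero[of v]] by (simp only: power2_eq_square)
  also have "\<dots> = 1 - d * norm v" by simp
  also have "\<dots> \<le> 1 - d * norm v + (d * norm v / 2)\<^sup>2" by simp
  also have "\<dots> = (1 - d * norm v / 2)\<^sup>2" by (simp add: power2_eq_square field_simps)
  finally have "(norm (1 - v))\<^sup>2 \<le> (1 - d * norm v / 2)\<^sup>2" .
  then show ?thesis by (rule power2_le_imp_le) (use dv in simp)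
qed simp

text \<open>With u = (1 - w)^\<alpha> one has f w = 1 - u/\<kappa> + e u. The main part loses
  \<delta> |u| / (2 \<kappa>) by \<open>norm_one_minus_le\<close>; the error is allowed half of
  that, which leaves the rate \<delta> / (4 \<kappa>).\<close>

lemma exp_bound_of_limit:
  assumes lim: "((\<lambda>w. (f w - 1) / (1 - w) powr of_real \<alpha>) \<longlongrightarrow> - of_real (1 / \<kappa>)) (at 1 within A)"
    and \<kappa>: "0 < \<kappa>" and \<alpha>: "0 < \<alpha>" and \<delta>: "0 < \<delta>"
    and sector: "\<And>w. w \<in> A \<Longrightarrow> \<delta> * norm (1 - w) powr \<alpha> \<le> Re ((1 - w) powr of_real \<alpha>)"
  obtains \<eta> where "0 < \<eta>"
    "\<And>w. w \<in> A \<Longrightarrow> w \<noteq> 1 \<Longrightarrow> norm (1 - w) < \<eta> \<Longrightarrow> norm (f w) \<le> exp (- (\<delta> / (4 * \<kappa>) * norm (1 - w) powr \<alpha>))"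
proof -
  let ?u = "\<lambda>w :: complex. (1 - w) powr of_real \<alpha>"
  have nu: "norm (?u w) = norm (1 - w) powr \<alpha>" for w
    using norm_powr_real_powr'[of "of_real \<alpha>" "1 - w"] by simp
  have "\<forall>\<^sub>F w in at 1 within A. dist ((f w - 1) / ?u w) (- of_real (1 / \<kappa>)) < \<delta> / (4 * \<kappa>)"
    using lim \<delta> \<kappa> by (intro tendstoD) auto
  moreover have "\<forall>\<^sub>F w in at 1 within A. norm (?u w) < \<delta> * \<kappa>"
    using tendstoD[OF one_minus_powr_tendsto_0[OF \<alpha>], of "\<delta> * \<kappa>"] \<delta> \<kappa> by simp
  ultimately have "\<forall>\<^sub>F w in at 1 within A. dist ((f w - 1) / ?u w) (- of_real (1 / \<kappa>)) < \<delta> / (4 * \<kappa>) \<and> norm (?u w) < \<delta> * \<kappa>"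
    by (rule eventually_conj)
  then obtain \<eta> where \<eta>: "0 < \<eta>" "\<And>w. w \<in> A \<Longrightarrow> w \<noteq> 1 \<Longrightarrow> dist w 1 < \<eta> \<Longrightarrow>
      dist ((f w - 1) / ?u w) (- of_real (1 / \<kappa>)) < \<delta> / (4 * \<kappa>) \<and> norm (?u w) < \<delta> * \<kappa>"
    unfolding eventually_at by blast
  show ?thesis
  proof (rule that[OF \<eta>(1)])
    fix w assume w: "w \<in> A" "w \<noteq> 1" "norm (1 - w) < \<eta>"
    define u where "u = ?u w"
    define e where "e = (f w - 1) / u + of_real (1 / \<kappa>)"
    have u0: "u \<noteq> 0" using w by (simp add: u_def)
    have "dist w 1 < \<eta>" using w by (simp add: dist_norm norm_minus_commute)
    from \<eta>(2)[OF w(1,2) this] have e: "norm e < \<delta> / (4 * \<kappa>)" and u: "norm u < \<delta> * \<kappa>"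
      by (simp_all add: dist_norm e_def u_def)
    have f: "f w = (1 - u / of_real \<kappa>) + e * u" using u0 \<kappa> by (simp add: e_def field_simps)
    have "norm (1 - u / of_real \<kappa>) \<le> 1 - \<delta> * norm (u / of_real \<kappa>) / 2"
    proof (rule norm_one_minus_le[OF \<delta>])
      have "\<delta> * norm u \<le> Re u" using sector[OF w(1)] by (simp add: u_def nu)
      then show "\<delta> * norm (u / of_real \<kappa>) \<le> Re (u / of_real \<kappa>)"
        using \<kappa> by (simp add: norm_divide divide_right_mono)
      show "norm (u / of_real \<kappa>) \<le> \<delta>" using u \<kappa> by (simp add: norm_divide pos_divide_le_eq)
    qed
    moreover have "norm (u / of_real \<kappa>) = norm u / \<kappa>" using \<kappa> by (simp add: norm_divide)
    moreover have "norm (e * u) \<le> \<delta> / (4 * \<kappa>) * norm u" unfolding norm_mult using e by (intro mult_right_mono) auto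
    ultimately have "norm (f w) \<le> 1 - \<delta> * (norm u / \<kappa>) / 2 + \<delta> / (4 * \<kappa>) * norm u"
      unfolding f by (intro norm_triangle_le) simp
    also have "\<dots> = 1 + - (\<delta> / (4 * \<kappa>) * norm u)" using \<kappa> by (simp add: field_simps)
    also have "\<dots> \<le> exp (- (\<delta> / (4 * \<kappa>) * norm u))" by (rule exp_ge_add_one_self)
    finally show "norm (f w) \<le> exp (- (\<delta> / (4 * \<kappa>) * norm (1 - w) powr \<alpha>))" by (simp add: u_def nu)
  qed
qed

text \<open>
  The points of the sector with \<open>\<bar>f\<bar> \<ge> 1\<close> form a compact set disjoint from the closed unit disc.
\<close>

lemma norm_less_1_beyond_disc:
  assumes f: "f holomorphic_on slit_disc \<epsilon> T" and \<epsilon>: "0 < \<epsilon>" and T: "0 < T" "T < S" and \<eta>: "0 < \<eta>"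
    and disc: "\<And>w. norm w \<le> 1 \<Longrightarrow> w \<noteq> 1 \<Longrightarrow> norm (f w) < 1"
  obtains \<epsilon>' where "0 < \<epsilon>'" "\<And>w. S * (Re w - 1) \<le> \<bar>Im w\<bar> \<Longrightarrow> \<eta> \<le> norm (w - 1) \<Longrightarrow> norm w \<le> 1 + \<epsilon>' \<Longrightarrow> norm (f w) < 1"
proof -
  define Q where "Q = {w. S * (Re w - 1) \<le> \<bar>Im w\<bar> \<and> \<eta> \<le> norm (w - 1) \<and> norm w \<le> 1 + \<epsilon> / 2}"
  have "closed Q" unfolding Q_def by (intro closed_Collect_conj closed_Collect_le continuous_intros)
  moreover have "bounded Q" unfolding bounded_iff Q_def by blast
  ultimately have Q: "compact Q" by (simp add: compact_eq_bounded_closed)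
  have QD: "Q \<subseteq> slit_disc \<epsilon> T"
  proof
    fix w assume w: "w \<in> Q"
    have "T * (Re w - 1) < \<bar>Im w\<bar>"
    proof (cases "1 < Re w")
      case True
      then have "T * (Re w - 1) < S * (Re w - 1)" using T by simp
      then show ?thesis using w by (simp add: Q_def)
    next
      case False
      then have "T * (Re w - 1) \<le> 0" using T by (simp add: mult_nonneg_nonpos)
      moreover have "Re w \<noteq> 1 \<or> Im w \<noteq> 0" using w \<eta> by (auto simp: Q_def complex_eq_iff norm_complex_def)
      ultimately show ?thesis using False T by (cases "Im w = 0") (auto simp: mult_less_0_iff)
    qed
    then show "w \<in> slit_disc \<epsilon> T" using w \<epsilon> by (auto simp: Q_def slit_disc_def)
  qed
  define Q1 where "Q1 = {w \<in> Q. 1 \<le> norm (f w)}"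
  have cont: "continuous_on Q (\<lambda>w. norm (f w))"
    using holomorphic_on_imp_continuous_on[OF f] QD by (intro continuous_intros) (rule continuous_on_subset)
  have "closed Q1"
    using continuous_closed_preimage[OF cont compact_imp_closed[OF Q], of "{1..}"]
    by (simp add: Q1_def vimage_def Int_def)
  moreover have "Q \<inter> Q1 = Q1" by (auto simp: Q1_def)
  ultimately have Q1: "compact Q1" using compact_Int_closed[OF Q, of Q1] by simp
  \<comment> \<open>Points with |f| >= 1 lie off the closed disc by \<open>disc\<close>, so by
    compactness the smallest of their moduli exceeds 1. Half of that gap gives
    \<open>\<epsilon>'\<close>.\<close>
  obtain s where s: "1 < s" "\<And>w. w \<in> Q1 \<Longrightarrow> s \<le> norm w"
  proof (cases "Q1 = {}")
    case False
    obtain v where v: "v \<in> Q1" "\<And>w. w \<in> Q1 \<Longrightarrow> norm v \<le> norm w"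
      using continuous_attains_inf[OF Q1 False, of norm] by (auto intro: continuous_intros)
    have "v \<noteq> 1" using v \<eta> by (auto simp: Q1_def Q_def)
    then have "1 < norm v" using disc[of v] v by (fastforce simp: Q1_def)
    then show ?thesis using v that by blast
  next
    case True
    show ?thesis by (rule that[of 2]) (use True in auto)
  qed
  show ?thesis
  proof (rule that[of "min (\<epsilon> / 2) ((s - 1) / 2)"])
    fix w assume w: "S * (Re w - 1) \<le> \<bar>Im w\<bar>" "\<eta> \<le> norm (w - 1)" "norm w \<le> 1 + min (\<epsilon> / 2) ((s - 1) / 2)"
    then have "w \<in> Q" by (auto simp: Q_def)
    moreover have "w \<notin> Q1"
    proof
      assume "w \<in> Q1"
      then have "s \<le> norm w" by (rule s(2))
      also have "norm w \<le> 1 + (s - 1) / 2" using w(3) min.cobounded2 by (rule order_trans[OF _ add_left_mono])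
      also have "\<dots> < s" using s(1) by (simp add: field_simps)
      finally show False by simp
    qed
    ultimately show "norm (f w) < 1" by (auto simp: Q1_def not_le)
  qed (use \<epsilon> s in auto)
qed

section \<open>Transfer of singular expansions to coefficients\<close>

context hankel_contour
begin

lemma far_bound:
  assumes "f holomorphic_on slit_disc \<epsilon> T"
  obtains B where "\<And>w. w \<in> far_set \<Longrightarrow> norm (f w) \<le> B"
proof -
  have "compact (f ` far_set)"
    using holomorphic_on_imp_continuous_on[OF assms] far_subset compact_far
    by (intro compact_continuous_image) (rule continuous_on_subset)
  then obtain B where "\<forall>x\<in>f ` far_set. norm x \<le> B" using compact_imp_bounded bounded_iff by metis
  then show ?thesis using that by blast
qed

lemma hankel_cmult: "hankel (\<lambda>t. c * f t) = c * hankel f"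
proof -
  have "ray (\<lambda>t. c * f t) d = c * ray f d" for d
    unfolding ray_def set_lebesgue_integral_def integral_mult_right_zero[symmetric] by (intro Bochner_Integration.integral_cong) (auto simp: scaleR_conv_of_real mult_ac)
  then show ?thesis by (simp add: hankel_def algebra_simps)
qed

lemma coefficient_limit:
  assumes f: "f holomorphic_on slit_disc \<epsilon> T" and F: "f has_fps_expansion F"
    and lim: "((\<lambda>w. f w * (1 - w) powr of_real \<gamma>) \<longlongrightarrow> b) (at 1 within slit_disc \<epsilon> T)"
    and K: "0 \<le> K" "\<And>w. w \<in> near_set \<Longrightarrow> norm (f w) \<le> K * norm (1 - w) powr (- \<gamma>)"
  shows "(\<lambda>n. of_real (real n powr (1 - \<gamma>)) * fps_nth F n) \<longlonglongrightarrow> b * of_real (rGamma \<gamma>)"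
proof -
  obtain B where B: "\<And>w. w \<in> far_set \<Longrightarrow> norm (f w) \<le> B" using far_bound[OF f] by blast
  have "(\<lambda>n. of_real (real n powr (1 - \<gamma>)) * fps_nth F n) \<longlonglongrightarrow> hankel (\<lambda>t. exp t * (b * t powr (- of_real \<gamma>)))"
    by (rule coeff_limit[where N = "\<lambda>n. n" and f = "\<lambda>_. f" and B = B, OF filterlim_ident K(1) f F K(2) B
          ray_point_limit[OF lim filterlim_ident]])
  also have "hankel (\<lambda>t. exp t * (b * t powr (- of_real \<gamma>))) = b * hankel (\<lambda>t. exp t * t powr (- of_real \<gamma>))"
    using hankel_cmult[of b "\<lambda>t. exp t * t powr (- of_real \<gamma>)"] by (simp add: mult_ac)
  finally show ?thesis by (simp add: hankel_rGamma)
qed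

end

text \<open>Subtracting the polynomial part changes only finitely many coefficients and leaves c (1
  - w)^l to leading order, to which the contour estimate applies with \<gamma> = - l.\<close>

theorem singularity_analysis:
  assumes A: "singular_expansion A \<rho> c l"
  shows "(\<lambda>n. real n powr (1 + l) * fps_nth (scale \<rho> A) n) \<longlonglongrightarrow> c * rGamma (- l)"
proof -
  obtain f \<epsilon> T P where pos: "0 < \<epsilon>" "0 < T" and f: "f holomorphic_on slit_disc \<epsilon> T"
    and sums: "\<And>w. norm w < 1 \<Longrightarrow> (\<lambda>n. of_real (fps_nth (scale \<rho> A) n) * w ^ n) sums f w"
    and lim: "((\<lambda>w. (f w - poly P (1 - w)) / (1 - w) powr of_real l) \<longlongrightarrow> of_real c) (at 1 within slit_disc \<epsilon> T)"
    and "l < 0 \<Longrightarrow> P = 0" "0 < l \<Longrightarrow> l < 1 \<Longrightarrow> degree P = 0"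
  proof (rule singular_expansion_normalise[OF A], goal_cases)
    case (1 f \<epsilon> T P)
    show ?case by (rule 1(1)[OF 1(2-8)])
  qed
  define p where "p = pcompose P [:1, -1:]"
  have p: "poly p w = poly P (1 - w)" for w by (simp add: p_def poly_pcompose)
  define \<phi> where "\<phi> = (\<lambda>w. f w - poly p w)"
  have lim': "((\<lambda>w. \<phi> w * (1 - w) powr of_real (- l)) \<longlongrightarrow> of_real c) (at 1 within slit_disc \<epsilon> T)"
    using lim by (simp add: \<phi>_def p powr_minus divide_inverse)
  have p_exp: "poly p has_fps_expansion fps_of_poly p" by (simp add: has_fps_expansion_def)
  obtain \<eta> K where \<eta>: "0 < \<eta>" and K: "0 \<le> K"
    "\<And>w. w \<in> slit_disc \<epsilon> T \<Longrightarrow> w \<noteq> 1 \<Longrightarrow> norm (1 - w) < \<eta> \<Longrightarrow> norm (\<phi> w) \<le> K * norm (1 - w) powr (- (- l))"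
    using near_bound_of_limit[OF lim'] by metis
  \<comment> \<open>Any slope above \<open>T\<close> is admissible here; with 1 + T the reach of the
    legs is r (3 + T), and the factor 2 keeps it strictly below both \<open>\<epsilon>\<close> and
    \<open>\<eta>\<close>.\<close>
  define r where "r = min 1 (min \<epsilon> \<eta> / (2 * (3 + T)))"
  have rz: "0 < r" "r \<le> 1" "r * (2 + (1 + T)) < min \<epsilon> \<eta>"
  proof -
    show "0 < r" "r \<le> 1" using pos \<eta> by (auto simp: r_def)
    have "r * (2 + (1 + T)) \<le> min \<epsilon> \<eta> / (2 * (3 + T)) * (2 + (1 + T))"
      using pos by (intro mult_right_mono) (auto simp: r_def)
    also have "\<dots> = min \<epsilon> \<eta> / 2" using pos by (simp add: field_simps)
    also have "\<dots> < min \<epsilon> \<eta>" using pos \<eta> by (auto simp: min_def)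
    finally show "r * (2 + (1 + T)) < min \<epsilon> \<eta>" .
  qed
  interpret hankel_contour \<epsilon> T "1 + T" r using pos rz by unfold_locales auto
  have "(\<lambda>n. of_real (real n powr (1 - - l)) * fps_nth (cfps (scale \<rho> A) - fps_of_poly p) n) \<longlonglongrightarrow> of_real c * of_real (rGamma (- l))"
  proof (rule coefficient_limit[OF _ _ lim' K(1)])
    show "\<phi> holomorphic_on slit_disc \<epsilon> T" unfolding \<phi>_def by (intro holomorphic_intros f)
    show "\<phi> has_fps_expansion cfps (scale \<rho> A) - fps_of_poly p"
      unfolding \<phi>_def by (intro fps_expansion_intros sums_has_fps_expansion sums p_exp)
    show "norm (\<phi> w) \<le> K * norm (1 - w) powr (- (- l))" if w: "w \<in> near_set" for w
    proof (rule K(2))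
      show "w \<in> slit_disc \<epsilon> T" using near_subset w by blast
      show "w \<noteq> 1" "norm (1 - w) < \<eta>" using w rz by (auto simp: near_set_def)
    qed
  qed
  then have "(\<lambda>n. of_real (real n powr (1 + l)) * fps_nth (cfps (scale \<rho> A) - fps_of_poly p) n) \<longlonglongrightarrow> complex_of_real (c * rGamma (- l))"
    by simp
  then have "(\<lambda>n. complex_of_real (real n powr (1 + l) * fps_nth (scale \<rho> A) n)) \<longlonglongrightarrow> complex_of_real (c * rGamma (- l))"
  proof (rule Lim_transform_eventually)
    show "\<forall>\<^sub>F n in sequentially. of_real (real n powr (1 + l)) * fps_nth (cfps (scale \<rho> A) - fps_of_poly p) n =
        complex_of_real (real n powr (1 + l) * fps_nth (scale \<rho> A) n)"
      using eventually_gt_at_top[of "degree p"] by eventually_elim (simp add: coeff_eq_0)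
  qed
  then show ?thesis by (simp only: tendsto_of_real_iff)
qed

text \<open>The order of choices matters: the slope from the sector, then the radius of the
  exponential bound in that sector, then the gap beyond the unit disc outside that radius, and only
  then \<open>r\<close>. On the far set |h| < 1 follows from the exponential bound near 1 and from
  the gap elsewhere. The parameter \<open>\<eta>\<close> leaves room for the bound on a further
  factor.\<close>

lemma large_powers_exists:
  assumes nonneg: "\<And>n. 0 \<le> fps_nth h n" and h0: "fps_nth h 0 = 0" and h1: "fps_nth h sums 1"
    and pos: "0 < \<epsilon>" "0 < T" "0 < \<eta>" and f: "fh holomorphic_on slit_disc \<epsilon> T"
    and sums: "\<And>w. norm w < 1 \<Longrightarrow> (\<lambda>n. of_real (fps_nth h n) * w ^ n) sums fh w"
    and \<alpha>: "0 < \<alpha>" "\<alpha> < 1" and \<kappa>: "0 < \<kappa>"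
    and lim: "((\<lambda>w. (fh w - 1) / (1 - w) powr of_real \<alpha>) \<longlongrightarrow> - of_real (1 / \<kappa>)) (at 1 within slit_disc \<epsilon> T)"
  obtains S r \<delta> c q Kh where "large_powers \<epsilon> T S r \<alpha> \<delta> h fh \<kappa> c q Kh" "r * (2 + S) < \<eta>"
proof -
  obtain S \<delta> where S: "T < S" "1 \<le> S" and \<delta>: "0 < \<delta>"
    and sector: "\<And>t. - (S * Re t) \<le> \<bar>Im t\<bar> \<Longrightarrow> \<delta> * norm t powr \<alpha> \<le> Re (t powr of_real \<alpha>)"
    using sector_exists[OF \<alpha>, of T] by metis
  define A where "A = {w \<in> slit_disc \<epsilon> T. S * (Re w - 1) \<le> \<bar>Im w\<bar>}"
  have AD: "A \<subseteq> slit_disc \<epsilon> T" by (auto simp: A_def)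
  note limA = tendsto_within_subset[OF lim AD]
  obtain \<eta>1 where \<eta>1: "0 < \<eta>1" "\<And>w. w \<in> A \<Longrightarrow> w \<noteq> 1 \<Longrightarrow> norm (1 - w) < \<eta>1 \<Longrightarrow>
      norm (fh w) \<le> exp (- (\<delta> / (4 * \<kappa>) * norm (1 - w) powr \<alpha>))"
  proof (rule exp_bound_of_limit[OF limA \<kappa> \<alpha>(1) \<delta>])
    fix w assume "w \<in> A"
    then show "\<delta> * norm (1 - w) powr \<alpha> \<le> Re ((1 - w) powr of_real \<alpha>)"
      by (intro sector) (auto simp: A_def algebra_simps)
  qed (use that in blast)
  have "((\<lambda>w. (fh w - 1) * (1 - w) powr of_real (- \<alpha>)) \<longlongrightarrow> - of_real (1 / \<kappa>)) (at 1 within slit_disc \<epsilon> T)"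
    using lim by (simp add: powr_minus divide_inverse)
  from near_bound_of_limit[OF this]
  obtain \<eta>2 Kh where \<eta>2: "0 < \<eta>2" and Kh: "0 \<le> Kh" "\<And>w. w \<in> slit_disc \<epsilon> T \<Longrightarrow> w \<noteq> 1 \<Longrightarrow> norm (1 - w) < \<eta>2 \<Longrightarrow>
      norm (fh w - 1) \<le> Kh * norm (1 - w) powr (- (- \<alpha>))" by metis
  have b0: "- complex_of_real (1 / \<kappa>) \<noteq> 0" using \<kappa> by simp
  have disc: "norm (fh w) < 1" if "norm w \<le> 1" "w \<noteq> 1" for w
    by (rule aperiodic_norm_less_1[OF nonneg h0 h1 pos(1,2) f sums \<alpha> b0 lim that])
  obtain \<epsilon>' where \<epsilon>': "0 < \<epsilon>'" "\<And>w. S * (Re w - 1) \<le> \<bar>Im w\<bar> \<Longrightarrow> \<eta>1 \<le> norm (w - 1) \<Longrightarrow> norm w \<le> 1 + \<epsilon>' \<Longrightarrow> norm (fh w) < 1"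
    using norm_less_1_beyond_disc[OF f pos(1,2) S(1) \<eta>1(1) disc] by metis
  define z where "z = Min {\<epsilon>, \<eta>, \<eta>1, \<eta>2, \<epsilon>'}"
  have z: "0 < z" "z \<le> \<epsilon>" "z \<le> \<eta>" "z \<le> \<eta>1" "z \<le> \<eta>2" "z \<le> \<epsilon>'"
    unfolding z_def using pos \<eta>1(1) \<eta>2 \<epsilon>'(1) by auto
  define r where "r = min 1 (z / (2 * (2 + S)))"
  have rz: "0 < r" "r \<le> 1" "r * (2 + S) < z"
  proof -
    show "0 < r" "r \<le> 1" using z S by (auto simp: r_def)
    have "r * (2 + S) \<le> z / (2 * (2 + S)) * (2 + S)" using S by (intro mult_right_mono) (auto simp: r_def)
    also have "\<dots> = z / 2" using S by (simp add: field_simps)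
    also have "\<dots> < z" using z by simp
    finally show "r * (2 + S) < z" .
  qed
  interpret hankel_contour \<epsilon> T S r using pos S rz z by unfold_locales auto
  have near: "w \<in> A" "w \<in> slit_disc \<epsilon> T" "w \<noteq> 1" "norm (1 - w) < z" if "w \<in> near_set" for w
    using that near_subset rz by (auto simp: near_set_def A_def)
  have far1: "norm (fh w) < 1" if w: "w \<in> far_set" for w
  proof (cases "\<eta>1 \<le> norm (w - 1)")
    case True
    then show ?thesis using w rz z by (intro \<epsilon>') (auto simp: far_set_def)
  next
    case False
    have w1: "w \<noteq> 1" using w rz by (auto simp: far_set_def)
    have "w \<in> A" using w far_subset by (auto simp: A_def far_set_def)
    from \<eta>1(2)[OF this w1] False
    have "norm (fh w) \<le> exp (- (\<delta> / (4 * \<kappa>) * norm (1 - w) powr \<alpha>))" by (simp add: norm_minus_commute)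
    also have "\<dots> < 1" using w1 \<delta> \<kappa> by simp
    finally show ?thesis .
  qed
  have "continuous_on far_set (\<lambda>w. norm (fh w))"
    using holomorphic_on_imp_continuous_on[OF f] far_subset by (intro continuous_intros) (rule continuous_on_subset)
  then obtain v where v: "v \<in> far_set" "\<And>w. w \<in> far_set \<Longrightarrow> norm (fh w) \<le> norm (fh v)"
    using continuous_attains_sup[OF compact_far far_nonempty] by blast
  \<comment> \<open>The maximum over the compact far set is below 1; the entry 1/2 keeps
    \<open>q\<close> positive, so that its logarithm can be used as a rate.\<close>
  define q where "q = max (1 / 2) (norm (fh v))"
  have "large_powers \<epsilon> T S r \<alpha> \<delta> h fh \<kappa> (\<delta> / (4 * \<kappa>)) q Kh"
  proof unfold_locales
    show "fh has_fps_expansion cfps h" by (rule sums_has_fps_expansion[OF sums])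
    show "norm (fh w) \<le> exp (- (\<delta> / (4 * \<kappa>) * norm (1 - w) powr \<alpha>))" if "w \<in> near_set" for w
      using near[OF that] z by (intro \<eta>1) auto
    show "norm (fh w - 1) \<le> Kh * norm (1 - w) powr \<alpha>" if "w \<in> near_set" for w
      using near[OF that] z Kh(2)[of w] by auto
    show "norm (fh w) \<le> q" if "w \<in> far_set" for w using v(2)[OF that] by (simp add: q_def)
    show "q < 1" using far1[OF v(1)] by (simp add: q_def)
  qed (use \<alpha> \<delta> \<kappa> nonneg h0 f sector Kh lim in \<open>auto simp: q_def\<close>)
  moreover have "r * (2 + S) < \<eta>" using rz z by simp
  ultimately show ?thesis by (rule that)
qed

section \<open>Normalised forms of the three series\<close>

lemma (in large_powers) factorI:
  assumes m: "\<And>n. 0 \<le> fps_nth m n" and f: "f holomorphic_on slit_disc \<epsilon> T" "f has_fps_expansion cfps m"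
    and lim: "((\<lambda>w. f w * (1 - w) powr of_real \<gamma>) \<longlongrightarrow> of_real C) (at 1 within slit_disc \<epsilon> T)"
    and K: "0 \<le> K" "r * (2 + S) < \<eta>"
      "\<And>w. w \<in> slit_disc \<epsilon> T \<Longrightarrow> w \<noteq> 1 \<Longrightarrow> norm (1 - w) < \<eta> \<Longrightarrow> norm (f w) \<le> K * norm (1 - w) powr (- \<gamma>)"
  shows "factor m \<gamma> C"
proof -
  obtain B where B: "\<And>w. w \<in> far_set \<Longrightarrow> norm (f w) \<le> B" using far_bound[OF f(1)] by blast
  have near: "norm (f w) \<le> K * norm (1 - w) powr (- \<gamma>)" if w: "w \<in> near_set" for w
  proof (rule K(3))
    show "w \<in> slit_disc \<epsilon> T" using near_subset w by blast
    show "w \<noteq> 1" "norm (1 - w) < \<eta>" using w K(2) by (auto simp: near_set_def)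
  qed
  show ?thesis unfolding factor_def
    using m f K(1) near B lim by (intro conjI allI exI[of _ f] exI[of _ K] exI[of _ B]) auto
qed

lemma singular_leading_coefficient_nonneg:
  assumes nonneg: "\<And>n. 0 \<le> fps_nth A n" and pos: "0 < \<epsilon>" "0 < T"
    and sums: "\<And>w. norm w < 1 \<Longrightarrow> (\<lambda>n. of_real (fps_nth A n) * w ^ n) sums f w"
    and lim: "((\<lambda>w. f w / (1 - w) powr of_real l) \<longlongrightarrow> of_real c) (at 1 within slit_disc \<epsilon> T)"
  shows "0 \<le> c"
proof -
  have "((\<lambda>x. Re (f (of_real x) / (1 - of_real x) powr of_real l)) \<longlongrightarrow> Re (of_real c)) (at_left 1)"
    by (intro tendsto_Re filterlim_compose[OF lim of_real_at_left_slit[OF pos]])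
  moreover have "\<forall>\<^sub>F x in at_left (1::real). 0 \<le> Re (f (of_real x) / (1 - of_real x) powr of_real l)"
    using eventually_at_left_real[OF zero_less_one]
  proof eventually_elim
    case (elim x)
    then have x: "0 < x" "x < 1" by auto
    note s = real_sums_Re[OF sums x]
    have "0 \<le> Re (f (of_real x))"
      using sums_le[OF _ sums_zero s(1)] nonneg x by simp
    moreover have "(1 - complex_of_real x) powr of_real l = of_real ((1 - x) powr l)"
      using powr_of_real[of "1 - x" l] x by simp
    ultimately show ?case by (simp add: Re_divide_of_real)
  qed
  ultimately show ?thesis using tendsto_lowerbound[OF _ _ trivial_limit_at_left_real] by fastforce
qed

text \<open>For 0 < \<alpha> < 1 the polynomial is constant, and its value is \<tau> by
  \<open>limit_sums\<close>. Nonnegative coefficients keep f below \<tau> on (0, 1), which forces c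
  < 0 and thus \<kappa> > 0.\<close>

lemma normalised_H:
  assumes H: "singular_expansion H \<rho> c \<alpha>" and nonneg: "\<And>n. 0 \<le> fps_nth H n"
    and \<alpha>: "0 < \<alpha>" "\<alpha> < 1" and \<tau>: "\<tau> = (\<Sum>n. fps_nth H n * \<rho> ^ n)" "0 < \<tau>"
  defines "h \<equiv> fps_const (1 / \<tau>) * scale \<rho> H" and "\<kappa> \<equiv> \<tau> / (- c)"
  obtains f \<epsilon> T where "0 < \<epsilon>" "0 < T" "f holomorphic_on slit_disc \<epsilon> T" "0 < \<kappa>" "fps_nth h sums 1"
    "\<And>w. norm w < 1 \<Longrightarrow> (\<lambda>n. of_real (fps_nth h n) * w ^ n) sums f w"
    "((\<lambda>w. (f w - 1) / (1 - w) powr of_real \<alpha>) \<longlongrightarrow> - of_real (1 / \<kappa>)) (at 1 within slit_disc \<epsilon> T)"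
proof -
  obtain f \<epsilon> T P where pos: "0 < \<epsilon>" "0 < T" and f: "f holomorphic_on slit_disc \<epsilon> T"
    and sums: "\<And>w. norm w < 1 \<Longrightarrow> (\<lambda>n. of_real (fps_nth (scale \<rho> H) n) * w ^ n) sums f w"
    and lim: "((\<lambda>w. (f w - poly P (1 - w)) / (1 - w) powr of_real \<alpha>) \<longlongrightarrow> of_real c) (at 1 within slit_disc \<epsilon> T)"
    and P: "\<alpha> < 0 \<Longrightarrow> P = 0" "0 < \<alpha> \<Longrightarrow> \<alpha> < 1 \<Longrightarrow> degree P = 0"
  proof (rule singular_expansion_normalise[OF H], goal_cases)
    case (1 f \<epsilon> T P)
    show ?case by (rule 1(1)[OF 1(2-8)])
  qed
  have \<rho>: "0 < \<rho>" and c: "c \<noteq> 0" using H by (auto simp: singular_expansion_def)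
  have nn: "0 \<le> fps_nth (scale \<rho> H) n" for n using nonneg \<rho> by simp
  obtain p0 where p0: "P = [:p0:]" using P(2)[OF \<alpha>] by (rule degree_eq_zeroE)
  have fl: "(f \<longlongrightarrow> p0) (at 1 within slit_disc \<epsilon> T)"
    using singular_part_limit[OF lim \<alpha>(1)] by (simp add: p0)
  have s: "fps_nth (scale \<rho> H) sums Re p0" by (rule limit_sums(1)[OF sums nn pos fl])
  have re: "p0 = of_real (Re p0)" by (rule limit_sums(2)[OF sums nn pos fl])
  have "fps_nth (scale \<rho> H) = (\<lambda>n. fps_nth H n * \<rho> ^ n)" by (rule ext) simp
  then have "Re p0 = \<tau>" using s by (simp add: sums_iff \<tau>(1))
  with re have p0\<tau>: "p0 = of_real \<tau>" by simp
  have lim1: "((\<lambda>w. (f w - of_real \<tau>) / (1 - w) powr of_real \<alpha>) \<longlongrightarrow> of_real c) (at 1 within slit_disc \<epsilon> T)"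
    using lim by (simp add: p0 p0\<tau>)
  have "c \<le> 0"
  proof -
    have "((\<lambda>x. Re ((f (of_real x) - of_real \<tau>) / (1 - of_real x) powr of_real \<alpha>)) \<longlongrightarrow> Re (of_real c)) (at_left 1)"
      by (intro tendsto_Re filterlim_compose[OF lim1 of_real_at_left_slit[OF pos]])
    moreover have "\<forall>\<^sub>F x in at_left (1::real). Re ((f (of_real x) - of_real \<tau>) / (1 - of_real x) powr of_real \<alpha>) \<le> 0"
      using eventually_at_left_real[OF zero_less_one]
    proof eventually_elim
      case (elim x)
      then have x: "0 < x" "x < 1" by auto
      have "fps_nth (scale \<rho> H) n * x ^ n \<le> fps_nth (scale \<rho> H) n" for n
        using nn[of n] x by (intro mult_left_le power_le_one) auto
      then have "Re (f (of_real x)) \<le> Re p0" by (intro sums_le[OF _ real_sums_Re(1)[OF sums x] s])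
      moreover have "(1 - complex_of_real x) powr of_real \<alpha> = of_real ((1 - x) powr \<alpha>)"
        using powr_of_real[of "1 - x" \<alpha>] x by simp
      ultimately show ?case by (simp add: Re_divide_of_real p0\<tau> divide_nonpos_nonneg)
    qed
    ultimately show ?thesis using tendsto_upperbound[OF _ _ trivial_limit_at_left_real] by fastforce
  qed
  with c have c0: "c < 0" by simp
  show ?thesis
  proof (rule that[OF pos])
    show "(\<lambda>w. of_real (1 / \<tau>) * f w) holomorphic_on slit_disc \<epsilon> T" by (intro holomorphic_intros f)
    show "0 < \<kappa>" unfolding \<kappa>_def using \<tau> c0 by (intro divide_pos_pos) auto
    show "fps_nth h sums 1"
    proof -
      have "fps_nth h = (\<lambda>n. 1 / \<tau> * fps_nth (scale \<rho> H) n)" by (rule ext) (simp add: h_def)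
      then show ?thesis using sums_mult[OF s, of "1 / \<tau>"] \<tau>(2) p0\<tau> by simp
    qed
    show "(\<lambda>n. of_real (fps_nth h n) * w ^ n) sums (of_real (1 / \<tau>) * f w)" if "norm w < 1" for w
      using sums_mult[OF sums[OF that], of "of_real (1 / \<tau>)"] unfolding h_def by (simp add: mult.assoc)
    have "((\<lambda>w. of_real (1 / \<tau>) * ((f w - of_real \<tau>) / (1 - w) powr of_real \<alpha>)) \<longlongrightarrow> of_real (1 / \<tau>) * of_real c) (at 1 within slit_disc \<epsilon> T)"
      by (intro tendsto_mult tendsto_const lim1)
    moreover have "of_real (1 / \<tau>) * ((f w - of_real \<tau>) / (1 - w) powr of_real \<alpha>) = (of_real (1 / \<tau>) * f w - 1) / (1 - w) powr of_real \<alpha>" for w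
      using \<tau>(2) by (simp add: field_simps)
    moreover have "of_real (1 / \<tau>) * of_real c = - complex_of_real (1 / \<kappa>)"
      unfolding \<kappa>_def using c0 \<tau>(2) by simp
    ultimately show "((\<lambda>w. (of_real (1 / \<tau>) * f w - 1) / (1 - w) powr of_real \<alpha>) \<longlongrightarrow> - of_real (1 / \<kappa>)) (at 1 within slit_disc \<epsilon> T)"
      by (simp only:)
  qed
qed

text \<open>A negative exponent gives \<gamma> = - \<lambda>_M and C = c_M, nonnegative as a limit
  along (0, 1) and nonzero by definition. A positive exponent or a larger radius of convergence
  gives \<gamma> = 0 and C = M(\<rho>).\<close>

lemma normalised_M:
  assumes nonneg: "\<And>n. 0 \<le> fps_nth M n" and M0: "M \<noteq> 0" and \<rho>: "0 < \<rho>"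
    and sing: "fps_conv_radius M = ereal \<rho> \<Longrightarrow> \<exists>c l. lam = ereal l \<and> singular_expansion M \<rho> c l"
    and reg: "fps_conv_radius M > ereal \<rho> \<Longrightarrow> lam = \<infinity>" and rad: "fps_conv_radius M \<ge> ereal \<rho>"
    and \<gamma>: "\<gamma> = real_of_ereal (- min 0 lam)"
  obtains f \<epsilon> T C where "0 < \<epsilon>" "0 < T" "f holomorphic_on slit_disc \<epsilon> T" "0 < C"
    "\<And>w. norm w < 1 \<Longrightarrow> (\<lambda>n. of_real (fps_nth (scale \<rho> M) n) * w ^ n) sums f w"
    "((\<lambda>w. f w * (1 - w) powr of_real \<gamma>) \<longlongrightarrow> of_real C) (at 1 within slit_disc \<epsilon> T)"
proof -
  note conclude = that
  have nn: "0 \<le> fps_nth (scale \<rho> M) n" for n using nonneg \<rho> by simp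
  have positive: "0 < L" if "fps_nth (scale \<rho> M) sums L" for L
  proof -
    obtain k where "fps_nth M k \<noteq> 0" using M0 by (auto simp: fps_eq_iff)
    then have "0 < fps_nth (scale \<rho> M) k" using nonneg[of k] \<rho> by simp
    then have "0 < suminf (fps_nth (scale \<rho> M))" using that nn by (intro suminf_pos2) (auto simp: sums_iff)
    then show ?thesis using that by (simp add: sums_iff)
  qed
  \<comment> \<open>Common end of the two cases with \<gamma> = 0. The boundary value is the sum of
    a nonnegative series with a nonzero term, hence positive.\<close>
  have finite_value: thesis
    if h: "0 < \<epsilon>" "0 < T" "f holomorphic_on slit_disc \<epsilon> T" "\<gamma> = 0"
      "\<And>w. norm w < 1 \<Longrightarrow> (\<lambda>n. of_real (fps_nth (scale \<rho> M) n) * w ^ n) sums f w"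
      "(f \<longlongrightarrow> L) (at 1 within slit_disc \<epsilon> T)" for f \<epsilon> T L
  proof (rule conclude[OF h(1-3) _ h(5)])
    have "fps_nth (scale \<rho> M) sums Re L" by (rule limit_sums(1)[OF h(5) nn h(1,2,6)])
    then show "0 < Re L" by (rule positive)
    have re: "L = of_real (Re L)" by (rule limit_sums(2)[OF h(5) nn h(1,2,6)])
    have "((\<lambda>w. f w * (1 - w) powr of_real \<gamma>) \<longlongrightarrow> L) (at 1 within slit_disc \<epsilon> T)"
      by (rule Lim_transform_eventually[OF h(6)]) (auto simp: eventually_at_filter h(4))
    then show "((\<lambda>w. f w * (1 - w) powr of_real \<gamma>) \<longlongrightarrow> of_real (Re L)) (at 1 within slit_disc \<epsilon> T)"
      by (subst re[symmetric])
  qed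
  show thesis
  proof (cases "fps_conv_radius M = ereal \<rho>")
    case True
    then obtain c l where l: "lam = ereal l" and M: "singular_expansion M \<rho> c l" using sing by blast
    obtain f \<epsilon> T P where pos: "0 < \<epsilon>" "0 < T" and f: "f holomorphic_on slit_disc \<epsilon> T"
      and sums: "\<And>w. norm w < 1 \<Longrightarrow> (\<lambda>n. of_real (fps_nth (scale \<rho> M) n) * w ^ n) sums f w"
      and lim: "((\<lambda>w. (f w - poly P (1 - w)) / (1 - w) powr of_real l) \<longlongrightarrow> of_real c) (at 1 within slit_disc \<epsilon> T)"
      and P: "l < 0 \<Longrightarrow> P = 0" "0 < l \<Longrightarrow> l < 1 \<Longrightarrow> degree P = 0"
    proof (rule singular_expansion_normalise[OF M], goal_cases)
      case (1 f \<epsilon> T P)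
      show ?case by (rule 1(1)[OF 1(2-8)])
    qed
    have c: "c \<noteq> 0" and lN: "l \<notin> \<nat>" using M by (auto simp: singular_expansion_def)
    have "l \<noteq> 0" using lN by auto
    show thesis
    proof (cases "l < 0")
      case True
      have g: "\<gamma> = - l" using True by (simp add: \<gamma> l min_def)
      have lim0: "((\<lambda>w. f w / (1 - w) powr of_real l) \<longlongrightarrow> of_real c) (at 1 within slit_disc \<epsilon> T)"
        using lim P(1)[OF True] by simp
      show thesis
      proof (rule that[OF pos f _ sums])
        show "0 < c" using singular_leading_coefficient_nonneg[OF nn pos sums lim0] c by simp
        show "((\<lambda>w. f w * (1 - w) powr of_real \<gamma>) \<longlongrightarrow> of_real c) (at 1 within slit_disc \<epsilon> T)"
          using lim0 by (simp add: g powr_minus divide_inverse)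
      qed
    next
      case False
      with \<open>l \<noteq> 0\<close> have l0: "0 < l" by simp
      have "\<gamma> = 0" using l0 by (simp add: \<gamma> l min_def)
      then show thesis using finite_value[OF pos f _ sums singular_part_limit[OF lim l0]] by blast
    qed
  next
    case False
    then have R: "ereal \<rho> < fps_conv_radius M" using rad by simp
    then have "lam = \<infinity>" by (rule reg)
    then have g0: "\<gamma> = 0" by (simp add: \<gamma> min_def)
    obtain \<rho>' where \<rho>': "ereal \<rho> < ereal \<rho>'" "ereal \<rho>' < fps_conv_radius M" using ereal_dense2[OF R] by auto
    define f where "f = (\<lambda>w. eval_fps (cfps M) (of_real \<rho> * w))"
    define \<epsilon> where "\<epsilon> = \<rho>' / \<rho> - 1"
    have \<epsilon>: "0 < \<epsilon>" using \<rho> \<rho>' by (simp add: \<epsilon>_def)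
    have rM: "fps_conv_radius (cfps M) = fps_conv_radius M"
      by (simp add: fps_conv_radius_def conv_radius_def)
    have in_ball: "of_real \<rho> * w \<in> eball 0 (fps_conv_radius (cfps M))" if "norm w < 1 + \<epsilon>" for w :: complex
    proof -
      have "norm (of_real \<rho> * w) < \<rho>'" using that \<rho> by (simp add: norm_mult \<epsilon>_def pos_less_divide_eq mult.commute)
      then have "ereal (norm (of_real \<rho> * w)) < fps_conv_radius M" using \<rho>'(2) by (meson ereal_less(2) less_ereal.simps(1) less_trans)
      then show ?thesis by (simp add: in_eball_iff rM)
    qed
    have f: "f holomorphic_on ball 0 (1 + \<epsilon>)"
    proof -
      have "eval_fps (cfps M) holomorphic_on eball 0 (fps_conv_radius (cfps M))" by (intro holomorphic_intros) auto
      moreover have "(\<lambda>w :: complex. of_real \<rho> * w) holomorphic_on ball 0 (1 + \<epsilon>)" by (intro holomorphic_intros)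
      moreover have "(\<lambda>w :: complex. of_real \<rho> * w) ` ball 0 (1 + \<epsilon>) \<subseteq> eball 0 (fps_conv_radius (cfps M))"
        using in_ball by (intro image_subsetI) simp
      ultimately have "eval_fps (cfps M) \<circ> (\<lambda>w. of_real \<rho> * w) holomorphic_on ball 0 (1 + \<epsilon>)"
        by (metis holomorphic_on_compose_gen)
      then show ?thesis by (simp add: f_def o_def)
    qed
    have "(f \<longlongrightarrow> f 1) (at 1 within slit_disc \<epsilon> 1)"
    proof -
      have "isCont f 1" using holomorphic_on_imp_continuous_on[OF f] \<epsilon> by (simp add: continuous_on_eq_continuous_at)
      then have "(f \<longlongrightarrow> f 1) (at 1)" by (simp add: isCont_def)
      then show ?thesis by (rule tendsto_within_subset) simp
    qed
    moreover have "f holomorphic_on slit_disc \<epsilon> 1"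
      by (rule holomorphic_on_subset[OF f]) (auto simp: slit_disc_def)
    moreover have "(\<lambda>n. of_real (fps_nth (scale \<rho> M) n) * w ^ n) sums f w" if "norm w < 1" for w
    proof -
      have "norm w < 1 + \<epsilon>" using that \<epsilon> by simp
      from in_ball[OF this] have "(\<lambda>n. fps_nth (cfps M) n * (of_real \<rho> * w) ^ n) sums f w"
        unfolding f_def by (intro sums_eval_fps) (simp add: in_eball_iff)
      then show ?thesis by (simp add: power_mult_distrib mult.assoc)
    qed
    ultimately show thesis using finite_value[OF \<epsilon> zero_less_one _ g0] by blast
  qed
qed

lemma regular_coefficient_decay:
  assumes R: "ereal \<rho> < fps_conv_radius M" and \<rho>: "0 < \<rho>"
  shows "(\<lambda>n. real n powr s * fps_nth (scale \<rho> M) n) \<longlonglongrightarrow> 0"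
proof -
  obtain \<rho>' where \<rho>': "\<rho> < \<rho>'" "ereal \<rho>' < fps_conv_radius M" using ereal_dense2[OF R] by auto
  have "summable (\<lambda>n. fps_nth M n * \<rho>' ^ n)"
    using \<rho> \<rho>' by (intro summable_fps) auto
  then have a: "(\<lambda>n. fps_nth M n * \<rho>' ^ n) \<longlonglongrightarrow> 0" by (rule summable_LIMSEQ_zero)
  have b: "1 < \<rho>' / \<rho>" using \<rho> \<rho>' by simp
  have "(\<lambda>n. real n powr s / b ^ n) \<longlonglongrightarrow> 0" if "1 < b" for b :: real using that by real_asymp
  from tendsto_mult[OF this[OF b] a]
  have "(\<lambda>n. real n powr s / (\<rho>' / \<rho>) ^ n * (fps_nth M n * \<rho>' ^ n)) \<longlonglongrightarrow> 0" by simp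
  moreover have "real n powr s / (\<rho>' / \<rho>) ^ n * (fps_nth M n * \<rho>' ^ n) = real n powr s * fps_nth (scale \<rho> M) n" for n
    using \<rho> \<rho>' by (simp add: power_divide)
  ultimately show ?thesis by simp
qed

text \<open>The series are rescaled to h(w) = H(\<rho>_H w)/\<tau>_H, m(w) = M(\<rho>_H w) and g(v)
  = G(\<rho>_G v). Criticality \<tau>_H = \<rho>_G makes the powers of \<tau>_H from h^k cancel
  those of \<rho>_G in g; the factor \<rho>_H^n does not depend on k and drops out of the
  probabilities.\<close>

lemma composition_limit_exists:
  fixes G H M :: "real fps"
    and \<rho>\<^sub>G \<rho>\<^sub>H c\<^sub>G c\<^sub>H lamG lamH \<tau>\<^sub>H \<gamma> \<kappa> :: real
    and lamM :: ereal
  assumes nonneg: "\<And>n. 0 \<le> fps_nth G n" "\<And>n. 0 \<le> fps_nth H n" "\<And>n. 0 \<le> fps_nth M n"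
    and H0: "fps_nth H 0 = 0"
    and M_nonzero: "M \<noteq> 0"
    and G_sing: "singular_expansion G \<rho>\<^sub>G c\<^sub>G lamG"
    and H_sing: "singular_expansion H \<rho>\<^sub>H c\<^sub>H lamH"
    and M_sing: "fps_conv_radius M = ereal \<rho>\<^sub>H \<Longrightarrow>
      \<exists>c l. lamM = ereal l \<and> singular_expansion M \<rho>\<^sub>H c l"
    and M_regular: "fps_conv_radius M > ereal \<rho>\<^sub>H \<Longrightarrow> lamM = \<infinity>"
    and tauH: "\<tau>\<^sub>H = (\<Sum>n. fps_nth H n * \<rho>\<^sub>H ^ n)"
    and critical: "\<tau>\<^sub>H = \<rho>\<^sub>G" "fps_conv_radius M \<ge> ereal \<rho>\<^sub>H"
    and lamH: "0 < lamH" "lamH < 1"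
    and pure: "lamG < 0 \<or> (0 < lamG \<and> lamG < 1 \<and> lamM > ereal (min (lamG * lamH) lamH))"
    and params: "\<gamma> = real_of_ereal (- min 0 lamM)" "\<kappa> = \<tau>\<^sub>H / (- c\<^sub>H)"
  obtains \<epsilon> T S r \<delta> h fh c q Kh g m C Cg where
    "composition_limit \<epsilon> T S r lamH \<delta> h fh \<kappa> c q Kh g m \<gamma> (- lamG) C Cg (core_size G H M)"
    "\<And>n. fps_nth (ext_scheme 1 G H M) n * \<rho>\<^sub>H ^ n = (\<Sum>k\<le>n. fps_nth g k * fps_nth (h ^ k * m) n)"
proof -
  have \<rho>: "0 < \<rho>\<^sub>G" "0 < \<rho>\<^sub>H" using G_sing H_sing by (auto simp: singular_expansion_def)
  have \<tau>: "0 < \<tau>\<^sub>H" using \<rho> critical by simp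
  define h where "h = fps_const (1 / \<tau>\<^sub>H) * scale \<rho>\<^sub>H H"
  define m where "m = scale \<rho>\<^sub>H M"
  define g where "g = scale \<rho>\<^sub>G G"
  have h_nonneg: "0 \<le> fps_nth h n" for n using nonneg(2) \<tau> \<rho> by (simp add: h_def)
  have h_0: "fps_nth h 0 = 0" by (simp add: h_def H0)
  have m_nonneg: "0 \<le> fps_nth m n" for n using nonneg(3) \<rho> by (simp add: m_def)
  have g_nonneg: "0 \<le> fps_nth g n" for n using nonneg(1) \<rho> by (simp add: g_def)

  obtain fh \<epsilon>1 T1 where H: "0 < \<epsilon>1" "0 < T1" "fh holomorphic_on slit_disc \<epsilon>1 T1" "0 < \<kappa>" "fps_nth h sums 1"
      "\<And>w. norm w < 1 \<Longrightarrow> (\<lambda>n. of_real (fps_nth h n) * w ^ n) sums fh w"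
      "((\<lambda>w. (fh w - 1) / (1 - w) powr of_real lamH) \<longlongrightarrow> - of_real (1 / \<kappa>)) (at 1 within slit_disc \<epsilon>1 T1)"
  proof (rule normalised_H[OF H_sing nonneg(2) lamH tauH \<tau>, folded h_def params(2)], goal_cases)
    case (1 f \<epsilon> T)
    show ?case by (rule 1(1)[OF 1(2-8)])
  qed
  obtain fm \<epsilon>2 T2 C where M: "0 < \<epsilon>2" "0 < T2" "fm holomorphic_on slit_disc \<epsilon>2 T2" "0 < C"
      "\<And>w. norm w < 1 \<Longrightarrow> (\<lambda>n. of_real (fps_nth m n) * w ^ n) sums fm w"
      "((\<lambda>w. fm w * (1 - w) powr of_real \<gamma>) \<longlongrightarrow> of_real C) (at 1 within slit_disc \<epsilon>2 T2)"
  proof (rule normalised_M[OF nonneg(3) M_nonzero \<rho>(2) M_sing M_regular critical(2) params(1), folded m_def], goal_cases)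
    case (3 f \<epsilon> T C)
    show ?case by (rule 3(1)[OF 3(2-7)])
  qed assumption+
  define \<epsilon> where "\<epsilon> = min \<epsilon>1 \<epsilon>2"
  define T where "T = max T1 T2"
  \<comment> \<open>H and M come with different domains; the smaller radius and the larger slope
    describe a slit disc contained in both.\<close>
  have pos: "0 < \<epsilon>" "0 < T" using H M by (auto simp: \<epsilon>_def T_def)
  have sub: "slit_disc \<epsilon> T \<subseteq> slit_disc \<epsilon>1 T1" "slit_disc \<epsilon> T \<subseteq> slit_disc \<epsilon>2 T2"
    unfolding \<epsilon>_def T_def by (rule slit_disc_subset; use H(1,2) M(1,2) in simp)+
  note fh = holomorphic_on_subset[OF H(3) sub(1)] tendsto_within_subset[OF H(7) sub(1)]
  note fm = holomorphic_on_subset[OF M(3) sub(2)] tendsto_within_subset[OF M(6) sub(2)]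
  obtain \<eta> K where \<eta>: "0 < \<eta>" "0 \<le> K"
    "\<And>w. w \<in> slit_disc \<epsilon> T \<Longrightarrow> w \<noteq> 1 \<Longrightarrow> norm (1 - w) < \<eta> \<Longrightarrow> norm (fm w) \<le> K * norm (1 - w) powr (- \<gamma>)"
    using near_bound_of_limit[OF fm(2)] by metis
  obtain S r \<delta> c q Kh where LP: "large_powers \<epsilon> T S r lamH \<delta> h fh \<kappa> c q Kh" and rz: "r * (2 + S) < \<eta>"
    by (rule large_powers_exists[OF h_nonneg h_0 H(5) pos \<eta>(1) fh(1) H(6) lamH H(4) fh(2)])
  interpret large_powers \<epsilon> T S r lamH \<delta> h fh \<kappa> c q Kh by (rule LP)

  have fm_exp: "fm has_fps_expansion cfps m" by (rule sums_has_fps_expansion[OF M(5)])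
  have factor: "factor m \<gamma> C"
    by (rule factorI[OF m_nonneg fm(1) fm_exp fm(2) \<eta>(2) rz \<eta>(3)])

  have lamG: "lamG \<notin> \<nat>" "c\<^sub>G \<noteq> 0" using G_sing by (auto simp: singular_expansion_def)
  have g_lim: "(\<lambda>n. real n powr (1 - - lamG) * fps_nth g n) \<longlonglongrightarrow> c\<^sub>G * rGamma (- lamG)"
    using singularity_analysis[OF G_sing] by (simp add: g_def)
  \<comment> \<open>Nonnegativity holds as a limit of nonnegative terms. The constant is nonzero
    because - \<lambda>_G is no pole of Gamma, \<lambda>_G not being a natural number.\<close>
  have "0 \<le> c\<^sub>G * rGamma (- lamG)"
    by (rule LIMSEQ_le_const[OF g_lim]) (use g_nonneg in auto)
  moreover have "- lamG \<notin> \<int>\<^sub>\<le>\<^sub>0"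
  proof
    assume "- lamG \<in> \<int>\<^sub>\<le>\<^sub>0"
    then obtain i where "- lamG = - real i" by (auto elim: nonpos_Ints_cases')
    then have "lamG = real i" by simp
    with lamG(1) show False by simp
  qed
  then have "rGamma (- lamG) \<noteq> 0" by (simp add: rGamma_eq_zero_iff)
  ultimately have Cg: "0 < c\<^sub>G * rGamma (- lamG)" using lamG(2) by (simp add: less_le)

  have p: "0 < - lamG \<and> 0 \<le> \<gamma> \<or> \<gamma> = 0 \<and> - 1 < - lamG \<and> - lamG < 0"
  proof (cases "lamG < 0")
    case True
    have "0 \<le> \<gamma>" unfolding params(1) using ereal_minus_le_minus[of 0 "min 0 lamM"] by (intro real_of_ereal_pos) simp
    with True show ?thesis by simp
  next
    case False
    with pure have l: "0 < lamG" "lamG < 1" "lamM > ereal (min (lamG * lamH) lamH)" by auto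
    have "0 < min (lamG * lamH) lamH" using l lamH by simp
    then have "0 < lamM" using l(3) by (metis ereal_less(2) less_trans)
    then have "\<gamma> = 0" by (simp add: params(1) min_def)
    with l show ?thesis by simp
  qed

  have g_summable: "summable (fps_nth g)" if "0 < lamG"
  proof -
    obtain f \<epsilon> T P where G: "0 < \<epsilon>" "0 < T" "f holomorphic_on slit_disc \<epsilon> T"
      "\<And>w. norm w < 1 \<Longrightarrow> (\<lambda>n. of_real (fps_nth (scale \<rho>\<^sub>G G) n) * w ^ n) sums f w"
      "((\<lambda>w. (f w - poly P (1 - w)) / (1 - w) powr of_real lamG) \<longlongrightarrow> of_real c\<^sub>G) (at 1 within slit_disc \<epsilon> T)"
      "lamG < 0 \<Longrightarrow> P = 0" "0 < lamG \<Longrightarrow> lamG < 1 \<Longrightarrow> degree P = 0"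
    proof (rule singular_expansion_normalise[OF G_sing], goal_cases)
      case (1 f \<epsilon> T P)
      show ?case by (rule 1(1)[OF 1(2-8)])
    qed
    have "0 \<le> fps_nth (scale \<rho>\<^sub>G G) n" for n using g_nonneg by (simp add: g_def)
    from limit_sums(1)[OF G(4) this G(1,2) singular_part_limit[OF G(5) that]]
    show ?thesis by (simp add: g_def sums_iff)
  qed

  \<comment> \<open>In the singular case \<mu> = \<lambda>_M, since the coefficients of m are O(n^(-
    1 - \<lambda>_M)). In the regular case they decay geometrically and \<lambda>_G \<lambda>_H + 1
    will do.\<close>
  have decay: "\<exists>\<mu> Km nm. - (lamH * - lamG) < \<mu> \<and> (\<forall>n\<ge>nm. real n * fps_nth m n \<le> Km * real n powr (- \<mu>))" if lG: "0 < lamG"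
  proof -
    have bound: ?thesis if \<mu>: "lamG * lamH < \<mu>" and L: "(\<lambda>n. real n powr (1 + \<mu>) * fps_nth m n) \<longlonglongrightarrow> L" for \<mu> L
    proof -
      have "\<forall>\<^sub>F n in sequentially. real n powr (1 + \<mu>) * fps_nth m n < L + 1"
        using L by (rule order_tendstoD) simp
      then obtain nm where nm: "\<And>n. n \<ge> nm \<Longrightarrow> real n powr (1 + \<mu>) * fps_nth m n < L + 1"
        unfolding eventually_sequentially by blast
      have "real n * fps_nth m n \<le> (L + 1) * real n powr (- \<mu>)" if "n \<ge> max 1 nm" for n
      proof -
        have n: "0 < real n" using that by simp
        have "real n * fps_nth m n = (real n powr (1 + \<mu>) * fps_nth m n) * real n powr (- \<mu>)"
          using n by (simp add: powr_add powr_minus)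
        also have "\<dots> \<le> (L + 1) * real n powr (- \<mu>)"
          using nm[of n] that by (intro mult_right_mono) auto
        finally show ?thesis .
      qed
      moreover have "- (lamH * - lamG) < \<mu>" using \<mu> by (simp add: mult.commute)
      ultimately show ?thesis by blast
    qed
    show ?thesis
    proof (cases "fps_conv_radius M = ereal \<rho>\<^sub>H")
      case True
      then obtain c l where l: "lamM = ereal l" "singular_expansion M \<rho>\<^sub>H c l" using M_sing by blast
      \<comment> \<open>For 0 < \<lambda>_G < 1 the minimum in the purity condition is \<lambda>_G
        \<lambda>_H, so the condition says precisely that \<mu> = \<lambda>_M is large
        enough.\<close>
      have "lamG * lamH \<le> lamH" using pure lG lamH by (simp add: mult_left_le_one_le)
      then have "lamG * lamH < l" using pure lG l(1) by (simp add: min_def split: if_splits)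
      then show ?thesis using singularity_analysis[OF l(2), folded m_def] by (rule bound)
    next
      case False
      then have "ereal \<rho>\<^sub>H < fps_conv_radius M" using critical(2) by simp
      from regular_coefficient_decay[OF this \<rho>(2), folded m_def, of "1 + (lamG * lamH + 1)"]
      show ?thesis by (rule bound[rotated]) simp
    qed
  qed

  have term_eq: "fps_nth G k * fps_nth (H ^ k * M) n * \<rho>\<^sub>H ^ n = fps_nth g k * fps_nth (h ^ k * m) n" for k n
  proof -
    have "scale \<rho>\<^sub>H H = fps_const \<tau>\<^sub>H * h" using \<tau> by (simp add: h_def mult.assoc[symmetric])
    then have "scale \<rho>\<^sub>H (H ^ k * M) = fps_const (\<tau>\<^sub>H ^ k) * (h ^ k * m)"
      by (simp add: scale_mult scale_power m_def power_mult_distrib fps_const_power mult.assoc)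
    then have "fps_nth (H ^ k * M) n * \<rho>\<^sub>H ^ n = \<tau>\<^sub>H ^ k * fps_nth (h ^ k * m) n"
      by (metis fps_mult_left_const_nth scale_nth)
    then show ?thesis by (simp add: g_def critical(1) mult.assoc)
  qed
  have total_eq: "fps_nth (ext_scheme 1 G H M) n * \<rho>\<^sub>H ^ n = (\<Sum>k\<le>n. fps_nth g k * fps_nth (h ^ k * m) n)" for n
    unfolding ext_scheme_one_nth[OF H0] sum_distrib_right term_eq ..
  have core: "pmf (core_size G H M n) k = fps_nth g k * fps_nth (h ^ k * m) n / (\<Sum>k\<le>n. fps_nth g k * fps_nth (h ^ k * m) n)"
    if "(\<Sum>k\<le>n. fps_nth g k * fps_nth (h ^ k * m) n) \<noteq> 0" for n k
  proof -
    have "fps_nth (ext_scheme 1 G H M) n \<noteq> 0" using that unfolding total_eq[symmetric] by auto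
    from pmf_core_size[OF nonneg H0 this, of k]
    have "pmf (core_size G H M n) k = fps_nth G k * fps_nth (H ^ k * M) n / fps_nth (ext_scheme 1 G H M) n"
      by (simp only: bivariate_scheme_nth[OF H0])
    also have "\<dots> = (fps_nth G k * fps_nth (H ^ k * M) n * \<rho>\<^sub>H ^ n) / (fps_nth (ext_scheme 1 G H M) n * \<rho>\<^sub>H ^ n)"
      using \<rho>(2) by simp
    finally show ?thesis by (simp only: total_eq term_eq)
  qed
  have "composition_limit \<epsilon> T S r lamH \<delta> h fh \<kappa> c q Kh g m \<gamma> (- lamG) C (c\<^sub>G * rGamma (- lamG)) (core_size G H M)"
  proof (intro composition_limit.intro LP composition_limit_axioms.intro)
  qed (use factor M(4) g_nonneg g_lim Cg p g_summable decay core in auto)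
  then show ?thesis using total_eq by (rule that)
qed

text \<open>Nonvanishing of the total coefficient for large n belongs to the conclusion because
  \<open>core_size\<close> is known to be the intended law when that coefficient is nonzero.
  Summability of the density series is stated so that its infinite sum is meaningful. The local
  limit ranges over those x for which x \<kappa> n^\<alpha> is a natural number, and speaks of the
  ratio to the predicted value.\<close>

theorem theorem4p1:
  fixes G H M :: "real fps"
    and \<rho>\<^sub>G \<rho>\<^sub>H c\<^sub>G c\<^sub>H lamG lamH \<tau>\<^sub>H \<alpha> \<beta> \<gamma> \<kappa> :: real
    and lamM :: ereal
  assumes nonneg: "\<And>n. 0 \<le> fps_nth G n" "\<And>n. 0 \<le> fps_nth H n" "\<And>n. 0 \<le> fps_nth M n"
    and H0: "fps_nth H 0 = 0"
    and M_nonzero: "M \<noteq> 0"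
    and M_analytic: "0 < fps_conv_radius M"
    and G_sing: "singular_expansion G \<rho>\<^sub>G c\<^sub>G lamG"
    and H_sing: "singular_expansion H \<rho>\<^sub>H c\<^sub>H lamH"
    and M_sing: "fps_conv_radius M = ereal \<rho>\<^sub>H \<Longrightarrow>
      \<exists>c l. lamM = ereal l \<and> singular_expansion M \<rho>\<^sub>H c l"
    and M_regular: "fps_conv_radius M > ereal \<rho>\<^sub>H \<Longrightarrow> lamM = \<infinity>"
    and tauH: "\<tau>\<^sub>H = (\<Sum>n. fps_nth H n * \<rho>\<^sub>H ^ n)"
    and critical: "\<tau>\<^sub>H = \<rho>\<^sub>G" "fps_conv_radius M \<ge> ereal \<rho>\<^sub>H"
    and lamH: "0 < lamH" "lamH < 1"
    and pure: "lamG < 0 \<or> (0 < lamG \<and> lamG < 1 \<and> lamM > ereal (min (lamG * lamH) lamH))"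
    and params: "\<alpha> = lamH" "\<beta> = - lamG * lamH" "\<gamma> = real_of_ereal (- min 0 lamM)"
      "\<kappa> = \<tau>\<^sub>H / (- c\<^sub>H)"
  shows
    "(\<forall>\<^sub>F n in sequentially. fps_nth (ext_scheme 1 G H M) n \<noteq> 0) \<and>
     (\<exists>X. mittag_leffler3 \<alpha> \<beta> \<gamma> X \<and>
        weak_conv_m
          (\<lambda>n. distr (measure_pmf (core_size G H M n)) borel (\<lambda>k. real k / (\<kappa> * real n powr lamH))) X \<and>
        (\<forall>s :: nat. integrable X (\<lambda>x. x ^ s) \<and>
           (\<lambda>n. measure_pmf.expectation (core_size G H M n)
                  (\<lambda>k. (real k / (\<kappa> * real n powr lamH)) ^ s))
             \<longlonglongrightarrow> (\<integral>x. x ^ s \<partial>X)) \<and>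
        distributed X lborel (\<lambda>x. x)
          (\<lambda>x. ennreal (if 0 < x then ml3_density \<alpha> \<beta> \<gamma> x else 0))) \<and>
     (\<forall>x>0. summable (ml3_density_term \<alpha> \<beta> \<gamma> x) \<and> 0 \<le> ml3_density \<alpha> \<beta> \<gamma> x) \<and>
     (\<forall>a b. 0 < a \<and> a \<le> b \<longrightarrow>
        (\<forall>e>0. \<forall>\<^sub>F n in sequentially. \<forall>x\<in>{a..b}. \<forall>k :: nat.
           real k = x * (\<kappa> * real n powr lamH) \<longrightarrow>
           \<bar>pmf (core_size G H M n) k
              / (1 / (\<kappa> * real n powr lamH) * ml3_density \<alpha> \<beta> \<gamma> x) - 1\<bar> < e))"
proof -
  \<comment> \<open>The form \<beta> = \<alpha> p with p = - \<lambda>_G in which the limit law was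
    developed.\<close>
  have \<beta>: "\<beta> = lamH * - lamG" by (simp add: params(2))
  obtain \<epsilon> T S r \<delta> h fh c q Kh g m C Cg where
    CL: "composition_limit \<epsilon> T S r lamH \<delta> h fh \<kappa> c q Kh g m \<gamma> (- lamG) C Cg (core_size G H M)"
    and tot: "\<And>n. fps_nth (ext_scheme 1 G H M) n * \<rho>\<^sub>H ^ n = (\<Sum>k\<le>n. fps_nth g k * fps_nth (h ^ k * m) n)"
  proof (rule composition_limit_exists[OF nonneg H0 M_nonzero G_sing H_sing M_sing M_regular tauH critical lamH pure params(3,4)], goal_cases)
    case (3 \<epsilon> T S r \<delta> h fh c q Kh g m C Cg)
    show ?case by (rule 3(1)[OF 3(2,3)])
  qed assumption+
  interpret composition_limit \<epsilon> T S r lamH \<delta> h fh \<kappa> c q Kh g m \<gamma> "- lamG" C Cg "core_size G H M" by (rule CL)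
  have dens: "ml3_density lamH (lamH * - lamG) \<gamma> x = wdens \<gamma> (- lamG) x" if "0 < x" for x
    by (rule ml3_density_wdens[OF that])
  show ?thesis unfolding params(1) \<beta>
  proof (intro conjI allI impI exI[of _ wlaw])
    show "\<forall>\<^sub>F n in sequentially. fps_nth (ext_scheme 1 G H M) n \<noteq> 0"
      using total_nonzero
    proof eventually_elim
      case (elim n)
      then show ?case using tot[of n] by (auto simp: total_def)
    qed
    show "mittag_leffler3 lamH (lamH * - lamG) \<gamma> wlaw" by (rule wlaw_mittag_leffler3[OF wright_0_nonneg])
    show "weak_conv_m (\<lambda>n. distr (measure_pmf (core_size G H M n)) borel (\<lambda>k. real k / (\<kappa> * real n powr lamH))) wlaw"
      by (rule weak_limit)
    show "integrable wlaw (\<lambda>x. x ^ s)" for s by (rule wlaw_moment)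
    show "(\<lambda>n. measure_pmf.expectation (core_size G H M n) (\<lambda>k. (real k / (\<kappa> * real n powr lamH)) ^ s)) \<longlonglongrightarrow> (\<integral>x. x ^ s \<partial>wlaw)" for s
      by (rule moment_limit)
    show "distributed wlaw lborel (\<lambda>x. x) (\<lambda>x. ennreal (if 0 < x then ml3_density lamH (lamH * - lamG) \<gamma> x else 0))"
      by (rule wlaw_distributed)
    show "summable (ml3_density_term lamH (lamH * - lamG) \<gamma> x)" if "0 < x" for x
      using ml3_density_sums[OF that] by (rule sums_summable)
    show "0 \<le> ml3_density lamH (lamH * - lamG) \<gamma> x" if "0 < x" for x
      unfolding dens[OF that] by (rule wdens_nonneg)
    fix a b e :: real assume ab: "0 < a \<and> a \<le> b" and e: "0 < e"
    have "0 < a" "a \<le> b" using ab by auto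
    from local_limit[OF this e]
    show "\<forall>\<^sub>F n in sequentially. \<forall>x\<in>{a..b}. \<forall>k :: nat. real k = x * (\<kappa> * real n powr lamH) \<longrightarrow>
        \<bar>pmf (core_size G H M n) k / (1 / (\<kappa> * real n powr lamH) * ml3_density lamH (lamH * - lamG) \<gamma> x) - 1\<bar> < e"
    proof eventually_elim
      case (elim n)
      have "0 < x" if "x \<in> {a..b}" for x using that ab by auto
      then show ?case using elim dens by simp
    qed
  qed
qed

end
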